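(* Let $n=3$. The first occurring spatial singularity classes occur at level $3$: there are no spatial points in $\mathcal P^k(3)$ for $k\le2$, and the spatial points of $\mathcal P^3(3)$ form exactly two classes, each of which is itself a single orbit. One of these two classes is an open subset of the RVT class $RVT$ (and so has codimension $2$) and is realized by the third prolongations of those curves whose $5$-jet is equivalent to $(t^3,t^4,t^5)$. The other class is $RVL$ (which has codimension $3$) and is realized by the third prolongations of those curves whose $7$-jet is equivalent to $(t^4,t^6,t^7)$.
   Context: All manifolds, curves and maps are complex analytic. A distribution on $Z$ is a subbundle $D\subset TZ$. If $D$ has rank $m$, put $\mathbb P D=\{(z,\ell): z\in Z,\ \ell\subset D(z)\text{ a line}\}$ with projection $\pi:\mathbb P D\to Z$, and define the rank $m$ distribution $D^1$ on $\mathbb PD$ by $D^1(z,\ell)=d\pi_{(z,\ell)}^{-1}(\ell)$. The prolongation of a nonconstant integral curve $\gamma$ of $D$ is the integral curve $\gamma^1$ of $D^1$ given by $\gamma^1(t)=(\gamma(t),\mathrm{span}\,\gamma'(t))$ where $\gamma'(t)\neq0$, extended by limits to the other $t$; $\gamma^{j+1}=(\gamma^j)^1$, $\gamma^0=\gamma$. Monster tower: $\mathcal P^0(n)=\mathbb C^n$, $\Delta_0=T\mathbb C^n$, $\mathcal P^{k}(n)=\mathbb P\Delta_{k-1}$, $\Delta_k=(\Delta_{k-1})^1$ (rank $n$), with projections $\pi_{k,i}:\mathcal P^k(n)\to\mathcal P^i(n)$; for $p\in\mathcal P^k(n)$ put $p_i=\pi_{k,i}(p)$. A local analytic diffeomorphism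 $\phi$ of $\mathbb C^n$ acts on the tower by prolongation: $\phi^0=\phi$, $\phi^{k+1}(p,\ell)=(\phi^k(p),d\phi^k_p(\ell))$; orbits are taken with respect to the pseudogroup $Diff(n)$ of local analytic diffeomorphisms of $\mathbb C^n$, and a singularity class is a $Diff(n)$-invariant subset of $\mathcal P^k(n)$. Curve germs (or jets) are equivalent if they agree after a germ of diffeomorphism of $\mathbb C^n$ and a reparameterization. For $k\ge1$ the vertical space at $p\in\mathcal P^k(n)$ is $V_k(p)=\ker d\pi_{k,k-1}(p)\subset\Delta_k(p)$. For $i\ge1$ let $F_i(p_i)=\pi_{i,i-1}^{-1}(p_{i-1})$, an integral submanifold of $\Delta_i$. Any manifold $F$ has its own tower $\mathcal P^0(F)=F$, $\Delta_0^F=TF$, $\mathcal P^{j+1}(F)=\mathbb P\Delta_j^F$, $\Delta_{j+1}^F=(\Delta_j^F)^1$, and $\mathcal P^j(F_i(p_i))\subset\mathcal P^{i+j}(n)$. The critical hyperplanes through $p\in\mathcal P^k(n)$ are the hyperplanes $\delta_i^j(p)=\Delta_j^{F_i(p_i)}(p)\subset\Delta_k(p)$ for those $i\ge1,j\ge0$, $i+j=k$, with $p\in\mathcal P^j(F_i(p_i))$ (so $\delta_k^0=V_k$). A line in $\Delta_k(p)$ is regular if it lies in no critical hyperplane, critical otherwise, and vertical if it lies in $V_k(p)$ (at level $0$ every line is regular). A point $p=(p_{k-1},\ell)\in\mathcal P^k(n)$, $k\ge1$, is called regular, critical or vertical according to the line $\ell\subset\Delta_{k-1}(p_{k-1})$.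 An integral curve germ $\sigma$ of $\Delta_k$ is regular if $\sigma'(0)\ne0$ spans a regular line. $Germ(p)$, $p\in\mathcal P^k(n)$, is the set of curve germs $\gamma:(\mathbb C,0)\to\mathbb C^n$ with $\gamma^k(0)=p$ and $\gamma^k$ regular; such $\gamma$ are said to realize $p$. The RVT code of $p\in\mathcal P^k(n)$ is the word $\omega_1\dots\omega_k$ with $\omega_i=R$ if $p_i$ is regular, $V$ if $p_i$ is vertical, $T$ if $p_i$ is critical but not vertical; an RVT class is the set of points with a given code. $RVL\subset\mathcal P^3(n)$ is the set of points $(p_2,\ell)$ with $p_2$ of code $RV$ and $\ell\subset V_2(p_2)\cap\delta_1^1(p_2)$. The embedding dimension of a curve germ is the smallest $d$ such that it lies in a smooth $d$-dimensional submanifold. A point $p$ is spatial if every curve in $Germ(p)$ has embedding dimension at least $3$ and at least one has embedding dimension exactly $3$; a singularity class is spatial if all its points are spatial. *)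

theory Defs
  imports "HOL-Analysis.Analysis"
begin

section \<open>Kumpera-Ruiz coordinates and the points of the tower\<close>

text \<open>
  The manifolds of the Monster tower over \<open>\<complex>\<^sup>n\<close> (\<open>n = CARD('n)\<close>) carry affine charts that
  are indexed, at level \<open>k\<close>, by a list of \<open>k\<close> elements of \<open>'n\<close>, the most recent level first.
  A coordinate vector is a sequence \<open>x\<close>: the entry \<open>x 0\<close> is the base point, and for \<open>i \<ge> 1\<close> the
  entry \<open>x i\<close> consists of the homogeneous coordinates, in the frame of the rank \<open>n\<close> distribution
  over the chart of level \<open>i - 1\<close>, of the line chosen at level \<open>i\<close>. They are normalized by
  requiring the component named by the chart to be \<open>1\<close>; entries beyond level \<open>k\<close> are \<open>0\<close>.
\<close>

type_synonym 'n coords = "nat \<Rightarrow> complex^'n"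

fun chart_dom :: "'n::finite list \<Rightarrow> 'n coords set" where
  "chart_dom [] = {x. \<forall>i>0. x i = 0}"
| "chart_dom (a # c) =
     {x. x (Suc (length c)) $ a = 1 \<and> x(Suc (length c) := 0) \<in> chart_dom c}"

text \<open>
  \<open>chart_frame c x u\<close> is the combination with coefficients \<open>u\<close> of the frame of the distribution
  of level \<open>length c\<close>. If \<open>X\<^sub>j\<close> is the frame in the chart \<open>c\<close>, then the frame in the chart \<open>a # c\<close>
  consists of the horizontal lift of \<open>\<Sum>j. y\<^sub>j X\<^sub>j\<close>, at the index \<open>a\<close>, and of the coordinate fields
  of \<open>y\<^sub>j\<close>, \<open>j \<noteq> a\<close>, where \<open>y = x (Suc (length c))\<close>.
\<close>

fun chart_frame :: "'n::finite list \<Rightarrow> 'n coords \<Rightarrow> complex^'n \<Rightarrow> 'n coords" where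
  "chart_frame [] x u = (\<lambda>i. if i = 0 then u else 0)"
| "chart_frame (a # c) x u =
     (chart_frame c x (u $ a *s x (Suc (length c))))
       (Suc (length c) := (\<chi> j. if j = a then 0 else u $ j))"

text \<open>
  A tangent vector is the class of all pairs of a chart and the coordinates of the vector in that
  chart. A point of level \<open>k + 1\<close> is a point of level \<open>k\<close> with a line of tangent vectors there.
\<close>

type_synonym 'n tvec = "('n list \<times> 'n coords) set"

datatype 'n::finite point =
    Base (foot: "complex^'n")
  | Prol (under: "'n point") (dir: "'n tvec set")

definition tscale :: "complex \<Rightarrow> 'n::finite tvec \<Rightarrow> 'n tvec" where
  "tscale s \<tau> = {(c, \<lambda>i. s *s v i) | c v. (c, v) \<in> \<tau>}"

definition tline :: "'n::finite tvec \<Rightarrow> 'n tvec set" where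
  "tline \<tau> = range (\<lambda>s. tscale s \<tau>)"

definition tzero :: "'n::finite tvec \<Rightarrow> bool" where
  "tzero \<tau> \<longleftrightarrow> (\<forall>(c, v) \<in> \<tau>. v = (\<lambda>i. 0))"

text \<open>
  The velocity of a curve \<open>\<Gamma>\<close>, given the family \<open>P\<close> of parametrizations of level \<open>k\<close>. It is the
  empty set when \<open>\<Gamma>\<close> is not analytic at \<open>t\<^sub>0\<close>.
\<close>

definition represents ::
  "('n::finite list \<Rightarrow> 'n coords \<Rightarrow> 'n point) \<Rightarrow> 'n list \<Rightarrow> (complex \<Rightarrow> 'n coords) \<Rightarrow>
   (complex \<Rightarrow> 'n point) \<Rightarrow> complex \<Rightarrow> bool" where
  "represents P c \<xi> \<Gamma> t\<^sub>0 \<longleftrightarrow>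
     (\<forall>i j. (\<lambda>t. \<xi> t i $ j) analytic_on {t\<^sub>0}) \<and>
     (\<forall>\<^sub>F t in nhds t\<^sub>0. \<xi> t \<in> chart_dom c \<and> \<Gamma> t = P c (\<xi> t))"

definition velocity_in ::
  "nat \<Rightarrow> ('n::finite list \<Rightarrow> 'n coords \<Rightarrow> 'n point) \<Rightarrow>
   (complex \<Rightarrow> 'n point) \<Rightarrow> complex \<Rightarrow> 'n tvec" where
  "velocity_in k P \<Gamma> t\<^sub>0 =
     {(c, \<lambda>i. \<chi> j. deriv (\<lambda>t. \<xi> t i $ j) t\<^sub>0) | c \<xi>. length c = k \<and> represents P c \<xi> \<Gamma> t\<^sub>0}"

text \<open>
  \<open>param k c x\<close> is the point with coordinates \<open>x \<in> chart_dom c\<close> in the chart \<open>c\<close> of level \<open>k\<close>.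
\<close>

primrec param :: "nat \<Rightarrow> 'n::finite list \<Rightarrow> 'n coords \<Rightarrow> 'n point" where
  "param 0 = (\<lambda>c x. Base (x 0))"
| "param (Suc k) = (\<lambda>c x.
     Prol (param k (tl c) x)
       (tline (velocity_in k (param k)
          (\<lambda>t. param k (tl c) (\<lambda>i. x i + t *s chart_frame (tl c) x (x (Suc k)) i)) 0)))"

definition analytic_curve :: "nat \<Rightarrow> (complex \<Rightarrow> 'n::finite point) \<Rightarrow> complex \<Rightarrow> bool" where
  "analytic_curve k \<Gamma> t\<^sub>0 \<longleftrightarrow> (\<exists>c \<xi>. length c = k \<and> represents (param k) c \<xi> \<Gamma> t\<^sub>0)"

definition velocity :: "nat \<Rightarrow> (complex \<Rightarrow> 'n::finite point) \<Rightarrow> complex \<Rightarrow> 'n tvec" where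
  "velocity k = velocity_in k (param k)"

text \<open>The tangent space at \<open>p\<close> of a submanifold \<open>F\<close> of level \<open>k\<close>.\<close>

definition tangent_space :: "nat \<Rightarrow> 'n::finite point set \<Rightarrow> 'n point \<Rightarrow> 'n tvec set" where
  "tangent_space k F p =
     {velocity k \<Gamma> 0 | \<Gamma>. analytic_curve k \<Gamma> 0 \<and> \<Gamma> 0 = p \<and> (\<forall>\<^sub>F t in nhds 0. \<Gamma> t \<in> F)}"

text \<open>The differential of the projection from a level to the previous one.\<close>

definition dproj :: "'n::finite tvec \<Rightarrow> 'n tvec" where
  "dproj \<tau> = {(tl c, v(length c := 0)) | c v. (c, v) \<in> \<tau>}"


section \<open>Towers\<close>

definition projectivize ::
  "'n::finite point set \<Rightarrow> ('n point \<Rightarrow> 'n tvec set) \<Rightarrow> 'n point set" where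
  "projectivize Z D = {Prol z (tline \<tau>) | z \<tau>. z \<in> Z \<and> \<tau> \<in> D z \<and> \<not> tzero \<tau>}"

text \<open>
  The tower of a submanifold \<open>F\<close> of the \<open>i\<close>-th manifold of the Monster tower, as a subset of level
  \<open>i + j\<close> together with the distribution on it. It is used for \<open>F = \<complex>\<^sup>n\<close>, \<open>i = 0\<close>, which gives the
  Monster tower itself, and for fibers, which are integral submanifolds.
\<close>

primrec tower ::
  "nat \<Rightarrow> 'n::finite point set \<Rightarrow> nat \<Rightarrow> 'n point set \<times> ('n point \<Rightarrow> 'n tvec set)" where
  "tower i F 0 = (F, tangent_space i F)"
| "tower i F (Suc j) =
     (let Y = projectivize (fst (tower i F j)) (snd (tower i F j))
      in (Y, \<lambda>p. {\<tau> \<in> tangent_space (i + Suc j) Y p. dproj \<tau> \<in> dir p}))"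

definition monster :: "nat \<Rightarrow> 'n::finite point set" where
  "monster k = fst (tower 0 (range Base) k)"

definition Delta :: "nat \<Rightarrow> 'n::finite point \<Rightarrow> 'n tvec set" where
  "Delta k = snd (tower 0 (range Base) k)"

definition monster_topology :: "nat \<Rightarrow> 'n::finite point topology" where
  "monster_topology k = topology (\<lambda>U. U \<subseteq> monster k \<and>
     (\<forall>c. length c = k \<longrightarrow>
        openin (top_of_set (chart_dom c)) {x \<in> chart_dom c. param k c x \<in> U}))"

text \<open>A continuous function that is holomorphic on every complex line of every chart.\<close>

definition holomorphic_fun :: "nat \<Rightarrow> 'n::finite point set \<Rightarrow> ('n point \<Rightarrow> complex) \<Rightarrow> bool" where
  "holomorphic_fun k U f \<longleftrightarrow>
     (\<forall>c. length c = k \<longrightarrow>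
        continuous_on {x \<in> chart_dom c. param k c x \<in> U} (\<lambda>x. f (param k c x)) \<and>
        (\<forall>x w. x \<in> chart_dom c \<and> param k c x \<in> U \<and>
             (\<forall>s. (\<lambda>i. x i + s *s w i) \<in> chart_dom c) \<longrightarrow>
           (\<lambda>s. f (param k c (\<lambda>i. x i + s *s w i))) analytic_on {0}))"

text \<open>
  \<open>S\<close> is a complex submanifold of codimension \<open>r\<close> of the \<open>k\<close>-th manifold: locally the common zero
  set of \<open>r\<close> holomorphic functions whose differentials are linearly independent, i.e. jointly map
  the tangent space onto \<open>\<complex>\<^sup>r\<close>.
\<close>

definition has_codim :: "nat \<Rightarrow> 'n::finite point set \<Rightarrow> nat \<Rightarrow> bool" where
  "has_codim k S r \<longleftrightarrow> S \<subseteq> monster k \<and>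
     (\<forall>p\<in>S. \<exists>U f. openin (monster_topology k) U \<and> p \<in> U \<and>
        (\<forall>i<r. holomorphic_fun k U (f i)) \<and>
        S \<inter> U = {q \<in> U. \<forall>i<r. f i q = 0} \<and>
        (\<forall>w. \<exists>\<Gamma>. analytic_curve k \<Gamma> 0 \<and> \<Gamma> 0 = p \<and>
           (\<forall>i<r. deriv (\<lambda>t. f i (\<Gamma> t)) 0 = w i)))"


section \<open>Symmetries\<close>

definition holomorphic_map :: "(complex^'n::finite) set \<Rightarrow> (complex^'n \<Rightarrow> complex^'n) \<Rightarrow> bool" where
  "holomorphic_map U \<phi> \<longleftrightarrow>
     (\<forall>z\<in>U. \<exists>A. (\<phi> has_derivative A) (at z) \<and> (\<forall>s v. A (s *s v) = s *s A v))"

definition local_diffeo :: "(complex^'n::finite) set \<Rightarrow> (complex^'n \<Rightarrow> complex^'n) \<Rightarrow> bool" where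
  "local_diffeo U \<phi> \<longleftrightarrow> open U \<and> holomorphic_map U \<phi> \<and> open (\<phi> ` U) \<and>
     (\<exists>\<psi>. holomorphic_map (\<phi> ` U) \<psi> \<and> (\<forall>z\<in>U. \<psi> (\<phi> z) = z))"

primrec prolong_map :: "(complex^'n::finite \<Rightarrow> complex^'n) \<Rightarrow> nat \<Rightarrow> 'n point \<Rightarrow> 'n point" where
  "prolong_map \<phi> 0 = (\<lambda>p. Base (\<phi> (foot p)))"
| "prolong_map \<phi> (Suc k) = (\<lambda>p.
     Prol (prolong_map \<phi> k (under p))
       {velocity k (\<lambda>t. prolong_map \<phi> k (\<Gamma> t)) 0 | \<Gamma>.
          analytic_curve k \<Gamma> 0 \<and> \<Gamma> 0 = under p \<and> velocity k \<Gamma> 0 \<in> dir p})"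

definition orbit :: "nat \<Rightarrow> 'n::finite point \<Rightarrow> 'n point set" where
  "orbit k p = {prolong_map \<phi> k p | U \<phi>. local_diffeo U \<phi> \<and> foot ((under ^^ k) p) \<in> U}"

definition is_orbit :: "nat \<Rightarrow> 'n::finite point set \<Rightarrow> bool" where
  "is_orbit k S \<longleftrightarrow> (\<exists>p\<in>monster k. S = orbit k p)"

definition singularity_class :: "nat \<Rightarrow> 'n::finite point set \<Rightarrow> bool" where
  "singularity_class k S \<longleftrightarrow> S \<subseteq> monster k \<and> (\<forall>p\<in>S. orbit k p \<subseteq> S)"


section \<open>Critical hyperplanes and RVT codes\<close>

text \<open>In the following definitions \<open>p\<close> is a point of level \<open>k\<close>.\<close>

definition vertical_space :: "nat \<Rightarrow> 'n::finite point \<Rightarrow> 'n tvec set" where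
  "vertical_space k p = {\<tau> \<in> tangent_space k (monster k) p. tzero (dproj \<tau>)}"

text \<open>The fiber through a point of level \<open>i \<ge> 1\<close>.\<close>

definition fiber :: "nat \<Rightarrow> 'n::finite point \<Rightarrow> 'n point set" where
  "fiber i p = {q \<in> monster i. under q = under p}"

text \<open>The tower of the fiber through the projection of \<open>p\<close>, a point of level \<open>i + j\<close>, to level \<open>i\<close>.\<close>

definition baby_monster :: "nat \<Rightarrow> nat \<Rightarrow> 'n::finite point \<Rightarrow> 'n point set" where
  "baby_monster i j p = fst (tower i (fiber i ((under ^^ j) p)) j)"

definition delta :: "nat \<Rightarrow> nat \<Rightarrow> 'n::finite point \<Rightarrow> 'n tvec set" where
  "delta i j p = snd (tower i (fiber i ((under ^^ j) p)) j) p"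

definition critical_hyperplanes :: "nat \<Rightarrow> 'n::finite point \<Rightarrow> 'n tvec set set" where
  "critical_hyperplanes k p =
     {delta i j p | i j. i \<ge> 1 \<and> i + j = k \<and> p \<in> baby_monster i j p}"

definition regular_line :: "nat \<Rightarrow> 'n::finite point \<Rightarrow> 'n tvec set \<Rightarrow> bool" where
  "regular_line k p L \<longleftrightarrow> (\<forall>H \<in> critical_hyperplanes k p. \<not> L \<subseteq> H)"

definition vertical_line :: "nat \<Rightarrow> 'n::finite point \<Rightarrow> 'n tvec set \<Rightarrow> bool" where
  "vertical_line k p L \<longleftrightarrow> k \<ge> 1 \<and> L \<subseteq> vertical_space k p"

datatype letter = R | V | T

primrec code :: "nat \<Rightarrow> 'n::finite point \<Rightarrow> letter list" where
  "code 0 p = []"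
| "code (Suc k) p = code k (under p) @
     [if vertical_line k (under p) (dir p) then V
      else if regular_line k (under p) (dir p) then R else T]"

definition RVT_class :: "letter list \<Rightarrow> 'n::finite point set" where
  "RVT_class w = {p \<in> monster (length w). code (length w) p = w}"

definition RVL :: "'n::finite point set" where
  "RVL = {p \<in> monster 3. under p \<in> RVT_class [R, V] \<and>
            dir p \<subseteq> vertical_space 2 (under p) \<inter> delta 1 1 (under p)}"


section \<open>Curves\<close>

text \<open>Germs at \<open>0\<close> are given by representatives, which are arbitrary away from \<open>0\<close>.\<close>

definition analytic_germ :: "(complex \<Rightarrow> complex^'n::finite) \<Rightarrow> bool" where
  "analytic_germ \<gamma> \<longleftrightarrow> (\<forall>j. (\<lambda>t. \<gamma> t $ j) analytic_on {0})"

definition nonconstant_germ :: "(complex \<Rightarrow> complex^'n::finite) \<Rightarrow> bool" where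
  "nonconstant_germ \<gamma> \<longleftrightarrow> \<not> (\<exists>z. \<forall>\<^sub>F t in nhds 0. \<gamma> t = z)"

definition prolong_curve1 :: "nat \<Rightarrow> (complex \<Rightarrow> 'n::finite point) \<Rightarrow> complex \<Rightarrow> 'n point" where
  "prolong_curve1 k \<Gamma> t =
     (if \<not> tzero (velocity k \<Gamma> t) then Prol (\<Gamma> t) (tline (velocity k \<Gamma> t))
      else (THE q. limitin (monster_topology (Suc k))
                     (\<lambda>s. Prol (\<Gamma> s) (tline (velocity k \<Gamma> s))) q (at t)))"

primrec prolong_curve :: "(complex \<Rightarrow> complex^'n::finite) \<Rightarrow> nat \<Rightarrow> complex \<Rightarrow> 'n point" where
  "prolong_curve \<gamma> 0 = (\<lambda>t. Base (\<gamma> t))"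
| "prolong_curve \<gamma> (Suc k) = prolong_curve1 k (prolong_curve \<gamma> k)"

definition regular_germ :: "nat \<Rightarrow> (complex \<Rightarrow> 'n::finite point) \<Rightarrow> bool" where
  "regular_germ k \<sigma> \<longleftrightarrow> analytic_curve k \<sigma> 0 \<and> \<not> tzero (velocity k \<sigma> 0) \<and>
     regular_line k (\<sigma> 0) (tline (velocity k \<sigma> 0))"

definition Germ :: "nat \<Rightarrow> 'n::finite point \<Rightarrow> (complex \<Rightarrow> complex^'n) set" where
  "Germ k p = {\<gamma>. analytic_germ \<gamma> \<and> nonconstant_germ \<gamma> \<and>
                 prolong_curve \<gamma> k 0 = p \<and> regular_germ k (prolong_curve \<gamma> k)}"

definition submanifold :: "nat \<Rightarrow> (complex^'n::finite) set \<Rightarrow> bool" where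
  "submanifold d S \<longleftrightarrow>
     (\<forall>z\<in>S. \<exists>U \<phi> J. z \<in> U \<and> local_diffeo U \<phi> \<and> card J = d \<and>
        \<phi> ` (S \<inter> U) = {w \<in> \<phi> ` U. \<forall>j. j \<notin> J \<longrightarrow> w $ j = 0})"

definition embedding_dim :: "(complex \<Rightarrow> complex^'n::finite) \<Rightarrow> nat" where
  "embedding_dim \<gamma> = (LEAST d. \<exists>S. submanifold d S \<and> (\<forall>\<^sub>F t in nhds 0. \<gamma> t \<in> S))"

definition spatial :: "nat \<Rightarrow> 'n::finite point \<Rightarrow> bool" where
  "spatial k p \<longleftrightarrow> (\<forall>\<gamma>\<in>Germ k p. embedding_dim \<gamma> \<ge> 3) \<and> (\<exists>\<gamma>\<in>Germ k p. embedding_dim \<gamma> = 3)"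

definition spatial_class :: "nat \<Rightarrow> 'n::finite point set \<Rightarrow> bool" where
  "spatial_class k S \<longleftrightarrow> singularity_class k S \<and> (\<forall>p\<in>S. spatial k p)"

definition jet_eq ::
  "nat \<Rightarrow> (complex \<Rightarrow> complex^'n::finite) \<Rightarrow> (complex \<Rightarrow> complex^'n) \<Rightarrow> bool" where
  "jet_eq m \<gamma> \<eta> \<longleftrightarrow>
     (\<forall>i\<le>m. \<forall>j. (deriv ^^ i) (\<lambda>t. \<gamma> t $ j) 0 = (deriv ^^ i) (\<lambda>t. \<eta> t $ j) 0)"

definition jet_equivalent ::
  "nat \<Rightarrow> (complex \<Rightarrow> complex^'n::finite) \<Rightarrow> (complex \<Rightarrow> complex^'n) \<Rightarrow> bool" where
  "jet_equivalent m \<gamma> \<eta> \<longleftrightarrow>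
     (\<exists>U \<phi> h. local_diffeo U \<phi> \<and> \<gamma> 0 \<in> U \<and>
        h analytic_on {0} \<and> h 0 = 0 \<and> deriv h 0 \<noteq> 0 \<and>
        jet_eq m (\<lambda>t. \<phi> (\<gamma> (h t))) \<eta>)"

definition curves_with_jet ::
  "nat \<Rightarrow> (complex \<Rightarrow> complex^'n::finite) \<Rightarrow> (complex \<Rightarrow> complex^'n) set" where
  "curves_with_jet m \<eta> = {\<gamma>. analytic_germ \<gamma> \<and> jet_equivalent m \<gamma> \<eta>}"

end

theory Submission
  imports Defs "HOL-Complex_Analysis.Complex_Analysis"
begin

text \<open>
  Everything is computed in Kumpera-Ruiz charts, and germs of curves are replaced by power series.
  In a chart a prolonged curve is a solution of explicit differential equations (\<open>lift3\<close> for level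
  three), the critical hyperplanes are coordinate hyperplanes, and a curve belongs to \<open>Germ\<close> of a point
  if and only if the components of the velocity of its lift that belong to these hyperplanes do not
  vanish (\<open>Germ_chart\<close>). So the vanishing orders of the derivative of \<open>\<gamma>\<close> can be read off from the
  coordinates of the point. For a point of level three in \<open>\<complex>\<^sup>3\<close> there are three cases.

  In the first, the code is \<open>RVT\<close> and the line is generic in the critical hyperplane: then every nonzero
  linear projection of every curve in \<open>Germ\<close> has a velocity of order 2, 3 or 4, as for \<open>(t\<^sup>3, t\<^sup>4, t\<^sup>5)\<close>. In the
  second, the point lies in \<open>RVL\<close>, and the orders are 3, 5, 6, as for \<open>(t\<^sup>4, t\<^sup>6, t\<^sup>7)\<close>. In all other cases,
  and at all lower levels, the equations have a solution in which the velocity on the last level is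
  constant and one coordinate of the curve is a function of the other two, so the curve lies in a
  surface (\<open>planar_Germ\<close>). Conversely these sets of orders determine the case
  (\<open>velocity_orders_Germ\<close>, \<open>Germ_velocity_orders\<close>).

  A diffeomorphism acts on a curve of velocity order \<open>e\<close> by its differential, up to terms of order
  \<open>2 e + 1\<close> in the velocity. Since 4 < 5 and 6 < 7, the orders are invariant
  (\<open>velocity_orders_diffeo\<close>). Hence curves of the two types lie in no surface, the two classes are
  invariant, and the jets of the statement are the curves of the two types, because three independent
  Taylor vectors are moved to the standard basis by an affine map; for the second type a quadratic
  reparametrization first removes the term of order five. Finally the third prolongation depends
  only on the 5-jet, respectively 7-jet (\<open>jet_determines_prolongation\<close>), so each class is one orbit.

  The claim that \<open>RVL\<close> is a spatial class does not fix the dimension of the base, so it is proved for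
  all \<open>n\<close>: invariance follows from the behaviour of chart changes on critical hyperplanes
  (\<open>RVL_transition\<close>), and spatiality from the orders of three chosen projections, which do not fit into
  the span of two series (\<open>RVL_embedding_ge\<close>).
\<close>

no_notation fps_nth (infixl "$" 75)

abbreviation near0 :: "(complex => bool) => bool" (binder "NEAR " 10) where
 "near0 P \<equiv> eventually P (nhds 0)"

section \<open>Holomorphic functions of several variables\<close>

text \<open>
  The real derivative is complex linear, so \<open>h\<close> is complex differentiable at \<open>z\<close> as a function of several variables.
\<close>

definition cdiff :: "(complex^'n::finite => complex) => complex^'n => bool" where
 "cdiff h z \<longleftrightarrow> (\<exists>A. (h has_derivative A) (at z) \<and> (\<forall>s v. A (s *s v) = s * A v))"

definition hol_near :: "(complex^'n::finite => complex) => complex^'n => bool" where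
 "hol_near h z \<longleftrightarrow> (\<forall>\<^sub>F y in nhds z. cdiff h y)"

definition fd :: "(complex^'n::finite => complex) => complex^'n => complex^'n => complex" where
 "fd h z = frechet_derivative h (at z)"

definition pdiv :: "(complex^'n::finite => complex) => 'n => complex^'n => complex" where
 "pdiv h j z = fd h z (axis j 1)"

lemma norm_smult_vec: "norm (s *s (v::complex^'n::finite)) = norm s * norm v"
 by (simp add: norm_vec_def norm_mult L2_set_right_distrib)

lemma has_derivative_line: "((%s. z + s *s (v::complex^'n::finite)) has_derivative (%t. t *s v)) (at s)"
proof -
 have "bounded_linear (%t. t *s v)"
  by (rule bounded_linear_intro[where K="norm v"])
    (auto simp: norm_smult_vec vec_eq_iff algebra_simps)
 then show ?thesis
  by (auto intro!: derivative_eq_intros bounded_linear_imp_has_derivative)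
qed

lemma cdiff_fd:
 assumes "cdiff h z"
 shows "(h has_derivative fd h z) (at z)" "fd h z (s *s v) = s * fd h z v"
  "bounded_linear (fd h z)"
proof -
 obtain A where A: "(h has_derivative A) (at z)" "\<forall>s v. A (s *s v) = s * A v"
  using assms unfolding cdiff_def by auto
 have "fd h z = A" unfolding fd_def using A(1) by (metis frechet_derivative_at)
 then show "(h has_derivative fd h z) (at z)" "fd h z (s *s v) = s * fd h z v" using A by auto
 then show "bounded_linear (fd h z)" by (simp add: has_derivative_bounded_linear)
qed

lemma fd_eqI: "(h has_derivative A) (at z) ==> fd h z = A"
 unfolding fd_def by (metis frechet_derivative_at)

lemma fd_sum:
 assumes "cdiff (h::complex^'n::finite => complex) z"
 shows "fd h z v = (\<Sum>j\<in>UNIV. pdiv h j z * v $ j)"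
proof -
 have "v = (\<Sum>j\<in>UNIV. v $ j *s axis j 1)" by (simp add: basis_expansion)
 then have "fd h z v = fd h z (\<Sum>j\<in>UNIV. v $ j *s axis j 1)" by simp
 also have "\<dots> = (\<Sum>j\<in>UNIV. fd h z (v $ j *s axis j 1))"
  using linear_sum[OF bounded_linear.linear[OF cdiff_fd(3)[OF assms]]] by (simp add: o_def)
 also have "\<dots> = (\<Sum>j\<in>UNIV. pdiv h j z * v $ j)"
  by (simp add: cdiff_fd(2)[OF assms] pdiv_def mult.commute)
 finally show ?thesis .
qed

lemma cdiff_line:
 assumes "cdiff h (z + s *s v)"
 shows "((%s. h (z + s *s v)) has_field_derivative fd h (z + s *s v) v) (at s)"
proof -
 have "((%s. h (z + s *s v)) has_derivative (%t. fd h (z + s *s v) (t *s v))) (at s)"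
  by (rule has_derivative_compose[OF has_derivative_line cdiff_fd(1)[OF assms]])
 moreover have "(%t. fd h (z + s *s v) (t *s v)) = (*) (fd h (z + s *s v) v)"
  by (auto simp: cdiff_fd(2)[OF assms])
 ultimately show ?thesis unfolding has_field_derivative_def by simp
qed

context
 fixes h :: "complex^'n::finite => complex" and z :: "complex^'n" and \<rho> M :: real
 assumes \<rho>: "\<rho> > 0" and cd: "!!y. norm (y - z) < \<rho> ==> cdiff h y"
  and bd: "!!y. norm (y - z) < \<rho> ==> norm (h y) \<le> M"
begin

lemma line_holomorphic:
 assumes "v ~= 0"
 shows "(%s. h (z + s *s v)) holomorphic_on ball 0 (\<rho> / norm v)"
proof (rule holomorphic_onI)
 fix s :: complex assume "s \<in> ball 0 (\<rho> / norm v)"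
 then have "norm (s *s v) < \<rho>" using assms by (simp add: norm_smult_vec field_simps)
 then have "cdiff h (z + s *s v)" using cd by simp
 from cdiff_line[OF this] show "(%s. h (z + s *s v)) field_differentiable at s within ball 0 (\<rho> / norm v)"
  using field_differentiable_at_within field_differentiable_def by blast
qed

lemma line_bound:
 assumes "v ~= 0" "s \<in> ball 0 (\<rho> / norm v)"
 shows "norm (h (z + s *s v)) \<le> M"
proof -
 have "norm (s *s v) < \<rho>" using assms by (simp add: norm_smult_vec field_simps)
 then show ?thesis using bd by simp
qed

text \<open>
  The Cauchy estimate on the complex line through \<open>z\<close> in the direction \<open>v\<close>.
\<close>

lemma fd_bound: "norm (fd h z v) \<le> 2 * M / \<rho> * norm v"
proof (cases "v = 0")
 case True
 have "cdiff h z" using cd \<rho> by simp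
 then have "fd h z 0 = 0" by (metis cdiff_fd(3) linear_simps(3))
 then show ?thesis using True by simp
next
 case False
 let ?g = "%s. h (z + s *s v)" and ?R = "\<rho> / (2 * norm v)"
 have R: "?R > 0" "?R < \<rho> / norm v" using \<rho> False by (auto simp: field_simps)
 have hol: "?g holomorphic_on ball 0 (\<rho> / norm v)" by (rule line_holomorphic[OF False])
 have "norm ((deriv ^^ 1) ?g 0) \<le> fact 1 * M / ?R ^ 1"
 proof (rule Cauchy_inequality)
  show "?g holomorphic_on ball 0 ?R" by (rule holomorphic_on_subset[OF hol]) (use R in auto)
  show "continuous_on (cball 0 ?R) ?g"
   by (rule holomorphic_on_imp_continuous_on, rule holomorphic_on_subset[OF hol]) (use R in auto)
  show "0 < ?R" by fact
  show "norm (?g x) \<le> M" if "norm (0 - x) = ?R" for x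
   by (rule line_bound[OF False]) (use that R in auto)
 qed
 moreover have "deriv ?g 0 = fd h z v"
  using cdiff_line[of h z 0 v] cd \<rho> by (simp add: DERIV_imp_deriv)
 ultimately show ?thesis by (simp add: field_simps)
qed

text \<open>
  The same for the second order Taylor remainder.
\<close>

lemma taylor2_bound:
 assumes "norm v \<le> \<rho> / 4"
 shows "norm (h (z + v) - h z - fd h z v) \<le> 32 * M / \<rho>\<^sup>2 * (norm v)\<^sup>2"
proof (cases "v = 0")
 case True
 have "cdiff h z" using cd \<rho> by simp
 then have "fd h z 0 = 0" by (metis cdiff_fd(3) linear_simps(3))
 then show ?thesis using True by simp
next
 case False
 let ?g = "%s. h (z + s *s v)" and ?R = "\<rho> / (2 * norm v)"
 have R: "?R > 0" "?R < \<rho> / norm v" "?R \<ge> 2" using \<rho> False assms by (auto simp: field_simps)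
 have hol: "?g holomorphic_on ball 0 (\<rho> / norm v)" by (rule line_holomorphic[OF False])
 have sub: "cball x (?R / 2) \<subseteq> ball 0 (\<rho> / norm v)" if "x \<in> cball 0 1" for x :: complex
 proof
  fix y assume "y \<in> cball x (?R/2)"
  then have "dist 0 y \<le> 1 + ?R/2" using that dist_triangle[of 0 y x] by (simp add: dist_commute)
  also have "\<dots> \<le> ?R" using R by simp
  finally show "y \<in> ball 0 (\<rho> / norm v)" using R by simp
 qed
 have b2: "norm ((deriv ^^ 2) ?g x) \<le> fact 2 * M / (?R/2) ^ 2" if "x \<in> cball 0 1" for x
 proof (rule Cauchy_inequality)
  show "?g holomorphic_on ball x (?R/2)" by (rule holomorphic_on_subset[OF hol]) (use sub[OF that] in auto)
  show "continuous_on (cball x (?R/2)) ?g"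
   by (rule holomorphic_on_imp_continuous_on, rule holomorphic_on_subset[OF hol]) (use sub[OF that] in auto)
  show "0 < ?R/2" using R by simp
  fix y assume y: "norm (x - y) = ?R/2"
  then have "y \<in> ball 0 (\<rho> / norm v)" using sub[OF that] by (auto simp: subset_iff dist_norm)
  then show "norm (?g y) \<le> M" by (rule line_bound[OF False])
 qed
 have one: "cball 0 1 \<subseteq> ball (0::complex) (\<rho> / norm v)" using R by auto
 have "norm ((deriv ^^ 0) ?g 1 - (\<Sum>i\<le>1. (deriv ^^ i) ?g 0 * (1 - 0) ^ i / fact i))
   \<le> fact 2 * M / (?R/2) ^ 2 * norm (1 - 0 :: complex) ^ Suc 1 / fact 1"
 proof (rule complex_Taylor[where S="cball 0 1"])
  show "convex (cball (0::complex) 1)" by simp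
  show "((deriv ^^ i) ?g has_field_derivative (deriv ^^ Suc i) ?g x) (at x within cball 0 1)"
   if "x \<in> cball 0 1" for i x
  proof -
   have "((deriv ^^ i) ?g has_field_derivative deriv ((deriv ^^ i) ?g) x) (at x)"
    by (rule holomorphic_derivI[OF holomorphic_higher_deriv[OF hol]]) (use that one in auto)
   then show ?thesis by (simp add: has_field_derivative_at_within)
  qed
  show "norm ((deriv ^^ Suc 1) ?g x) \<le> fact 2 * M / (?R/2) ^ 2" if "x \<in> cball 0 1" for x
   using b2[OF that] by (simp add: numeral_2_eq_2)
 qed auto
 moreover have "deriv ?g 0 = fd h z v"
  using cdiff_line[of h z 0 v] cd \<rho> by (simp add: DERIV_imp_deriv)
 ultimately have "norm (h (z + v) - h z - fd h z v) \<le> 2 * M / (?R/2)^2" by (simp add: algebra_simps)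
 also have "\<dots> = 32 * M / \<rho>\<^sup>2 * (norm v)\<^sup>2" using False \<rho> by (simp add: field_simps power2_eq_square)
 finally show ?thesis .
qed

end

lemma hol_near_bounded:
 assumes "hol_near h z"
 obtains \<rho> M where "\<rho> > 0" "!!y. norm (y - z) < \<rho> ==> cdiff h y"
  "!!y. norm (y - z) < \<rho> ==> norm (h y) \<le> M"
proof -
 obtain r where r: "r > 0" "!!y. dist y z < r ==> cdiff h y"
  using assms unfolding hol_near_def eventually_nhds_metric by auto
 have "isCont h y" if "dist y z < r" for y
  using r(2)[OF that] cdiff_fd(1) has_derivative_continuous by blast
 then have "continuous_on (cball z (r/2)) h"
  using r(1) by (intro continuous_at_imp_continuous_on) (auto simp: dist_commute)
 then have "bounded (h ` cball z (r/2))"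
  by (simp add: compact_continuous_image compact_imp_bounded)
 then obtain M where M: "\<forall>y\<in>cball z (r/2). norm (h y) \<le> M"
  unfolding bounded_iff by (auto simp del: mem_cball)
 show ?thesis
  by (rule that[of "r/2" M]) (use r M in \<open>auto simp: dist_norm norm_minus_commute\<close>)
qed

lemma cdiff_diff:
 assumes "cdiff f z" "cdiff g z"
 shows "cdiff (%x. f x - g x) z" "fd (%x. f x - g x) z v = fd f z v - fd g z v"
proof -
 have *: "((%x. f x - g x) has_derivative (%v. fd f z v - fd g z v)) (at z)"
  by (intro has_derivative_diff cdiff_fd(1) assms)
 then show "fd (%x. f x - g x) z v = fd f z v - fd g z v" by (simp add: fd_eqI)
 show "cdiff (%x. f x - g x) z"
  unfolding cdiff_def using * cdiff_fd(2)[OF assms(1)] cdiff_fd(2)[OF assms(2)]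
  by (auto intro!: exI[of _ "%v. fd f z v - fd g z v"] simp: algebra_simps)
qed

lemma cdiff_shift:
 assumes "cdiff h (z + w)"
 shows "cdiff (%x. c * (h (x + w))) z" "fd (%x. c * (h (x + w))) z v = c * fd h (z + w) v"
proof -
 have "((%x. h (x + w)) has_derivative (%v. fd h (z + w) v)) (at z)"
  by (rule has_derivative_compose[of "%x. x + w" "%v. v" z UNIV h "fd h (z + w)", OF _ cdiff_fd(1)[OF assms]])
    (auto intro!: derivative_eq_intros)
 then have *: "((%x. c * (h (x + w))) has_derivative (%v. c * fd h (z + w) v)) (at z)"
  by (rule has_derivative_mult_right)
 then show "fd (%x. c * (h (x + w))) z v = c * fd h (z + w) v" by (simp add: fd_eqI)
 show "cdiff (%x. c * (h (x + w))) z"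
  unfolding cdiff_def using * cdiff_fd(2)[OF assms]
  by (auto intro!: exI[of _ "%v. c * fd h (z + w) v"] simp: algebra_simps)
qed

lemma norm_axis_one [simp]: "norm (axis j (1::complex) :: complex^'n::finite) = 1"
proof -
 have "(norm ((axis j 1 :: complex^'n) $ i))\<^sup>2 = (if i = j then 1 else 0)" for i
  by (simp add: axis_def)
 then show ?thesis by (simp add: norm_vec_def L2_set_def)
qed

text \<open>
 The difference quotients of \<open>h\<close> converge uniformly to the partial derivative, and by the Cauchy
 estimates their differentials converge uniformly too.
\<close>

lemma hol_near_pdiv:
 fixes h :: "complex^'n::finite => complex"
 assumes "hol_near h z0"
 shows "hol_near (pdiv h j) z0"
proof -
 obtain \<rho> M where \<rho>: "\<rho> > 0" and cd: "!!y. norm (y - z0) < \<rho> ==> cdiff h y"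
  and bd: "!!y. norm (y - z0) < \<rho> ==> norm (h y) \<le> M"
  using hol_near_bounded[OF assms] by blast
 define r where "r = \<rho> / 3"
 have r: "r > 0" using \<rho> by (simp add: r_def)
 define K where "K = 32 * M / r\<^sup>2"
 define e :: "complex^'n" where "e = axis j 1"
 have e1: "norm (c *s e) = norm c" for c by (simp add: norm_smult_vec e_def)
 obtain N :: nat where N: "inverse (real (Suc N)) < r / 4"
  using reals_Archimedean[of "r/4"] r by auto
 define c :: "nat => complex" where "c n = of_nat (Suc (n + N))" for n
 have c0: "c n ~= 0" for n by (simp add: c_def del: of_nat_Suc)
 have nc: "norm (c n) = real (Suc (n + N))" for n by (simp add: c_def norm_of_nat del: of_nat_Suc)
 have inv: "norm (inverse (c n)) < r / 4" for n
 proof -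
  have "norm (inverse (c n)) \<le> inverse (real (Suc N))"
   unfolding norm_inverse nc by (intro le_imp_inverse_le) auto
  then show ?thesis using N by simp
 qed
 define f where "f n y = c n * h (y + inverse (c n) *s e) - c n * h (y + 0)" for n y
 define f' where "f' n y v = c n * fd h (y + inverse (c n) *s e) v - c n * fd h (y + 0) v" for n y v
 have in2: "norm (y - z0) < 2 * r ==> norm (x - y) < r ==> norm (x - z0) < \<rho>" for x y
  using norm_triangle_ineq[of "x - y" "y - z0"] by (simp add: r_def)
 have cdf: "cdiff (f n) y" "fd (f n) y v = f' n y v" if "norm (y - z0) < 2 * r" for n y v
 proof -
  have 1: "cdiff h (y + inverse (c n) *s e)"
   by (rule cd, rule in2[OF that]) (use inv[of n] r e1[of "inverse (c n)"] in \<open>simp add: norm_inverse\<close>)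
  have 2: "cdiff h (y + 0)" by (rule cd, rule in2[OF that]) (use r in simp)
  show "cdiff (f n) y" unfolding f_def
   by (rule cdiff_diff(1)[OF cdiff_shift(1)[OF 1] cdiff_shift(1)[OF 2]])
  show "fd (f n) y v = f' n y v" unfolding f_def f'_def
   unfolding cdiff_diff(2)[OF cdiff_shift(1)[OF 1] cdiff_shift(1)[OF 2]]
   using cdiff_shift(2)[OF 1] cdiff_shift(2)[OF 2] by simp
 qed
 have K0: "0 \<le> K"
 proof -
  have "0 \<le> M" using order_trans[OF norm_ge_zero bd[of z0]] \<rho> by simp
  then show ?thesis by (simp add: K_def)
 qed
 have close: "norm (f n y - pdiv h j y) \<le> K / norm (c n)" if "norm (y - z0) < 2 * r" for n y
 proof -
  have "norm (h (y + inverse (c n) *s e) - h y - fd h y (inverse (c n) *s e)) \<le> K * (norm (inverse (c n) *s e))\<^sup>2"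
   unfolding K_def
  proof (rule taylor2_bound[OF r])
   show "norm (inverse (c n) *s e) \<le> r / 4" using inv[of n] e1 by (simp add: less_imp_le)
  qed (use in2[OF that] cd bd in auto)
  then have "norm (c n) * norm (h (y + inverse (c n) *s e) - h y - fd h y (inverse (c n) *s e))
    \<le> norm (c n) * (K * (norm (inverse (c n)))\<^sup>2)"
   by (intro mult_left_mono) (auto simp: e1)
  also have "\<dots> = K / norm (c n)" using c0[of n] by (simp add: norm_divide power2_eq_square field_simps)
  also have "norm (c n) * norm (h (y + inverse (c n) *s e) - h y - fd h y (inverse (c n) *s e))
    = norm (f n y - pdiv h j y)"
  proof -
   have "cdiff h y" by (rule cd, rule in2[OF that]) (use r in simp)
   then have "fd h y (inverse (c n) *s e) = inverse (c n) * pdiv h j y"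
    by (simp add: cdiff_fd(2) pdiv_def e_def)
   then have "c n * (h (y + inverse (c n) *s e) - h y - fd h y (inverse (c n) *s e)) = f n y - pdiv h j y"
    using c0[of n] by (simp add: f_def algebra_simps)
   then show ?thesis by (metis norm_mult)
  qed
  finally show ?thesis .
 qed
 have dcl: "norm (f' n y v - f' m y v) \<le> 2 * (K / norm (c n) + K / norm (c m)) / r * norm v"
  if y: "norm (y - z0) < r" for n m y v
 proof -
  have s: "norm (x - z0) < 2 * r" if "norm (x - y) < r" for x
   using norm_triangle_ineq[of "x - y" "y - z0"] that y by simp
  have "norm (fd (%x. f n x - f m x) y v) \<le> 2 * (K / norm (c n) + K / norm (c m)) / r * norm v"
  proof (rule fd_bound[OF r])
   fix x assume x: "norm (x - y) < r"
   show "cdiff (%x. f n x - f m x) x" by (intro cdiff_diff cdf s x)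
   have "norm (f n x - f m x) = norm ((f n x - pdiv h j x) - (f m x - pdiv h j x))" by simp
   also have "\<dots> \<le> K / norm (c n) + K / norm (c m)"
    using norm_triangle_ineq4 close[OF s[OF x], of n] close[OF s[OF x], of m]
    by (meson add_mono order_trans)
   finally show "norm (f n x - f m x) \<le> K / norm (c n) + K / norm (c m)" .
  qed
  moreover have "fd (%x. f n x - f m x) y v = f' n y v - f' m y v"
   using cdiff_diff(2)[OF cdf(1) cdf(1)] cdf(2) s[of y] r by simp
  ultimately show ?thesis by simp
 qed
 have lim0: "(%n. K / norm (c n)) \<longlonglongrightarrow> 0"
 proof -
  have "(%n. K * inverse (real (Suc (n + N)))) \<longlonglongrightarrow> K * 0"
   using LIMSEQ_ignore_initial_segment[OF LIMSEQ_inverse_real_of_nat, of N]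
   by (intro tendsto_mult tendsto_const) auto
  then show ?thesis by (simp add: nc divide_inverse del: of_nat_Suc)
 qed
 have anti: "K / norm (c m) \<le> K / norm (c n)" if "n \<le> m" for n m
  using that K0 by (intro divide_left_mono) (auto simp: nc)
 have Cau: "Cauchy (%n. f' n y v)" if y: "norm (y - z0) < r" for y v
 proof (rule metric_CauchyI)
  fix \<epsilon> :: real assume \<epsilon>: "\<epsilon> > 0"
  have "(%n. 2 * (K / norm (c n) + K / norm (c n)) / r * norm v) \<longlonglongrightarrow> 2 * (0 + 0) / r * norm v"
   by (intro tendsto_intros lim0) (use r in auto)
  then have "\<forall>\<^sub>F n in sequentially. 2 * (K / norm (c n) + K / norm (c n)) / r * norm v < \<epsilon>"
   using \<epsilon> by (auto elim!: order_tendstoD)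
  then obtain n0 where n0: "2 * (K / norm (c n0) + K / norm (c n0)) / r * norm v < \<epsilon>"
   by (auto simp: eventually_sequentially)
  show "\<exists>M. \<forall>m\<ge>M. \<forall>n\<ge>M. dist (f' m y v) (f' n y v) < \<epsilon>"
  proof (intro exI allI impI)
   fix m n assume mn: "m \<ge> n0" "n \<ge> n0"
   have "dist (f' m y v) (f' n y v) \<le> 2 * (K / norm (c m) + K / norm (c n)) / r * norm v"
    using dcl[OF y] by (simp add: dist_norm)
   also have "\<dots> \<le> 2 * (K / norm (c n0) + K / norm (c n0)) / r * norm v"
    using anti[OF mn(1)] anti[OF mn(2)] r
    by (intro mult_right_mono divide_right_mono mult_left_mono add_mono) auto
   finally show "dist (f' m y v) (f' n y v) < \<epsilon>" using n0 by simp
  qed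
 qed
 define g' where "g' y v = lim (%n. f' n y v)" for y v
 have g': "(%n. f' n y v) \<longlonglongrightarrow> g' y v" if "norm (y - z0) < r" for y v
  using Cau[OF that] unfolding g'_def by (simp add: Cauchy_convergent convergent_LIMSEQ_iff[symmetric])
 have fg: "norm (f' n y v - g' y v) \<le> 2 * (K / norm (c n)) / r * norm v" if y: "norm (y - z0) < r" for n y v
 proof -
  have 1: "(%m. norm (f' n y v - f' m y v)) \<longlonglongrightarrow> norm (f' n y v - g' y v)"
   by (intro tendsto_intros g' y)
  have 2: "(%m. 2 * (K / norm (c n) + K / norm (c m)) / r * norm v) \<longlonglongrightarrow> 2 * (K / norm (c n) + 0) / r * norm v"
   by (intro tendsto_intros lim0) (use r in auto)
  show ?thesis using LIMSEQ_le[OF 1 2] dcl[OF y] by auto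
 qed
 have "\<exists>g. \<forall>x\<in>ball z0 r. (%n. f n x) \<longlonglongrightarrow> g x \<and> (g has_derivative g' x) (at x within ball z0 r)"
 proof (rule has_derivative_sequence[where f'=f'])
  show "(f n has_derivative f' n x) (at x within ball z0 r)" if "x \<in> ball z0 r" for n x
  proof -
   have "norm (x - z0) < 2 * r" using that r by (simp add: dist_norm norm_minus_commute)
   then have "fd (f n) x = f' n x" "cdiff (f n) x" using cdf by auto
   then have "(f n has_derivative f' n x) (at x)" using cdiff_fd(1) by metis
   then show ?thesis by (rule has_derivative_at_withinI)
  qed
  show "\<forall>\<^sub>F n in sequentially. \<forall>x\<in>ball z0 r. \<forall>h. norm (f' n x h - g' x h) \<le> \<epsilon> * norm h" if "\<epsilon> > 0" for \<epsilon>
  proof -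
   have "(%n. 2 * (K / norm (c n)) / r) \<longlonglongrightarrow> 2 * 0 / r"
    by (intro tendsto_intros lim0) (use r in auto)
   then have "\<forall>\<^sub>F n in sequentially. 2 * (K / norm (c n)) / r < \<epsilon>"
    using that by (auto elim!: order_tendstoD)
   then show ?thesis
   proof (eventually_elim, intro ballI allI)
    fix n x v assume n: "2 * (K / norm (c n)) / r < \<epsilon>" and "x \<in> ball z0 r"
    then have "norm (x - z0) < r" by (simp add: dist_norm norm_minus_commute)
    from fg[OF this, of n v] show "norm (f' n x v - g' x v) \<le> \<epsilon> * norm v"
     using n by (meson less_imp_le mult_right_mono norm_ge_zero order_trans)
   qed
  qed
  show "z0 \<in> ball z0 r" using r by simp
  have "(%n. f n z0 - pdiv h j z0) \<longlonglongrightarrow> 0"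
   by (rule Lim_null_comparison[OF _ lim0]) (use close[of z0] r in auto)
  then show "(%n. f n z0) \<longlonglongrightarrow> pdiv h j z0" by (simp add: LIM_zero_iff)
 qed simp
 then obtain g where g: "!!x. x \<in> ball z0 r ==> (%n. f n x) \<longlonglongrightarrow> g x"
  "!!x. x \<in> ball z0 r ==> (g has_derivative g' x) (at x within ball z0 r)" by blast
 have geq: "g x = pdiv h j x" if "x \<in> ball z0 r" for x
 proof -
  have "norm (x - z0) < 2 * r" using that r by (simp add: dist_norm norm_minus_commute)
  then have "(%n. f n x - pdiv h j x) \<longlonglongrightarrow> 0"
   by (intro Lim_null_comparison[OF _ lim0]) (use close[of x] in auto)
  then have "(%n. f n x) \<longlonglongrightarrow> pdiv h j x" by (simp add: LIM_zero_iff)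
  then show ?thesis using g(1)[OF that] LIMSEQ_unique by blast
 qed
 have "cdiff (pdiv h j) x" if x: "x \<in> ball z0 r" for x
 proof -
  have x': "norm (x - z0) < r" using x by (simp add: dist_norm norm_minus_commute)
  have "(g has_derivative g' x) (at x)" using g(2)[OF x] unfolding at_within_open[OF x open_ball] .
  then have 1: "(pdiv h j has_derivative g' x) (at x)"
   by (rule has_derivative_transform_within_open[OF _ open_ball x geq])
  have "g' x (s *s v) = s * g' x v" for s v
  proof -
   have "f' n x (s *s v) = s * f' n x v" for n
    using cdiff_fd(2)[OF cdf(1)[of x n]] cdf(2)[of x n] x' r by simp
   then have "(%n. s * f' n x v) \<longlonglongrightarrow> g' x (s *s v)" using g'[OF x', of "s *s v"] by simp
   moreover have "(%n. s * f' n x v) \<longlonglongrightarrow> s * g' x v" by (intro tendsto_intros g' x')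
   ultimately show ?thesis using LIMSEQ_unique by blast
  qed
  then show ?thesis unfolding cdiff_def using 1 by blast
 qed
 then show ?thesis unfolding hol_near_def eventually_nhds using r
  by (intro exI[of _ "ball z0 r"]) auto
qed

section \<open>Rational differential expressions\<close>

definition analytic_vec :: "(complex => complex^'n::finite) => complex => bool" where
 "analytic_vec f t \<longleftrightarrow> (\<forall>j. (%t. f t $ j) analytic_on {t})"

definition analytic_coords :: "(complex => 'n::finite coords) => complex => bool" where
 "analytic_coords \<xi> t \<longleftrightarrow> (\<forall>i j. (%t. \<xi> t i $ j) analytic_on {t})"

definition vderiv :: "(complex => complex^'n::finite) => complex => complex^'n" where
 "vderiv f t = (\<chi> j. deriv (%s. f s $ j) t)"

definition cderiv :: "(complex => 'n::finite coords) => complex => 'n coords" where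
 "cderiv \<xi> t = (%i. \<chi> j. deriv (%s. \<xi> s i $ j) t)"

text \<open>
  The chart changes of the tower, and the action of a diffeomorphism on it, are obtained from functions on
  the base by field operations and by derivatives along vector fields with coefficients of the same
  kind. Representing them as expressions reduces continuity, analyticity along curves and the chain rule
  to one induction each. \<open>Crd i j\<close> is the coordinate \<open>x i $ j\<close>.
\<close>

datatype 'n::finite rexp =
  Cst complex
 | Crd nat 'n
 | Hol "complex^'n => complex"
 | Add "'n rexp" "'n rexp"
 | Mul "'n rexp" "'n rexp"
 | Inv "'n rexp"
 | Sum "'n => 'n rexp"

primrec eval :: "'n::finite rexp => 'n coords => complex" where
 "eval (Cst c) x = c"
| "eval (Crd i j) x = x i $ j"
| "eval (Hol h) x = h (x 0)"
| "eval (Add e f) x = eval e x + eval f x"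
| "eval (Mul e f) x = eval e x * eval f x"
| "eval (Inv e) x = inverse (eval e x)"
| "eval (Sum f) x = (\<Sum>j\<in>UNIV. eval (f j) x)"

primrec ok :: "'n::finite rexp => 'n coords => bool" where
 "ok (Cst c) x = True"
| "ok (Crd i j) x = True"
| "ok (Hol h) x = hol_near h (x 0)"
| "ok (Add e f) x = (ok e x \<and> ok f x)"
| "ok (Mul e f) x = (ok e x \<and> ok f x)"
| "ok (Inv e) x = (ok e x \<and> eval e x ~= 0)"
| "ok (Sum f) x = (\<forall>j. ok (f j) x)"

text \<open>
  The directional derivative along a vector; \<open>pd\<close> below is the derivative along a vector field given by expressions.
\<close>

primrec dd :: "'n::finite rexp => 'n coords => 'n coords => complex" where
 "dd (Cst c) x v = 0"
| "dd (Crd i j) x v = v i $ j"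
| "dd (Hol h) x v = (\<Sum>j\<in>UNIV. pdiv h j (x 0) * v 0 $ j)"
| "dd (Add e f) x v = dd e x v + dd f x v"
| "dd (Mul e f) x v = dd e x v * eval f x + eval e x * dd f x v"
| "dd (Inv e) x v = - (inverse (eval e x) * dd e x v * inverse (eval e x))"
| "dd (Sum f) x v = (\<Sum>j\<in>UNIV. dd (f j) x v)"

primrec pd :: "'n::finite rexp => (nat => 'n => 'n rexp) => 'n rexp" where
 "pd (Cst c) W = Cst 0"
| "pd (Crd i j) W = W i j"
| "pd (Hol h) W = Sum (%j. Mul (Hol (pdiv h j)) (W 0 j))"
| "pd (Add e f) W = Add (pd e W) (pd f W)"
| "pd (Mul e f) W = Add (Mul (pd e W) f) (Mul e (pd f W))"
| "pd (Inv e) W = Mul (Cst (-1)) (Mul (Mul (Inv e) (pd e W)) (Inv e))"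
| "pd (Sum f) W = Sum (%j. pd (f j) W)"

primrec lev :: "nat => 'n::finite rexp => bool" where
 "lev k (Cst c) = True"
| "lev k (Crd i j) = (i \<le> k)"
| "lev k (Hol h) = True"
| "lev k (Add e f) = (lev k e \<and> lev k f)"
| "lev k (Mul e f) = (lev k e \<and> lev k f)"
| "lev k (Inv e) = lev k e"
| "lev k (Sum f) = (\<forall>j. lev k (f j))"

lemma eval_pd: "eval (pd e W) x = dd e x (%i. \<chi> j. eval (W i j) x)"
 by (induction e) auto

lemma ok_pd: "ok e x ==> (!!i j. ok (W i j) x) ==> ok (pd e W) x"
 by (induction e) (auto intro: hol_near_pdiv)

lemma lev_pd: "lev k e ==> (!!i j. lev k (W i j)) ==> lev k (pd e W)"
 by (induction e) auto

lemma lev_mono: "lev k e ==> k \<le> l ==> lev l e"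
 by (induction e) auto

lemma lev_cong:
 assumes "\<forall>i\<le>k. x i = y i" "\<forall>i\<le>k. v i = w i"
 shows lev_eval: "lev k e ==> eval e x = eval e y"
  and lev_ok: "lev k e ==> ok e x = ok e y"
  and lev_dd: "lev k e ==> dd e x v = dd e y w"
proof -
 show 1: "lev k e ==> eval e x = eval e y" for e
  by (induction e) (simp_all add: assms)
 show "lev k e ==> ok e x = ok e y"
  by (induction e) (simp_all add: assms 1)
 show "lev k e ==> dd e x v = dd e y w"
  by (induction e) (simp_all add: assms 1)
qed

lemma dd_add: "dd e x (%i. v i + w i) = dd e x v + dd e x w"
 by (induction e) (auto simp: algebra_simps sum.distrib)

lemma dd_scale: "dd e x (%i. s *s v i) = s * dd e x v"
 by (induction e) (auto simp: algebra_simps sum_distrib_left)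

lemma dd_zero: "dd e x (%i. 0) = 0"
 by (induction e) auto

lemma analytic_vecD: "analytic_vec f t ==> (%t. f t $ j) analytic_on {t}"
 by (simp add: analytic_vec_def)

lemma analytic_vec_tendsto:
 assumes "analytic_vec f t" shows "(f \<longlongrightarrow> f t) (nhds t)"
proof -
 have "((%s. f s $ j) \<longlongrightarrow> f t $ j) (nhds t)" for j
  using analytic_at_imp_isCont[OF analytic_vecD[OF assms, of j]]
   tendsto_at_iff_tendsto_nhds[of "%s. f s $ j" t] by (simp add: isCont_def)
 then show ?thesis by (auto intro: vec_tendstoI)
qed

lemma eventually_analytic_on:
 assumes "f analytic_on {t::complex}" shows "\<forall>\<^sub>F s in nhds t. f analytic_on {s}"
proof -
 obtain S where S: "open S" "t \<in> S" "f holomorphic_on S" using assms unfolding analytic_at by blast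
 then have "f analytic_on {s}" if "s \<in> S" for s unfolding analytic_at using that by blast
 then show ?thesis using S eventually_nhds by blast
qed

lemma has_derivative_vec_complex:
 assumes "analytic_vec f t"
 shows "(f has_derivative (%s. s *s vderiv f t)) (at t)"
proof -
 have c: "((%s. f s $ j) has_derivative (%s. s * deriv (%s. f s $ j) t)) (at t)" for j
  using analytic_derivI[OF analytic_vecD[OF assms, of j]]
  by (simp add: has_field_derivative_def mult.commute[of _ "deriv _ _"])
 have "bounded_linear (%s. s *s vderiv f t)"
  by (rule bounded_linear_intro[where K="norm (vderiv f t)"])
    (auto simp: norm_smult_vec vec_eq_iff algebra_simps)
 moreover have "((%y. (f y - f t - (y - t) *s vderiv f t) /\<^sub>R norm (y - t)) \<longlongrightarrow> 0) (at t)"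
 proof (rule vec_tendstoI)
  fix j
  show "((%y. ((f y - f t - (y - t) *s vderiv f t) /\<^sub>R norm (y - t)) $ j) \<longlongrightarrow> 0 $ j) (at t)"
   using c[of j] unfolding has_derivative_def by (simp only: vector_scaleR_component
    vector_minus_component vector_smult_component vderiv_def vec_lambda_beta zero_index Lim_ident_at trivial_limit_at not_False_eq_True)
 qed
 ultimately show ?thesis by (simp add: has_derivative_def)
qed

text \<open>
  Composition of a holomorphic function with an analytic curve, with the chain rule.
\<close>

lemma hol_curve:
 assumes "hol_near h (\<alpha> t)" "analytic_vec \<alpha> t"
 shows "(%s. h (\<alpha> s)) analytic_on {t}"
  and "deriv (%s. h (\<alpha> s)) t = fd h (\<alpha> t) (vderiv \<alpha> t)"
proof -
 have D: "((%s. h (\<alpha> s)) has_field_derivative fd h (\<alpha> s) (vderiv \<alpha> s)) (at s)"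
  if "cdiff h (\<alpha> s)" "analytic_vec \<alpha> s" for s
 proof -
  have "((%s. h (\<alpha> s)) has_derivative (%r. fd h (\<alpha> s) (r *s vderiv \<alpha> s))) (at s)"
   by (rule has_derivative_compose[OF has_derivative_vec_complex[OF that(2)] cdiff_fd(1)[OF that(1)]])
  moreover have "(%r. fd h (\<alpha> s) (r *s vderiv \<alpha> s)) = (*) (fd h (\<alpha> s) (vderiv \<alpha> s))"
   by (auto simp: cdiff_fd(2)[OF that(1)])
  ultimately show ?thesis unfolding has_field_derivative_def by simp
 qed
 have 0: "cdiff h (\<alpha> t)" using assms(1) unfolding hol_near_def by (rule eventually_nhds_x_imp_x)
 show "deriv (%s. h (\<alpha> s)) t = fd h (\<alpha> t) (vderiv \<alpha> t)"
  by (rule DERIV_imp_deriv[OF D[OF 0 assms(2)]])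
 have 1: "\<forall>\<^sub>F s in nhds t. cdiff h (\<alpha> s)"
  using analytic_vec_tendsto[OF assms(2)] assms(1) unfolding hol_near_def
  by (rule eventually_compose_filterlim[rotated])
 have "\<forall>\<^sub>F s in nhds t. (%r. \<alpha> r $ j) analytic_on {s}" for j
  using analytic_vecD[OF assms(2), of j] by (rule eventually_analytic_on)
 then have 2: "\<forall>\<^sub>F s in nhds t. analytic_vec \<alpha> s"
  unfolding analytic_vec_def by (simp add: eventually_all_finite)
 from 1 2 have "\<forall>\<^sub>F s in nhds t. (%s. h (\<alpha> s)) field_differentiable at s"
  unfolding field_differentiable_def by eventually_elim (rule exI, rule D)
 then show "(%s. h (\<alpha> s)) analytic_on {t}"
  unfolding analytic_at eventually_nhds holomorphic_on_def
  using field_differentiable_at_within by blast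
qed

lemma eval_curve:
 assumes "analytic_coords \<xi> t" "ok e (\<xi> t)"
 shows "(%s. eval e (\<xi> s)) analytic_on {t} \<and>
  deriv (%s. eval e (\<xi> s)) t = dd e (\<xi> t) (cderiv \<xi> t) \<and>
  (\<forall>\<^sub>F s in nhds t. ok e (\<xi> s))"
 using assms(2)
proof (induction e)
 case (Crd i j)
 then show ?case using assms(1) by (simp add: analytic_coords_def cderiv_def)
next
 case (Hol h)
 have a: "analytic_vec (%t. \<xi> t 0) t" using assms(1) by (simp add: analytic_coords_def analytic_vec_def)
 have h: "hol_near h (\<xi> t 0)" using Hol by simp
 then have "cdiff h (\<xi> t 0)" unfolding hol_near_def by (rule eventually_nhds_x_imp_x)
 then have "deriv (%s. h (\<xi> s 0)) t = dd (Hol h) (\<xi> t) (cderiv \<xi> t)"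
  using hol_curve(2)[OF h a] by (simp add: fd_sum vderiv_def cderiv_def)
 moreover have "\<forall>\<^sub>F s in nhds t. hol_near h (\<xi> s 0)"
  using analytic_vec_tendsto[OF a] h unfolding hol_near_def
  by (subst (asm) eventually_eventually[symmetric]) (rule eventually_compose_filterlim)
 ultimately show ?case using hol_curve(1)[OF h a] by simp
next
 case (Add e f)
 then show ?case
  by (auto intro!: analytic_intros deriv_add eventually_conj simp: analytic_on_imp_differentiable_at)
next
 case (Mul e f)
 then show ?case
  by (auto intro!: analytic_intros eventually_conj simp: analytic_on_imp_differentiable_at deriv_mult algebra_simps)
next
 case (Inv e)
 then have *: "(%s. eval e (\<xi> s)) analytic_on {t}" "eval e (\<xi> t) ~= 0" by auto
 have "\<forall>\<^sub>F s in nhds t. eval e (\<xi> s) ~= 0"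
  using analytic_at_imp_isCont[OF *(1)] *(2)
  by (metis isCont_def tendsto_at_iff_tendsto_nhds tendsto_imp_eventually_ne)
 moreover have "deriv (%s. inverse (eval e (\<xi> s))) t = dd (Inv e) (\<xi> t) (cderiv \<xi> t)"
  using DERIV_inverse'[OF analytic_derivI[OF *(1)] *(2)] Inv by (auto intro!: DERIV_imp_deriv)
 ultimately show ?case using Inv * by (auto intro!: analytic_intros eventually_conj)
next
 case (Sum f)
 have "((%s. \<Sum>j\<in>UNIV. eval (f j) (\<xi> s)) has_field_derivative (\<Sum>j\<in>UNIV. deriv (%s. eval (f j) (\<xi> s)) t)) (at t)"
  using Sum by (intro DERIV_sum analytic_derivI) auto
 then show ?case using Sum
  by (auto intro!: analytic_intros DERIV_imp_deriv[THEN trans] sum.cong simp: eventually_all_finite)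
qed simp_all

lemma continuous_on_eval: "(!!x. x \<in> S ==> ok e x) ==> continuous_on S (eval e)"
 and open_ok: "open {x. ok e x}"
proof -
 have "continuous_on {x. ok e x} (eval e) \<and> open {x. ok e x}"
 proof (induction e)
  case (Crd i j)
  then show ?case by (auto intro!: continuous_intros continuous_on_component)
 next
  case (Hol h)
  have o: "open {z. hol_near h z}"
   unfolding hol_near_def by (subst open_subopen) (force simp: eventually_nhds)
  have c: "continuous_on {z. hol_near h z} h"
  proof (rule continuous_at_imp_continuous_on, rule ballI)
   fix z assume "z \<in> {z. hol_near h z}"
   then have "cdiff h z" unfolding hol_near_def using eventually_nhds_x_imp_x by blast
   then show "isCont h z" using cdiff_fd(1) has_derivative_continuous by blast
  qed
  have "open ((%x. x (0::nat)) -` {z. hol_near h z})"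
   by (rule open_vimage[OF o]) (rule continuous_on_product_coordinates)
  then show ?case
   by (auto simp: vimage_def intro!: continuous_on_compose2[OF c]
     continuous_on_subset[OF continuous_on_product_coordinates])
 next
  case (Add e f)
  then show ?case
   by (auto intro!: continuous_intros open_Collect_conj elim!: continuous_on_subset)
 next
  case (Mul e f)
  then show ?case
   by (auto intro!: continuous_intros open_Collect_conj elim!: continuous_on_subset)
 next
  case (Inv e)
  have "open ({x. ok e x} \<inter> eval e -` (- {0}))"
   using Inv by (intro continuous_open_preimage) auto
  moreover have "{x. ok e x} \<inter> eval e -` (- {0}) = {x. ok (Inv e) x}" by auto
  ultimately show ?case using Inv by (auto intro!: continuous_intros elim!: continuous_on_subset)
 next
  case (Sum f)
  have "open (\<Inter>j. {x. ok (f j) x})" using Sum by (intro open_INT) auto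
  moreover have "(\<Inter>j. {x. ok (f j) x}) = {x. ok (Sum f) x}" by auto
  moreover have "continuous_on {x. ok (Sum f) x} (eval (f j))" for j
   using Sum[of "f j"] by (auto elim!: continuous_on_subset)
  ultimately show ?case by (auto intro!: continuous_intros)
 qed auto
 then show "open {x. ok e x}" "(!!x. x \<in> S ==> ok e x) ==> continuous_on S (eval e)"
  by (auto intro: continuous_on_subset)
qed

section \<open>Charts\<close>

fun chart_tan :: "'n::finite list => 'n coords set" where
 "chart_tan [] = {v. \<forall>i>0. v i = 0}"
| "chart_tan (a # c) =
   {v. v (Suc (length c)) $ a = 0 \<and> v(Suc (length c) := 0) \<in> chart_tan c}"

text \<open>
  The level on which the frame vector of index \<open>j\<close> is a coordinate field: it is the last level whose chart
  does not use \<open>j\<close> for the horizontal lift. Reading off the coordinate of that level (\<open>coef\<close>) inverts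
  \<open>chart_frame\<close>.
\<close>

primrec lvl :: "'n list => 'n => nat" where
 "lvl [] j = 0"
| "lvl (a # c) j = (if j = a then lvl c j else Suc (length c))"

definition coef :: "'n::finite list => 'n coords => complex^'n" where
 "coef c v = (\<chi> j. v (lvl c j) $ j)"

lemma lvl_le: "lvl c j \<le> length c"
 by (induction c) auto

lemma chart_dom_high: "x \<in> chart_dom c ==> i > length c ==> x i = 0"
proof (induction c arbitrary: x)
 case (Cons a c)
 then show ?case by (auto dest!: Cons.IH[of "x(Suc (length c) := 0)"])
qed auto

lemma chart_dom_trunc: "x \<in> chart_dom c ==> x(Suc (length c) := 0) = x"
 using chart_dom_high[of x c "Suc (length c)"] by (metis fun_upd_triv lessI)

lemma chart_frame_high: "i > length c ==> chart_frame c x u i = 0"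
 by (induction c arbitrary: u) auto

lemma chart_frame_cong:
 assumes "!!i. i \<le> length c ==> x i = y i"
 shows "chart_frame c x u = chart_frame c y u"
proof -
 have "\<forall>i\<le>k. x i = y i ==> length c \<le> k ==> chart_frame c x u = chart_frame c y u" for k
  by (induction c arbitrary: u) simp_all
 then show ?thesis using assms by blast
qed

lemma chart_frame_scale: "chart_frame c x (s *s u) = (%i. s *s chart_frame c x u i)"
proof (induction c arbitrary: u)
 case (Cons a c)
 have "(s *s u) $ a *s x (Suc (length c)) = s *s (u $ a *s x (Suc (length c)))"
  by (simp add: vec_eq_iff)
 then have "chart_frame c x ((s *s u) $ a *s x (Suc (length c))) =
   (%i. s *s chart_frame c x (u $ a *s x (Suc (length c))) i)" using Cons by metis
 then show ?case by (auto simp: fun_eq_iff vec_eq_iff)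
qed (auto simp: fun_eq_iff)

lemma chart_frame_zero [simp]: "chart_frame c x 0 = (%i. 0)"
 by (induction c) (auto simp: fun_eq_iff vec_eq_iff)

lemma chart_frame_add: "chart_frame c x (u + w) = (%i. chart_frame c x u i + chart_frame c x w i)"
 by (induction c arbitrary: u w) (auto simp: fun_eq_iff vec_eq_iff vector_sadd_rdistrib)

lemma chart_frame_trunc:
 "(chart_frame (a # c) x u)(Suc (length c) := 0) = chart_frame c x (u $ a *s x (Suc (length c)))"
 by (auto simp: fun_eq_iff chart_frame_high)

lemma chart_frame_upd [simp]: "length c < k ==> chart_frame c (x(k := z)) u = chart_frame c x u"
 by (rule chart_frame_cong) auto

lemma chart_frame_tan: "chart_frame c x u \<in> chart_tan c"
proof (induction c arbitrary: u)
 case (Cons a c)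
 then show ?case unfolding chart_tan.simps mem_Collect_eq chart_frame_trunc by simp
qed simp

lemma coef_frame: "x \<in> chart_dom c ==> coef c (chart_frame c x u) = u"
proof (induction c arbitrary: x u)
 case (Cons a c)
 let ?x = "x(Suc (length c) := 0)"
 have "coef c (chart_frame c ?x (u $ a *s x (Suc (length c)))) = u $ a *s x (Suc (length c))"
  by (rule Cons.IH) (use Cons.prems in \<open>simp del: fun_upd_apply\<close>)
 then have "chart_frame c x (u $ a *s x (Suc (length c))) (lvl c a) $ a = u $ a"
  using Cons.prems by (simp add: coef_def vec_eq_iff)
 moreover have "lvl c a ~= Suc (length c)" using lvl_le[of c a] by simp
 ultimately show ?case by (simp add: coef_def vec_eq_iff del: chart_dom.simps)
qed (simp add: coef_def)

lemma chart_frame_inj: "x \<in> chart_dom c ==> chart_frame c x u = chart_frame c x w \<longleftrightarrow> u = w"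
 using coef_frame by metis

lemma chart_frame_eq_0: "x \<in> chart_dom c ==> chart_frame c x u = (%i. 0) \<longleftrightarrow> u = 0"
 using chart_frame_inj[of x c u 0] by simp

lemma chart_line: "x \<in> chart_dom c ==> v \<in> chart_tan c ==> (%i. x i + t *s v i) \<in> chart_dom c"
proof (induction c arbitrary: x v)
 case (Cons a c)
 have "(%i. (x(Suc (length c) := 0)) i + t *s (v(Suc (length c) := 0)) i) \<in> chart_dom c"
  using Cons.IH[of "x(Suc (length c) := 0)" "v(Suc (length c) := 0)"] Cons.prems by (simp del: fun_upd_apply)
 moreover have "(%i. (x(Suc (length c) := 0)) i + t *s (v(Suc (length c) := 0)) i) =
   (%i. x i + t *s v i)(Suc (length c) := 0)" by auto
 ultimately show ?case using Cons.prems by simp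
qed simp

lemma chart_tan_frame:
 assumes "v \<in> chart_tan (a # c)" "v(Suc (length c) := 0) = chart_frame c x (s *s x (Suc (length c)))"
 shows "v = chart_frame (a # c) x (\<chi> j. if j = a then s else v (Suc (length c)) $ j)"
proof -
 have "v = (v(Suc (length c) := 0))(Suc (length c) := v (Suc (length c)))" by simp
 also have "\<dots> = (chart_frame c x (s *s x (Suc (length c))))(Suc (length c) := v (Suc (length c)))"
  using assms(2) by simp
 also have "\<dots> = chart_frame (a # c) x (\<chi> j. if j = a then s else v (Suc (length c)) $ j)"
  using assms(1) by (auto simp: fun_eq_iff vec_eq_iff)
 finally show ?thesis .
qed

lemma analytic_line: "analytic_coords (%t i. x i + t *s v i) t"
 unfolding analytic_coords_def by (auto intro!: analytic_intros)

lemma cderiv_line: "cderiv (%t i. x i + t *s v i) t = v"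
 unfolding cderiv_def by (auto simp: fun_eq_iff vec_eq_iff intro!: DERIV_imp_deriv derivative_eq_intros)

lemma cderiv_cong:
 assumes "\<forall>\<^sub>F s in nhds t. \<xi> s = \<zeta> s" shows "cderiv \<xi> t = cderiv \<zeta> t"
 unfolding cderiv_def
 by (auto simp: fun_eq_iff vec_eq_iff intro!: deriv_cong_ev eventually_mono[OF assms])

lemma analytic_coords_cong:
 assumes "\<forall>\<^sub>F s in nhds t. \<xi> s = \<zeta> s" shows "analytic_coords \<xi> t = analytic_coords \<zeta> t"
proof -
 have "(%s. \<xi> s i $ j) analytic_on {t} \<longleftrightarrow> (%s. \<zeta> s i $ j) analytic_on {t}" for i j
  by (rule analytic_at_cong) (auto intro: eventually_mono[OF assms])
 then show ?thesis by (simp add: analytic_coords_def)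
qed

lemma cderiv_tan:
 assumes "\<forall>\<^sub>F s in nhds t. \<xi> s \<in> chart_dom c"
 shows "cderiv \<xi> t \<in> chart_tan c"
 using assms
proof (induction c arbitrary: \<xi>)
 case Nil
 have "deriv (%s. \<xi> s i $ j) t = 0" if "i > 0" for i j
 proof -
  have "deriv (%s. \<xi> s i $ j) t = deriv (%s. 0) t"
   by (rule deriv_cong_ev) (use that in \<open>auto intro: eventually_mono[OF Nil]\<close>)
  then show ?thesis by simp
 qed
 then show ?case by (simp add: cderiv_def vec_eq_iff)
next
 case (Cons a c)
 have "deriv (%s. \<xi> s (Suc (length c)) $ a) t = deriv (%s. 1) t"
  by (rule deriv_cong_ev) (auto intro: eventually_mono[OF Cons.prems])
 moreover have "cderiv (%s. (\<xi> s)(Suc (length c) := 0)) t \<in> chart_tan c"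
  by (rule Cons.IH, rule eventually_mono[OF Cons.prems]) (simp del: fun_upd_apply)
 moreover have "cderiv (%s. (\<xi> s)(Suc (length c) := 0)) t = (cderiv \<xi> t)(Suc (length c) := 0)"
  by (auto simp: cderiv_def fun_eq_iff vec_eq_iff)
 ultimately show ?case by (simp add: cderiv_def)
qed

section \<open>Transition maps\<close>

primrec frE :: "'n::finite list => ('n => 'n rexp) => nat => 'n => 'n rexp" where
 "frE [] U = (%i j. if i = 0 then U j else Cst 0)"
| "frE (a # c) U = (%i j. if i = Suc (length c) then (if j = a then Cst 0 else U j)
   else frE c (%j. Mul (U a) (Crd (Suc (length c)) j)) i j)"

lemma eval_frE: "eval (frE c U i j) x = chart_frame c x (\<chi> j. eval (U j) x) i $ j"
proof (induction c arbitrary: U)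
 case (Cons a c)
 have "(\<chi> j. eval (U a) x * x (Suc (length c)) $ j) = eval (U a) x *s x (Suc (length c))"
  by (simp add: vec_eq_iff)
 then show ?case using Cons by simp
qed simp

lemma ok_frE: "(!!j. ok (U j) x) ==> ok (frE c U i j) x"
 by (induction c arbitrary: U) auto

lemma lev_frE: "(!!j. lev k (U j)) ==> length c \<le> k ==> lev k (frE c U i j)"
 by (induction c arbitrary: U) auto

text \<open>
  The action of \<open>\<phi>\<close> from the chart \<open>c\<close> to the chart \<open>d\<close>: on a new level the homogeneous coordinates of the line
  are mapped by the differential, written in the frames of both charts, and normalized by the component
  \<open>b\<close>. With the identity for \<open>\<phi>\<close> these are the chart changes.
\<close>

fun tr :: "(complex^'n::finite => complex^'n) => 'n list => 'n list => nat => 'n => 'n rexp" where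
 "tr \<phi> [] d i j = (if i = 0 then Hol (%z. \<phi> z $ j) else Cst 0)"
| "tr \<phi> (a # c) [] i j = Cst 0"
| "tr \<phi> (a # c) (b # d) i j =
   (if i = Suc (length c)
   then Mul (pd (tr \<phi> c d (lvl d j) j) (frE c (Crd (Suc (length c)))))
        (Inv (pd (tr \<phi> c d (lvl d b) b) (frE c (Crd (Suc (length c))))))
   else tr \<phi> c d i j)"

definition trm :: "(complex^'n::finite => complex^'n) => 'n list => 'n list => 'n coords => 'n coords" where
 "trm \<phi> c d x = (%i. \<chi> j. eval (tr \<phi> c d i j) x)"

text \<open>
  The denominators in the transition map do not vanish, i.e. the image lies in the chart \<open>d\<close>.
\<close>

definition trok :: "(complex^'n::finite => complex^'n) => 'n list => 'n list => 'n coords => bool" where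
 "trok \<phi> c d x \<longleftrightarrow> (\<forall>i j. ok (tr \<phi> c d i j) x)"

definition trd :: "(complex^'n::finite => complex^'n) => 'n list => 'n list => 'n coords => 'n coords => 'n coords" where
 "trd \<phi> c d x v = (%i. \<chi> j. dd (tr \<phi> c d i j) x v)"

text \<open>
  The differential of the transition map on the distribution, in the frames of the two charts.
\<close>

definition trG :: "(complex^'n::finite => complex^'n) => 'n list => 'n list => 'n coords => complex^'n => complex^'n" where
 "trG \<phi> c d x u = coef d (trd \<phi> c d x (chart_frame c x u))"

lemma lev_tr: "length c = length d ==> lev (length c) (tr \<phi> c d i j)"
proof (induction c d arbitrary: i j rule: list_induct2)
 case (Cons a c b d)
 have "lev (Suc (length c)) (tr \<phi> c d i j)" for i j using Cons(2) lev_mono by (metis le_SucI order_refl)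
 then show ?case by (auto intro!: lev_pd lev_frE)
qed auto

lemma tr_high: "length c = length d ==> i > length c ==> tr \<phi> c d i j = Cst 0"
 by (induction c d rule: list_induct2) auto

lemma tr_cong:
 assumes "length c = length d" "!!i. i \<le> length c ==> x i = y i"
 shows "trm \<phi> c d x = trm \<phi> c d y" "trok \<phi> c d x = trok \<phi> c d y"
  "(!!i. i \<le> length c ==> v i = w i) ==> trd \<phi> c d x v = trd \<phi> c d y w"
  "trG \<phi> c d x u = trG \<phi> c d y u"
proof -
 have xy: "\<forall>i\<le>length c. x i = y i" using assms(2) by simp
 show "trm \<phi> c d x = trm \<phi> c d y" unfolding trm_def
  using lev_eval[OF xy xy lev_tr[OF assms(1)]] by simp
 show "trok \<phi> c d x = trok \<phi> c d y" unfolding trok_def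
  using lev_ok[OF xy xy lev_tr[OF assms(1)]] by simp
 show 1: "trd \<phi> c d x v = trd \<phi> c d y w" if "!!i. i \<le> length c ==> v i = w i" for v w
 proof -
  have "\<forall>i\<le>length c. v i = w i" using that by simp
  from lev_dd[OF xy this lev_tr[OF assms(1)]] show ?thesis by (simp add: trd_def)
 qed
 show "trG \<phi> c d x u = trG \<phi> c d y u"
 proof -
  have "chart_frame c x u = chart_frame c y u" by (rule chart_frame_cong) (rule assms(2))
  then show ?thesis unfolding trG_def using 1[of "chart_frame c x u" "chart_frame c x u"] by simp
 qed
qed

lemma tr_upd [simp]:
 assumes "length c = length d" "length d < k"
 shows "trm \<phi> c d (x(k := z)) = trm \<phi> c d x"
  "trok \<phi> c d (x(k := z)) = trok \<phi> c d x"
  "trG \<phi> c d (x(k := z)) u = trG \<phi> c d x u"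
  "trd \<phi> c d (x(k := z)) v = trd \<phi> c d x v"
  "trd \<phi> c d x (v(k := z)) = trd \<phi> c d x v"
 by (rule tr_cong[OF assms(1)]; use assms in auto)+

lemma trd_linear:
 "trd \<phi> c d x (%i. v i + w i) = (%i. trd \<phi> c d x v i + trd \<phi> c d x w i)"
 "trd \<phi> c d x (%i. s *s v i) = (%i. s *s trd \<phi> c d x v i)"
 "trd \<phi> c d x (%i. 0) = (%i. 0)"
 by (auto simp: trd_def fun_eq_iff vec_eq_iff dd_add dd_scale dd_zero)

lemma trG_linear:
 "trG \<phi> c d x (u + w) = trG \<phi> c d x u + trG \<phi> c d x w"
 "trG \<phi> c d x (s *s u) = s *s trG \<phi> c d x u"
 "trG \<phi> c d x 0 = 0"
 by (auto simp: trG_def coef_def chart_frame_add chart_frame_scale trd_linear vec_eq_iff)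

lemma eval_dir:
 "eval (pd (tr \<phi> c d (lvl d j) j) (frE c (Crd (Suc (length c))))) x = trG \<phi> c d x (x (Suc (length c))) $ j"
 by (simp add: eval_pd eval_frE trG_def coef_def trd_def)

lemma trm_Cons:
 assumes "length c = length d"
 shows "trm \<phi> (a # c) (b # d) x = (trm \<phi> c d x)(Suc (length c) :=
   inverse (trG \<phi> c d x (x (Suc (length c))) $ b) *s trG \<phi> c d x (x (Suc (length c))))"
 by (auto simp: trm_def fun_eq_iff vec_eq_iff eval_dir)

lemma ok_dir: "trok \<phi> c d x ==> ok (pd (tr \<phi> c d (lvl d j) j) (frE c (Crd (Suc (length c))))) x"
 by (intro ok_pd ok_frE) (auto simp: trok_def)

lemma trok_Cons:
 assumes "length c = length d"
 shows "trok \<phi> (a # c) (b # d) x \<longleftrightarrow> trok \<phi> c d x \<and> trG \<phi> c d x (x (Suc (length c))) $ b ~= 0"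
proof
 assume t: "trok \<phi> (a # c) (b # d) x"
 have "ok (tr \<phi> c d i j) x" for i j
 proof (cases "i = Suc (length c)")
  case True
  then show ?thesis using tr_high[OF assms, of i \<phi> j] by simp
 next
  case False
  then show ?thesis using t[unfolded trok_def, rule_format, of i j] by simp
 qed
 moreover have "trG \<phi> c d x (x (Suc (length c))) $ b ~= 0"
  using t[unfolded trok_def, rule_format, of "Suc (length c)" b] by (simp add: eval_dir)
 ultimately show "trok \<phi> c d x \<and> trG \<phi> c d x (x (Suc (length c))) $ b ~= 0" by (simp add: trok_def)
next
 assume "trok \<phi> c d x \<and> trG \<phi> c d x (x (Suc (length c))) $ b ~= 0"
 then show "trok \<phi> (a # c) (b # d) x"
  using ok_dir[of \<phi> c d x] by (auto simp: trok_def eval_dir)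
qed

lemma trm_Cons_trunc:
 assumes "length c = length d"
 shows "(trm \<phi> (a # c) (b # d) x)(Suc (length c) := 0) = trm \<phi> c d x"
proof -
 have "trm \<phi> c d x (Suc (length c)) = 0" by (simp add: trm_def tr_high[OF assms] vec_eq_iff)
 then show ?thesis by (simp add: trm_Cons[OF assms] fun_upd_idem)
qed

lemma trm_dom:
 "length c = length d ==> x \<in> chart_dom c ==> trok \<phi> c d x ==> trm \<phi> c d x \<in> chart_dom d"
proof (induction c d arbitrary: x rule: list_induct2)
 case (Cons a c b d)
 have "trm \<phi> c d (x(Suc (length c) := 0)) \<in> chart_dom d"
  using Cons.prems Cons.hyps by (intro Cons.IH) (simp_all add: trok_Cons del: fun_upd_apply)
 then have "(trm \<phi> (a # c) (b # d) x)(Suc (length d) := 0) \<in> chart_dom d"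
  using trm_Cons_trunc[OF Cons.hyps(1), of \<phi> a b x] Cons.hyps(1) by simp
 moreover have "trm \<phi> (a # c) (b # d) x (Suc (length d)) $ b = 1"
  using Cons.prems Cons.hyps(1) by (simp add: trok_Cons trm_Cons)
 ultimately show ?case unfolding chart_dom.simps mem_Collect_eq by blast
qed (auto simp: trm_def vec_eq_iff)

lemma trm_curve:
 assumes "analytic_coords \<xi> t" "trok \<phi> c d (\<xi> t)" "length c = length d"
 shows "analytic_coords (%s. trm \<phi> c d (\<xi> s)) t"
  "cderiv (%s. trm \<phi> c d (\<xi> s)) t = trd \<phi> c d (\<xi> t) (cderiv \<xi> t)"
  "\<forall>\<^sub>F s in nhds t. trok \<phi> c d (\<xi> s)"
proof -
 have e: "(%s. eval (tr \<phi> c d i j) (\<xi> s)) analytic_on {t}"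
  "deriv (%s. eval (tr \<phi> c d i j) (\<xi> s)) t = dd (tr \<phi> c d i j) (\<xi> t) (cderiv \<xi> t)"
  "\<forall>\<^sub>F s in nhds t. ok (tr \<phi> c d i j) (\<xi> s)" for i j
  using eval_curve[OF assms(1), of "tr \<phi> c d i j"] assms(2) by (auto simp: trok_def)
 show "analytic_coords (%s. trm \<phi> c d (\<xi> s)) t"
  "cderiv (%s. trm \<phi> c d (\<xi> s)) t = trd \<phi> c d (\<xi> t) (cderiv \<xi> t)"
  using e by (auto simp: analytic_coords_def trm_def cderiv_def trd_def)
 have "\<forall>\<^sub>F s in nhds t. \<forall>i\<in>{..length c}. \<forall>j\<in>UNIV. ok (tr \<phi> c d i j) (\<xi> s)"
  using e(3) by (intro eventually_ball_finite ballI) auto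
 then show "\<forall>\<^sub>F s in nhds t. trok \<phi> c d (\<xi> s)"
 proof eventually_elim
  case (elim s)
  then show ?case unfolding trok_def using tr_high[OF assms(3)]
   by (metis UNIV_I atMost_iff not_le_imp_less ok.simps(1))
 qed
qed

lemma trd_tan:
 assumes "length c = length d" "x \<in> chart_dom c" "trok \<phi> c d x" "v \<in> chart_tan c"
 shows "trd \<phi> c d x v \<in> chart_tan d"
proof -
 let ?\<xi> = "%t i. x i + t *s v i"
 have 0: "?\<xi> 0 = x" by (simp add: fun_eq_iff)
 note cu = trm_curve[OF analytic_line[of x v 0], of \<phi> c d, unfolded 0 cderiv_line, OF assms(3,1)]
 have "NEAR s. trm \<phi> c d (?\<xi> s) \<in> chart_dom d"
  using cu(3) by eventually_elim (intro trm_dom chart_line assms)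
 from cderiv_tan[OF this] show ?thesis using cu(2) by simp
qed

lemma trd_Cons_trunc:
 assumes "length c = length d"
 shows "(trd \<phi> (a # c) (b # d) x v)(Suc (length c) := 0) = trd \<phi> c d x v"
 using tr_high[OF assms, of "Suc (length c)" \<phi>] by (auto simp: trd_def fun_eq_iff vec_eq_iff)

text \<open>
  Prolonged maps preserve the distribution; the proof compares both sides level by level.
\<close>

lemma trd_frame:
 "length c = length d ==> x \<in> chart_dom c ==> trok \<phi> c d x ==>
  trd \<phi> c d x (chart_frame c x u) = chart_frame d (trm \<phi> c d x) (trG \<phi> c d x u)"
proof (induction c d arbitrary: x u rule: list_induct2)
 case Nil
 then show ?case by (auto simp: trG_def coef_def trd_def fun_eq_iff vec_eq_iff)
next
 case (Cons a c b d)
 let ?k = "Suc (length c)"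
 let ?w = "trG \<phi> c d x (x ?k)" and ?v = "chart_frame (a # c) x u"
 have l: "length (a # c) = length (b # d)" using Cons.hyps by simp
 have ok: "trok \<phi> c d x" "?w $ b ~= 0" using Cons.prems trok_Cons[OF Cons.hyps(1)] by auto
 let ?v' = "trd \<phi> (a # c) (b # d) x ?v"
 have tan: "?v' \<in> chart_tan (b # d)"
  by (intro trd_tan l Cons.prems chart_frame_tan)
 have "?v'(Suc (length d) := 0) = trd \<phi> c d x ?v"
  using trd_Cons_trunc[OF Cons.hyps(1)] Cons.hyps(1) by simp
 also have "\<dots> = trd \<phi> c d x (?v(?k := 0))" using Cons.hyps(1) by simp
 also have "\<dots> = trd \<phi> c d (x(?k := 0)) (chart_frame c (x(?k := 0)) (u $ a *s x ?k))"
  unfolding chart_frame_trunc using Cons.hyps(1) by simp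
 also have "\<dots> = chart_frame d (trm \<phi> c d (x(?k := 0))) (trG \<phi> c d (x(?k := 0)) (u $ a *s x ?k))"
  using Cons.prems Cons.hyps(1) ok by (intro Cons.IH) (simp_all del: fun_upd_apply)
 also have "\<dots> = chart_frame d (trm \<phi> c d x) ((u $ a * ?w $ b) *s (inverse (?w $ b) *s ?w))"
 proof -
  have "(u $ a * ?w $ b) *s (inverse (?w $ b) *s ?w) = u $ a *s ?w" using ok(2) by (simp add: vec_eq_iff)
  then show ?thesis using Cons.hyps(1) by (simp only: trG_linear tr_upd lessI)
 qed
 also have "\<dots> = chart_frame d (trm \<phi> (a # c) (b # d) x)
   ((u $ a * ?w $ b) *s trm \<phi> (a # c) (b # d) x (Suc (length d)))"
 proof -
  have "trm \<phi> (a # c) (b # d) x i = trm \<phi> c d x i" if "i \<le> length d" for i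
   using that Cons.hyps(1) by (simp add: trm_Cons)
  then show ?thesis using Cons.hyps(1) chart_frame_cong[of d "trm \<phi> (a # c) (b # d) x" "trm \<phi> c d x"]
   by (simp add: trm_Cons)
 qed
 finally have "\<exists>u'. ?v' = chart_frame (b # d) (trm \<phi> (a # c) (b # d) x) u'"
  using chart_tan_frame[OF tan] by blast
 then show ?case using coef_frame[OF trm_dom[OF l Cons.prems]] unfolding trG_def by metis
qed

definition diffeo_at :: "(complex^'n::finite => complex^'n) => complex^'n => bool" where
 "diffeo_at \<phi> z \<longleftrightarrow> (\<forall>j. hol_near (%z. \<phi> z $ j) z) \<and>
   (\<forall>v. (\<forall>j. fd (%z. \<phi> z $ j) z v = 0) --> v = 0)"

lemma hol_near_cdiff: "hol_near h z ==> cdiff h z"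
 unfolding hol_near_def by (rule eventually_nhds_x_imp_x)

lemma trd_inj:
 "length c = length d ==> x \<in> chart_dom c ==> trok \<phi> c d x ==> diffeo_at \<phi> (x 0) ==>
  v \<in> chart_tan c ==> trd \<phi> c d x v = (%i. 0) ==> v = (%i. 0)"
proof (induction c d arbitrary: x v rule: list_induct2)
 case Nil
 have "fd (%z. \<phi> z $ j) (x 0) (v 0) = 0" for j
 proof -
  have "trd \<phi> [] [] x v 0 $ j = 0" using Nil(5) by simp
  moreover have "cdiff (%z. \<phi> z $ j) (x 0)" using Nil(3) hol_near_cdiff by (auto simp: diffeo_at_def)
  ultimately show ?thesis by (simp add: trd_def fd_sum)
 qed
 then have "v 0 = 0" using Nil(3) by (auto simp: diffeo_at_def)
 then show ?case using Nil(4) by (auto simp: fun_eq_iff) (metis gr0I)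
next
 case (Cons a c b d)
 let ?k = "Suc (length c)"
 let ?w = "trG \<phi> c d x (x ?k)" and ?\<eta> = "v ?k"
 have ok: "trok \<phi> c d x" "?w $ b ~= 0" using Cons.prems trok_Cons[OF Cons.hyps(1)] by auto
 have vx: "x(?k := 0) \<in> chart_dom c" "v(?k := 0) \<in> chart_tan c" using Cons.prems by auto
 have "trd \<phi> c d x v = (%i. 0)(?k := 0)"
  using trd_Cons_trunc[OF Cons.hyps(1), of \<phi> a b x v] Cons.prems by metis
 then have "trd \<phi> c d (x(?k := 0)) (v(?k := 0)) = (%i. 0)"
  using Cons.hyps(1) by (simp add: fun_eq_iff)
 moreover have ok': "trok \<phi> c d (x(?k := 0))" using ok Cons.hyps(1) by simp
 moreover have d': "diffeo_at \<phi> ((x(?k := 0)) 0)" using Cons.prems by simp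
 ultimately have low: "v(?k := 0) = (%i. 0)" using Cons.IH[OF vx(1) _ _ vx(2)] by blast
 then have low': "v i = 0" if "i ~= ?k" for i
 proof -
  have "(v(?k := 0)) i = 0" by (simp only: low)
  then show ?thesis using that by simp
 qed
 let ?W = "%j. pd (tr \<phi> c d (lvl d j) j) (frE c (Crd ?k))"
 have ddW: "dd (?W j) x v = trG \<phi> c d x ?\<eta> $ j" for j
 proof -
  let ?\<xi> = "%t i. x i + t *s v i"
  have 0: "?\<xi> 0 = x" by (simp add: fun_eq_iff)
  have "deriv (%s. eval (?W j) (?\<xi> s)) 0 = dd (?W j) x v"
   using eval_curve[OF analytic_line[of x v 0], of "?W j"] ok_dir[OF ok(1), of j] 0
   by (simp add: cderiv_line)
  moreover have "eval (?W j) (?\<xi> s) = ?w $ j + s * trG \<phi> c d x ?\<eta> $ j" for s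
  proof -
   have "eval (?W j) (?\<xi> s) = trG \<phi> c d (?\<xi> s) (x ?k + s *s ?\<eta>) $ j" by (simp add: eval_dir)
   also have "trG \<phi> c d (?\<xi> s) = trG \<phi> c d x"
    by (rule ext, rule tr_cong(4)[OF Cons.hyps(1)]) (auto simp: low')
   finally show ?thesis by (simp add: trG_linear)
  qed
  moreover have "((%s. ?w $ j + s * trG \<phi> c d x ?\<eta> $ j) has_field_derivative trG \<phi> c d x ?\<eta> $ j) (at 0)"
   by (auto intro!: derivative_eq_intros)
  ultimately show ?thesis by (simp add: DERIV_imp_deriv)
 qed
 have "trG \<phi> c d x ?\<eta> $ j = trG \<phi> c d x ?\<eta> $ b / ?w $ b * ?w $ j" for j
 proof -
  have "trd \<phi> (a # c) (b # d) x v ?k $ j = 0" using Cons.prems by simp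
  then have "trG \<phi> c d x ?\<eta> $ j * inverse (?w $ b) =
    ?w $ j * (inverse (?w $ b) * trG \<phi> c d x ?\<eta> $ b * inverse (?w $ b))"
   by (simp add: trd_def ddW eval_dir)
  then show ?thesis using ok(2) by (simp add: field_simps)
 qed
 then obtain s where "!!j. trG \<phi> c d x ?\<eta> $ j = s * ?w $ j" by blast
 then have "trG \<phi> c d x ?\<eta> = trG \<phi> c d x (s *s x ?k)" by (simp add: vec_eq_iff trG_linear)
 then have "trG \<phi> c d x (?\<eta> + (-1) *s (s *s x ?k)) = 0"
  by (simp only: trG_linear) (simp add: vec_eq_iff)
 then have "trd \<phi> c d (x(?k := 0)) (chart_frame c (x(?k := 0)) (?\<eta> + (-1) *s (s *s x ?k))) = (%i. 0)"
  using trd_frame[OF Cons.hyps(1) vx(1) ok'] Cons.hyps(1) by simp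
 then have "chart_frame c (x(?k := 0)) (?\<eta> + (-1) *s (s *s x ?k)) = (%i. 0)"
  using Cons.IH[OF vx(1) ok' d' chart_frame_tan] by blast
 then have e: "?\<eta> + (-1) *s (s *s x ?k) = 0" by (rule chart_frame_eq_0[OF vx(1), THEN iffD1])
 have "?\<eta> $ a + (-1) * (s * x ?k $ a) = 0" using arg_cong[OF e, of "%z. z $ a"] by simp
 moreover have "?\<eta> $ a = 0" "x ?k $ a = 1" using Cons.prems by auto
 ultimately have "s = 0" by simp
 then have "?\<eta> = 0" using e by simp
 show ?case
 proof
  show "v i = 0" for i using low'[of i] \<open>?\<eta> = 0\<close> by (cases "i = ?k") auto
 qed
qed

lemma trG_inj:
 assumes "length c = length d" "x \<in> chart_dom c" "trok \<phi> c d x" "diffeo_at \<phi> (x 0)" "trG \<phi> c d x u = 0"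
 shows "u = 0"
proof -
 have "trd \<phi> c d x (chart_frame c x u) = (%i. 0)" using trd_frame[OF assms(1-3)] assms(5) by simp
 then have "chart_frame c x u = (%i. 0)" using trd_inj[OF assms(1-4) chart_frame_tan] by blast
 then show ?thesis using chart_frame_eq_0[OF assms(2)] by blast
qed

text \<open>
  The differential is injective, so the image of the line has some nonzero component.
\<close>

lemma trok_extend:
 assumes "length c = length d" "x \<in> chart_dom (a # c)" "trok \<phi> c d x" "diffeo_at \<phi> (x 0)"
 shows "\<exists>b. trok \<phi> (a # c) (b # d) x"
proof -
 have "x (Suc (length c)) ~= 0" using assms(2) by auto
 then have "trG \<phi> c d (x(Suc (length c) := 0)) (x (Suc (length c))) ~= 0"
  using trG_inj[of c d "x(Suc (length c) := 0)" \<phi> "x (Suc (length c))"] assms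
  by (auto simp del: fun_upd_apply simp: fun_upd_other)
 then obtain b where "trG \<phi> c d x (x (Suc (length c))) $ b ~= 0"
  using assms(1) by (auto simp: vec_eq_iff)
 then show ?thesis using trok_Cons[OF assms(1)] assms(3) by blast
qed

lemma trok_exists:
 "x \<in> chart_dom c ==> diffeo_at \<phi> (x 0) ==> \<exists>d. length d = length c \<and> trok \<phi> c d x"
proof (induction c arbitrary: x)
 case Nil
 then show ?case by (auto simp: trok_def diffeo_at_def)
next
 case (Cons a c)
 have "\<exists>d. length d = length c \<and> trok \<phi> c d (x(Suc (length c) := 0))"
  using Cons.prems by (intro Cons.IH) (simp_all del: fun_upd_apply add: fun_upd_other)
 then obtain d where "length d = length c" "trok \<phi> c d (x(Suc (length c) := 0))" by blast
 then have d: "length c = length d" "trok \<phi> c d x" by simp_all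
 then show ?case using trok_extend[OF d(1) Cons.prems(1) d(2) Cons.prems(2)] by (metis length_Cons)
qed


section \<open>Points and tangent vectors in charts\<close>

definition idm :: "complex^'n::finite => complex^'n" where
 "idm z = z"

definition tv :: "'n::finite list => 'n coords => 'n coords => 'n tvec" where
 "tv c x v = {(d, trd idm c d x v) | d. length d = length c \<and> trok idm c d x}"

text \<open>
  Two charts describe the same point exactly when the transition map of the identity relates them. This is
  proved by induction on the level, together with all consequences that the next level needs; therefore
  the following lemmas up to \<open>good_Suc\<close> assume it.
\<close>

definition good :: "'n::finite itself => nat => bool" where
 "good _ k \<longleftrightarrow> (\<forall>(c::'n list) d x y. length c = k --> length d = k --> x \<in> chart_dom c --> y \<in> chart_dom d -->
   (param k c x = param k d y \<longleftrightarrow> trok idm c d x \<and> y = trm idm c d x))"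

lemma diffeo_at_idm: "diffeo_at idm (z :: complex^'b::finite)"
proof -
 have D: "((%z. idm z $ j) has_derivative (%v. v $ j)) (at y)" for j :: 'b and y :: "complex^'b::finite"
  unfolding idm_def by (auto intro!: bounded_linear_imp_has_derivative bounded_linear_vec_nth)
 then have "cdiff (%z. idm z $ j) y" for j :: 'b and y :: "complex^'b::finite"
  unfolding cdiff_def by (intro exI[of _ "%v. v $ j"]) auto
 then show ?thesis
  unfolding diffeo_at_def hol_near_def using fd_eqI[OF D] by (auto simp: vec_eq_iff always_eventually)
qed

lemma represents_iff:
 "represents P c \<xi> \<Gamma> t \<longleftrightarrow> analytic_coords \<xi> t \<and> (\<forall>\<^sub>F s in nhds t. \<xi> s \<in> chart_dom c \<and> \<Gamma> s = P c (\<xi> s))"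
 by (simp add: represents_def analytic_coords_def)

lemma velocity_in_eq:
 "velocity_in k P \<Gamma> t = {(d, cderiv \<zeta> t) | d \<zeta>. length d = k \<and> represents P d \<zeta> \<Gamma> t}"
 by (simp add: velocity_in_def cderiv_def)

lemma represents_at: "represents P c \<xi> \<Gamma> t ==> \<xi> t \<in> chart_dom c \<and> \<Gamma> t = P c (\<xi> t)"
 unfolding represents_iff by (auto dest: eventually_nhds_x_imp_x)

lemma param_cong:
 "length c = k ==> \<forall>i\<le>k. x i = y i ==> param k c x = param k c y"
proof (induction k arbitrary: c x y)
 case (Suc k)
 then have l: "length (tl c) = k" by simp
 have f: "chart_frame (tl c) x u = chart_frame (tl c) y u" for u
  by (rule chart_frame_cong) (use Suc.prems l in auto)
 have "param k (tl c) x = param k (tl c) y" using Suc.prems by (intro Suc.IH l) auto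
 moreover have "param k (tl c) (%i. x i + t *s chart_frame (tl c) x (x (Suc k)) i) =
   param k (tl c) (%i. y i + t *s chart_frame (tl c) y (y (Suc k)) i)" for t
  using Suc.prems f by (intro Suc.IH l) auto
 ultimately show ?case by simp
qed simp

lemma param_upd [simp]: "length c = k ==> k < m ==> param k c (x(m := z)) = param k c x"
 by (rule param_cong) auto

lemma tv_upd [simp]:
 "length c < k ==> tv c (x(k := z)) v = tv c x v"
 "length c < k ==> tv c x (v(k := z)) = tv c x v"
 unfolding tv_def by (auto simp: tr_upd[of c _ k])

lemma tscale_tv: "tscale s (tv c x v) = tv c x (%i. s *s v i)"
 unfolding tscale_def tv_def by (auto simp: trd_linear)

context
 fixes k :: nat
 assumes good: "good TYPE('n::finite) k"
begin

lemma geq: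
 "length (c::'n list) = k ==> length d = k ==> x \<in> chart_dom c ==> y \<in> chart_dom d ==>
   param k c x = param k d y \<longleftrightarrow> trok idm c d x \<and> y = trm idm c d x"
 using good unfolding good_def by blast

lemma velocity_tv':
 assumes "length (c::'n list) = k" "represents (param k) c \<xi> \<Gamma> t"
 shows "velocity_in k (param k) \<Gamma> t = tv c (\<xi> t) (cderiv \<xi> t)"
proof -
 have an: "analytic_coords \<xi> t" and ev: "\<forall>\<^sub>F s in nhds t. \<xi> s \<in> chart_dom c \<and> \<Gamma> s = param k c (\<xi> s)"
  using assms(2) by (auto simp: represents_iff)
 have "cderiv \<zeta> t = trd idm c d (\<xi> t) (cderiv \<xi> t) \<and> trok idm c d (\<xi> t)"
  if d: "length d = k" "represents (param k) d \<zeta> \<Gamma> t" for d \<zeta>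
 proof -
  have "\<forall>\<^sub>F s in nhds t. \<zeta> s \<in> chart_dom d \<and> \<Gamma> s = param k d (\<zeta> s)" using d by (auto simp: represents_iff)
  with ev have *: "\<forall>\<^sub>F s in nhds t. trok idm c d (\<xi> s) \<and> \<zeta> s = trm idm c d (\<xi> s)"
  proof eventually_elim
   case (elim s)
   then show ?case using geq[OF assms(1) d(1), of "\<xi> s" "\<zeta> s"] by metis
  qed
  then have t: "trok idm c d (\<xi> t)" using eventually_nhds_x_imp_x by blast
  have "cderiv \<zeta> t = cderiv (%s. trm idm c d (\<xi> s)) t"
   by (rule cderiv_cong) (rule eventually_mono[OF *], simp)
  then show ?thesis using trm_curve(2)[OF an t] t assms(1) d(1) by simp
 qed
 moreover have "\<exists>\<zeta>. represents (param k) d \<zeta> \<Gamma> t \<and> cderiv \<zeta> t = trd idm c d (\<xi> t) (cderiv \<xi> t)"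
  if d: "length d = k" "trok idm c d (\<xi> t)" for d
 proof -
  have l: "length c = length d" using assms(1) d(1) by simp
  note cu = trm_curve[OF an d(2) l]
  from cu(3) ev have "\<forall>\<^sub>F s in nhds t. trm idm c d (\<xi> s) \<in> chart_dom d \<and> \<Gamma> s = param k d (trm idm c d (\<xi> s))"
  proof eventually_elim
   case (elim s)
   then have "trm idm c d (\<xi> s) \<in> chart_dom d" by (intro trm_dom l) auto
   then show ?case using elim geq[of c d "\<xi> s" "trm idm c d (\<xi> s)"] assms(1) d(1) by simp
  qed
  then have "represents (param k) d (%s. trm idm c d (\<xi> s)) \<Gamma> t" using cu(1) by (simp add: represents_iff)
  then show ?thesis using cu(2) by blast
 qed
 ultimately show ?thesis unfolding velocity_in_eq tv_def using assms(1) by (auto; metis)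
qed

lemma refl':
 assumes "length (c::'n list) = k" "x \<in> chart_dom c"
 shows "trok idm c c x" "trm idm c c x = x" "v \<in> chart_tan c ==> trd idm c c x v = v"
proof -
 have r: "trok idm c c x \<and> x = trm idm c c x" if "x \<in> chart_dom c" for x
  using geq[of c c x x] assms(1) that by simp
 then show t: "trok idm c c x" "trm idm c c x = x" using assms(2) by auto
 assume v: "v \<in> chart_tan c"
 let ?\<xi> = "%t i. x i + t *s v i"
 have 0: "?\<xi> 0 = x" by (simp add: fun_eq_iff)
 have "trm idm c c (?\<xi> s) = ?\<xi> s" for s using r[OF chart_line[OF assms(2) v]] by simp
 then show "trd idm c c x v = v"
  using trm_curve(2)[OF analytic_line[of x v 0], of idm c c, unfolded 0 cderiv_line, OF t(1)] cderiv_line[of x v 0]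
  by simp
qed

lemma represents_line:
 assumes "length (c::'n list) = k" "x \<in> chart_dom c" "v \<in> chart_tan c"
 shows "represents (param k) c (%t i. x i + t *s v i) (%t. param k c (%i. x i + t *s v i)) t"
 unfolding represents_iff using analytic_line chart_line[OF assms(2,3)] by simp

lemma tv_change':
 assumes "length (c::'n list) = k" "length d = k" "x \<in> chart_dom c" "v \<in> chart_tan c" "trok idm c d x"
 shows "tv c x v = tv d (trm idm c d x) (trd idm c d x v)"
proof -
 let ?\<xi> = "%t i. x i + t *s v i" and ?\<Gamma> = "%t. param k c (%i. x i + t *s v i)"
 have 0: "?\<xi> 0 = x" by (simp add: fun_eq_iff)
 have l: "length c = length d" using assms by simp
 note cu = trm_curve[OF analytic_line[of x v 0], of idm c d, unfolded 0 cderiv_line, OF assms(5) l]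
 have "represents (param k) d (%t. trm idm c d (?\<xi> t)) ?\<Gamma> 0"
  unfolding represents_iff
 proof (intro conjI cu(1))
  show "NEAR s. trm idm c d (?\<xi> s) \<in> chart_dom d \<and> ?\<Gamma> s = param k d (trm idm c d (?\<xi> s))"
   using cu(3)
  proof eventually_elim
   case (elim s)
   have x: "?\<xi> s \<in> chart_dom c" by (rule chart_line[OF assms(3,4)])
   then have "trm idm c d (?\<xi> s) \<in> chart_dom d" by (intro trm_dom l elim)
   then show ?case using elim x geq[of c d "?\<xi> s" "trm idm c d (?\<xi> s)"] assms by simp
  qed
 qed
 from velocity_tv'[OF assms(2) this] velocity_tv'[OF assms(1) represents_line[OF assms(1,3,4)], of 0]
 show ?thesis by (simp add: cderiv_line cu(2) 0)
qed

lemma tv_inj':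
 assumes "length (c::'n list) = k" "x \<in> chart_dom c" "v \<in> chart_tan c" "w \<in> chart_tan c"
 shows "tv c x v = tv c x w \<longleftrightarrow> v = w"
proof
 assume e: "tv c x v = tv c x w"
 have "(c, trd idm c c x v) \<in> tv c x v" unfolding tv_def using refl'(1)[OF assms(1,2)] by blast
 then have "(c, trd idm c c x v) \<in> tv c x w" using e by simp
 then have "trd idm c c x v = trd idm c c x w" by (auto simp: tv_def)
 then show "v = w" using refl'(3)[OF assms(1,2)] assms(3,4) by simp
qed simp

lemma tzero_tv':
 assumes "length (c::'n list) = k" "x \<in> chart_dom c" "v \<in> chart_tan c"
 shows "tzero (tv c x v) \<longleftrightarrow> v = (%i. 0)"
proof
 assume e: "tzero (tv c x v)"
 have "(c, trd idm c c x v) \<in> tv c x v" unfolding tv_def using refl'(1)[OF assms(1,2)] by blast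
 then show "v = (%i. 0)" using e refl'(3)[OF assms] by (auto simp: tzero_def)
qed (auto simp: tzero_def tv_def trd_linear)

end

definition tvf :: "'n::finite list => 'n coords => complex^'n => 'n tvec" where
 "tvf c x u = tv c x (chart_frame c x u)"

lemma tvf_upd [simp]: "length c < k ==> tvf c (x(k := z)) u = tvf c x u"
 by (simp add: tvf_def)

lemma tscale_tvf: "tscale s (tvf c x u) = tvf c x (s *s u)"
 by (simp add: tvf_def tscale_tv chart_frame_scale)

lemma tline_tvf: "tline (tvf c x u) = range (%s. tvf c x (s *s u))"
 by (simp add: tline_def tscale_tvf)

context
 fixes k :: nat
 assumes good: "good TYPE('n::finite) k"
begin

lemma tvf_inj':
 assumes "length (c::'n list) = k" "x \<in> chart_dom c"
 shows "tvf c x u = tvf c x w \<longleftrightarrow> u = w"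
 unfolding tvf_def using tv_inj'[OF good assms chart_frame_tan chart_frame_tan] chart_frame_inj[OF assms(2)] by simp

lemma tvf_change':
 assumes "length (c::'n list) = k" "length d = k" "x \<in> chart_dom c" "trok idm c d x"
 shows "tvf c x u = tvf d (trm idm c d x) (trG idm c d x u)"
 unfolding tvf_def using tv_change'[OF good assms(1-3) chart_frame_tan assms(4)] trd_frame[OF _ assms(3,4)] assms(1,2)
 by simp

lemma tline_tvf_eq':
 assumes "length (d::'n list) = k" "x \<in> chart_dom d" "y $ b = 1"
 shows "tline (tvf d x w) = tline (tvf d x y) \<longleftrightarrow> w $ b ~= 0 \<and> y = inverse (w $ b) *s w"
proof
 assume "tline (tvf d x w) = tline (tvf d x y)"
 moreover have "tvf d x (1 *s y) \<in> tline (tvf d x y)" unfolding tline_tvf by blast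
 ultimately have "tvf d x (1 *s y) \<in> range (%s. tvf d x (s *s w))" unfolding tline_tvf by simp
 then obtain s where "tvf d x (1 *s y) = tvf d x (s *s w)" by blast
 then have s: "y = s *s w" using tvf_inj'[OF assms(1,2)] by simp
 then have "s * w $ b = 1" using assms(3) by simp
 then have "w $ b ~= 0" "s = inverse (w $ b)"
  by (auto, metis inverse_unique mult.commute)
 then show "w $ b ~= 0 \<and> y = inverse (w $ b) *s w" using s by simp
next
 assume a: "w $ b ~= 0 \<and> y = inverse (w $ b) *s w"
 have "range (%s. tvf d x (s *s w)) = range (%s. tvf d x (s *s y))"
 proof (intro equalityI image_subsetI)
  show "tvf d x (s *s w) \<in> range (%s. tvf d x (s *s y))" for s
  proof (rule range_eqI[of _ _ "s * w $ b"])
   have "(s * w $ b) *s y = s *s w" using a by (auto simp: vec_eq_iff)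
   then show "tvf d x (s *s w) = tvf d x ((s * w $ b) *s y)" by simp
  qed
  show "tvf d x (s *s y) \<in> range (%s. tvf d x (s *s w))" for s
   by (rule range_eqI[of _ _ "s * inverse (w $ b)"]) (use a in \<open>simp add: vector_smult_assoc\<close>)
 qed
 then show "tline (tvf d x w) = tline (tvf d x y)" by (simp add: tline_tvf)
qed

lemma param_Suc':
 assumes "length (c::'n list) = k" "x \<in> chart_dom (a # c)"
 shows "param (Suc k) (a # c) x = Prol (param k c x) (tline (tvf c x (x (Suc k))))"
proof -
 let ?x = "x(Suc k := 0)" and ?v = "chart_frame c x (x (Suc k))"
 have x: "?x \<in> chart_dom c" using assms by simp
 have "(%t. param k c (%i. x i + t *s ?v i)) = (%t. param k c (%i. ?x i + t *s ?v i))"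
  by (rule ext, rule param_cong) (use assms in auto)
 then have "velocity_in k (param k) (%t. param k c (%i. x i + t *s ?v i)) 0
   = tv c (%i. ?x i + 0 *s ?v i) (cderiv (%t i. ?x i + t *s ?v i) 0)"
  using velocity_tv'[OF good assms(1) represents_line[OF good assms(1) x chart_frame_tan[of c x]]] by metis
 also have "\<dots> = tv c ?x ?v" unfolding cderiv_line by (simp del: fun_upd_apply)
 also have "\<dots> = tvf c x (x (Suc k))" using assms(1) by (simp add: tvf_def)
 finally show ?thesis by simp
qed

lemma good_Suc: "good TYPE('n) (Suc k)"
 unfolding good_def
proof (intro allI impI)
 fix c' d' :: "'n list" and x y
 assume l: "length c' = Suc k" "length d' = Suc k" and xy: "x \<in> chart_dom c'" "y \<in> chart_dom d'"
 obtain a c where c: "c' = a # c" "length c = k" using l(1) by (cases c') auto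
 obtain b d where d: "d' = b # d" "length d = k" using l(2) by (cases d') auto
 let ?x = "x(Suc k := 0)" and ?y = "y(Suc k := 0)" and ?w = "trG idm c d x (x (Suc k))"
 have dom: "?x \<in> chart_dom c" "?y \<in> chart_dom d" "y (Suc k) $ b = 1" using xy c d by auto
 have cd: "length c = length d" using c d by simp
 have "param k c x = param k d y \<longleftrightarrow> param k c ?x = param k d ?y" using c d by simp
 also have "\<dots> \<longleftrightarrow> trok idm c d ?x \<and> ?y = trm idm c d ?x"
  using good[unfolded good_def] c(2) d(2) dom by blast
 also have "\<dots> \<longleftrightarrow> trok idm c d x \<and> ?y = trm idm c d x" using cd c d by simp
 finally have 1: "param k c x = param k d y \<longleftrightarrow> trok idm c d x \<and> ?y = trm idm c d x" .
 have 2: "tline (tvf c x (x (Suc k))) = tline (tvf d y (y (Suc k))) \<longleftrightarrow>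
   ?w $ b ~= 0 \<and> y (Suc k) = inverse (?w $ b) *s ?w" if "trok idm c d x" "?y = trm idm c d x"
 proof -
  have "tvf c x (x (Suc k)) = tvf c ?x (x (Suc k))" using c by simp
  also have "\<dots> = tvf d (trm idm c d ?x) (trG idm c d ?x (x (Suc k)))"
   using that c d cd dom by (intro tvf_change') auto
  also have "\<dots> = tvf d ?y ?w" using that c d cd by simp
  finally show ?thesis using tline_tvf_eq'[OF d(2) dom(2,3), of ?w] d by simp
 qed
 have "trm idm c d x (Suc k) = 0" using tr_high[OF cd, of "Suc k" idm] c by (simp add: trm_def vec_eq_iff)
 then have 3: "y = (trm idm c d x)(Suc k := inverse (?w $ b) *s ?w) \<longleftrightarrow>
   ?y = trm idm c d x \<and> y (Suc k) = inverse (?w $ b) *s ?w"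
  by (auto simp: fun_eq_iff)
 have "param (Suc k) c' x = param (Suc k) d' y \<longleftrightarrow>
   param k c x = param k d y \<and> tline (tvf c x (x (Suc k))) = tline (tvf d y (y (Suc k)))"
  using param_Suc'[OF c(2) xy(1)[unfolded c(1)]] param_Suc'[OF d(2) xy(2)[unfolded d(1)]] c(1) d(1)
  by (simp del: param.simps)
 also have "\<dots> \<longleftrightarrow> (trok idm c d x \<and> ?w $ b ~= 0) \<and> y = (trm idm c d x)(Suc k := inverse (?w $ b) *s ?w)"
  using 1 2 3 by blast
 also have "\<dots> \<longleftrightarrow> trok idm c' d' x \<and> y = trm idm c' d' x"
  using cd c d by (simp add: trok_Cons trm_Cons)
 finally show "param (Suc k) c' x = param (Suc k) d' y \<longleftrightarrow> trok idm c' d' x \<and> y = trm idm c' d' x" .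
qed

end

lemma good: "good TYPE('n::finite) k"
proof (induction k)
 case 0
 have t: "trm idm [] [] x = (%i. if i = 0 then x 0 else 0)" for x :: "'n coords"
  by (auto simp: trm_def idm_def fun_eq_iff vec_eq_iff)
 have "trok idm [] [] x" for x :: "'n coords"
  using diffeo_at_idm[of "x 0"] by (auto simp: trok_def diffeo_at_def)
 then show ?case unfolding good_def by (auto simp: t fun_eq_iff)
qed (rule good_Suc)

lemma param_eq_iff:
 "length c = length d ==> x \<in> chart_dom c ==> y \<in> chart_dom d ==>
  param (length d) c x = param (length d) d y \<longleftrightarrow> trok idm c d x \<and> y = trm idm c d x"
 using good[of "length d"] unfolding good_def by blast

lemmas trok_refl = refl'(1)[OF good refl] and trm_refl = refl'(2)[OF good refl]
 and trd_refl = refl'(3)[OF good refl]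
 and tv_inj = tv_inj'[OF good refl] and tzero_tv = tzero_tv'[OF good refl]
 and tvf_inj = tvf_inj'[OF good refl] and tline_tvf_eq = tline_tvf_eq'[OF good refl]

lemma param_inj: "x \<in> chart_dom c ==> y \<in> chart_dom c ==> param (length c) c x = param (length c) c y \<longleftrightarrow> x = y"
 using param_eq_iff[of c c x y] trok_refl[of x c] trm_refl[of x c] by metis

lemma tzero_tvf: "x \<in> chart_dom c ==> tzero (tvf c x u) \<longleftrightarrow> u = 0"
 unfolding tvf_def using tzero_tv[OF _ chart_frame_tan] chart_frame_eq_0 by blast

lemma param_Suc:
 "x \<in> chart_dom (a # c) ==>
  param (Suc (length c)) (a # c) x = Prol (param (length c) c x) (tline (tvf c x (x (Suc (length c)))))"
 by (rule param_Suc'[OF good refl])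

lemma velocity_tv:
 "represents (param (length c)) c \<xi> \<Gamma> t ==> velocity (length c) \<Gamma> t = tv c (\<xi> t) (cderiv \<xi> t)"
 unfolding velocity_def by (rule velocity_tv'[OF good refl])

text \<open>
  A curve that is analytic in one chart is analytic in every chart around the point.
\<close>

lemma rechart:
 assumes "analytic_curve (length c) \<Gamma> t" "\<Gamma> t = param (length c) c x" "x \<in> chart_dom c"
 shows "\<exists>\<xi>. represents (param (length c)) c \<xi> \<Gamma> t \<and> \<xi> t = x"
proof -
 obtain d \<zeta> where d: "length d = length c" "represents (param (length c)) d \<zeta> \<Gamma> t"
  using assms(1) unfolding analytic_curve_def by blast
 have \<zeta>: "\<zeta> t \<in> chart_dom d" "\<Gamma> t = param (length c) d (\<zeta> t)" using represents_at[OF d(2)] by auto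
 have ok: "trok idm d c (\<zeta> t)" "x = trm idm d c (\<zeta> t)"
  using param_eq_iff[OF d(1) \<zeta>(1) assms(3)] assms(2) \<zeta>(2) by auto
 have an: "analytic_coords \<zeta> t" and ev: "\<forall>\<^sub>F s in nhds t. \<zeta> s \<in> chart_dom d \<and> \<Gamma> s = param (length c) d (\<zeta> s)"
  using d(2) by (auto simp: represents_iff)
 note cu = trm_curve[OF an ok(1) d(1)]
 from cu(3) ev have "\<forall>\<^sub>F s in nhds t. trm idm d c (\<zeta> s) \<in> chart_dom c \<and> \<Gamma> s = param (length c) c (trm idm d c (\<zeta> s))"
 proof eventually_elim
  case (elim s)
  then have "trm idm d c (\<zeta> s) \<in> chart_dom c" by (intro trm_dom d) auto
  then show ?case using elim param_eq_iff[OF d(1)] by auto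
 qed
 then have "represents (param (length c)) c (%s. trm idm d c (\<zeta> s)) \<Gamma> t"
  using cu(1) by (simp add: represents_iff)
 then show ?thesis using ok(2) by (intro exI[of _ "%s. trm idm d c (\<zeta> s)"]) auto
qed

lemma tangent_space_chart:
 assumes "x \<in> chart_dom c"
 shows "tangent_space (length c) F (param (length c) c x) =
  {tv c x (cderiv \<xi> 0) | \<xi>. analytic_coords \<xi> 0 \<and> \<xi> 0 = x \<and>
    (NEAR t. \<xi> t \<in> chart_dom c \<and> param (length c) c (\<xi> t) \<in> F)}" (is "?L = ?R")
proof (intro equalityI subsetI)
 fix \<tau> assume "\<tau> \<in> ?L"
 then obtain \<Gamma> where \<Gamma>: "\<tau> = velocity (length c) \<Gamma> 0" "analytic_curve (length c) \<Gamma> 0"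
  "\<Gamma> 0 = param (length c) c x" "NEAR t. \<Gamma> t \<in> F" unfolding tangent_space_def by auto
 obtain \<xi> where \<xi>: "represents (param (length c)) c \<xi> \<Gamma> 0" "\<xi> 0 = x"
  using rechart[OF \<Gamma>(2,3) assms] by blast
 have "analytic_coords \<xi> 0" and ev: "NEAR t. \<xi> t \<in> chart_dom c \<and> \<Gamma> t = param (length c) c (\<xi> t)"
  using \<xi>(1) by (auto simp: represents_iff)
 moreover from ev \<Gamma>(4) have "NEAR t. \<xi> t \<in> chart_dom c \<and> param (length c) c (\<xi> t) \<in> F"
  by eventually_elim auto
 moreover have "\<tau> = tv c x (cderiv \<xi> 0)" using velocity_tv[OF \<xi>(1)] \<Gamma>(1) \<xi>(2) by simp
 ultimately show "\<tau> \<in> ?R" using \<xi>(2) by blast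
next
 fix \<tau> assume "\<tau> \<in> ?R"
 then obtain \<xi> where \<xi>: "\<tau> = tv c x (cderiv \<xi> 0)" "analytic_coords \<xi> 0" "\<xi> 0 = x"
  "NEAR t. \<xi> t \<in> chart_dom c \<and> param (length c) c (\<xi> t) \<in> F" by blast
 let ?\<Gamma> = "%t. param (length c) c (\<xi> t)"
 have r: "represents (param (length c)) c \<xi> ?\<Gamma> 0"
  unfolding represents_iff using \<xi>(2,4) by (auto elim: eventually_mono)
 then have "analytic_curve (length c) ?\<Gamma> 0" unfolding analytic_curve_def by blast
 moreover have "NEAR t. ?\<Gamma> t \<in> F" using \<xi>(4) by (auto elim: eventually_mono)
 moreover have "\<tau> = velocity (length c) ?\<Gamma> 0" using velocity_tv[OF r] \<xi> by simp
 ultimately show "\<tau> \<in> ?L" unfolding tangent_space_def using \<xi>(3) by blast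
qed

lemma dproj_tv:
 assumes "x \<in> chart_dom (a # c)"
 shows "dproj (tv (a # c) x v) = tv c x v"
proof (intro equalityI subsetI)
 fix p assume "p \<in> dproj (tv (a # c) x v)"
 then obtain d' where d': "length d' = Suc (length c)" "trok idm (a # c) d' x"
  "p = (tl d', (trd idm (a # c) d' x v)(length d' := 0))"
  unfolding dproj_def tv_def by auto
 then obtain b d where d: "d' = b # d" "length c = length d" by (cases d') auto
 have "(trd idm (a # c) d' x v)(length d' := 0) = trd idm c d x v"
  using trd_Cons_trunc[OF d(2), of idm a b x v] d by simp
 then show "p \<in> tv c x v" using d' d trok_Cons[OF d(2), of idm a b x] unfolding tv_def by auto
next
 fix p assume "p \<in> tv c x v"
 then obtain d where d: "length d = length c" "trok idm c d x" "p = (d, trd idm c d x v)" unfolding tv_def by auto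
 obtain b where b: "trok idm (a # c) (b # d) x" using trok_extend[OF _ assms d(2) diffeo_at_idm] d(1) by auto
 then have "(b # d, trd idm (a # c) (b # d) x v) \<in> tv (a # c) x v" using d(1) unfolding tv_def by simp
 moreover have "(tl (b # d), (trd idm (a # c) (b # d) x v)(length (b # d) := 0)) = p"
  using trd_Cons_trunc[of c d idm a b x v] d by simp
 ultimately show "p \<in> dproj (tv (a # c) x v)" unfolding dproj_def by blast
qed

lemma dproj_tvf:
 assumes "x \<in> chart_dom (a # c)"
 shows "dproj (tvf (a # c) x u) = tvf c x (u $ a *s x (Suc (length c)))"
 unfolding tvf_def dproj_tv[OF assms] using tv_upd(2)[of c "Suc (length c)" x "chart_frame (a # c) x u" 0]
 by (simp only: lessI chart_frame_trunc)

lemma dproj_in_dir: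
 assumes x: "x \<in> chart_dom (a # c)" and v: "v \<in> chart_tan (a # c)"
 shows "dproj (tv (a # c) x v) \<in> dir (param (Suc (length c)) (a # c) x) \<longleftrightarrow>
  (\<exists>u. v = chart_frame (a # c) x u)"
proof
 let ?x = "x(Suc (length c) := 0)" and ?v = "v(Suc (length c) := 0)"
 have dom: "?x \<in> chart_dom c" "?v \<in> chart_tan c" using x v by auto
 assume "dproj (tv (a # c) x v) \<in> dir (param (Suc (length c)) (a # c) x)"
 then obtain s where "tv c x v = tvf c x (s *s x (Suc (length c)))"
  unfolding dproj_tv[OF x] param_Suc[OF x] by (auto simp: tline_tvf)
 then have "tv c ?x ?v = tv c ?x (chart_frame c ?x (s *s x (Suc (length c))))" by (simp add: tvf_def)
 then have "?v = chart_frame c ?x (s *s x (Suc (length c)))"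
  using tv_inj[OF dom chart_frame_tan] by blast
 then have "?v = chart_frame c x (s *s x (Suc (length c)))" by (simp only: chart_frame_upd lessI)
 then show "\<exists>u. v = chart_frame (a # c) x u" using chart_tan_frame[OF v] by blast
next
 assume "\<exists>u. v = chart_frame (a # c) x u"
 then obtain u where "v = chart_frame (a # c) x u" by blast
 then show "dproj (tv (a # c) x v) \<in> dir (param (Suc (length c)) (a # c) x)"
  using dproj_tvf[OF x, of u] unfolding param_Suc[OF x] tvf_def[of "a # c", symmetric] point.sel tline_tvf
  by (simp add: tvf_def)
qed

declare param.simps(2) [simp del]

section \<open>Towers in charts\<close>

definition chart_pts :: "nat => 'n::finite point set" where
 "chart_pts k = {param k c x | c x. length c = k \<and> x \<in> chart_dom c}"

text \<open>
  The properties of a distribution that make its projectivization a union of chart pieces.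
\<close>

definition scaled_dist :: "nat => 'n::finite point set => ('n point => 'n tvec set) => bool" where
 "scaled_dist k Y D \<longleftrightarrow> Y \<subseteq> chart_pts k \<and>
   (\<forall>c x. length c = k --> x \<in> chart_dom c --> param k c x \<in> Y --> D (param k c x) \<subseteq> range (tvf c x)) \<and>
   (\<forall>p\<in>Y. \<forall>\<tau>\<in>D p. \<forall>s. tscale s \<tau> \<in> D p)"

lemma chart_ptsI: "length c = k ==> x \<in> chart_dom c ==> param k c x \<in> chart_pts k"
 unfolding chart_pts_def by blast

lemma chart_dom_Cons_upd:
 "x \<in> chart_dom c ==> y $ a = 1 ==> x(Suc (length c) := y) \<in> chart_dom (a # c)"
 using chart_dom_trunc[of x c] by (simp only: chart_dom.simps mem_Collect_eq fun_upd_same fun_upd_upd)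

lemma projectivize_subset:
 assumes "scaled_dist k Y D"
 shows "projectivize Y D \<subseteq> chart_pts (Suc k)"
proof
 fix q assume "q \<in> projectivize Y D"
 then obtain p \<tau> where q: "q = Prol p (tline \<tau>)" "p \<in> Y" "\<tau> \<in> D p" "\<not> tzero \<tau>"
  unfolding projectivize_def by blast
 have "p \<in> chart_pts k" using assms q(2) unfolding scaled_dist_def by blast
 then obtain c x where c: "length c = k" "x \<in> chart_dom c" "p = param k c x"
  unfolding chart_pts_def by blast
 obtain u where u: "\<tau> = tvf c x u" using assms c q(2,3) unfolding scaled_dist_def by blast
 then have "u ~= 0" using q(4) tzero_tvf[OF c(2)] by blast
 then obtain b where b: "u $ b ~= 0" by (auto simp: vec_eq_iff)
 let ?y = "inverse (u $ b) *s u"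
 have z: "x(Suc k := ?y) \<in> chart_dom (b # c)" using chart_dom_Cons_upd[OF c(2), of ?y b] b c(1) by simp
 have "param (Suc k) (b # c) (x(Suc k := ?y)) = Prol p (tline (tvf c x ?y))"
  using param_Suc[OF z] c by (simp del: param.simps)
 also have "tline (tvf c x ?y) = tline \<tau>"
  using tline_tvf_eq[OF c(2), of ?y b u] b u by simp
 finally have "q = param (Suc k) (b # c) (x(Suc k := ?y))" by (simp only: q(1))
 then show "q \<in> chart_pts (Suc k)" using z c(1) by (auto intro!: chart_ptsI)
qed

lemma projectivize_chart:
 assumes D: "scaled_dist (length c) Y D" and x: "x \<in> chart_dom (b # c)"
 shows "param (Suc (length c)) (b # c) x \<in> projectivize Y D \<longleftrightarrow>
  param (length c) c x \<in> Y \<and> tvf c x (x (Suc (length c))) \<in> D (param (length c) c x)"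
proof
 let ?y = "x (Suc (length c))" and ?p = "param (length c) c x"
 have y: "?y $ b = 1" "?y ~= 0" and x': "x(Suc (length c) := 0) \<in> chart_dom c" using x by auto
 {
  assume "param (Suc (length c)) (b # c) x \<in> projectivize Y D"
  then obtain \<tau> where \<tau>: "tline (tvf c x ?y) = tline \<tau>" "?p \<in> Y" "\<tau> \<in> D ?p" "\<not> tzero \<tau>"
   unfolding param_Suc[OF x] projectivize_def by blast
  have "param (length c) c (x(Suc (length c) := 0)) \<in> Y" using \<tau>(2) by simp
  then have "D ?p \<subseteq> range (tvf c (x(Suc (length c) := 0)))"
   using D x' unfolding scaled_dist_def by (metis param_upd lessI)
  then obtain u where u: "\<tau> = tvf c x u" using \<tau>(3) by auto
  have "tline (tvf c (x(Suc (length c) := 0)) u) = tline (tvf c (x(Suc (length c) := 0)) ?y)"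
   using \<tau>(1) u by simp
  then have "?y = inverse (u $ b) *s u" using tline_tvf_eq[OF x' y(1)] by blast
  then have "tvf c x ?y = tscale (inverse (u $ b)) \<tau>" using u by (simp add: tscale_tvf)
  then show "?p \<in> Y \<and> tvf c x ?y \<in> D ?p" using D \<tau> unfolding scaled_dist_def by metis
 next
  assume a: "?p \<in> Y \<and> tvf c x ?y \<in> D ?p"
  have "\<not> tzero (tvf c (x(Suc (length c) := 0)) ?y)" using tzero_tvf[OF x'] y(2) by blast
  then show "param (Suc (length c)) (b # c) x \<in> projectivize Y D"
   unfolding param_Suc[OF x] projectivize_def using a by auto
 }
qed

lemma tangent_space_chart_pts:
 assumes "x \<in> chart_dom c"
 shows "tangent_space (length c) (chart_pts (length c)) (param (length c) c x) = tv c x ` chart_tan c"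
proof (intro equalityI subsetI)
 fix \<tau> assume "\<tau> \<in> tangent_space (length c) (chart_pts (length c)) (param (length c) c x)"
 then obtain \<xi> where \<xi>: "\<tau> = tv c x (cderiv \<xi> 0)"
  "NEAR t. \<xi> t \<in> chart_dom c \<and> param (length c) c (\<xi> t) \<in> chart_pts (length c)"
  unfolding tangent_space_chart[OF assms] by blast
 from \<xi>(2) have "NEAR t. \<xi> t \<in> chart_dom c" by eventually_elim simp
 then show "\<tau> \<in> tv c x ` chart_tan c" using cderiv_tan \<xi>(1) by blast
next
 fix \<tau> assume "\<tau> \<in> tv c x ` chart_tan c"
 then obtain v where v: "\<tau> = tv c x v" "v \<in> chart_tan c" by blast
 let ?\<xi> = "%t i. x i + t *s v i"
 have "?\<xi> t \<in> chart_dom c \<and> param (length c) c (?\<xi> t) \<in> chart_pts (length c)" for t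
  using chart_line[OF assms v(2)] by (auto intro: chart_ptsI)
 then show "\<tau> \<in> tangent_space (length c) (chart_pts (length c)) (param (length c) c x)"
  unfolding tangent_space_chart[OF assms] using v(1) analytic_line cderiv_line[of x v 0]
  by (intro CollectI exI[of _ ?\<xi>]) auto
qed

text \<open>
  On the set of all chart points the recursion of the tower reproduces itself: a vector is tangent to the
  next level and projects into the line exactly when it is a combination of the frame.
\<close>

lemma monster_tower:
 "fst (tower 0 (range (Base :: complex^'n::finite => _)) k) = chart_pts k \<and>
  (\<forall>c x. length c = k --> x \<in> chart_dom c -->
   snd (tower 0 (range (Base :: complex^'n => _)) k) (param k c x) = range (tvf c x))"
proof (induction k)
 case 0
 have eq: "chart_pts 0 = (range Base :: 'n point set)"
 proof (intro equalityI subsetI)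
  fix p :: "'n point" assume "p \<in> range Base"
  then obtain z where "p = Base z" by blast
  then have "p = param 0 [] (%i. if i = 0 then z else 0)" by simp
  then show "p \<in> chart_pts 0" by (auto intro!: chart_ptsI simp del: param.simps)
 qed (auto simp: chart_pts_def)
 have "tangent_space 0 (range Base) (param 0 c x) = range (tvf c x)"
  if "length c = 0" "x \<in> chart_dom c" for c and x :: "'n coords"
 proof -
  have c: "c = []" using that by simp
  have "chart_tan [] = range (chart_frame [] x)"
  proof (intro equalityI subsetI)
   fix v :: "'n coords" assume "v \<in> chart_tan []"
   then have "v = chart_frame [] x (v 0)" by (auto simp: fun_eq_iff)
   then show "v \<in> range (chart_frame [] x)" by blast
  qed (use chart_frame_tan in blast)
  then show ?thesis using tangent_space_chart_pts[OF that(2)] c eq by (auto simp: tvf_def image_image)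
 qed
 then show ?case using eq by simp
next
 case (Suc k)
 let ?Y = "fst (tower 0 (range Base) k) :: 'n point set" and ?D = "snd (tower 0 (range Base) k) :: 'n point => _"
 have Y: "?Y = chart_pts k" and D: "!!c x. length c = k ==> x \<in> chart_dom c ==> ?D (param k c x) = range (tvf c x)"
  using Suc by auto
 have sd: "scaled_dist k ?Y ?D" unfolding scaled_dist_def
 proof (intro conjI ballI allI impI)
  fix p \<tau> s assume p: "p \<in> ?Y" "\<tau> \<in> ?D p"
  then obtain c x where c: "length c = k" "x \<in> chart_dom c" "p = param k c x" by (auto simp: Y chart_pts_def)
  then show "tscale s \<tau> \<in> ?D p" using p(2) D[OF c(1,2)] by (auto simp: tscale_tvf)
 qed (use Y D in auto)
 have P: "projectivize ?Y ?D = chart_pts (Suc k)"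
 proof (intro equalityI projectivize_subset[OF sd] subsetI)
  fix p :: "'n point" assume "p \<in> chart_pts (Suc k)"
  then obtain c' x where c': "length c' = Suc k" "x \<in> chart_dom c'" "p = param (Suc k) c' x"
   by (auto simp: chart_pts_def simp del: param.simps)
  then obtain a c where c: "c' = a # c" "length c = k" by (cases c') auto
  have x: "x \<in> chart_dom (a # c)" using c' c by simp
  have x0: "x(Suc k := 0) \<in> chart_dom c" using x c by simp
  have "param k c (x(Suc k := 0)) \<in> ?Y" using Y chart_ptsI[OF c(2) x0] by simp
  moreover have "tvf c (x(Suc k := 0)) (x (Suc k)) \<in> ?D (param k c (x(Suc k := 0)))" using D[OF c(2) x0] by blast
  ultimately have "param k c x \<in> ?Y" "tvf c x (x (Suc k)) \<in> ?D (param k c x)" using c(2) by simp_all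
  then show "p \<in> projectivize ?Y ?D"
   using projectivize_chart[of c ?Y ?D x a] sd x c c' by (simp del: param.simps)
 qed
 have "{\<tau> \<in> tangent_space (Suc k) (chart_pts (Suc k)) (param (Suc k) c' x). dproj \<tau> \<in> dir (param (Suc k) c' x)} = range (tvf c' x)"
  if c': "length c' = Suc k" and x: "x \<in> chart_dom c'" for c' and x :: "'n coords"
 proof -
  obtain a c where c: "c' = a # c" "length c = k" using c' by (cases c') auto
  have x': "x \<in> chart_dom (a # c)" using x c by simp
  have "tangent_space (Suc k) (chart_pts (Suc k)) (param (Suc k) c' x) = tv c' x ` chart_tan c'"
   using tangent_space_chart_pts[OF x] c' by simp
  moreover have "(dproj (tv c' x v) \<in> dir (param (Suc k) c' x)) \<longleftrightarrow> (\<exists>u. v = chart_frame c' x u)"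
   if "v \<in> chart_tan c'" for v
   using dproj_in_dir[OF x', of v] that c by (simp del: param.simps chart_frame.simps)
  moreover have "range (tvf c' x) = tv c' x ` range (chart_frame c' x)" by (auto simp: tvf_def)
  moreover have "range (chart_frame c' x) \<subseteq> chart_tan c'" using chart_frame_tan by blast
  moreover have "dproj (tv c' x (chart_frame c' x u)) \<in> dir (param (Suc k) c' x)" for u
   using dproj_in_dir[OF x' chart_frame_tan] c by (auto simp del: chart_frame.simps)
  ultimately show ?thesis by auto
 qed
 moreover have "fst (tower 0 (range Base) (Suc k)) = projectivize ?Y ?D"
  "snd (tower 0 (range Base) (Suc k)) p = {\<tau> \<in> tangent_space (Suc k) (projectivize ?Y ?D) p. dproj \<tau> \<in> dir p}" for p
  by (simp_all add: Let_def)
 ultimately show ?case using P by (simp del: tower.simps)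
qed

lemma monster_eq: "monster k = chart_pts k"
 unfolding monster_def using monster_tower by blast

lemma Delta_eq: "x \<in> chart_dom c ==> Delta (length c) (param (length c) c x) = range (tvf c x)"
 unfolding Delta_def using monster_tower by blast

lemma under_param:
 assumes "x \<in> chart_dom (a # c)" shows "under (param (Suc (length c)) (a # c) x) = param (length c) c x"
 by (simp add: param_Suc[OF assms] del: param.simps)

lemma fiber_iff:
 assumes x: "x \<in> chart_dom (a # c)"
 shows "param (Suc (length c)) (a # c) x \<in> fiber (Suc (length c)) q \<longleftrightarrow> param (length c) c x = under q"
 unfolding fiber_def monster_eq using under_param[OF x] chart_ptsI[OF _ x, of "Suc (length c)"] by auto

lemma chart_dom_drop: "x \<in> chart_dom c ==> (%m. if m \<le> length c - j then x m else 0) \<in> chart_dom (drop j c)"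
proof (induction c arbitrary: j x)
 case (Cons a c)
 show ?case
 proof (cases j)
  case 0
  have "(%m. if m \<le> length (a # c) - j then x m else 0) = x"
   using chart_dom_high[OF Cons.prems] 0 by (auto simp: fun_eq_iff)
  then show ?thesis using Cons.prems 0 by simp
 next
  case (Suc i)
  have "x(Suc (length c) := 0) \<in> chart_dom c" using Cons.prems by simp
  from Cons.IH[OF this, of i] have "(%m. if m \<le> length c - i then (x(Suc (length c) := 0)) m else 0) \<in> chart_dom (drop i c)" .
  moreover have "(%m. if m \<le> length c - i then (x(Suc (length c) := 0)) m else 0) = (%m. if m \<le> length (a # c) - j then x m else 0)"
   using Suc by (auto simp: fun_eq_iff)
  ultimately show ?thesis using Suc by simp
 qed
qed simp

text \<open>The coordinates of a frame vector along which the tower of a fiber is preserved.\<close>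

lemma frame_critical:
 assumes "x \<in> chart_dom c" "j < length c" "u $ (c ! j) = 0"
  "\<forall>m. length c - j < m \<and> m \<le> length c --> x m $ (c ! j) = 0"
 shows "(\<forall>m. length c - j < m \<and> m \<le> length c --> chart_frame c x u m $ (c ! j) = 0) \<and>
  (\<forall>m < length c - j. chart_frame c x u m = 0)"
 using assms
proof (induction c arbitrary: j u x)
 case (Cons a c)
 let ?k = "Suc (length c)"
 show ?case
 proof (cases j)
  case 0
  then show ?thesis using Cons.prems by (auto simp: chart_frame_zero)
 next
  case (Suc i)
  have i: "i < length c" "(a # c) ! j = c ! i" using Cons.prems Suc by auto
  have x0: "x ?k $ (c ! i) = 0" using Cons.prems(4) i Suc by auto
  have xd: "x(?k := 0) \<in> chart_dom c" using Cons.prems by simp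
  have "(\<forall>m. length c - i < m \<and> m \<le> length c --> chart_frame c (x(?k := 0)) (u $ a *s x ?k) m $ (c ! i) = 0) \<and>
   (\<forall>m < length c - i. chart_frame c (x(?k := 0)) (u $ a *s x ?k) m = 0)"
   by (rule Cons.IH[OF xd i(1)]) (use x0 Cons.prems(4) Suc i in auto)
  then show ?thesis using Suc Cons.prems(3) i by (auto simp: le_Suc_eq)
 qed
qed simp

text \<open>
  In a chart the fiber is an affine space, and its tower consists of the points for which the
  coordinates with index \<open>c ! j\<close> vanish on all later levels: the directions of the fiber are the
  vertical ones, and the chart normalizes the component of this index on the line.
\<close>

lemma fiber_tower:
 fixes F :: "'n::finite point set"
 assumes F: "F = fiber i q" and i: "i \<ge> 1"
 shows "fst (tower i F j) \<subseteq> chart_pts (i + j) \<and>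
  (\<forall>c x. length c = i + j --> x \<in> chart_dom c -->
   (param (i + j) c x \<in> fst (tower i F j) \<longleftrightarrow>
    param i (drop j c) x \<in> F \<and> (\<forall>m. i < m \<and> m \<le> i + j --> x m $ (c ! j) = 0)) \<and>
   (param (i + j) c x \<in> fst (tower i F j) -->
    snd (tower i F j) (param (i + j) c x) = tvf c x ` {u. u $ (c ! j) = 0}))"
proof (induction j)
 case 0
 have "tangent_space i F (param i c x) = tvf c x ` {u. u $ (c ! 0) = 0}"
  if c': "length c = i" and x: "x \<in> chart_dom c" and inF: "param i c x \<in> F" for c and x :: "'n coords"
 proof -
  obtain a d where c: "c = a # d" "i = Suc (length d)" using c' i by (cases c) auto
  let ?k = "Suc (length d)"
  have xd: "x \<in> chart_dom (a # d)" "x(?k := 0) \<in> chart_dom d" using x c by auto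
  have pF: "param i c z \<in> F \<longleftrightarrow> z(?k := 0) = x(?k := 0)" if z: "z \<in> chart_dom c" for z
  proof -
   have zd: "z \<in> chart_dom (a # d)" "z(?k := 0) \<in> chart_dom d" using z c by auto
   have "param i c z \<in> F \<longleftrightarrow> param (length d) d z = under q" using fiber_iff[OF zd(1), of q] c F by (simp del: param.simps)
   moreover have "param (length d) d x = under q" using fiber_iff[OF xd(1), of q] c F inF by (simp del: param.simps)
   ultimately have "param i c z \<in> F \<longleftrightarrow> param (length d) d (z(?k := 0)) = param (length d) d (x(?k := 0))" by simp
   then show ?thesis using param_inj[OF zd(2) xd(2)] by simp
  qed
  show ?thesis
  proof (intro equalityI subsetI)
   fix \<tau> assume "\<tau> \<in> tangent_space i F (param i c x)"
   then obtain \<xi> where \<xi>: "\<tau> = tv c x (cderiv \<xi> 0)" "NEAR t. \<xi> t \<in> chart_dom c \<and> param i c (\<xi> t) \<in> F"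
    using tangent_space_chart[OF x, of F] c' by auto
   from \<xi>(2) have ev: "NEAR t. (\<xi> t)(?k := 0) = x(?k := 0)" by eventually_elim (use pF in blast)
   have "(cderiv \<xi> 0)(?k := 0) = cderiv (%t. (\<xi> t)(?k := 0)) 0" by (auto simp: cderiv_def fun_eq_iff vec_eq_iff)
   also have "\<dots> = cderiv (%t. x(?k := 0)) 0" by (rule cderiv_cong[OF ev])
   also have "\<dots> = chart_frame d x (0 *s x ?k)" by (simp add: cderiv_def fun_eq_iff vec_eq_iff del: fun_upd_apply)
   finally have e: "(cderiv \<xi> 0)(?k := 0) = chart_frame d x (0 *s x ?k)" .
   have "NEAR t. \<xi> t \<in> chart_dom (a # d)"
    by (rule eventually_mono[OF \<xi>(2)]) (use c in blast)
   then have "cderiv \<xi> 0 \<in> chart_tan (a # d)" by (rule cderiv_tan)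
   from chart_tan_frame[OF this e] obtain w where "cderiv \<xi> 0 = chart_frame (a # d) x w" "w $ a = 0"
    by (metis (mono_tags, lifting) vec_lambda_beta)
   then show "\<tau> \<in> tvf c x ` {u. u $ (c ! 0) = 0}"
    unfolding \<xi>(1) tvf_def c(1) by (simp del: chart_frame.simps)
  next
   fix \<tau> assume "\<tau> \<in> tvf c x ` {u. u $ (c ! 0) = 0}"
   then obtain u where u: "\<tau> = tvf c x u" "u $ a = 0" using c by auto
   let ?\<xi> = "%t i. x i + t *s chart_frame c x u i"
   have "?\<xi> t \<in> chart_dom c \<and> param i c (?\<xi> t) \<in> F" for t
   proof -
    have d: "?\<xi> t \<in> chart_dom c" by (rule chart_line[OF x chart_frame_tan])
    have "(?\<xi> t)(?k := 0) = x(?k := 0)" using u(2) c by (auto simp: fun_eq_iff)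
    then show ?thesis using d pF[OF d] by blast
   qed
   then show "\<tau> \<in> tangent_space i F (param i c x)"
    using tangent_space_chart[OF x, of F] c' u(1) analytic_line[of x "chart_frame c x u" 0]
     cderiv_line[of x "chart_frame c x u" 0]
    unfolding tvf_def by (auto intro!: exI[of _ ?\<xi>])
  qed
 qed
 moreover have "F \<subseteq> chart_pts i" using F by (auto simp: fiber_def monster_eq)
 ultimately show ?case by auto
next
 case (Suc j)
 let ?Y = "fst (tower i F j)" and ?D = "snd (tower i F j)" and ?k = "i + j"
 have Ysub: "?Y \<subseteq> chart_pts ?k"
  and Yi: "!!c x. length c = ?k ==> x \<in> chart_dom c ==> param ?k c x \<in> ?Y \<longleftrightarrow>
    param i (drop j c) x \<in> F \<and> (\<forall>m. i < m \<and> m \<le> ?k --> x m $ (c ! j) = 0)"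
  and D: "!!c x. length c = ?k ==> x \<in> chart_dom c ==> param ?k c x \<in> ?Y ==>
    ?D (param ?k c x) = tvf c x ` {u. u $ (c ! j) = 0}"
  using Suc by blast+
 have sd: "scaled_dist ?k ?Y ?D" unfolding scaled_dist_def
 proof (intro conjI ballI allI impI)
  fix p \<tau> s assume p: "p \<in> ?Y" "\<tau> \<in> ?D p"
  then obtain c x where c: "length c = ?k" "x \<in> chart_dom c" "p = param ?k c x" using Ysub by (auto simp: chart_pts_def)
  have "?D p = tvf c x ` {u. u $ (c ! j) = 0}" using D[OF c(1,2)] p(1) c(3) by simp
  then show "tscale s \<tau> \<in> ?D p" using p(2) by (auto simp: tscale_tvf)
 next
  fix c x assume "length c = ?k" "x \<in> chart_dom c" "param ?k c x \<in> ?Y"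
  then show "?D (param ?k c x) \<subseteq> range (tvf c x)" using D by auto
 qed (rule Ysub)
 let ?P = "projectivize ?Y ?D"
 have P: "param (Suc ?k) c' x \<in> ?P \<longleftrightarrow>
   param i (drop (Suc j) c') x \<in> F \<and> (\<forall>m. i < m \<and> m \<le> Suc ?k --> x m $ (c' ! Suc j) = 0)"
  if c': "length c' = Suc ?k" and x: "x \<in> chart_dom c'" for c' and x :: "'n coords"
 proof -
  obtain b c where c: "c' = b # c" "length c = ?k" using c' by (cases c') auto
  have xd: "x \<in> chart_dom (b # c)" "x(Suc ?k := 0) \<in> chart_dom c" using x c by auto
  let ?x = "x(Suc ?k := 0)"
  have 1: "param ?k c x \<in> ?Y \<longleftrightarrow> param i (drop j c) x \<in> F \<and> (\<forall>m. i < m \<and> m \<le> ?k --> x m $ (c ! j) = 0)"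
  proof -
   have "param i (drop j c) ?x = param i (drop j c) x" using c by (intro param_upd) auto
   then show ?thesis using Yi[OF c(2) xd(2)] c(2) by auto
  qed
  have 2: "tvf c x (x (Suc ?k)) \<in> ?D (param ?k c x) \<longleftrightarrow> x (Suc ?k) $ (c ! j) = 0" if "param ?k c x \<in> ?Y"
  proof -
   have "?D (param ?k c ?x) = tvf c ?x ` {u. u $ (c ! j) = 0}" using D[OF c(2) xd(2)] that c(2) by simp
   moreover have "tvf c ?x (x (Suc ?k)) = tvf c ?x u \<longleftrightarrow> x (Suc ?k) = u" for u by (rule tvf_inj[OF xd(2)])
   ultimately show ?thesis using c(2) by (auto simp: image_iff)
  qed
  have "param (Suc ?k) c' x \<in> ?P \<longleftrightarrow> param ?k c x \<in> ?Y \<and> tvf c x (x (Suc ?k)) \<in> ?D (param ?k c x)"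
   using projectivize_chart[of c ?Y ?D x b] sd xd(1) c by (simp del: param.simps)
  also have "\<dots> \<longleftrightarrow> param i (drop j c) x \<in> F \<and> (\<forall>m. i < m \<and> m \<le> ?k --> x m $ (c ! j) = 0) \<and> x (Suc ?k) $ (c ! j) = 0"
   using 1 2 by blast
  finally show ?thesis using c i by (auto simp: le_Suc_eq)
 qed
 have T: "{\<tau> \<in> tangent_space (Suc ?k) ?P (param (Suc ?k) c' x). dproj \<tau> \<in> dir (param (Suc ?k) c' x)}
   = tvf c' x ` {u. u $ (c' ! Suc j) = 0}"
  if c': "length c' = Suc ?k" and x: "x \<in> chart_dom c'" and inP: "param (Suc ?k) c' x \<in> ?P" for c' and x :: "'n coords"
 proof -
  obtain b c where c: "c' = b # c" "length c = ?k" using c' by (cases c') auto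
  have xd: "x \<in> chart_dom (b # c)" using x c by simp
  let ?a = "c ! j"
  have a: "c' ! Suc j = ?a" using c by simp
  have x0: "\<forall>m. i < m \<and> m \<le> Suc ?k --> x m $ ?a = 0" "param i (drop j c) x \<in> F" using P[OF c' x] inP a c by auto
  then have "x (Suc ?k) $ ?a = 0" by simp
  then have ab: "?a ~= b" using xd c by auto
  show ?thesis
  proof (intro equalityI subsetI)
   fix \<tau> assume "\<tau> \<in> {\<tau> \<in> tangent_space (Suc ?k) ?P (param (Suc ?k) c' x). dproj \<tau> \<in> dir (param (Suc ?k) c' x)}"
   then obtain \<xi> where \<xi>: "\<tau> = tv c' x (cderiv \<xi> 0)" "dproj \<tau> \<in> dir (param (Suc ?k) c' x)"
    "NEAR t. \<xi> t \<in> chart_dom c' \<and> param (Suc ?k) c' (\<xi> t) \<in> ?P"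
    using tangent_space_chart[OF x, of ?P] c' by (auto simp del: param.simps)
   have "NEAR t. \<xi> t \<in> chart_dom (b # c)"
    by (rule eventually_mono[OF \<xi>(3)]) (use c in blast)
   then have tan: "cderiv \<xi> 0 \<in> chart_tan (b # c)" by (rule cderiv_tan)
   obtain u where u: "cderiv \<xi> 0 = chart_frame (b # c) x u"
    using dproj_in_dir[OF xd tan] \<xi>(1,2) c by (auto simp del: param.simps chart_frame.simps)
   from \<xi>(3) have ev: "NEAR t. \<xi> t (Suc ?k) $ ?a = 0"
   proof eventually_elim
    case (elim t)
    then show ?case using P[OF c', of "\<xi> t"] a i by (auto simp del: param.simps)
   qed
   have "cderiv \<xi> 0 (Suc ?k) $ ?a = deriv (%t. 0) (0::complex)"
    unfolding cderiv_def vec_lambda_beta by (rule deriv_cong_ev[OF ev refl])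
   then have "chart_frame (b # c) x u (Suc ?k) $ ?a = 0" by (simp only: u deriv_const)
   then have "u $ ?a = 0" using c(2) ab by simp
   then have "u \<in> {u. u $ (c' ! Suc j) = 0}" using a by simp
   moreover have "\<tau> = tvf c' x u" by (simp only: \<xi>(1) tvf_def u c(1))
   ultimately show "\<tau> \<in> tvf c' x ` {u. u $ (c' ! Suc j) = 0}" by (rule rev_image_eqI)
  next
   fix \<tau> assume "\<tau> \<in> tvf c' x ` {u. u $ (c' ! Suc j) = 0}"
   then obtain u where u: "\<tau> = tvf c' x u" "u $ ?a = 0" using a by auto
   let ?v = "chart_frame c' x u"
   let ?\<xi> = "%t i. x i + t *s ?v i"
   have sub: "length c' - Suc j = i" using c' by simp
   have v0: "\<forall>m. i < m \<and> m \<le> Suc ?k --> ?v m $ ?a = 0" "\<forall>m<i. ?v m = 0"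
    using frame_critical[of x c' "Suc j" u] x c' u(2) x0(1) a i unfolding sub by auto
   have "?\<xi> t \<in> chart_dom c' \<and> param (Suc ?k) c' (?\<xi> t) \<in> ?P" for t
   proof -
    have d: "?\<xi> t \<in> chart_dom c'" by (rule chart_line[OF x chart_frame_tan])
    obtain e f where ef: "drop j c = e # f" "i = Suc (length f)"
     using c i by (cases "drop j c") (auto dest: arg_cong[of _ _ length])
    let ?tr = "%z m. if m \<le> i then z m else (0::complex^'n)"
    have df: "?tr z \<in> chart_dom (e # f)" if z: "z \<in> chart_dom c'" for z
     using chart_dom_drop[OF z, of "Suc j"] c ef by simp
    have "param (length f) f (?tr (?\<xi> t)) = param (length f) f (?tr x)"
     by (rule param_cong) (use v0(2) ef in auto)
    then have "param i (e # f) (?tr (?\<xi> t)) \<in> F \<longleftrightarrow> param i (e # f) (?tr x) \<in> F"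
     using fiber_iff[OF df[OF d], of q] fiber_iff[OF df[OF x], of q] F ef(2) by (simp del: param.simps)
    moreover have "param i (e # f) (?tr z) = param i (e # f) z" for z
     by (rule param_cong) (use ef in auto)
    ultimately have "param i (drop j c) (?\<xi> t) \<in> F" using x0(2) ef(1) by (simp del: param.simps)
    then have "param (Suc ?k) c' (?\<xi> t) \<in> ?P"
     unfolding P[OF c' d] using x0(1) v0(1) a c by auto
    then show ?thesis using d by blast
   qed
   then have "\<tau> \<in> tangent_space (Suc ?k) ?P (param (Suc ?k) c' x)"
    using tangent_space_chart[OF x, of ?P] c' u(1) analytic_line[of x ?v 0] cderiv_line[of x ?v 0]
    unfolding tvf_def by (auto intro!: exI[of _ ?\<xi>] simp del: param.simps)
   moreover have "dproj \<tau> \<in> dir (param (Suc ?k) c' x)"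
    using dproj_in_dir[OF xd chart_frame_tan] u(1) c
    by (auto simp: tvf_def simp del: param.simps chart_frame.simps)
   ultimately show "\<tau> \<in> {\<tau> \<in> tangent_space (Suc ?k) ?P (param (Suc ?k) c' x). dproj \<tau> \<in> dir (param (Suc ?k) c' x)}" by blast
  qed
 qed
 have "fst (tower i F (Suc j)) = ?P" by (simp add: Let_def)
 moreover have "snd (tower i F (Suc j)) p = {\<tau> \<in> tangent_space (Suc ?k) ?P p. dproj \<tau> \<in> dir p}" for p
  by (simp add: Let_def)
 ultimately show ?case using projectivize_subset[OF sd] P T by (simp del: param.simps tower.simps)
qed

lemma under_pow_param:
 "x \<in> chart_dom c ==> j \<le> length c ==>
  (under ^^ j) (param (length c) c x) = param (length c - j) (drop j c) x"
proof (induction j arbitrary: c x)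
 case (Suc j)
 then obtain a d where c: "c = a # d" by (cases c) auto
 have d: "x(Suc (length d) := 0) \<in> chart_dom d" using Suc.prems c by simp
 have "(under ^^ Suc j) (param (length c) c x) = (under ^^ j) (under (param (length c) c x))"
  by (simp only: funpow_Suc_right o_apply)
 also have "under (param (length c) c x) = param (length d) d (x(Suc (length d) := 0))"
  using under_param[of x a d] Suc.prems c by (simp del: param.simps)
 also have "(under ^^ j) \<dots> = param (length d - j) (drop j d) (x(Suc (length d) := 0))"
  by (rule Suc.IH[OF d]) (use Suc.prems c in simp)
 also have "\<dots> = param (length d - j) (drop j d) x" using Suc.prems c by (intro param_upd) auto
 finally show ?case using c by simp
qed simp

text \<open>
  The critical hyperplanes through a point are the coordinate hyperplanes of the indices \<open>c ! j\<close> for these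
  \<open>j\<close>. The hyperplane of \<open>j\<close> comes from the fiber of level \<open>length c - j\<close>; \<open>j = 0\<close> is the vertical one.
\<close>

definition critical_index :: "'n::finite list => 'n coords => nat => bool" where
 "critical_index c x j \<longleftrightarrow> j < length c \<and> (\<forall>m. length c - j < m \<and> m \<le> length c --> x m $ (c ! j) = 0)"

lemma baby_monster_chart:
 assumes x: "x \<in> chart_dom c" and ij: "i \<ge> 1" "i + j = length c"
 shows "param (length c) c x \<in> baby_monster i j (param (length c) c x) \<longleftrightarrow> critical_index c x j"
  "critical_index c x j ==> delta i j (param (length c) c x) = tvf c x ` {u. u $ (c ! j) = 0}"
proof -
 let ?p = "param (length c) c x"
 let ?q = "(under ^^ j) ?p"
 have "length c - j = i" "j \<le> length c" using ij by auto
 then have q: "?q = param i (drop j c) x" using under_pow_param[OF x, of j] by simp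
 have "?q \<in> fiber i ?q"
 proof -
  let ?z = "%m. if m \<le> length c - j then x m else 0"
  have "?z \<in> chart_dom (drop j c)" by (rule chart_dom_drop[OF x])
  then have "param i (drop j c) ?z \<in> chart_pts i" using ij by (intro chart_ptsI) auto
  moreover have "param i (drop j c) ?z = param i (drop j c) x" using ij by (intro param_cong) auto
  ultimately show ?thesis using q by (simp add: fiber_def monster_eq)
 qed
 then have "param i (drop j c) x \<in> fiber i ?q" using q by simp
 then have "(?p \<in> baby_monster i j ?p \<longleftrightarrow> critical_index c x j) \<and>
   (?p \<in> baby_monster i j ?p --> delta i j ?p = tvf c x ` {u. u $ (c ! j) = 0})"
  using fiber_tower[OF refl ij(1), of ?q j] x ij unfolding baby_monster_def delta_def critical_index_def
  by (auto simp del: param.simps tower.simps)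
 then show "?p \<in> baby_monster i j ?p \<longleftrightarrow> critical_index c x j"
  "critical_index c x j ==> delta i j ?p = tvf c x ` {u. u $ (c ! j) = 0}" by auto
qed

lemma critical_hyperplanes_chart:
 assumes x: "x \<in> chart_dom c"
 shows "critical_hyperplanes (length c) (param (length c) c x) =
  {tvf c x ` {u. u $ (c ! j) = 0} | j. critical_index c x j}"
proof -
 let ?p = "param (length c) c x"
 have *: "(?p \<in> baby_monster i j ?p \<longleftrightarrow> critical_index c x j) \<and>
   (?p \<in> baby_monster i j ?p --> delta i j ?p = tvf c x ` {u. u $ (c ! j) = 0})"
  if ij: "i \<ge> 1" "i + j = length c" for i j
  using baby_monster_chart[OF x ij] by blast
 have 2: "(\<exists>i. i \<ge> 1 \<and> i + j = length c) \<longleftrightarrow> j < length c" for j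
  by (auto intro!: exI[of _ "length c - j"])
 show ?thesis
  unfolding critical_hyperplanes_def
 proof (intro Collect_cong iffI; elim exE conjE)
  fix H i j assume a: "H = delta i j ?p" "1 \<le> i" "i + j = length c" "?p \<in> baby_monster i j ?p"
  then show "\<exists>j. H = tvf c x ` {u. u $ (c ! j) = 0} \<and> critical_index c x j" using *[OF a(2,3)] by blast
 next
  fix H j assume a: "H = tvf c x ` {u. u $ (c ! j) = 0}" "critical_index c x j"
  then obtain i where i: "i \<ge> 1" "i + j = length c" using 2 unfolding critical_index_def by blast
  then show "\<exists>i j. H = delta i j ?p \<and> 1 \<le> i \<and> i + j = length c \<and> ?p \<in> baby_monster i j ?p"
   using *[OF i] a by blast
 qed
qed

lemma tline_subset_hyperplane:
 assumes "x \<in> chart_dom c"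
 shows "tline (tvf c x y) \<subseteq> tvf c x ` {u. u $ a = 0} \<longleftrightarrow> y $ a = 0"
proof
 assume "tline (tvf c x y) \<subseteq> tvf c x ` {u. u $ a = 0}"
 moreover have "tvf c x (1 *s y) \<in> tline (tvf c x y)" unfolding tline_tvf by blast
 ultimately obtain u where "tvf c x (1 *s y) = tvf c x u" "u $ a = 0" by blast
 then show "y $ a = 0" using tvf_inj[OF assms] by simp
qed (auto simp: tline_tvf)

lemma regular_line_chart:
 assumes "x \<in> chart_dom c"
 shows "regular_line (length c) (param (length c) c x) (tline (tvf c x y)) \<longleftrightarrow>
  (\<forall>j. critical_index c x j --> y $ (c ! j) ~= 0)"
 unfolding regular_line_def critical_hyperplanes_chart[OF assms]
 using tline_subset_hyperplane[OF assms, of y] by blast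

lemma vertical_space_chart:
 assumes x: "x \<in> chart_dom (a # c)"
 shows "vertical_space (Suc (length c)) (param (Suc (length c)) (a # c) x) = tvf (a # c) x ` {u. u $ a = 0}"
proof -
 let ?k = "Suc (length c)"
 have x': "x(?k := 0) \<in> chart_dom c" using x by simp
 have ts: "tangent_space ?k (monster ?k) (param ?k (a # c) x) = tv (a # c) x ` chart_tan (a # c)"
  using tangent_space_chart_pts[OF x] by (simp add: monster_eq del: param.simps)
 have z: "tzero (dproj (tv (a # c) x v)) \<longleftrightarrow> (\<exists>u. u $ a = 0 \<and> v = chart_frame (a # c) x u)"
  if v: "v \<in> chart_tan (a # c)" for v
 proof -
  have v': "v(?k := 0) \<in> chart_tan c" using v by simp
  have "dproj (tv (a # c) x v) = tv c (x(?k := 0)) (v(?k := 0))" using dproj_tv[OF x] by simp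
  then have 1: "tzero (dproj (tv (a # c) x v)) \<longleftrightarrow> v(?k := 0) = (%i. 0)" using tzero_tv[OF x' v'] by simp
  show ?thesis
  proof
   assume "tzero (dproj (tv (a # c) x v))"
   then have "v(?k := 0) = chart_frame c x (0 *s x ?k)" using 1 by simp
   from chart_tan_frame[OF v this] show "\<exists>u. u $ a = 0 \<and> v = chart_frame (a # c) x u"
    by (intro exI[of _ "\<chi> j. if j = a then 0 else v ?k $ j"]) simp
  next
   assume "\<exists>u. u $ a = 0 \<and> v = chart_frame (a # c) x u"
   then show "tzero (dproj (tv (a # c) x v))" unfolding 1 by (auto simp: fun_eq_iff)
  qed
 qed
 show ?thesis
  unfolding vertical_space_def ts using z chart_frame_tan[of "a # c" x] unfolding tvf_def by blast
qed

lemma vertical_line_chart: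
 assumes x: "x \<in> chart_dom (a # c)"
 shows "vertical_line (Suc (length c)) (param (Suc (length c)) (a # c) x) (tline (tvf (a # c) x y)) \<longleftrightarrow> y $ a = 0"
 unfolding vertical_line_def vertical_space_chart[OF x] using tline_subset_hyperplane[OF x] by simp

section \<open>Topology\<close>

lemma openin_monster:
 "openin (monster_topology k) (U :: 'n::finite point set) \<longleftrightarrow> U \<subseteq> monster k \<and>
   (\<forall>c. length c = k --> openin (top_of_set (chart_dom c)) {x \<in> chart_dom c. param k c x \<in> U})"
proof -
 let ?O = "%U :: 'n point set. U \<subseteq> monster k \<and>
   (\<forall>c. length c = k --> openin (top_of_set (chart_dom c)) {x \<in> chart_dom c. param k c x \<in> U})"
 have "istopology ?O"
  unfolding istopology_def
 proof (intro conjI allI impI)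
  fix S T c assume ST: "?O S" "?O T" and c: "length (c::'n list) = k"
  have "{x \<in> chart_dom c. param k c x \<in> S \<inter> T} =
    {x \<in> chart_dom c. param k c x \<in> S} \<inter> {x \<in> chart_dom c. param k c x \<in> T}" by auto
  then show "openin (top_of_set (chart_dom c)) {x \<in> chart_dom c. param k c x \<in> S \<inter> T}"
   using ST c by auto
 next
  fix \<K> c assume K: "\<forall>K\<in>\<K>. ?O K" and c: "length (c::'n list) = k"
  have "{x \<in> chart_dom c. param k c x \<in> \<Union>\<K>} = (\<Union>K\<in>\<K>. {x \<in> chart_dom c. param k c x \<in> K})" by auto
  then show "openin (top_of_set (chart_dom c)) {x \<in> chart_dom c. param k c x \<in> \<Union>\<K>}"
   using K c by (auto intro!: openin_Union)
 qed auto
 then show ?thesis unfolding monster_topology_def by (simp add: topology_inverse')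
qed

lemma topspace_monster [simp]: "topspace (monster_topology k) = (monster k :: 'n::finite point set)"
proof -
 have "{x \<in> chart_dom c. param k c x \<in> monster k} = chart_dom c" if "length c = k" for c :: "'n list"
  using that by (auto simp: monster_eq intro: chart_ptsI)
 then have "openin (monster_topology k) (monster k :: 'n point set)" unfolding openin_monster by simp
 moreover have "openin (monster_topology k) U ==> U \<subseteq> monster k" for U unfolding openin_monster by simp
 ultimately show ?thesis unfolding topspace_def by blast
qed

lemma trok_open:
 assumes "length c = length d" shows "open {x. trok \<phi> c d x}"
proof -
 have "trok \<phi> c d x \<longleftrightarrow> (\<forall>i\<in>{..length c}. \<forall>j. ok (tr \<phi> c d i j) x)" for x
  unfolding trok_def using tr_high[OF assms] by (metis atMost_iff not_le_imp_less ok.simps(1))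
 then have "{x. trok \<phi> c d x} = (\<Inter>i\<in>{..length c}. \<Inter>j. {x. ok (tr \<phi> c d i j) x})" by auto
 then show ?thesis by (auto intro!: open_INT open_ok)
qed

lemma trm_continuous: "continuous_on {x. trok \<phi> c d x} (trm \<phi> c d)"
proof (rule continuous_on_coordinatewise_then_product)
 fix i
 have "continuous_on {x. trok \<phi> c d x} (%x. \<chi> j. eval (tr \<phi> c d i j) x)"
  by (intro continuous_on_vec_lambda continuous_on_eval) (auto simp: trok_def)
 then show "continuous_on {x. trok \<phi> c d x} (%x. trm \<phi> c d x i)" by (simp add: trm_def)
qed

text \<open>
  Chart changes are continuous with open domain, so the charts are homeomorphisms onto open sets.
\<close>

lemma chart_open:
 assumes "open W"
 shows "openin (monster_topology (length c)) (param (length c) c ` (chart_dom c \<inter> W))"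
 unfolding openin_monster
proof (intro conjI allI impI)
 show "param (length c) c ` (chart_dom c \<inter> W) \<subseteq> monster (length c)"
  by (auto simp: monster_eq intro: chart_ptsI)
 fix d :: "'a list" assume d: "length d = length c"
 have "{x \<in> chart_dom d. param (length c) d x \<in> param (length c) c ` (chart_dom c \<inter> W)}
   = chart_dom d \<inter> ({x. trok idm d c x} \<inter> trm idm d c -` W)"
 proof (intro equalityI subsetI)
  fix x assume "x \<in> {x \<in> chart_dom d. param (length c) d x \<in> param (length c) c ` (chart_dom c \<inter> W)}"
  then obtain z where "x \<in> chart_dom d" "z \<in> chart_dom c" "z \<in> W" "param (length c) d x = param (length c) c z" by auto
  then show "x \<in> chart_dom d \<inter> ({x. trok idm d c x} \<inter> trm idm d c -` W)"
   using param_eq_iff[OF d] by auto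
 next
  fix x assume x: "x \<in> chart_dom d \<inter> ({x. trok idm d c x} \<inter> trm idm d c -` W)"
  then have t: "trm idm d c x \<in> chart_dom c" by (intro trm_dom d) auto
  then have "param (length c) d x = param (length c) c (trm idm d c x)"
   using param_eq_iff[OF d, of x "trm idm d c x"] x by auto
  then show "x \<in> {x \<in> chart_dom d. param (length c) d x \<in> param (length c) c ` (chart_dom c \<inter> W)}"
   using x t by auto
 qed
 moreover have "open ({x. trok idm d c x} \<inter> trm idm d c -` W)"
  by (intro continuous_open_preimage trm_continuous trok_open d assms)
 ultimately show "openin (top_of_set (chart_dom d)) {x \<in> chart_dom d. param (length c) d x \<in> param (length c) c ` (chart_dom c \<inter> W)}"
  by (auto simp: openin_open)
qed

lemma coords_tendsto:
 assumes "analytic_coords \<xi> t"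
 shows "(\<xi> \<longlongrightarrow> \<xi> t) (nhds t)"
proof -
 have "((%s. \<xi> s i) \<longlongrightarrow> \<xi> t i) (nhds t)" for i
  using assms analytic_vec_tendsto[of "%s. \<xi> s i" t] by (simp add: analytic_coords_def analytic_vec_def)
 then show ?thesis
  using limitin_componentwise[of "%_. euclidean" UNIV \<xi> "\<xi> t" "nhds t"]
  by (simp add: euclidean_product_topology)
qed

lemma analytic_coords_upd:
 assumes "analytic_coords \<xi> t" "analytic_vec y t"
 shows "analytic_coords (%s. (\<xi> s)(k := y s)) t"
proof -
 have "(%s. ((\<xi> s)(k := y s)) i $ j) analytic_on {t}" for i j
  using assms by (cases "i = k") (auto simp: analytic_coords_def analytic_vec_def)
 then show ?thesis by (simp add: analytic_coords_def)
qed

lemma limitin_chart: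
 assumes "analytic_coords \<xi> t" "\<forall>\<^sub>F s in nhds t. \<xi> s \<in> chart_dom c"
 shows "limitin (monster_topology (length c)) (%s. param (length c) c (\<xi> s)) (param (length c) c (\<xi> t)) (at t)"
 unfolding limitin_def
proof (intro conjI allI impI)
 have 0: "\<xi> t \<in> chart_dom c" using assms(2) by (rule eventually_nhds_x_imp_x)
 then show "param (length c) c (\<xi> t) \<in> topspace (monster_topology (length c))"
  by (simp add: monster_eq chart_ptsI)
 fix U assume U: "openin (monster_topology (length c)) U \<and> param (length c) c (\<xi> t) \<in> U"
 then obtain W where W: "open W" "{x \<in> chart_dom c. param (length c) c x \<in> U} = chart_dom c \<inter> W"
  unfolding openin_monster openin_open by blast
 have "\<xi> t \<in> W" using W(2) 0 U by auto
 then have "\<forall>\<^sub>F s in nhds t. \<xi> s \<in> W"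
  using coords_tendsto[OF assms(1)] W(1) by (auto simp: tendsto_def)
 with assms(2) have "\<forall>\<^sub>F s in nhds t. param (length c) c (\<xi> s) \<in> U"
  by eventually_elim (use W(2) in blast)
 then show "\<forall>\<^sub>F s in at t. param (length c) c (\<xi> s) \<in> U" by (simp add: eventually_nhds_conv_at)
qed

lemma limitin_under:
 assumes "limitin (monster_topology (Suc k)) f q F"
 shows "limitin (monster_topology k) (%s. under (f s)) (under q) F"
 unfolding limitin_def
proof (intro conjI allI impI)
 have inm: "under p \<in> monster k" if p: "p \<in> monster (Suc k)" for p :: "'a point"
 proof -
  obtain c x where c: "length c = Suc k" "x \<in> chart_dom c" "p = param (Suc k) c x"
   using p unfolding monster_eq chart_pts_def by blast
  then obtain a d where d: "c = a # d" "length d = k" by (cases c) auto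
  have "x(Suc k := 0) \<in> chart_dom d" using c d by simp
  moreover have "under p = param k d (x(Suc k := 0))" using under_param[of x a d] c d by simp
  ultimately show ?thesis using chart_ptsI[OF d(2)] unfolding monster_eq by metis
 qed
 show "under q \<in> topspace (monster_topology k)" using assms inm by (simp add: limitin_def)
 fix U assume U: "openin (monster_topology k) U \<and> under q \<in> U"
 let ?V = "{p \<in> monster (Suc k). under p \<in> U}"
 have "openin (monster_topology (Suc k)) ?V"
  unfolding openin_monster
 proof (intro conjI allI impI)
  fix c :: "'a list" assume "length c = Suc k"
  then obtain a d where d: "c = a # d" "length d = k" by (cases c) auto
  obtain W where W: "open W" "{x \<in> chart_dom d. param k d x \<in> U} = chart_dom d \<inter> W"
   using U d unfolding openin_monster openin_open by blast
  have "continuous_on UNIV (%x::'a coords. x(Suc k := 0))"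
  proof (rule continuous_on_coordinatewise_then_product)
   fix i show "continuous_on UNIV (%x::'a coords. (x(Suc k := 0)) i)"
    by (cases "i = Suc k") (auto intro: continuous_on_product_coordinates)
  qed
  then have "open ((%x::'a coords. x(Suc k := 0)) -` W)" by (rule open_vimage[OF W(1)])
  moreover have "{x \<in> chart_dom c. param (Suc k) c x \<in> ?V} = chart_dom c \<inter> (%x. x(Suc k := 0)) -` W"
  proof -
   have "param (Suc k) c x \<in> ?V \<longleftrightarrow> x(Suc k := 0) \<in> W" if x: "x \<in> chart_dom c" for x
   proof -
    have xd: "x \<in> chart_dom (a # d)" "x(Suc k := 0) \<in> chart_dom d" using x d by auto
    have "param (Suc k) c x \<in> monster (Suc k)" using d x by (auto simp: monster_eq intro!: chart_ptsI)
    moreover have "under (param (Suc k) c x) = param k d (x(Suc k := 0))"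
     using under_param[OF xd(1)] d by simp
    ultimately show ?thesis using W(2) xd(2) by auto
   qed
   then show ?thesis by auto
  qed
  ultimately show "openin (top_of_set (chart_dom c)) {x \<in> chart_dom c. param (Suc k) c x \<in> ?V}"
   by (auto simp: openin_open)
 qed auto
 moreover have "q \<in> ?V" using assms U by (auto simp: limitin_def)
 ultimately have "\<forall>\<^sub>F s in F. f s \<in> ?V" using assms unfolding limitin_def by blast
 then show "\<forall>\<^sub>F s in F. under (f s) \<in> U" by eventually_elim simp
qed

text \<open>
 Limits along a curve in a chart are unique: by induction they lie over the limit of the projected
 curve, and two limits in the same fiber are compared through their homogeneous coordinates.
\<close>

lemma limitin_unique_chart:
 "analytic_coords \<xi> t ==> \<forall>\<^sub>F s in nhds t. \<xi> s \<in> chart_dom c ==>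
  limitin (monster_topology (length c)) (%s. param (length c) c (\<xi> s)) q (at t) ==>
  q = param (length c) c (\<xi> t)"
proof (induction c arbitrary: \<xi> q)
 case Nil
 have "q \<in> monster 0" using Nil(3) by (simp add: limitin_def)
 then obtain x where x: "x \<in> chart_dom []" "q = param 0 [] x" unfolding monster_eq chart_pts_def by auto
 have "\<xi> t 0 = x 0"
 proof (rule ccontr)
  assume ne: "\<xi> t 0 ~= x 0"
  then obtain A B where AB: "open A" "open B" "\<xi> t 0 \<in> A" "x 0 \<in> B" "A \<inter> B = {}"
   by (meson hausdorff)
  have "open ((%x::'a coords. x 0) -` B)" by (rule open_vimage[OF AB(2)]) (rule continuous_on_product_coordinates)
  then have "openin (monster_topology 0) (param 0 [] ` (chart_dom [] \<inter> (%x::'a coords. x 0) -` B))"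
   using chart_open[of _ "[] :: 'a list"] by simp
  moreover have "q \<in> param 0 [] ` (chart_dom [] \<inter> (%x::'a coords. x 0) -` B)"
   using x AB(4) by auto
  ultimately have "\<forall>\<^sub>F s in at t. param 0 [] (\<xi> s) \<in> param 0 [] ` (chart_dom [] \<inter> (%x. x 0) -` B)"
   using Nil(3) unfolding limitin_def by simp
  then have 1: "\<forall>\<^sub>F s in at t. \<xi> s 0 \<in> B" by eventually_elim auto
  have "((%s. \<xi> s 0) \<longlongrightarrow> \<xi> t 0) (nhds t)"
   using Nil(1) analytic_vec_tendsto[of "%s. \<xi> s 0" t] by (simp add: analytic_coords_def analytic_vec_def)
  then have "\<forall>\<^sub>F s in nhds t. \<xi> s 0 \<in> A" using AB by (auto simp: tendsto_def)
  then have "\<forall>\<^sub>F s in at t. \<xi> s 0 \<in> A" by (simp add: eventually_nhds_conv_at)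
  with 1 have "\<forall>\<^sub>F s in at t. False" by eventually_elim (use AB in auto)
  then show False by simp
 qed
 then show ?case using x by simp
next
 case (Cons a c)
 let ?k = "Suc (length c)"
 let ?\<xi> = "%s. (\<xi> s)(?k := 0)" and ?y = "%s. \<xi> s ?k"
 have 0: "\<xi> t \<in> chart_dom (a # c)" using Cons.prems(2) by (rule eventually_nhds_x_imp_x)
 then have y1: "?y t $ a = 1" and x0: "?\<xi> t \<in> chart_dom c" by auto
 have an: "analytic_coords ?\<xi> t" by (rule analytic_coords_upd[OF Cons.prems(1)]) (simp add: analytic_vec_def)
 have ev: "\<forall>\<^sub>F s in nhds t. ?\<xi> s \<in> chart_dom c" using Cons.prems(2) by eventually_elim simp
 have l: "limitin (monster_topology ?k) (%s. param ?k (a # c) (\<xi> s)) q (at t)" using Cons.prems(3) by simp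
 have "limitin (monster_topology (length c)) (%s. under (param ?k (a # c) (\<xi> s))) (under q) (at t)"
  by (rule limitin_under[OF l])
 moreover have "\<forall>\<^sub>F s in at t. under (param ?k (a # c) (\<xi> s)) = param (length c) c (?\<xi> s)"
  using Cons.prems(2) unfolding eventually_nhds_conv_at
  by (rule eventually_mono[OF conjunct1]) (simp add: under_param del: chart_dom.simps)
 ultimately have "limitin (monster_topology (length c)) (%s. param (length c) c (?\<xi> s)) (under q) (at t)"
  by (rule limitin_transform_eventually[rotated])
 then have uq: "under q = param (length c) c (?\<xi> t)" by (rule Cons.IH[OF an ev])
 have "q \<in> monster ?k" using l by (simp add: limitin_def)
 then obtain e z where e: "length e = ?k" "z \<in> chart_dom e" "q = param ?k e z" unfolding monster_eq chart_pts_def by auto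
 \<comment> \<open>rewrite the limit point in a chart over \<open>c\<close>\<close>
 obtain b0 e0 where e0: "e = b0 # e0" "length e0 = length c" using e by (cases e) auto
 have z0: "z(?k := 0) \<in> chart_dom e0" using e e0 by simp
 have "param (length c) e0 (z(?k := 0)) = param (length c) c (?\<xi> t)"
  using uq under_param[of z b0 e0] e e0 by simp
 then have ok: "trok idm e0 c (z(?k := 0))" "?\<xi> t = trm idm e0 c (z(?k := 0))"
  using param_eq_iff[OF e0(2) z0 x0] by auto
 then have ok0: "trok idm e0 c z" using e0(2) by simp
 obtain b where b: "trok idm (b0 # e0) (b # c) z"
  using trok_extend[OF e0(2) _ ok0 diffeo_at_idm] e e0 by blast
 define z' where "z' = trm idm (b0 # e0) (b # c) z"
 have z': "z' \<in> chart_dom (b # c)" unfolding z'_def using e e0 b by (intro trm_dom) auto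
 have qz: "q = param ?k (b # c) z'"
  using param_eq_iff[of "b0 # e0" "b # c" z z'] e e0 b z' by (simp add: z'_def)
 have zl: "z'(?k := 0) = ?\<xi> t"
  using trm_Cons_trunc[OF e0(2), of idm b0 b z] ok(2) e0(2) by (simp add: z'_def)
 let ?w = "z' ?k"
 have w1: "?w $ b = 1" using z' by simp
 \<comment> \<open>a neighborhood basis of the limit point in the fiber direction\<close>
 have conv: "((%s. inverse (?y s $ b) * ?y s $ j) \<longlongrightarrow> ?w $ j) (at t)"
  and nz: "\<forall>\<^sub>F s in at t. ?y s $ b ~= 0" for j
 proof -
  have key: "\<forall>\<^sub>F s in at t. ?y s $ b ~= 0 \<and> inverse (?y s $ b) * ?y s $ j \<in> B"
   if B: "open B" "?w $ j \<in> B" for B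
  proof -
   let ?N = "(%x::'a coords. x ?k $ j) -` B"
   have "continuous_on UNIV (%x::'a coords. x ?k $ j)"
    by (intro continuous_on_component continuous_on_product_coordinates)
   then have "open ?N" by (rule open_vimage[OF B(1)])
   then have "openin (monster_topology ?k) (param ?k (b # c) ` (chart_dom (b # c) \<inter> ?N))"
    using chart_open[of ?N "b # c"] by simp
   moreover have "q \<in> param ?k (b # c) ` (chart_dom (b # c) \<inter> ?N)"
    using qz z' B(2) by blast
   ultimately have "\<forall>\<^sub>F s in at t. param ?k (a # c) (\<xi> s) \<in> param ?k (b # c) ` (chart_dom (b # c) \<inter> ?N)"
    using l unfolding limitin_def by blast
   moreover have "\<forall>\<^sub>F s in at t. \<xi> s \<in> chart_dom (a # c)" using Cons.prems(2) by (simp add: eventually_nhds_conv_at)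
   ultimately show ?thesis
   proof eventually_elim
    case (elim s)
    then obtain x where x: "x \<in> chart_dom (b # c)" "x ?k $ j \<in> B" "param ?k (a # c) (\<xi> s) = param ?k (b # c) x" by auto
    have "trok idm (a # c) (b # c) (\<xi> s)" "x = trm idm (a # c) (b # c) (\<xi> s)"
     using param_eq_iff[of "a # c" "b # c" "\<xi> s" x] elim(2) x by auto
    moreover have s0: "?\<xi> s \<in> chart_dom c" using elim(2) by simp
    moreover have "trG idm c c (\<xi> s) (?y s) = ?y s"
    proof -
     have "trG idm c c (?\<xi> s) (?y s) = ?y s"
      unfolding trG_def using trd_refl[OF s0 chart_frame_tan] coef_frame[OF s0] by simp
     then show ?thesis by simp
    qed
    ultimately show ?case using x(2) by (simp add: trok_Cons trm_Cons)
   qed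
  qed
  show "((%s. inverse (?y s $ b) * ?y s $ j) \<longlongrightarrow> ?w $ j) (at t)"
   unfolding tendsto_def
  proof (intro allI impI)
   fix B assume "open B" "?w $ j \<in> B"
   from key[OF this] show "\<forall>\<^sub>F s in at t. inverse (?y s $ b) * ?y s $ j \<in> B"
    by (rule eventually_mono) simp
  qed
  show "\<forall>\<^sub>F s in at t. ?y s $ b ~= 0" using key[of UNIV] by simp
 qed
 have yl: "((%s. ?y s $ j) \<longlongrightarrow> ?y t $ j) (at t)" for j
  using Cons.prems(1) analytic_at_imp_isCont unfolding analytic_coords_def isCont_def by blast
 have yw: "?y t $ j = ?y t $ b * ?w $ j" for j
 proof -
  have "((%s. ?y s $ b * (inverse (?y s $ b) * ?y s $ j)) \<longlongrightarrow> ?y t $ b * ?w $ j) (at t)"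
   by (intro tendsto_mult yl conv)
  moreover have "\<forall>\<^sub>F s in at t. ?y s $ b * (inverse (?y s $ b) * ?y s $ j) = ?y s $ j"
   using nz by eventually_elim simp
  ultimately have "((%s. ?y s $ j) \<longlongrightarrow> ?y t $ b * ?w $ j) (at t)" by (rule Lim_transform_eventually)
  then show ?thesis by (rule tendsto_unique[OF trivial_limit_at yl])
 qed
 have yb: "?y t $ b ~= 0" using yw[of a] y1 by auto
 have "inverse (?y t $ b) * ?y t $ j = ?w $ j" for j
  by (subst yw[of j]) (simp add: yb)
 then have "inverse (?y t $ b) *s ?y t = ?w" by (simp add: vec_eq_iff)
 then have "tline (tvf c (?\<xi> t) (?y t)) = tline (tvf c (?\<xi> t) ?w)"
  using tline_tvf_eq[OF x0 w1] yb by metis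
 moreover have "tvf c (?\<xi> t) (?y t) = tvf c (\<xi> t) (?y t)" "tvf c (?\<xi> t) ?w = tvf c z' ?w"
  using zl tvf_upd[of c ?k z' 0 ?w] by auto
 moreover have "param (length c) c (\<xi> t) = param (length c) c z'"
  using param_upd[of c "length c" ?k "\<xi> t" 0] param_upd[of c "length c" ?k z' 0] zl by simp
 ultimately have "param ?k (a # c) (\<xi> t) = param ?k (b # c) z'"
  using param_Suc[OF 0] param_Suc[OF z'] by simp
 then show ?case using qz by simp
qed

section \<open>Prolongation of curves\<close>

text \<open>
 A curve \<open>\<xi>\<close> in the chart \<open>c\<close> that prolongs \<open>\<gamma>\<close>, with velocity of components \<open>u\<close> in the frame.
\<close>

fun clift :: "(complex => complex^'n::finite) => 'n list => (complex => 'n coords) => (complex => complex^'n) => bool" where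
 "clift \<gamma> [] \<xi> u \<longleftrightarrow> analytic_vec \<gamma> 0 \<and>
   (NEAR t. \<xi> t = (%i. if i = 0 then \<gamma> t else 0) \<and> u t = vderiv \<gamma> t)"
| "clift \<gamma> (a # c) \<xi> u \<longleftrightarrow>
   (\<exists>w. clift \<gamma> c (%t. (\<xi> t)(Suc (length c) := 0)) w \<and>
    analytic_vec (%t. \<xi> t (Suc (length c))) 0 \<and>
    \<not> (NEAR t. w t $ a = 0) \<and>
    (NEAR t. \<xi> t (Suc (length c)) $ a = 1 \<and>
      w t = w t $ a *s \<xi> t (Suc (length c)) \<and>
      u t = (\<chi> j. if j = a then w t $ a else vderiv (%s. \<xi> s (Suc (length c))) t $ j)))"

lemma analytic_vec_cong:
 assumes "\<forall>\<^sub>F s in nhds t. f s = g s" shows "analytic_vec f t = analytic_vec g t"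
proof -
 have "(%s. f s $ j) analytic_on {t} \<longleftrightarrow> (%s. g s $ j) analytic_on {t}" for j
  by (rule analytic_at_cong) (auto intro: eventually_mono[OF assms])
 then show ?thesis by (simp add: analytic_vec_def)
qed

lemma vderiv_cong:
 assumes "\<forall>\<^sub>F s in nhds t. f s = g s" shows "vderiv f t = vderiv g t"
 unfolding vderiv_def
 by (auto simp: vec_eq_iff intro!: deriv_cong_ev eventually_mono[OF assms])

lemma analytic_vec_vderiv: "analytic_vec f t ==> analytic_vec (vderiv f) t"
 unfolding analytic_vec_def vderiv_def by (auto intro: analytic_deriv)

lemma eventually_analytic_vec:
 "analytic_vec f t ==> \<forall>\<^sub>F s in nhds t. analytic_vec f s"
 unfolding analytic_vec_def by (intro eventually_all_finite) (auto intro: eventually_analytic_on)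

lemma eventually_nhds_nhds: "\<forall>\<^sub>F s in nhds (t::complex). P s ==> \<forall>\<^sub>F s in nhds t. \<forall>\<^sub>F r in nhds s. P r"
 by (simp add: eventually_eventually)

lemma eventually_analytic_coords:
 assumes an: "analytic_coords \<xi> t" and ev: "\<forall>\<^sub>F s in nhds t. \<xi> s \<in> chart_dom c"
 shows "\<forall>\<^sub>F s in nhds t. analytic_coords \<xi> s"
proof -
 have "\<forall>\<^sub>F s in nhds t. analytic_vec (%s. \<xi> s i) s" for i
  by (rule eventually_analytic_vec) (use an in \<open>auto simp: analytic_coords_def analytic_vec_def\<close>)
 then have "\<forall>\<^sub>F s in nhds t. \<forall>i\<in>{..length c}. analytic_vec (%s. \<xi> s i) s"
  by (intro eventually_ball_finite) auto
 with eventually_nhds_nhds[OF ev] show ?thesis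
 proof eventually_elim
  case (elim s)
  have "analytic_vec (%s. \<xi> s i) s" for i
  proof (cases "i \<le> length c")
   case False
   have "\<forall>\<^sub>F r in nhds s. \<xi> r i = 0" using elim(1)
    by eventually_elim (use False chart_dom_high in force)
   then have "(%r. \<xi> r i $ j) analytic_on {s} \<longleftrightarrow> (%r. 0) analytic_on {s}" for j
    by (intro analytic_at_cong) (auto elim: eventually_mono)
   then show ?thesis by (simp add: analytic_vec_def)
  qed (use elim(2) in auto)
  then show ?case by (simp add: analytic_coords_def analytic_vec_def)
 qed
qed

lemma clift_cong:
 "clift \<gamma> c \<xi> u ==> NEAR t. \<xi> t = \<zeta> t ==> NEAR t. u t = v t ==> clift \<gamma> c \<zeta> v"
proof (induction c arbitrary: \<xi> u \<zeta> v)
 case Nil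
 then have "NEAR t. \<xi> t = (%i. if i = 0 then \<gamma> t else 0) \<and> u t = vderiv \<gamma> t" by simp
 with Nil(2,3) have "NEAR t. \<zeta> t = (%i. if i = 0 then \<gamma> t else 0) \<and> v t = vderiv \<gamma> t"
  by eventually_elim simp
 then show ?case using Nil by simp
next
 case (Cons a c)
 let ?k = "Suc (length c)"
 obtain w where w: "clift \<gamma> c (%t. (\<xi> t)(?k := 0)) w" "analytic_vec (%t. \<xi> t ?k) 0"
  "\<not> (NEAR t. w t $ a = 0)"
  "NEAR t. \<xi> t ?k $ a = 1 \<and> w t = w t $ a *s \<xi> t ?k \<and>
    u t = (\<chi> j. if j = a then w t $ a else vderiv (%s. \<xi> s ?k) t $ j)"
  using Cons.prems(1) by auto
 have k: "NEAR t. \<xi> t ?k = \<zeta> t ?k" using Cons.prems(2) by eventually_elim simp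
 have 1: "clift \<gamma> c (%t. (\<zeta> t)(?k := 0)) w"
  by (rule Cons.IH[OF w(1)], rule eventually_mono[OF Cons.prems(2)]) simp_all
 have 2: "analytic_vec (%t. \<zeta> t ?k) 0" using analytic_vec_cong[OF k] w(2) by simp
 from w(4) Cons.prems(2,3) eventually_nhds_nhds[OF k]
 have "NEAR t. \<zeta> t ?k $ a = 1 \<and> w t = w t $ a *s \<zeta> t ?k \<and>
    v t = (\<chi> j. if j = a then w t $ a else vderiv (%s. \<zeta> s ?k) t $ j)"
 proof eventually_elim
  case (elim t)
  then show ?case using vderiv_cong[OF elim(4)] by (simp cong: if_cong)
 qed
 then show ?case using 1 2 w(3) by auto
qed

lemma clift_germ: "clift \<gamma> c \<xi> u ==> analytic_vec \<gamma> 0"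
 by (induction c arbitrary: \<xi> u) auto

text \<open>
  A lift is an integral curve of the distribution, with velocity \<open>u\<close> in the frame.
\<close>

lemma clift_integral:
 "clift \<gamma> c \<xi> u ==> analytic_coords \<xi> 0 \<and> analytic_vec u 0 \<and>
   (NEAR t. \<xi> t \<in> chart_dom c \<and> cderiv \<xi> t = chart_frame c (\<xi> t) (u t) \<and> \<xi> t 0 = \<gamma> t)"
proof (induction c arbitrary: \<xi> u)
 case Nil
 let ?\<zeta> = "%t i. if i = (0::nat) then \<gamma> t else 0"
 have an: "analytic_vec \<gamma> 0" and ev: "NEAR t. \<xi> t = ?\<zeta> t \<and> u t = vderiv \<gamma> t" using Nil by auto
 have \<xi>: "NEAR t. \<xi> t = ?\<zeta> t" and u: "NEAR t. u t = vderiv \<gamma> t"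
  using ev by (auto elim: eventually_mono)
 have "(%t. ?\<zeta> t i $ j) analytic_on {0}" for i j
  by (cases "i = 0") (use an in \<open>auto simp: analytic_vec_def\<close>)
 then have "analytic_coords ?\<zeta> 0" by (simp add: analytic_coords_def)
 then have 1: "analytic_coords \<xi> 0" using analytic_coords_cong[OF \<xi>] by simp
 have 2: "analytic_vec u 0" using analytic_vec_cong[OF u] analytic_vec_vderiv[OF an] by simp
 have c: "cderiv ?\<zeta> t = (%i. if i = 0 then vderiv \<gamma> t else 0)" for t
  by (auto simp: cderiv_def vderiv_def fun_eq_iff vec_eq_iff)
 from ev eventually_nhds_nhds[OF \<xi>]
 have "NEAR t. \<xi> t \<in> chart_dom [] \<and> cderiv \<xi> t = chart_frame [] (\<xi> t) (u t) \<and> \<xi> t 0 = \<gamma> t"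
 proof eventually_elim
  case (elim t)
  then show ?case using cderiv_cong[OF elim(2)] c[of t] by simp
 qed
 then show ?case using 1 2 by blast
next
 case (Cons a c)
 let ?k = "Suc (length c)" and ?\<xi> = "%t. (\<xi> t)(Suc (length c) := 0)"
 obtain w where w: "clift \<gamma> c ?\<xi> w" "analytic_vec (%t. \<xi> t ?k) 0"
  "NEAR t. \<xi> t ?k $ a = 1 \<and> w t = w t $ a *s \<xi> t ?k \<and>
    u t = (\<chi> j. if j = a then w t $ a else vderiv (%s. \<xi> s ?k) t $ j)"
  using Cons.prems(1) by auto
 have IH: "analytic_coords ?\<xi> 0" "analytic_vec w 0"
   "NEAR t. ?\<xi> t \<in> chart_dom c \<and> cderiv ?\<xi> t = chart_frame c (?\<xi> t) (w t) \<and> ?\<xi> t 0 = \<gamma> t"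
  using Cons.IH[OF w(1)] by blast+
 have "analytic_coords (%t. (?\<xi> t)(?k := \<xi> t ?k)) 0" by (rule analytic_coords_upd[OF IH(1) w(2)])
 then have 1: "analytic_coords \<xi> 0" by simp
 have ue: "NEAR t. u t = (\<chi> j. if j = a then w t $ a else vderiv (%s. \<xi> s ?k) t $ j)"
  using w(3) by eventually_elim blast
 have "(%t. if j = a then w t $ a else vderiv (%s. \<xi> s ?k) t $ j) analytic_on {0}" for j
  using analytic_vec_vderiv[OF w(2)] IH(2) unfolding analytic_vec_def by (cases "j = a") auto
 then have "analytic_vec (%t. \<chi> j. if j = a then w t $ a else vderiv (%s. \<xi> s ?k) t $ j) 0"
  by (simp add: analytic_vec_def)
 then have 2: "analytic_vec u 0" using analytic_vec_cong[OF ue] by simp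
 have dom: "NEAR t. \<xi> t \<in> chart_dom (a # c)" using w(3) IH(3) by eventually_elim simp
 from w(3) IH(3) dom eventually_nhds_nhds[OF dom]
 have "NEAR t. \<xi> t \<in> chart_dom (a # c) \<and> cderiv \<xi> t = chart_frame (a # c) (\<xi> t) (u t) \<and> \<xi> t 0 = \<gamma> t"
 proof eventually_elim
  case (elim t)
  have tan: "cderiv \<xi> t \<in> chart_tan (a # c)" by (rule cderiv_tan[OF elim(4)])
  have "(cderiv \<xi> t)(?k := 0) = cderiv ?\<xi> t" by (auto simp: cderiv_def fun_eq_iff vec_eq_iff)
  also have "\<dots> = chart_frame c (\<xi> t) (w t)" using elim(2) by simp
  also have "\<dots> = chart_frame c (\<xi> t) (w t $ a *s \<xi> t ?k)" using elim(1) by metis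
  finally have "cderiv \<xi> t = chart_frame (a # c) (\<xi> t) (\<chi> j. if j = a then w t $ a else cderiv \<xi> t ?k $ j)"
   by (rule chart_tan_frame[OF tan])
  moreover have "cderiv \<xi> t ?k = vderiv (%s. \<xi> s ?k) t" by (simp add: cderiv_def vderiv_def)
  ultimately have "cderiv \<xi> t = chart_frame (a # c) (\<xi> t) (u t)" using elim(1) by metis
  then show ?case using elim by simp
 qed
 then show ?case using 1 2 by blast
qed

section \<open>Power series expansions\<close>

abbreviation E :: "(complex => complex) => complex fps" where
 "E f \<equiv> fps_expansion f 0"

lemma E_exp: "f analytic_on {0} ==> f has_fps_expansion E f"
 by (rule analytic_at_imp_has_fps_expansion_0)

lemma E_eqI: "f has_fps_expansion F ==> E f = F"
 by (rule fps_ext) (simp add: fps_nth_fps_expansion fps_expansion_def)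

lemma E_cong: "NEAR t. f t = g t ==> E f = E g"
 unfolding fps_expansion_def by (auto intro!: fps_ext higher_deriv_cong_ev)

lemma E_eq_iff:
 assumes "f analytic_on {0}" "g analytic_on {0}"
 shows "E f = E g \<longleftrightarrow> (NEAR t. f t = g t)"
proof
 assume e: "E f = E g"
 from E_exp[OF assms(1)] E_exp[OF assms(2)]
 have "NEAR t. eval_fps (E f) t = f t" "NEAR t. eval_fps (E g) t = g t"
  unfolding has_fps_expansion_def by blast+
 then show "NEAR t. f t = g t" unfolding e by eventually_elim simp
qed (rule E_cong)

lemma E_zero_iff: "f analytic_on {0} ==> E f = 0 \<longleftrightarrow> (NEAR t. f t = 0)"
 using E_eq_iff[of f "%t. 0"] E_eqI[OF has_fps_expansion_0] by simp

lemma E_nth_0: "fps_nth (E f) 0 = f 0"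
 by (simp add: fps_expansion_def)

lemma E_factor:
 assumes f: "f analytic_on {0}" and d: "\<forall>i<d. fps_nth (E f) i = 0"
 shows "\<exists>g. g analytic_on {0} \<and> E g = fps_shift d (E f) \<and> (NEAR t. f t = t ^ d * g t)"
proof -
 let ?G = "fps_shift d (E f)"
 let ?g = "eval_fps ?G"
 have "fps_conv_radius (E f) > 0" using E_exp[OF f] by (simp add: has_fps_expansion_def)
 then have g: "?g has_fps_expansion ?G" by (intro eval_fps_has_fps_expansion) simp
 have ga: "?g analytic_on {0}" by (rule has_fps_expansion_imp_analytic_0[OF g])
 have "E f = fps_X ^ d * ?G"
  using d by (intro fps_ext) (auto simp: fps_X_power_mult_nth)
 moreover have "(%t. t ^ d * ?g t) has_fps_expansion fps_X ^ d * ?G"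
  by (intro has_fps_expansion_mult has_fps_expansion_fps_X_power g)
 ultimately have "E (%t. t ^ d * ?g t) = E f" using E_eqI by metis
 moreover have "(%t. t ^ d * ?g t) analytic_on {0}" by (intro analytic_intros ga)
 ultimately have "NEAR t. f t = t ^ d * ?g t" using E_eq_iff[OF f] by metis
 then show ?thesis using ga E_eqI[OF g] by blast
qed

lemma E_factor_exact:
 assumes f: "f analytic_on {0}" and nz: "\<not> (NEAR t. f t = 0)"
 shows "\<exists>g. g analytic_on {0} \<and> g 0 ~= 0 \<and> (NEAR t. f t = t ^ subdegree (E f) * g t)"
proof -
 have F: "E f ~= 0" using E_zero_iff[OF f] nz by simp
 obtain g where g: "g analytic_on {0}" "E g = fps_shift (subdegree (E f)) (E f)"
  "NEAR t. f t = t ^ subdegree (E f) * g t"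
  using E_factor[OF f, of "subdegree (E f)"] nth_less_subdegree_zero by blast
 have "g 0 = fps_nth (E f) (subdegree (E f))" using arg_cong[OF g(2), of "%F. fps_nth F 0"] by (simp add: E_nth_0)
 then show ?thesis using g F by auto
qed

lemma analytic_eventually_nonzero:
 assumes "g analytic_on {0::complex}" "g 0 ~= (0::complex)"
 shows "NEAR t. g t ~= 0"
proof -
 have "(g \<longlongrightarrow> g 0) (nhds 0)"
  using analytic_at_imp_isCont[OF assms(1)] tendsto_at_iff_tendsto_nhds[of g 0] by (simp add: isCont_def)
 then show ?thesis using assms(2) by (rule tendsto_imp_eventually_ne)
qed

lemma not_eventually_zero:
 assumes "f analytic_on {0}" "\<not> (NEAR t. f t = (0::complex))"
 shows "\<forall>\<^sub>F t in at 0. f t ~= 0"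
proof -
 obtain g where g: "g analytic_on {0}" "g 0 ~= 0" "NEAR t. f t = t ^ subdegree (E f) * g t"
  using E_factor_exact[OF assms] by blast
 have "NEAR t. t ~= 0 --> f t ~= 0"
  using analytic_eventually_nonzero[OF g(1,2)] g(3) by eventually_elim simp
 then show ?thesis by (simp add: eventually_at_filter)
qed

section \<open>Lifts of curves\<close>

text \<open>
  At a zero of the velocity the prolongation is a limit. The lift is continuous and represents the
  prolongation away from the zeros, so it represents the limit too.
\<close>

lemma clift_prolong:
 "clift \<gamma> c \<xi> u ==> NEAR t. prolong_curve \<gamma> (length c) t = param (length c) c (\<xi> t)"
proof (induction c arbitrary: \<xi> u)
 case Nil
 then have "NEAR t. \<xi> t = (%i. if i = 0 then \<gamma> t else 0) \<and> u t = vderiv \<gamma> t" by simp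
 then show ?case by eventually_elim simp
next
 case (Cons a c)
 let ?k = "Suc (length c)" and ?\<xi> = "%t. (\<xi> t)(Suc (length c) := 0)"
 let ?\<Gamma> = "prolong_curve \<gamma> (length c)" and ?p = "%t. param (Suc (length c)) (a # c) (\<xi> t)"
 let ?G = "%s. Prol (?\<Gamma> s) (tline (velocity (length c) ?\<Gamma> s))"
 obtain w where w: "clift \<gamma> c ?\<xi> w" "\<not> (NEAR t. w t $ a = 0)"
  "NEAR t. \<xi> t ?k $ a = 1 \<and> w t = w t $ a *s \<xi> t ?k \<and>
    u t = (\<chi> j. if j = a then w t $ a else vderiv (%s. \<xi> s ?k) t $ j)"
  using Cons.prems(1) by auto
 have int: "analytic_coords ?\<xi> 0" "analytic_vec w 0"
   "NEAR t. ?\<xi> t \<in> chart_dom c \<and> cderiv ?\<xi> t = chart_frame c (?\<xi> t) (w t)"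
  using clift_integral[OF w(1)] by (auto elim: eventually_mono)
 have int': "analytic_coords \<xi> 0" "NEAR t. \<xi> t \<in> chart_dom (a # c)"
  using clift_integral[OF Cons.prems] by (auto elim: eventually_mono)
 have dom: "NEAR t. ?\<xi> t \<in> chart_dom c" using int(3) by eventually_elim blast
 have IH: "NEAR t. ?\<Gamma> t = param (length c) c (?\<xi> t)" by (rule Cons.IH[OF w(1)])
 have rep: "NEAR t. represents (param (length c)) c ?\<xi> ?\<Gamma> t"
  using eventually_nhds_nhds[OF IH] eventually_nhds_nhds[OF dom] eventually_analytic_coords[OF int(1) dom]
  unfolding represents_iff by eventually_elim (simp add: eventually_conj_iff)
 have key: "NEAR t. (w t $ a ~= 0 --> ?G t = ?p t \<and> \<not> tzero (velocity (length c) ?\<Gamma> t)) \<and>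
   (w t $ a = 0 --> tzero (velocity (length c) ?\<Gamma> t))"
  using rep int(3) w(3) int'(2) IH
 proof eventually_elim
  case (elim t)
  have x: "?\<xi> t \<in> chart_dom c" using elim by blast
  have v: "velocity (length c) ?\<Gamma> t = tvf c (?\<xi> t) (w t)"
   using velocity_tv[OF elim(1)] elim(2) by (simp add: tvf_def)
  have wt: "w t = w t $ a *s \<xi> t ?k" "\<xi> t ?k $ a = 1" using elim(3) by auto
  have 1: "tzero (velocity (length c) ?\<Gamma> t) \<longleftrightarrow> w t = 0" using v tzero_tvf[OF x] by simp
  have 2: "w t = 0 \<longleftrightarrow> w t $ a = 0" using wt(1) by (metis vector_smult_lzero zero_index)
  have 3: "?G t = ?p t" if "w t $ a ~= 0"
  proof -
   have "\<xi> t ?k = inverse (w t $ a) *s w t" using wt(1) that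
    by (metis left_inverse vector_smult_assoc vector_smult_lid)
   then have "tline (tvf c (?\<xi> t) (w t)) = tline (tvf c (?\<xi> t) (\<xi> t ?k))"
    using tline_tvf_eq[OF x wt(2)] that by blast
   then show ?thesis using param_Suc[OF elim(4)] v elim(5) by simp
  qed
  show ?case using 1 2 3 by blast
 qed
 have w0: "\<forall>\<^sub>F t in at 0. w t $ a ~= 0"
  using not_eventually_zero[OF _ w(2)] int(2) by (simp add: analytic_vec_def)
 have key': "\<forall>\<^sub>F t in at 0. ?G t = ?p t \<and> \<not> tzero (velocity (length c) ?\<Gamma> t)"
  using key[unfolded eventually_nhds_conv_at, THEN conjunct1] w0 by eventually_elim blast
 have at0: "prolong_curve \<gamma> ?k 0 = ?p 0"
 proof (cases "w 0 $ a = 0")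
  case False
  then show ?thesis using eventually_nhds_x_imp_x[OF key] by (simp add: prolong_curve1_def)
 next
  case True
  have lim: "limitin (monster_topology ?k) ?p (?p 0) (at 0)"
   using limitin_chart[OF int'] by simp
  have "limitin (monster_topology ?k) ?G (?p 0) (at 0)"
   by (rule limitin_transform_eventually[OF eventually_mono[OF key'] lim]) simp
  moreover have "q = ?p 0" if "limitin (monster_topology ?k) ?G q (at 0)" for q
  proof -
   have "limitin (monster_topology ?k) ?p q (at 0)"
    by (rule limitin_transform_eventually[OF eventually_mono[OF key'] that]) simp
   then have "limitin (monster_topology (length (a # c))) (%s. param (length (a # c)) (a # c) (\<xi> s)) q (at 0)"
    by simp
   from limitin_unique_chart[OF int' this] show ?thesis by simp
  qed
  ultimately have "(THE q. limitin (monster_topology ?k) ?G q (at 0)) = ?p 0" by (rule the_equality)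
  moreover have "tzero (velocity (length c) ?\<Gamma> 0)" using eventually_nhds_x_imp_x[OF key] True by blast
  ultimately show ?thesis by (simp add: prolong_curve1_def)
 qed
 have "\<forall>\<^sub>F t in at 0. prolong_curve \<gamma> ?k t = ?p t"
  using key' by eventually_elim (simp add: prolong_curve1_def)
 then have "NEAR t. prolong_curve \<gamma> ?k t = ?p t"
  unfolding eventually_nhds_conv_at using at0 by blast
 then show ?case by (simp only: list.size(4) add_0_right add_Suc_right One_nat_def)
qed

text \<open>
  The component that normalizes a level does not vanish identically; on the base the velocity is the derivative
  of the curve.
\<close>

lemma clift_nonzero:
 assumes "clift \<gamma> c \<xi> u" "nonconstant_germ \<gamma>"
 shows "\<not> (NEAR t. u t = 0)"
proof (cases c)
 case Nil
 have an: "analytic_vec \<gamma> 0" and u: "NEAR t. u t = vderiv \<gamma> t"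
  using assms(1) Nil by (auto elim: eventually_mono)
 show ?thesis
 proof
  assume "NEAR t. u t = 0"
  with u eventually_analytic_vec[OF an]
  have "NEAR t. vderiv \<gamma> t = 0 \<and> analytic_vec \<gamma> t" by eventually_elim simp
  then obtain r where r: "r > 0" "!!t. dist t 0 < r ==> vderiv \<gamma> t = 0 \<and> analytic_vec \<gamma> t"
   unfolding eventually_nhds_metric by auto
  have "\<exists>c. \<forall>t\<in>ball 0 r. \<gamma> t $ j = c" for j
  proof (rule has_field_derivative_zero_constant)
   show "((%t. \<gamma> t $ j) has_field_derivative 0) (at x within ball 0 r)" if x: "x \<in> ball 0 r" for x
   proof -
    have "dist x 0 < r" using x by (simp add: dist_commute)
    then have "((%t. \<gamma> t $ j) has_field_derivative deriv (%t. \<gamma> t $ j) x) (at x)" "vderiv \<gamma> x $ j = 0"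
     using r(2)[of x] analytic_derivI[OF analytic_vecD, of \<gamma> x j] by auto
    then show ?thesis by (simp add: vderiv_def has_field_derivative_at_within)
   qed
  qed simp
  then have "\<gamma> t $ j = \<gamma> 0 $ j" if "t \<in> ball 0 r" for t j
   using that r(1) by (metis centre_in_ball)
  then have "\<forall>t\<in>ball 0 r. \<gamma> t = \<gamma> 0" unfolding vec_eq_iff by blast
  moreover have "open (ball (0::complex) r)" "0 \<in> ball (0::complex) r" using r(1) by auto
  ultimately have "NEAR t. \<gamma> t = \<gamma> 0" unfolding eventually_nhds by blast
  then show False using assms(2) unfolding nonconstant_germ_def by blast
 qed
next
 case (Cons a c')
 obtain w where w: "\<not> (NEAR t. w t $ a = 0)"
  "NEAR t. \<xi> t (Suc (length c')) $ a = 1 \<and> w t = w t $ a *s \<xi> t (Suc (length c')) \<and>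
   u t = (\<chi> j. if j = a then w t $ a else vderiv (%s. \<xi> s (Suc (length c'))) t $ j)"
  using assms(1) unfolding Cons clift.simps by blast
 from w(2) have u: "NEAR t. u t $ a = w t $ a" by eventually_elim simp
 show ?thesis
 proof
  assume "NEAR t. u t = 0"
  with u have "NEAR t. w t $ a = 0" by eventually_elim simp
  then show False using w(1) by blast
 qed
qed

lemma clift_ConsI:
 assumes "clift \<gamma> c \<xi> w" "analytic_vec y 0" "\<not> (NEAR t. w t $ a = 0)"
  "NEAR t. y t $ a = 1 \<and> w t = w t $ a *s y t"
 shows "clift \<gamma> (a # c) (%t. (\<xi> t)(Suc (length c) := y t)) (%t. \<chi> j. if j = a then w t $ a else vderiv y t $ j)"
proof -
 have "NEAR t. \<xi> t = (\<xi> t)(Suc (length c) := 0)"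
  using clift_integral[OF assms(1)] by (auto elim!: eventually_mono simp: chart_dom_trunc)
 then have "clift \<gamma> c (%t. (\<xi> t)(Suc (length c) := 0)) w"
  by (rule clift_cong[OF assms(1)]) simp
 then show ?thesis using assms(2-4) by (auto intro!: exI[of _ w] cong: if_cong)
qed

text \<open>
  Division by a component of least vanishing order at 0.
\<close>

lemma analytic_direction:
 assumes w: "analytic_vec (w :: complex => complex^'n::finite) 0" and nz: "\<not> (NEAR t. w t = 0)"
 shows "\<exists>a y. analytic_vec y 0 \<and> \<not> (NEAR t. w t $ a = 0) \<and>
   (NEAR t. y t $ a = 1 \<and> w t = w t $ a *s y t)"
proof -
 let ?W = "%j. E (%t. w t $ j)"
 have an: "(%t. w t $ j) analytic_on {0}" for j using w by (rule analytic_vecD)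
 have "\<exists>j. \<not> (NEAR t. w t $ j = 0)"
 proof (rule ccontr)
  assume "\<nexists>j. \<not> (NEAR t. w t $ j = 0)"
  then have "NEAR t. \<forall>j. w t $ j = 0" by (intro eventually_all_finite) auto
  then have "NEAR t. w t = 0" by eventually_elim (simp add: vec_eq_iff)
  then show False using nz by blast
 qed
 then have ne: "{j. ?W j ~= 0} ~= {}" using E_zero_iff[OF an] by auto
 define a where "a = arg_min_on (%j. subdegree (?W j)) {j. ?W j ~= 0}"
 have a: "?W a ~= 0" "!!j. ?W j ~= 0 ==> subdegree (?W a) \<le> subdegree (?W j)"
  using arg_min_if_finite(1)[OF _ ne, of "%j. subdegree (?W j)"] arg_min_least[OF _ ne, of _ "%j. subdegree (?W j)"]
  unfolding a_def by auto
 have wa: "\<not> (NEAR t. w t $ a = 0)" using a(1) E_zero_iff[OF an] by simp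
 let ?d = "subdegree (?W a)"
 obtain g where g: "g analytic_on {0}" "g 0 ~= 0" "NEAR t. w t $ a = t ^ ?d * g t"
  using E_factor_exact[OF an wa] by blast
 have "\<exists>h. h analytic_on {0} \<and> (NEAR t. w t $ j = t ^ ?d * h t)" for j
 proof -
  have "\<forall>i<?d. fps_nth (?W j) i = 0"
  proof (intro allI impI)
   fix i assume "i < ?d"
   then show "fps_nth (?W j) i = 0"
    using a(2)[of j] nth_less_subdegree_zero[of i "?W j"] by (cases "?W j = 0") auto
  qed
  then show ?thesis using E_factor[OF an] by blast
 qed
 then obtain h where h: "!!j. h j analytic_on {0}" "!!j. NEAR t. w t $ j = t ^ ?d * h j t" by metis
 define y :: "complex => complex^'n" where "y t = (\<chi> j. if j = a then 1 else h j t / g t)" for t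
 have "(%t. h j t / g t) analytic_on {0}" for j by (intro analytic_intros h g) (use g in auto)
 then have "(%t. if j = a then 1 else h j t / g t) analytic_on {0}" for j by (cases "j = a") auto
 then have y: "analytic_vec y 0" unfolding analytic_vec_def y_def by simp
 have "NEAR t. \<forall>j. w t $ j = t ^ ?d * h j t" using h(2) by (intro eventually_all_finite) auto
 with g(3) analytic_eventually_nonzero[OF g(1,2)]
 have "NEAR t. y t $ a = 1 \<and> w t = w t $ a *s y t"
 proof eventually_elim
  case (elim t)
  have "w t $ j = w t $ a * y t $ j" for j
  proof (cases "j = a")
   case False
   have "w t $ j = t ^ ?d * h j t" "w t $ a = t ^ ?d * g t" using elim by blast+
   then show ?thesis using False elim(2) by (simp only: y_def vec_lambda_beta if_False) simp
  qed (simp add: y_def)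
  then have "w t = w t $ a *s y t" unfolding vec_eq_iff vector_smult_component by blast
  moreover have "y t $ a = 1" by (simp add: y_def)
  ultimately show ?case by blast
 qed
 then show ?thesis using y wa by blast
qed

lemma analytic_direction_change:
 assumes "analytic_vec y 0" "analytic_vec w 0" "\<not> (NEAR t. w t $ b = 0)"
  "NEAR t. y t $ b = 1 \<and> w t = w t $ b *s y t" "y 0 $ a ~= 0"
 shows "\<exists>z. analytic_vec z 0 \<and> z 0 = inverse (y 0 $ a) *s y 0 \<and> \<not> (NEAR t. w t $ a = 0) \<and>
   (NEAR t. z t $ a = 1 \<and> w t = w t $ a *s z t)"
proof -
 let ?z = "%t. inverse (y t $ a) *s y t"
 have ne: "NEAR t. y t $ a ~= 0"
  by (rule analytic_eventually_nonzero) (use assms in \<open>auto simp: analytic_vec_def\<close>)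
 have "analytic_vec ?z 0" using assms(1,5) unfolding analytic_vec_def by (auto intro!: analytic_intros)
 moreover have "NEAR t. ?z t $ a = 1 \<and> w t = w t $ a *s ?z t"
  using ne assms(4)
 proof eventually_elim
  case (elim t)
  then have e: "w t = w t $ b *s y t" and n: "y t $ a ~= 0" by blast+
  have c: "w t $ j = w t $ b * y t $ j" for j
   using arg_cong[OF e, of "%v. v $ j"] by (simp only: vector_smult_component)
  have "w t $ j = (w t $ a *s ?z t) $ j" for j
   unfolding vector_smult_component by (subst c[of j], subst c[of a]) (simp add: n)
  then have "w t = w t $ a *s ?z t" unfolding vec_eq_iff by blast
  moreover have "?z t $ a = 1" using n by simp
  ultimately show ?case by blast
 qed
 moreover have "\<not> (NEAR t. w t $ a = 0)"
 proof
  assume "NEAR t. w t $ a = 0"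
  with ne assms(4) have "NEAR t. w t $ b = 0"
  proof eventually_elim
   case (elim t)
   then have e: "w t = w t $ b *s y t" and n: "y t $ a ~= 0" "w t $ a = 0" by blast+
   from arg_cong[OF e, of "%v. v $ a"] n show ?case by (simp only: vector_smult_component) simp
  qed
  then show False using assms(3) by blast
 qed
 ultimately show ?thesis by blast
qed

lemma clift_any:
 assumes "analytic_vec \<gamma> 0" "nonconstant_germ \<gamma>"
 shows "\<exists>c \<xi> u. length (c::'n::finite list) = k \<and> clift \<gamma> c \<xi> u"
proof (induction k)
 case 0
 have "clift \<gamma> [] (%t i. if i = 0 then \<gamma> t else 0) (vderiv \<gamma>)" using assms(1) by simp
 then show ?case by blast
next
 case (Suc k)
 then obtain c :: "'n list" and \<xi> w where c: "length c = k" "clift \<gamma> c \<xi> w" by blast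
 have "analytic_vec w 0" using clift_integral[OF c(2)] by blast
 from analytic_direction[OF this clift_nonzero[OF c(2) assms(2)]]
 obtain a y where "analytic_vec y 0" "\<not> (NEAR t. w t $ a = 0)"
   "NEAR t. y t $ a = 1 \<and> w t = w t $ a *s y t" by blast
 note clift_ConsI[OF c(2) this]
 moreover have "length (a # c) = Suc k" using c(1) by simp
 ultimately show ?case by blast
qed

lemma under_prolong_curve:
 assumes "analytic_vec \<gamma> 0" "nonconstant_germ \<gamma>"
 shows "under (prolong_curve \<gamma> (Suc k) 0) = prolong_curve \<gamma> k 0"
proof -
 obtain c \<xi> u where c: "length (c::'a list) = Suc k" "clift \<gamma> c \<xi> u" using clift_any[OF assms] by blast
 obtain a d where d: "c = a # d" "length d = k" using c(1) by (cases c) auto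
 obtain w where w: "clift \<gamma> d (%t. (\<xi> t)(Suc k := 0)) w" using c(2) d by auto
 have "\<xi> 0 \<in> chart_dom (a # d)" using clift_integral[OF c(2)] d eventually_nhds_x_imp_x by blast
 from under_param[OF this] eventually_nhds_x_imp_x[OF clift_prolong[OF c(2)]] d
 have "under (prolong_curve \<gamma> (Suc k) 0) = param k d (\<xi> 0)" by (simp del: prolong_curve.simps)
 also have "\<dots> = prolong_curve \<gamma> k 0" using eventually_nhds_x_imp_x[OF clift_prolong[OF w]] d by simp
 finally show ?thesis .
qed

text \<open>
  The chart can be prescribed, as long as it contains the prolonged point.
\<close>

lemma clift_exists:
 assumes an: "analytic_vec \<gamma> 0" and nc: "nonconstant_germ \<gamma>"
 shows "prolong_curve \<gamma> (length c) 0 = param (length c) c x ==> x \<in> chart_dom c ==>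
  \<exists>\<xi> u. clift \<gamma> c \<xi> u \<and> \<xi> 0 = x"
proof (induction c arbitrary: x)
 case Nil
 have "(%i. if i = 0 then \<gamma> 0 else 0) = x" using Nil by (auto simp: fun_eq_iff)
 moreover have "clift \<gamma> [] (%t i. if i = 0 then \<gamma> t else 0) (vderiv \<gamma>)" using an by simp
 ultimately show ?case
  by (intro exI[of _ "%t i. if i = 0 then \<gamma> t else 0"] exI[of _ "vderiv \<gamma>"] conjI)
next
 case (Cons a c)
 let ?k = "Suc (length c)"
 have x0: "x(?k := 0) \<in> chart_dom c" using Cons.prems by simp
 have "prolong_curve \<gamma> (length c) 0 = param (length c) c (x(?k := 0))"
  using under_prolong_curve[OF an nc, of "length c"] under_param[OF Cons.prems(2)] Cons.prems(1)
  by (simp del: prolong_curve.simps)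
 from Cons.IH[OF this x0] obtain \<xi> w where w: "clift \<gamma> c \<xi> w" "\<xi> 0 = x(?k := 0)" by blast
 have wa: "analytic_vec w 0" using clift_integral[OF w(1)] by blast
 from analytic_direction[OF this clift_nonzero[OF w(1) nc]]
 obtain b y where y: "analytic_vec y 0" "\<not> (NEAR t. w t $ b = 0)"
   "NEAR t. y t $ b = 1 \<and> w t = w t $ b *s y t" by blast
 note l = clift_ConsI[OF w(1) y]
 let ?z = "(\<xi> 0)(?k := y 0)"
 have z: "?z \<in> chart_dom (b # c)" using clift_integral[OF l] eventually_nhds_x_imp_x by blast
 have "param ?k (a # c) x = param ?k (b # c) ?z"
  using eventually_nhds_x_imp_x[OF clift_prolong[OF l]] Cons.prems(1) by (simp del: prolong_curve.simps)
 then have "tline (tvf c x (x ?k)) = tline (tvf c ?z (y 0))"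
  using param_Suc[OF Cons.prems(2)] param_Suc[OF z] by simp
 then have "tline (tvf c (x(?k := 0)) (y 0)) = tline (tvf c (x(?k := 0)) (x ?k))" using w(2) by simp
 moreover have "x ?k $ a = 1" using Cons.prems(2) by simp
 ultimately have ya: "y 0 $ a ~= 0" "x ?k = inverse (y 0 $ a) *s y 0" using tline_tvf_eq[OF x0] by auto
 obtain y' where y': "analytic_vec y' 0" "y' 0 = x ?k" "\<not> (NEAR t. w t $ a = 0)"
   "NEAR t. y' t $ a = 1 \<and> w t = w t $ a *s y' t"
  using analytic_direction_change[OF y(1) wa y(2,3) ya(1)] ya(2) by auto
 have "(\<xi> 0)(?k := y' 0) = x" using w(2) y'(2) by simp
 then show ?case using clift_ConsI[OF w(1) y'(1,3,4)] by blast
qed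

text \<open>
  The description of regular realizations of a point by power series: only the velocity \<open>u\<close> of the lift
  matters, and regularity means that \<open>u 0\<close> avoids the critical coordinate hyperplanes.
\<close>

lemma Germ_chart:
 assumes x: "x \<in> chart_dom c"
 shows "\<gamma> \<in> Germ (length c) (param (length c) c x) \<longleftrightarrow> nonconstant_germ \<gamma> \<and>
  (\<exists>\<xi> u. clift \<gamma> c \<xi> u \<and> \<xi> 0 = x \<and> u 0 ~= 0 \<and> (\<forall>j. critical_index c x j --> u 0 $ (c ! j) ~= 0))"
proof -
 let ?\<Gamma> = "prolong_curve \<gamma> (length c)"
 have reg: "?\<Gamma> 0 = param (length c) c x \<and> (regular_germ (length c) ?\<Gamma> \<longleftrightarrow>
   u 0 ~= 0 \<and> (\<forall>j. critical_index c x j --> u 0 $ (c ! j) ~= 0))"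
  if l: "clift \<gamma> c \<xi> u" "\<xi> 0 = x" for \<xi> u
 proof -
  have ev: "NEAR t. \<xi> t \<in> chart_dom c \<and> ?\<Gamma> t = param (length c) c (\<xi> t)"
   using clift_prolong[OF l(1)] clift_integral[OF l(1)] by (auto elim: eventually_elim2)
  then have r: "represents (param (length c)) c \<xi> ?\<Gamma> 0"
   unfolding represents_iff using clift_integral[OF l(1)] by blast
  have "cderiv \<xi> 0 = chart_frame c (\<xi> 0) (u 0)"
   using clift_integral[OF l(1)] eventually_nhds_x_imp_x by blast
  then have v: "velocity (length c) ?\<Gamma> 0 = tvf c x (u 0)"
   using velocity_tv[OF r] l(2) by (simp add: tvf_def)
  have p: "?\<Gamma> 0 = param (length c) c x" using represents_at[OF r] l(2) by simp
  have "analytic_curve (length c) ?\<Gamma> 0" unfolding analytic_curve_def using r by blast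
  then show ?thesis unfolding regular_germ_def v p using tzero_tvf[OF x] regular_line_chart[OF x] by simp
 qed
 have an: "analytic_germ \<gamma> \<longleftrightarrow> analytic_vec \<gamma> 0" by (simp add: analytic_germ_def analytic_vec_def)
 show ?thesis
 proof
  assume "\<gamma> \<in> Germ (length c) (param (length c) c x)"
  then have g: "analytic_vec \<gamma> 0" "nonconstant_germ \<gamma>" "?\<Gamma> 0 = param (length c) c x" "regular_germ (length c) ?\<Gamma>"
   using an unfolding Germ_def by auto
  from clift_exists[OF g(1-3) x] show "nonconstant_germ \<gamma> \<and>
   (\<exists>\<xi> u. clift \<gamma> c \<xi> u \<and> \<xi> 0 = x \<and> u 0 ~= 0 \<and> (\<forall>j. critical_index c x j --> u 0 $ (c ! j) ~= 0))"
   using reg g by blast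
 next
  assume "nonconstant_germ \<gamma> \<and>
   (\<exists>\<xi> u. clift \<gamma> c \<xi> u \<and> \<xi> 0 = x \<and> u 0 ~= 0 \<and> (\<forall>j. critical_index c x j --> u 0 $ (c ! j) ~= 0))"
  then show "\<gamma> \<in> Germ (length c) (param (length c) c x)"
   unfolding Germ_def mem_Collect_eq using an reg clift_germ by blast
 qed
qed

section \<open>Reparametrizations and diffeomorphisms\<close>

context
 fixes h :: "complex => complex"
 assumes h: "h analytic_on {0}" "h 0 = 0" "deriv h 0 ~= 0"
begin

lemma reparam_nhds: "filterlim h (nhds 0) (nhds 0)"
 using analytic_at_imp_isCont[OF h(1)] tendsto_at_iff_tendsto_nhds[of h 0] h(2) by (simp add: isCont_def)

lemma reparam_at: "filterlim h (at 0) (at 0)"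
proof -
 have "\<not> (NEAR t. h t = 0)"
 proof
  assume "NEAR t. h t = 0"
  then have "deriv h 0 = deriv (%t. 0) 0" by (rule deriv_cong_ev) simp
  then show False using h(3) by simp
 qed
 then have "\<forall>\<^sub>F t in at 0. h t ~= 0" by (rule not_eventually_zero[OF h(1)])
 moreover have "(h \<longlongrightarrow> 0) (at 0)"
  using reparam_nhds by (rule filterlim_mono) (auto simp: at_within_def)
 ultimately show ?thesis by (simp add: filterlim_at)
qed

lemma reparam_eventually: "NEAR t. P t ==> NEAR t. P (h t)"
 using reparam_nhds by (rule eventually_compose_filterlim[rotated])

lemma reparam_analytic: "f analytic_on {0} ==> (%t. f (h t)) analytic_on {0}"
 using analytic_on_compose_gen[OF h(1), of f "{0}"] h(2) by (simp add: o_def)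

lemma reparam_analytic_vec: "analytic_vec f 0 ==> analytic_vec (%t. f (h t)) 0"
 unfolding analytic_vec_def using reparam_analytic[of "%t. f t $ j" for j] by blast

lemma reparam_vderiv:
 assumes "analytic_vec f 0"
 shows "NEAR t. vderiv (%t. f (h t)) t = deriv h t *s vderiv f (h t)"
 using reparam_eventually[OF eventually_analytic_vec[OF assms]] eventually_analytic_on[OF h(1)]
proof eventually_elim
 case (elim t)
 have "deriv (%t. f (h t) $ j) t = deriv (%t. f t $ j) (h t) * deriv h t" for j
 proof -
  have "(%t. f t $ j) field_differentiable at (h t)" "h field_differentiable at t"
   using elim by (auto simp: analytic_vec_def intro: analytic_on_imp_differentiable_at)
  from deriv_chain[OF this(2,1)] show ?thesis by (simp add: o_def)
 qed
 then show ?case by (simp add: vderiv_def vec_eq_iff mult.commute)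
qed

lemma clift_reparam:
 "clift \<gamma> c \<xi> u ==> clift (%t. \<gamma> (h t)) c (%t. \<xi> (h t)) (%t. deriv h t *s u (h t))"
proof (induction c arbitrary: \<xi> u)
 case Nil
 then have an: "analytic_vec \<gamma> 0"
  and ev: "NEAR t. \<xi> t = (%i. if i = 0 then \<gamma> t else 0) \<and> u t = vderiv \<gamma> t" by auto
 have "NEAR t. \<xi> (h t) = (%i. if i = 0 then \<gamma> (h t) else 0) \<and>
   deriv h t *s u (h t) = vderiv (%t. \<gamma> (h t)) t"
  using reparam_eventually[OF ev] reparam_vderiv[OF an] by eventually_elim simp
 then show ?case using reparam_analytic_vec[OF an] by simp
next
 case (Cons a c)
 let ?k = "Suc (length c)"
 obtain w where w: "clift \<gamma> c (%t. (\<xi> t)(?k := 0)) w" "analytic_vec (%t. \<xi> t ?k) 0"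
  "\<not> (NEAR t. w t $ a = 0)"
  "NEAR t. \<xi> t ?k $ a = 1 \<and> w t = w t $ a *s \<xi> t ?k \<and>
    u t = (\<chi> j. if j = a then w t $ a else vderiv (%s. \<xi> s ?k) t $ j)"
  using Cons.prems by auto
 let ?w = "%t. deriv h t *s w (h t)"
 have 1: "clift (%t. \<gamma> (h t)) c (%t. (\<xi> (h t))(?k := 0)) ?w" using Cons.IH[OF w(1)] .
 have wa: "(%t. w t $ a) analytic_on {0}" using clift_integral[OF w(1)] by (auto simp: analytic_vec_def)
 have 3: "\<not> (NEAR t. ?w t $ a = 0)"
 proof
  assume "NEAR t. ?w t $ a = 0"
  then have "\<forall>\<^sub>F t in at 0. ?w t $ a = 0" by (simp add: eventually_nhds_conv_at)
  moreover have "\<forall>\<^sub>F t in at 0. w (h t) $ a ~= 0"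
   by (rule eventually_compose_filterlim[OF not_eventually_zero[OF wa w(3)] reparam_at])
  moreover have "\<forall>\<^sub>F t in at 0. deriv h t ~= 0"
   using analytic_eventually_nonzero[OF analytic_deriv[OF h(1)] h(3)] by (simp add: eventually_nhds_conv_at)
  ultimately have "\<forall>\<^sub>F t in at (0::complex). False" by eventually_elim simp
  then show False by simp
 qed
 have "NEAR t. \<xi> (h t) ?k $ a = 1 \<and> ?w t = ?w t $ a *s \<xi> (h t) ?k \<and>
   deriv h t *s u (h t) = (\<chi> j. if j = a then ?w t $ a else vderiv (%s. \<xi> (h s) ?k) t $ j)"
  using reparam_eventually[OF w(4)] reparam_vderiv[OF w(2)]
 proof eventually_elim
  case (elim t)
  then have e: "\<xi> (h t) ?k $ a = 1" "w (h t) = w (h t) $ a *s \<xi> (h t) ?k"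
   "u (h t) = (\<chi> j. if j = a then w (h t) $ a else vderiv (%s. \<xi> s ?k) (h t) $ j)" by blast+
  have "?w t = deriv h t *s (w (h t) $ a *s \<xi> (h t) ?k)" by (rule arg_cong[OF e(2)])
  also have "\<dots> = ?w t $ a *s \<xi> (h t) ?k" by (simp only: vector_smult_assoc vector_smult_component)
  finally have "?w t = ?w t $ a *s \<xi> (h t) ?k" .
  moreover have "deriv h t *s u (h t) = (\<chi> j. if j = a then ?w t $ a else vderiv (%s. \<xi> (h s) ?k) t $ j)"
   unfolding e(3) elim(2) by (simp add: vec_eq_iff)
  ultimately show ?case using e(1) by blast
 qed
 then show ?case using 1 3 reparam_analytic_vec[OF w(2)] by auto
qed

end

lemma prolong_reparam:
 assumes "h analytic_on {0}" "h 0 = 0" "deriv h 0 ~= 0" "analytic_vec \<gamma> 0" "nonconstant_germ \<gamma>"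
 shows "prolong_curve (%t. \<gamma> (h t)) k 0 = prolong_curve \<gamma> k 0"
proof -
 obtain c \<xi> u where c: "length (c::'a list) = k" "clift \<gamma> c \<xi> u" using clift_any[OF assms(4,5)] by blast
 have "prolong_curve (%t. \<gamma> (h t)) k 0 = param k c (\<xi> (h 0))"
  using eventually_nhds_x_imp_x[OF clift_prolong[OF clift_reparam[OF assms(1-3) c(2)]]] c(1) by simp
 also have "\<dots> = prolong_curve \<gamma> k 0"
  using eventually_nhds_x_imp_x[OF clift_prolong[OF c(2)]] c(1) assms(2) by simp
 finally show ?thesis .
qed

lemma trm_integral:
 assumes l: "clift \<gamma> c \<xi> u" and cd: "length c = length d" and ok: "trok \<phi> c d (\<xi> 0)"
 shows "analytic_coords (%t. trm \<phi> c d (\<xi> t)) 0"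
  "NEAR t. trok \<phi> c d (\<xi> t) \<and> trm \<phi> c d (\<xi> t) \<in> chart_dom d \<and> \<xi> t \<in> chart_dom c \<and>
    cderiv (%t. trm \<phi> c d (\<xi> t)) t = chart_frame d (trm \<phi> c d (\<xi> t)) (trG \<phi> c d (\<xi> t) (u t))"
proof -
 have int: "analytic_coords \<xi> 0" "NEAR t. \<xi> t \<in> chart_dom c \<and> cderiv \<xi> t = chart_frame c (\<xi> t) (u t) \<and> \<xi> t 0 = \<gamma> t"
  using clift_integral[OF l] by blast+
 note cu = trm_curve[OF int(1) ok cd]
 show "analytic_coords (%t. trm \<phi> c d (\<xi> t)) 0" by (rule cu(1))
 have dom: "NEAR t. \<xi> t \<in> chart_dom c" using int(2) by eventually_elim blast
 from cu(3) int(2) eventually_analytic_coords[OF int(1) dom]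
 show "NEAR t. trok \<phi> c d (\<xi> t) \<and> trm \<phi> c d (\<xi> t) \<in> chart_dom d \<and> \<xi> t \<in> chart_dom c \<and>
    cderiv (%t. trm \<phi> c d (\<xi> t)) t = chart_frame d (trm \<phi> c d (\<xi> t)) (trG \<phi> c d (\<xi> t) (u t))"
 proof eventually_elim
  case (elim t)
  have x: "\<xi> t \<in> chart_dom c" using elim by blast
  have "cderiv (%t. trm \<phi> c d (\<xi> t)) t = trd \<phi> c d (\<xi> t) (cderiv \<xi> t)" by (rule trm_curve(2)[OF elim(3,1) cd])
  also have "cderiv \<xi> t = chart_frame c (\<xi> t) (u t)" using elim(2) by blast
  also have "trd \<phi> c d (\<xi> t) \<dots> = chart_frame d (trm \<phi> c d (\<xi> t)) (trG \<phi> c d (\<xi> t) (u t))"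
   by (rule trd_frame[OF cd x elim(1)])
  finally show ?case using elim(1) x trm_dom[OF cd x elim(1)] by blast
 qed
qed

lemma clift_map:
 "length c = length d ==> clift \<gamma> c \<xi> u ==> trok \<phi> c d (\<xi> 0) ==>
  clift (%t. \<phi> (\<gamma> t)) d (%t. trm \<phi> c d (\<xi> t)) (%t. trG \<phi> c d (\<xi> t) (u t))"
proof (induction c d arbitrary: \<xi> u rule: list_induct2)
 case Nil
 let ?\<zeta> = "%t. trm \<phi> [] [] (\<xi> t)"
 note I = trm_integral[OF Nil(1) refl Nil(2)]
 have "NEAR t. \<xi> t = (%i. if i = 0 then \<gamma> t else 0) \<and> u t = vderiv \<gamma> t" using Nil(1) by simp
 then have z: "NEAR t. ?\<zeta> t = (%i. if i = 0 then \<phi> (\<gamma> t) else 0)"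
 proof eventually_elim
  case (elim t)
  then have "\<xi> t 0 = \<gamma> t" by simp
  then have "\<phi> (\<xi> t 0) $ i = \<phi> (\<gamma> t) $ i" for i by simp
  then show ?case by (simp add: trm_def fun_eq_iff vec_eq_iff)
 qed
 then have z0: "NEAR t. ?\<zeta> t 0 = \<phi> (\<gamma> t)" by eventually_elim simp
 have "analytic_vec (%t. ?\<zeta> t 0) 0" using I(1) by (simp add: analytic_coords_def analytic_vec_def)
 then have an: "analytic_vec (%t. \<phi> (\<gamma> t)) 0" using analytic_vec_cong[OF z0] by simp
 from I(2) z eventually_nhds_nhds[OF z0]
 have "NEAR t. ?\<zeta> t = (%i. if i = 0 then \<phi> (\<gamma> t) else 0) \<and>
   trG \<phi> [] [] (\<xi> t) (u t) = vderiv (%t. \<phi> (\<gamma> t)) t"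
 proof eventually_elim
  case (elim t)
  have "vderiv (%t. \<phi> (\<gamma> t)) t = cderiv ?\<zeta> t 0"
   using vderiv_cong[OF elim(3)] by (simp add: vderiv_def cderiv_def)
  also have "\<dots> = trG \<phi> [] [] (\<xi> t) (u t)" using elim(1) by simp
  finally show ?case using elim(2) by simp
 qed
 then show ?case using an by simp
next
 case (Cons a c b d)
 let ?k = "Suc (length c)" and ?\<zeta> = "%t. trm \<phi> (a # c) (b # d) (\<xi> t)"
 have kd: "Suc (length d) = ?k" using Cons.hyps(1) by simp
 have l: "length (a # c) = length (b # d)" using Cons.hyps(1) by simp
 obtain w where w: "clift \<gamma> c (%t. (\<xi> t)(?k := 0)) w" "analytic_vec (%t. \<xi> t ?k) 0"
  "\<not> (NEAR t. w t $ a = 0)"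
  "NEAR t. \<xi> t ?k $ a = 1 \<and> w t = w t $ a *s \<xi> t ?k \<and>
    u t = (\<chi> j. if j = a then w t $ a else vderiv (%s. \<xi> s ?k) t $ j)"
  using Cons.prems(1) by auto
 have ok: "trok \<phi> c d ((\<xi> 0)(?k := 0))" using Cons.prems(2) trok_Cons[OF Cons.hyps(1)] Cons.hyps(1) by simp
 note I = trm_integral[OF Cons.prems(1) l Cons.prems(2)]
 note I0 = trm_integral[OF w(1) Cons.hyps(1) ok]
 let ?w = "%t. trG \<phi> c d (\<xi> t) (w t)"
 have up: "trm \<phi> c d ((\<xi> t)(?k := 0)) = (?\<zeta> t)(?k := 0)" "trG \<phi> c d ((\<xi> t)(?k := 0)) = trG \<phi> c d (\<xi> t)" for t
  using trm_Cons_trunc[OF Cons.hyps(1), of \<phi> a b "\<xi> t"] Cons.hyps(1) by auto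
 have 1: "clift (%t. \<phi> (\<gamma> t)) d (%t. (?\<zeta> t)(?k := 0)) ?w"
  using Cons.IH[OF w(1) ok] unfolding up .
 have 2: "analytic_vec (%t. ?\<zeta> t ?k) 0" using I(1) by (simp add: analytic_coords_def analytic_vec_def)
 have key: "NEAR t. ?\<zeta> t ?k $ b = 1 \<and> ?w t = ?w t $ b *s ?\<zeta> t ?k \<and>
   trG \<phi> (a # c) (b # d) (\<xi> t) (u t) = (\<chi> j. if j = b then ?w t $ b else vderiv (%s. ?\<zeta> s ?k) t $ j)"
  using I(2) I0(2)
 proof eventually_elim
  case (elim t)
  let ?g = "trG \<phi> (a # c) (b # d) (\<xi> t) (u t)"
  have cd: "cderiv ?\<zeta> t = chart_frame (b # d) (?\<zeta> t) ?g" using elim(1) by blast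
  have dom: "(?\<zeta> t)(?k := 0) \<in> chart_dom d" "?\<zeta> t ?k $ b = 1" using elim(1) kd by auto
  have "chart_frame d ((?\<zeta> t)(?k := 0)) (?w t) = cderiv (%t. (?\<zeta> t)(?k := 0)) t"
   using elim(2) unfolding up by simp
  also have "\<dots> = (cderiv ?\<zeta> t)(?k := 0)" by (auto simp: cderiv_def fun_eq_iff vec_eq_iff)
  also have "\<dots> = chart_frame d (?\<zeta> t) (?g $ b *s ?\<zeta> t ?k)"
   unfolding cd using chart_frame_trunc[of b d "?\<zeta> t" ?g] kd by simp
  also have "\<dots> = chart_frame d ((?\<zeta> t)(?k := 0)) (?g $ b *s ?\<zeta> t ?k)" using kd by simp
  finally have e: "?w t = ?g $ b *s ?\<zeta> t ?k" using chart_frame_inj[OF dom(1)] by blast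
  then have wb: "?w t $ b = ?g $ b" using dom(2) by simp
  have "vderiv (%s. ?\<zeta> s ?k) t = cderiv ?\<zeta> t ?k" by (simp add: vderiv_def cderiv_def)
  also have "\<dots> = (\<chi> j. if j = b then 0 else ?g $ j)" unfolding cd using kd by simp
  finally have "?g = (\<chi> j. if j = b then ?w t $ b else vderiv (%s. ?\<zeta> s ?k) t $ j)"
   using wb by (simp add: vec_eq_iff)
  then show ?case using e wb dom(2) by metis
 qed
 have 3: "\<not> (NEAR t. ?w t $ b = 0)"
 proof
  assume "NEAR t. ?w t $ b = 0"
  with w(4) I(2) have "NEAR t. w t $ a = 0"
  proof eventually_elim
   case (elim t)
   have "w t = w t $ a *s \<xi> t ?k" using elim(1) by blast
   then have "?w t = w t $ a *s trG \<phi> c d (\<xi> t) (\<xi> t ?k)" using trG_linear(2) by metis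
   then have "w t $ a * trG \<phi> c d (\<xi> t) (\<xi> t ?k) $ b = 0" using elim(3) by simp
   moreover have "trG \<phi> c d (\<xi> t) (\<xi> t ?k) $ b ~= 0" using elim(2) trok_Cons[OF Cons.hyps(1)] by blast
   ultimately show ?case by simp
  qed
  then show False using w(3) by blast
 qed
 show ?case unfolding clift.simps kd using 1 2 3 key by blast
qed

text \<open>
  Lines are mapped by mapping the velocities of curves; in charts this is the transition map, by the
  chain rule.
\<close>

lemma prolong_map_chart:
 "length c = length d ==> x \<in> chart_dom c ==> trok \<phi> c d x ==>
  prolong_map \<phi> (length c) (param (length c) c x) = param (length c) d (trm \<phi> c d x)"
proof (induction c d arbitrary: x rule: list_induct2)
 case Nil
 then show ?case by (simp add: trm_def vec_eq_iff)
next
 case (Cons a c b d)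
 let ?k = "Suc (length c)" and ?x = "x(Suc (length c) := 0)" and ?y = "x (Suc (length c))"
 let ?w = "trG \<phi> c d x ?y"
 have l: "length (a # c) = length (b # d)" using Cons.hyps by simp
 have ok: "trok \<phi> c d ?x" "?w $ b ~= 0" using Cons.prems(2) trok_Cons[OF Cons.hyps(1)] Cons.hyps(1) by auto
 have x0: "?x \<in> chart_dom c" using Cons.prems(1) by simp
 let ?p = "param (length c) c ?x" and ?z = "trm \<phi> c d ?x"
 have z: "?z \<in> chart_dom d" by (rule trm_dom[OF Cons.hyps(1) x0 ok(1)])
 have G: "trG \<phi> c d ?x = trG \<phi> c d x" using Cons.hyps(1) by auto
 have vel: "velocity (length c) (%t. prolong_map \<phi> (length c) (\<Gamma> t)) 0 = tvf d ?z (s *s ?w)"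
  if r: "represents (param (length c)) c \<xi> \<Gamma> 0" and \<xi>: "\<xi> 0 = ?x" "cderiv \<xi> 0 = chart_frame c ?x (s *s ?y)" for \<Gamma> \<xi> s
 proof -
  have an: "analytic_coords \<xi> 0" and ev: "NEAR t. \<xi> t \<in> chart_dom c \<and> \<Gamma> t = param (length c) c (\<xi> t)"
   using r by (auto simp: represents_iff)
  have ok': "trok \<phi> c d (\<xi> 0)" using ok(1) \<xi>(1) by simp
  note cu = trm_curve[OF an ok' Cons.hyps(1)]
  from cu(3) ev have "NEAR t. trm \<phi> c d (\<xi> t) \<in> chart_dom d \<and>
    prolong_map \<phi> (length c) (\<Gamma> t) = param (length d) d (trm \<phi> c d (\<xi> t))"
  proof eventually_elim
   case (elim t)
   then have "prolong_map \<phi> (length c) (\<Gamma> t) = param (length c) d (trm \<phi> c d (\<xi> t))"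
    using Cons.IH[of "\<xi> t"] by simp
   then show ?case using elim trm_dom[OF Cons.hyps(1), of "\<xi> t" \<phi>] Cons.hyps(1) by simp
  qed
  then have "represents (param (length d)) d (%t. trm \<phi> c d (\<xi> t)) (%t. prolong_map \<phi> (length c) (\<Gamma> t)) 0"
   unfolding represents_iff using cu(1) by blast
  from velocity_tv[OF this] have "velocity (length d) (%t. prolong_map \<phi> (length c) (\<Gamma> t)) 0 =
    tv d ?z (trd \<phi> c d ?x (chart_frame c ?x (s *s ?y)))" unfolding cu(2) \<xi> .
  also have "\<dots> = tvf d ?z (trG \<phi> c d ?x (s *s ?y))"
   unfolding trd_frame[OF Cons.hyps(1) x0 ok(1)] tvf_def ..
  also have "\<dots> = tvf d ?z (s *s ?w)" unfolding trG_linear G ..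
  finally show ?thesis using Cons.hyps(1) by simp
 qed
 have dir: "dir (param ?k (a # c) x) = range (%s. tvf c ?x (s *s ?y))"
  unfolding param_Suc[OF Cons.prems(1)] point.sel tline_tvf by simp
 have und: "under (param ?k (a # c) x) = ?p" using under_param[OF Cons.prems(1)] by simp
 have "{velocity (length c) (%t. prolong_map \<phi> (length c) (\<Gamma> t)) 0 | \<Gamma>.
   analytic_curve (length c) \<Gamma> 0 \<and> \<Gamma> 0 = ?p \<and> velocity (length c) \<Gamma> 0 \<in> dir (param ?k (a # c) x)} =
   range (%s. tvf d ?z (s *s ?w))" (is "?L = ?R")
 proof (intro equalityI subsetI)
  fix \<tau> assume "\<tau> \<in> ?L"
  then obtain \<Gamma> where \<Gamma>: "\<tau> = velocity (length c) (%t. prolong_map \<phi> (length c) (\<Gamma> t)) 0"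
   "analytic_curve (length c) \<Gamma> 0" "\<Gamma> 0 = ?p" "velocity (length c) \<Gamma> 0 \<in> dir (param ?k (a # c) x)" by blast
  obtain \<xi> where r: "represents (param (length c)) c \<xi> \<Gamma> 0" "\<xi> 0 = ?x" using rechart[OF \<Gamma>(2,3) x0] by blast
  obtain s where s: "velocity (length c) \<Gamma> 0 = tvf c ?x (s *s ?y)" using \<Gamma>(4) dir by blast
  have "NEAR t. \<xi> t \<in> chart_dom c" using r(1) unfolding represents_iff by (auto elim: eventually_mono)
  then have tan: "cderiv \<xi> 0 \<in> chart_tan c" by (rule cderiv_tan)
  have "tv c ?x (cderiv \<xi> 0) = tv c ?x (chart_frame c ?x (s *s ?y))"
   using velocity_tv[OF r(1)] r(2) s unfolding tvf_def by simp
  then have "cderiv \<xi> 0 = chart_frame c ?x (s *s ?y)" using tv_inj[OF x0 tan chart_frame_tan] by blast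
  from vel[OF r this] show "\<tau> \<in> ?R" using \<Gamma>(1) by blast
 next
  fix \<tau> assume "\<tau> \<in> ?R"
  then obtain s where s: "\<tau> = tvf d ?z (s *s ?w)" by blast
  let ?v = "chart_frame c ?x (s *s ?y)"
  let ?\<xi> = "%t i. ?x i + t *s ?v i"
  let ?\<Gamma> = "%t. param (length c) c (?\<xi> t)"
  have r: "represents (param (length c)) c ?\<xi> ?\<Gamma> 0"
   unfolding represents_iff using analytic_line chart_line[OF x0 chart_frame_tan] by simp
  have 0: "?\<xi> 0 = ?x" by (simp add: fun_eq_iff del: fun_upd_apply)
  have v: "velocity (length c) ?\<Gamma> 0 = tvf c ?x (s *s ?y)"
   using velocity_tv[OF r] unfolding cderiv_line 0 tvf_def .
  show "\<tau> \<in> ?L" unfolding dir mem_Collect_eq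
  proof (intro exI[of _ ?\<Gamma>] conjI)
   show "analytic_curve (length c) ?\<Gamma> 0" unfolding analytic_curve_def using r by blast
   show "?\<Gamma> 0 = ?p" unfolding 0 ..
   show "\<tau> = velocity (length c) (%t. prolong_map \<phi> (length c) (?\<Gamma> t)) 0"
    using vel[OF r 0 cderiv_line] s by simp
   show "velocity (length c) ?\<Gamma> 0 \<in> range (%s. tvf c ?x (s *s ?y))" unfolding v by blast
  qed
 qed
 also have "?R = tline (tvf d ?z ?w)" by (simp add: tline_tvf)
 finally have "prolong_map \<phi> ?k (param ?k (a # c) x) = Prol (prolong_map \<phi> (length c) ?p) (tline (tvf d ?z ?w))"
  by (simp add: und)
 also have "prolong_map \<phi> (length c) ?p = param (length d) d ?z" using Cons.IH[OF x0 ok(1)] unfolding Cons.hyps(1) .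
 also have "Prol (param (length d) d ?z) (tline (tvf d ?z ?w)) = param (Suc (length d)) (b # d) (trm \<phi> (a # c) (b # d) x)"
 proof -
  have zz: "?z = trm \<phi> c d x" using Cons.hyps(1) by simp
  let ?y' = "inverse (?w $ b) *s ?w"
  have dom: "trm \<phi> (a # c) (b # d) x \<in> chart_dom (b # d)" by (rule trm_dom[OF l Cons.prems])
  have e: "trm \<phi> (a # c) (b # d) x = ?z(Suc (length d) := ?y')" using trm_Cons[OF Cons.hyps(1)] zz Cons.hyps(1) by simp
  have "?y' $ b = 1" using ok(2) by simp
  then have "tline (tvf d ?z ?w) = tline (tvf d ?z ?y')" using tline_tvf_eq[OF z, of ?y' b ?w] ok(2) by blast
  then show ?thesis using param_Suc[OF dom] unfolding e by simp
 qed
 finally show ?case using Cons.hyps(1) by simp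
qed

lemma prolong_map_curve:
 assumes "analytic_vec \<gamma> 0" "nonconstant_germ \<gamma>" "diffeo_at \<phi> (\<gamma> 0)"
 shows "prolong_map \<phi> k (prolong_curve \<gamma> k 0) = prolong_curve (%t. \<phi> (\<gamma> t)) k 0"
proof -
 obtain c \<xi> u where c: "length (c::'a list) = k" "clift \<gamma> c \<xi> u" using clift_any[OF assms(1,2)] by blast
 have x: "\<xi> 0 \<in> chart_dom c" "\<xi> 0 0 = \<gamma> 0" using clift_integral[OF c(2)] eventually_nhds_x_imp_x by blast+
 obtain d where d: "length d = length c" "trok \<phi> c d (\<xi> 0)" using trok_exists[OF x(1)] assms(3) x(2) by auto
 have "prolong_curve \<gamma> k 0 = param k c (\<xi> 0)"
  using eventually_nhds_x_imp_x[OF clift_prolong[OF c(2)]] c(1) by simp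
 moreover have "prolong_curve (%t. \<phi> (\<gamma> t)) k 0 = param k d (trm \<phi> c d (\<xi> 0))"
  using eventually_nhds_x_imp_x[OF clift_prolong[OF clift_map[OF _ c(2) d(2)]]] c(1) d(1) by simp
 moreover have "prolong_map \<phi> k (param k c (\<xi> 0)) = param k d (trm \<phi> c d (\<xi> 0))"
  using prolong_map_chart[OF _ x(1) d(2)] c(1) d(1) by simp
 ultimately show ?thesis by simp
qed

lemma holomorphic_map_component:
 assumes "holomorphic_map U \<phi>" "z \<in> U"
 shows "cdiff (%z. \<phi> z $ j) z" and "\<exists>A. (\<phi> has_derivative A) (at z) \<and> (\<forall>v j. A v $ j = fd (%z. \<phi> z $ j) z v)"
proof -
 obtain A where A: "(\<phi> has_derivative A) (at z)" "\<forall>s v. A (s *s v) = s *s A v"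
  using assms unfolding holomorphic_map_def by blast
 have D: "((%z. \<phi> z $ j) has_derivative (%v. A v $ j)) (at z)" for j
  by (rule bounded_linear.has_derivative[OF bounded_linear_vec_nth A(1)])
 then show "cdiff (%z. \<phi> z $ j) z" unfolding cdiff_def
  by (intro exI[of _ "%v. A v $ j"]) (simp add: A(2))
 show "\<exists>A. (\<phi> has_derivative A) (at z) \<and> (\<forall>v j. A v $ j = fd (%z. \<phi> z $ j) z v)"
  using A(1) fd_eqI[OF D] by auto
qed

lemma local_diffeo_diffeo_at:
 assumes "local_diffeo U \<phi>" "z \<in> U"
 shows "diffeo_at \<phi> z"
proof -
 have U: "open U" "holomorphic_map U \<phi>" using assms by (auto simp: local_diffeo_def)
 obtain \<psi> where \<psi>: "holomorphic_map (\<phi> ` U) \<psi>" "\<forall>z\<in>U. \<psi> (\<phi> z) = z" using assms by (auto simp: local_diffeo_def)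
 have "hol_near (%z. \<phi> z $ j) z" for j
  unfolding hol_near_def eventually_nhds using U assms(2) holomorphic_map_component(1)[OF U(2)] by blast
 moreover have "v = 0" if v: "\<forall>j. fd (%z. \<phi> z $ j) z v = 0" for v
 proof -
  obtain A where A: "(\<phi> has_derivative A) (at z)" "\<forall>v j. A v $ j = fd (%z. \<phi> z $ j) z v"
   using holomorphic_map_component(2)[OF U(2) assms(2)] by blast
  obtain B where B: "(\<psi> has_derivative B) (at (\<phi> z))" using \<psi>(1) assms(2) unfolding holomorphic_map_def by blast
  have "((%z. \<psi> (\<phi> z)) has_derivative (%v. B (A v))) (at z)"
   by (rule has_derivative_compose[OF A(1) B])
  moreover have "((%z. \<psi> (\<phi> z)) has_derivative (%v. v)) (at z)"
   by (rule has_derivative_transform_within_open[OF has_derivative_ident U(1) assms(2)]) (use \<psi>(2) in auto)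
  ultimately have "(%v. B (A v)) = (%v. v)" by (rule has_derivative_unique)
  then have "B (A v) = v" by meson
  moreover have "A v = 0" using A(2) v by (simp add: vec_eq_iff)
  moreover have "B 0 = 0" using has_derivative_linear[OF B] linear_0 by blast
  ultimately show ?thesis by simp
 qed
 ultimately show ?thesis unfolding diffeo_at_def by blast
qed

lemma local_diffeo_inverse:
 assumes "local_diffeo U \<phi>"
 obtains \<psi> where "local_diffeo (\<phi> ` U) \<psi>" "!!z. z \<in> U ==> \<psi> (\<phi> z) = z"
proof -
 obtain \<psi> where \<psi>: "holomorphic_map (\<phi> ` U) \<psi>" "\<forall>z\<in>U. \<psi> (\<phi> z) = z" using assms by (auto simp: local_diffeo_def)
 have im: "\<psi> ` \<phi> ` U = U" using \<psi>(2) by force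
 have "local_diffeo (\<phi> ` U) \<psi>"
  unfolding local_diffeo_def im
 proof (intro conjI exI[of _ \<phi>] ballI)
  show "\<phi> (\<psi> y) = y" if "y \<in> \<phi> ` U" for y using that \<psi>(2) by force
 qed (use assms \<psi>(1) in \<open>simp_all add: local_diffeo_def\<close>)
 then show ?thesis using that \<psi>(2) by blast
qed

lemma diffeo_analytic_vec:
 "diffeo_at \<phi> (\<gamma> 0) ==> analytic_vec \<gamma> 0 ==> analytic_vec (%t. \<phi> (\<gamma> t)) 0"
 unfolding analytic_vec_def[of "%t. \<phi> (\<gamma> t)"] diffeo_at_def using hol_curve(1) by blast

text \<open>
  Along a curve that starts with order \<open>d\<close> the second order Taylor remainder has order \<open>2 * d\<close>. This
  is what makes orders below \<open>2 * d\<close> invariant under diffeomorphisms.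
\<close>

lemma hol_near_taylor_curve:
 assumes h: "hol_near h (\<gamma> 0)" and an: "analytic_vec (\<gamma> :: complex => complex^'n::finite) 0"
  and ord: "!!j. \<forall>i<d. fps_nth (E (%t. \<gamma> t $ j - \<gamma> 0 $ j)) i = 0"
 shows "\<exists>C. NEAR t. norm (h (\<gamma> t) - h (\<gamma> 0) - fd h (\<gamma> 0) (\<gamma> t - \<gamma> 0)) \<le> C * norm t ^ (2 * d)"
proof -
 obtain \<rho> M where \<rho>: "\<rho> > 0" "!!y. norm (y - \<gamma> 0) < \<rho> ==> cdiff h y" "!!y. norm (y - \<gamma> 0) < \<rho> ==> norm (h y) \<le> M"
  using hol_near_bounded[OF h] by blast
 have "\<exists>g. g analytic_on {0} \<and> (NEAR t. \<gamma> t $ j - \<gamma> 0 $ j = t ^ d * g t)" for j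
 proof -
  have "(%t. \<gamma> t $ j - \<gamma> 0 $ j) analytic_on {0}" by (intro analytic_intros analytic_vecD an)
  from E_factor[OF this ord] show ?thesis by blast
 qed
 then have "\<exists>g. \<forall>j. g j analytic_on {0} \<and> (NEAR t. \<gamma> t $ j - \<gamma> 0 $ j = t ^ d * g j t)"
  by (intro choice allI)
 then obtain g where g: "!!j. g j analytic_on {0}" "!!j. NEAR t. \<gamma> t $ j - \<gamma> 0 $ j = t ^ d * g j t" by blast
 define G :: "complex => complex^'n" where "G t = (\<chi> j. g j t)" for t
 have Gan: "analytic_vec G 0" using g(1) by (simp add: G_def analytic_vec_def)
 have "NEAR t. \<forall>j. \<gamma> t $ j - \<gamma> 0 $ j = t ^ d * g j t" using g(2) by (intro eventually_all_finite) auto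
 then have e1: "NEAR t. \<gamma> t - \<gamma> 0 = t ^ d *s G t" by eventually_elim (simp add: G_def vec_eq_iff)
 have "((%t. norm (G t)) \<longlongrightarrow> norm (G 0)) (nhds 0)" by (intro tendsto_norm analytic_vec_tendsto[OF Gan])
 then have e2: "NEAR t. norm (G t) < norm (G 0) + 1" by (rule order_tendstoD) simp
 have "((%t. norm (\<gamma> t - \<gamma> 0)) \<longlongrightarrow> norm (\<gamma> 0 - \<gamma> 0)) (nhds 0)"
  by (intro tendsto_intros analytic_vec_tendsto[OF an])
 then have e3: "NEAR t. norm (\<gamma> t - \<gamma> 0) < \<rho> / 4" by (rule order_tendstoD) (use \<rho>(1) in simp)
 have M0: "0 \<le> 32 * M / \<rho>\<^sup>2" using order_trans[OF norm_ge_zero \<rho>(3)[of "\<gamma> 0"]] \<rho>(1) by simp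
 show ?thesis
 proof (intro exI)
  show "NEAR t. norm (h (\<gamma> t) - h (\<gamma> 0) - fd h (\<gamma> 0) (\<gamma> t - \<gamma> 0))
    \<le> (32 * M / \<rho>\<^sup>2 * (norm (G 0) + 1)\<^sup>2) * norm t ^ (2 * d)"
   using e1 e2 e3
  proof eventually_elim
   case (elim t)
   have "norm (h (\<gamma> 0 + (\<gamma> t - \<gamma> 0)) - h (\<gamma> 0) - fd h (\<gamma> 0) (\<gamma> t - \<gamma> 0)) \<le> 32 * M / \<rho>\<^sup>2 * (norm (\<gamma> t - \<gamma> 0))\<^sup>2"
    by (rule taylor2_bound[OF \<rho>(1)]) (use \<rho> elim in auto)
   also have "norm (\<gamma> t - \<gamma> 0) = norm t ^ d * norm (G t)" by (simp add: elim(1) norm_smult_vec norm_power)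
   also have "32 * M / \<rho>\<^sup>2 * (norm t ^ d * norm (G t))\<^sup>2 \<le> 32 * M / \<rho>\<^sup>2 * (norm t ^ d * (norm (G 0) + 1))\<^sup>2"
    by (intro mult_left_mono power_mono M0) (use elim in auto)
   also have "\<dots> = (32 * M / \<rho>\<^sup>2 * (norm (G 0) + 1)\<^sup>2) * norm t ^ (2 * d)"
    by (simp add: power_mult_distrib power_mult[symmetric] mult.commute)
   finally show ?case by simp
  qed
 qed
qed

lemma E_order_bound:
 assumes f: "f analytic_on {0}" and b: "NEAR t. norm (f t) \<le> C * norm t ^ m" and i: "i < m"
 shows "fps_nth (E f) i = 0"
proof (rule ccontr)
 assume "fps_nth (E f) i ~= 0"
 then have nz: "E f ~= 0" and d: "subdegree (E f) < m" using i subdegree_leI by force+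
 have "\<not> (NEAR t. f t = 0)" using nz E_zero_iff[OF f] by simp
 from E_factor_exact[OF f this] obtain g where g: "g analytic_on {0}" "g 0 ~= 0"
  "NEAR t. f t = t ^ subdegree (E f) * g t" by blast
 let ?d = "subdegree (E f)"
 have "NEAR t. t ~= 0 --> norm (g t) \<le> C * norm t ^ (m - ?d)"
  using g(3) b
 proof eventually_elim
  case (elim t)
  show ?case
  proof
   assume t: "t ~= 0"
   have "norm t ^ ?d * norm (g t) \<le> C * norm t ^ m" using elim by (simp add: norm_mult norm_power)
   also have "\<dots> = norm t ^ ?d * (C * norm t ^ (m - ?d))" using d by (simp add: power_add[symmetric])
   finally show "norm (g t) \<le> C * norm t ^ (m - ?d)" using t by (simp add: mult_le_cancel_left)
  qed
 qed
 then have ev: "\<forall>\<^sub>F t in at 0. norm (g t) \<le> C * norm t ^ (m - ?d)" by (simp add: eventually_at_filter)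
 have "isCont (%t::complex. C * norm t ^ (m - ?d)) 0" by (intro continuous_intros)
 then have l0: "((%t::complex. C * norm t ^ (m - ?d)) \<longlongrightarrow> 0) (at 0)" unfolding isCont_def using d by (simp add: zero_power)
 have "(g \<longlongrightarrow> 0) (at 0)" by (rule Lim_null_comparison[OF ev l0])
 moreover have "(g \<longlongrightarrow> g 0) (at 0)" using analytic_at_imp_isCont[OF g(1)] by (simp add: isCont_def)
 ultimately show False using g(2) tendsto_unique trivial_limit_at by blast
qed

section \<open>Orders of vanishing\<close>

text \<open>
  Vanishing order exactly \<open>d\<close>; the zero series has no such order, whereas it satisfies \<open>ge\<close> for every \<open>d\<close>.
\<close>

definition od :: "complex fps => nat => bool" where
 "od F d \<longleftrightarrow> (\<forall>i<d. fps_nth F i = 0) \<and> fps_nth F d ~= 0"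

definition ge :: "complex fps => nat => bool" where
 "ge F d \<longleftrightarrow> (\<forall>i<d. fps_nth F i = 0)"

lemma od_iff: "od F d \<longleftrightarrow> F ~= 0 \<and> subdegree F = d"
proof
 assume "od F d"
 then show "F ~= 0 \<and> subdegree F = d" unfolding od_def by (auto intro: subdegreeI)
qed (auto simp: od_def)

lemma ge_iff: "ge F d \<longleftrightarrow> F = 0 \<or> d \<le> subdegree F"
 unfolding ge_def by (meson fps_zero_nth nth_less_subdegree_zero less_le_trans not_le_imp_less subdegree_geI
   nth_subdegree_nonzero)

lemma od_ge: "od F d ==> ge F d"
 by (simp add: od_def ge_def)

lemma od_unique: "od F d ==> od F e ==> d = e"
 by (simp add: od_iff)

lemma od_0: "od F 0 \<longleftrightarrow> fps_nth F 0 ~= 0"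
 by (simp add: od_def)

lemma od_1: "od F (Suc 0) \<longleftrightarrow> fps_nth F 0 = 0 \<and> fps_nth F 1 ~= 0"
 by (auto simp: od_def less_Suc_eq)

lemma od_mult: "od F d ==> od G e ==> od (F * G) (d + e)"
 by (simp add: od_iff)

lemma od_cancel: "od F d ==> od (F * G) (d + e) ==> od G e"
 by (auto simp: od_iff)

lemma ge_mult: "ge F d ==> ge G e ==> ge (F * G) (d + e)"
 unfolding ge_iff by (cases "F = 0"; cases "G = 0") auto

lemma ge_cancel: "od F d ==> ge (F * G) (d + e) ==> ge G e"
 unfolding ge_iff od_iff by (cases "G = 0") auto

lemma ge_0 [simp]: "ge F 0"
 by (simp add: ge_def)

lemma ge_add: "ge F d ==> ge G d ==> ge (F + G) d"
 and ge_diff: "ge F d ==> ge G d ==> ge (F - G) d"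
 by (simp_all add: ge_def)

lemma ge_mono: "ge F d ==> e \<le> d ==> ge F e"
 by (simp add: ge_def)

lemma od_deriv: "od F (Suc d) ==> od (fps_deriv F) d"
 by (auto simp: od_def simp del: of_nat_Suc)

lemma od_deriv_iff: "od F (Suc d) \<longleftrightarrow> fps_nth F 0 = 0 \<and> od (fps_deriv F) d"
proof
 assume a: "fps_nth F 0 = 0 \<and> od (fps_deriv F) d"
 have "fps_nth F i = 0" if i: "i < Suc d" for i
 proof (cases i)
  case (Suc m)
  then have "fps_nth (fps_deriv F) m = 0" using a i unfolding od_def by blast
  then have "of_nat (Suc m) * fps_nth F (Suc m) = 0" by simp
  then show ?thesis using Suc by (simp only: mult_eq_0_iff of_nat_eq_0_iff) simp
 qed (use a in simp)
 moreover have "fps_nth F (Suc d) ~= 0" using a unfolding od_def by auto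
 ultimately show "od F (Suc d)" unfolding od_def by blast
qed (use od_deriv in \<open>auto simp: od_def simp del: of_nat_Suc\<close>)

lemma ge_deriv: "ge F (Suc d) ==> ge (fps_deriv F) d"
 by (auto simp: ge_def)

lemma ge_deriv_iff: "ge F (Suc d) \<longleftrightarrow> fps_nth F 0 = 0 \<and> ge (fps_deriv F) d"
proof
 assume a: "fps_nth F 0 = 0 \<and> ge (fps_deriv F) d"
 have "fps_nth F i = 0" if i: "i < Suc d" for i
 proof (cases i)
  case (Suc m)
  then have "fps_nth (fps_deriv F) m = 0" using a i unfolding ge_def by blast
  then have "of_nat (Suc m) * fps_nth F (Suc m) = 0" by simp
  then show ?thesis using Suc by (simp only: mult_eq_0_iff of_nat_eq_0_iff) simp
 qed (use a in simp)
 then show "ge F (Suc d)" unfolding ge_def by blast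
qed (auto simp: ge_deriv ge_def)

lemma od_congr: "ge (G - F) (Suc d) ==> od F d ==> od G d"
 by (auto simp: ge_def od_def)

lemma not_ge_od: "\<not> ge F d ==> \<exists>e<d. od F e"
 unfolding ge_iff od_iff by auto

lemma E_add: "f analytic_on {0} ==> g analytic_on {0} ==> E (%t. f t + g t) = E f + E g"
 by (intro E_eqI has_fps_expansion_add E_exp)

lemma E_diff: "f analytic_on {0} ==> g analytic_on {0} ==> E (%t. f t - g t) = E f - E g"
 by (intro E_eqI has_fps_expansion_diff E_exp)

lemma E_mult: "f analytic_on {0} ==> g analytic_on {0} ==> E (%t. f t * g t) = E f * E g"
 by (intro E_eqI has_fps_expansion_mult E_exp)

lemma E_const: "E (%t. c) = fps_const c"
 by (intro E_eqI has_fps_expansion_const)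

lemma E_cmult: "f analytic_on {0} ==> E (%t. c * f t) = fps_const c * E f"
 by (intro E_eqI has_fps_expansion_cmult_left E_exp)

lemma E_sum: "(!!j. j \<in> A ==> f j analytic_on {0}) ==> E (%t. \<Sum>j\<in>A. f j t) = (\<Sum>j\<in>A. E (f j))"
 by (intro E_eqI has_fps_expansion_sum E_exp)

lemma E_deriv: "f analytic_on {0} ==> E (deriv f) = fps_deriv (E f)"
 by (intro E_eqI has_fps_expansion_deriv E_exp)

definition dot :: "complex^'n::finite => complex^'n => complex" where
 "dot w v = (\<Sum>j\<in>UNIV. w $ j * v $ j)"

definition Ev :: "(complex => complex^'n::finite) => 'n => complex fps" where
 "Ev f j = E (%t. f t $ j)"

lemma analytic_dot: "analytic_vec f 0 ==> (%t. dot w (f t)) analytic_on {0}"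
 unfolding dot_def by (intro analytic_intros analytic_vecD)

lemma E_dot: "analytic_vec f 0 ==> E (%t. dot w (f t)) = (\<Sum>j\<in>UNIV. fps_const (w $ j) * Ev f j)"
 unfolding dot_def Ev_def by (subst E_sum) (auto intro!: analytic_intros analytic_vecD simp: E_cmult analytic_vecD)

lemma dot_axis: "dot (axis j 1) v = v $ j"
proof -
 have "dot (axis j 1) v = (\<Sum>i\<in>UNIV. if i = j then v $ i else 0)"
  unfolding dot_def by (rule sum.cong) (auto simp: axis_def)
 then show ?thesis by simp
qed

lemma axis_nonzero: "axis j (1::complex) ~= 0"
 by (metis axis_eq_0_iff one_neq_zero)

text \<open>
 The orders of the velocities of the linear projections of a curve. These orders are invariant under
 diffeomorphisms and reparametrizations.
\<close>

definition velocity_orders :: "nat set => (complex => complex^'n::finite) => bool" where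
 "velocity_orders S \<gamma> \<longleftrightarrow> analytic_vec \<gamma> 0 \<and>
   (\<forall>w. w ~= 0 --> (\<exists>d\<in>S. od (fps_deriv (E (%t. dot w (\<gamma> t)))) d))"

lemma velocity_orders_cong:
 assumes "velocity_orders S \<gamma>" "analytic_vec \<eta> 0" "\<forall>d\<in>S. d \<le> m"
  "!!j. ge (fps_deriv (Ev \<gamma> j) - fps_deriv (Ev \<eta> j)) (Suc m)"
 shows "velocity_orders S \<eta>"
 unfolding velocity_orders_def
proof (intro conjI allI impI assms(2))
 fix w :: "complex^'a" assume "w ~= 0"
 then obtain d where d: "d \<in> S" "od (fps_deriv (E (%t. dot w (\<gamma> t)))) d"
  using assms(1) unfolding velocity_orders_def by blast
 have "fps_nth (fps_deriv (E (%t. dot w (\<gamma> t)))) i = fps_nth (fps_deriv (E (%t. dot w (\<eta> t)))) i" if "i \<le> d" for i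
 proof -
  have "fps_nth (fps_deriv (Ev \<gamma> j)) i = fps_nth (fps_deriv (Ev \<eta> j)) i" for j
   using assms(4)[of j] that d(1) assms(3) unfolding ge_def by fastforce
  then have "fps_nth (Ev \<gamma> j) (Suc i) = fps_nth (Ev \<eta> j) (Suc i)" for j by (simp del: of_nat_Suc)
  moreover have "analytic_vec \<gamma> 0" using assms(1) by (simp add: velocity_orders_def)
  ultimately show ?thesis using assms(2) by (simp add: E_dot fps_sum_nth)
 qed
 then have "od (fps_deriv (E (%t. dot w (\<eta> t)))) d" using d(2) unfolding od_def by (metis less_imp_le order_refl)
 then show "\<exists>d\<in>S. od (fps_deriv (E (%t. dot w (\<eta> t)))) d" using d(1) by blast
qed

lemma velocity_orders_nonconstant:
 assumes "velocity_orders S \<gamma>" shows "nonconstant_germ \<gamma>"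
 unfolding nonconstant_germ_def
proof
 assume "\<exists>z. NEAR t. \<gamma> t = z"
 then obtain z where "NEAR t. \<gamma> t = z" by blast
 then have ev: "NEAR t. dot (axis undefined 1) (\<gamma> t) = dot (axis undefined 1) z"
  by (rule eventually_mono) simp
 have "E (%t. dot (axis undefined 1) (\<gamma> t)) = fps_const (dot (axis undefined 1) z)"
  by (rule trans[OF E_cong[OF ev] E_const])
 then have "\<not> od (fps_deriv (E (%t. dot (axis undefined 1) (\<gamma> t)))) d" for d by (simp add: od_def)
 then show False using assms axis_nonzero unfolding velocity_orders_def by blast
qed

lemma dot_linear: "dot w (u + v) = dot w u + dot w v" "dot w (u - v) = dot w u - dot w v" "dot w (s *s v) = s * dot w v"
 "dot w 0 = 0" "dot 0 v = 0"
 by (auto simp: dot_def algebra_simps sum.distrib sum_subtractf sum_distrib_left)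

text \<open>
  A reparametrization has order one, so composition with it preserves orders.
\<close>

lemma od_compose:
 assumes h: "h analytic_on {0}" "h 0 = 0" "deriv h 0 ~= 0" and f: "f analytic_on {0}"
 shows "E (%t. f (h t)) = E f oo E h" "od (E h) (Suc 0)"
proof -
 show "E (%t. f (h t)) = E f oo E h"
  using has_fps_expansion_compose[OF E_exp[OF f] E_exp[OF h(1)]] h(2)
  by (intro E_eqI) (simp add: o_def E_nth_0)
 show "od (E h) (Suc 0)" unfolding od_1 using h by (simp add: fps_expansion_def)
qed

lemma od_oo: "od H (Suc 0) ==> F ~= 0 ==> od (F oo H) (subdegree F)"
proof -
 assume H: "od H (Suc 0)" and F: "F ~= 0"
 have H0: "fps_nth H 0 = 0" "fps_nth H 1 ~= 0" using H by (auto simp: od_1)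
 have pz: "fps_nth (H ^ i) m = 0" if "m < i" for i m
  using H0(1) that startsby_zero_power_prefix[of H] by auto
 have pn: "fps_nth (H ^ i) i ~= 0" for i
  using startsby_zero_power_nth_same[OF H0(1), of i] H0(2) by simp
 have n: "fps_nth (F oo H) m = (\<Sum>i=0..m. fps_nth F i * fps_nth (H ^ i) m)" for m by (rule fps_compose_nth)
 show "od (F oo H) (subdegree F)" unfolding od_def
 proof (intro conjI allI impI)
  fix m assume m: "m < subdegree F"
  have z: "fps_nth F i = 0" if "i \<le> m" for i
   by (rule nth_less_subdegree_zero) (rule le_less_trans[OF that m])
  show "fps_nth (F oo H) m = 0" unfolding n
  proof (rule sum.neutral, rule ballI)
   fix i assume "i \<in> {0..m}"
   then have "fps_nth F i = 0" by (intro z) simp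
   then show "fps_nth F i * fps_nth (H ^ i) m = 0" by simp
  qed
 next
  have "fps_nth (F oo H) (subdegree F) = fps_nth F (subdegree F) * fps_nth (H ^ subdegree F) (subdegree F)"
  proof -
   have "fps_nth F i * fps_nth (H ^ i) (subdegree F) = 0" if "i \<in> {0..subdegree F} - {subdegree F}" for i
   proof -
    have "i < subdegree F" using that by simp
    then show ?thesis by (simp only: nth_less_subdegree_zero mult_zero_left)
   qed
   then have "(\<Sum>i\<in>{0..subdegree F} - {subdegree F}. fps_nth F i * fps_nth (H ^ i) (subdegree F)) = 0"
    by (intro sum.neutral ballI)
   then show ?thesis unfolding n by (subst sum.remove[of _ "subdegree F"]) simp_all
  qed
  then show "fps_nth (F oo H) (subdegree F) ~= 0" using F pn by simp
 qed
qed

lemma velocity_orders_reparam: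
 assumes h: "h analytic_on {0}" "h 0 = 0" "deriv h 0 ~= 0" and an: "analytic_vec \<gamma> 0"
 shows "velocity_orders S (%t. \<gamma> (h t)) \<longleftrightarrow> velocity_orders S \<gamma>"
proof -
 have eq: "od (fps_deriv (E (%t. dot w (\<gamma> (h t))))) d \<longleftrightarrow> od (fps_deriv (E (%t. dot w (\<gamma> t)))) d" for w d
 proof -
  let ?f = "%t. dot w (\<gamma> t)"
  have f: "?f analytic_on {0}" by (rule analytic_dot[OF an])
  have "E (%t. ?f (h t)) = E ?f oo E h" by (rule od_compose(1)[OF h f])
  then have "fps_deriv (E (%t. ?f (h t))) = (fps_deriv (E ?f) oo E h) * fps_deriv (E h)"
   using od_compose(2)[OF h f] unfolding od_1 by (simp add: fps_compose_deriv)
  moreover have "od (fps_deriv (E h)) 0" using od_deriv_iff[of "E h" 0] od_compose(2)[OF h f] by simp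
  moreover have "od ((fps_deriv (E ?f) oo E h) * fps_deriv (E h)) d \<longleftrightarrow> od (fps_deriv (E ?f)) d"
   if "od (fps_deriv (E h)) 0"
  proof (cases "fps_deriv (E ?f) = 0")
   case False
   then have "od (fps_deriv (E ?f) oo E h) (subdegree (fps_deriv (E ?f)))" using od_oo od_compose(2)[OF h f] by blast
   from od_mult[OF this that] show ?thesis using False by (auto simp: od_iff)
  next
   case True
   then show ?thesis unfolding True by (simp add: od_def)
  qed
  ultimately show ?thesis by simp
 qed
 show ?thesis unfolding velocity_orders_def using eq an reparam_analytic_vec[OF h an] by blast
qed

lemma transpose_kernel:
 fixes M :: "complex^'n::finite^'n"
 assumes "!!v. M *v v = 0 ==> v = 0" and "transpose M *v w = 0"
 shows "w = 0"
proof -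
 have "\<exists>B. B ** M = mat 1" using assms(1) matrix_left_invertible_ker[of M] by blast
 then obtain B where "B ** M = mat 1" by blast
 then have "M ** B = mat 1" using matrix_left_right_inverse by blast
 then have "transpose B ** transpose M = mat 1" by (metis matrix_transpose_mul transpose_mat)
 then have "w = transpose B *v (transpose M *v w)" by (simp only: matrix_vector_mul_assoc matrix_vector_mul_lid)
 then show ?thesis unfolding assms(2) by simp
qed

section \<open>Expansions of lifts\<close>

definition Ec :: "(complex => 'n::finite coords) => nat => 'n => complex fps" where
 "Ec \<xi> m j = E (%t. \<xi> t m $ j)"

lemma Ev_cong: "NEAR t. f t = g t ==> Ev f j = Ev g j"
 unfolding Ev_def by (rule E_cong) (auto elim: eventually_mono)

lemma Ev_vderiv: "analytic_vec f 0 ==> Ev (vderiv f) j = fps_deriv (Ev f j)"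
 unfolding Ev_def vderiv_def by (simp add: E_deriv[symmetric] analytic_vecD eta_contract_eq)

lemma Ev_nth_0: "fps_nth (Ev f j) 0 = f 0 $ j"
 by (simp add: Ev_def E_nth_0)

lemma clift_Nil_fps:
 assumes "clift \<gamma> [] \<xi> u" shows "Ev u j = fps_deriv (Ev \<gamma> j)"
proof -
 have "NEAR t. u t = vderiv \<gamma> t" using assms by (auto elim: eventually_mono)
 from Ev_cong[OF this] show ?thesis using Ev_vderiv[of \<gamma> j] assms by simp
qed

lemma clift_Cons_fps:
 assumes "clift \<gamma> (a # c) \<xi> u"
 shows "\<exists>w. clift \<gamma> c (%t. (\<xi> t)(Suc (length c) := 0)) w \<and> Ev w a ~= 0 \<and>
  (\<forall>j. Ev w j = Ev w a * Ec \<xi> (Suc (length c)) j) \<and> Ec \<xi> (Suc (length c)) a = 1 \<and>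
  (\<forall>j. Ev u j = (if j = a then Ev w a else fps_deriv (Ec \<xi> (Suc (length c)) j)))"
proof -
 let ?k = "Suc (length c)"
 obtain w where w: "clift \<gamma> c (%t. (\<xi> t)(?k := 0)) w" "analytic_vec (%t. \<xi> t ?k) 0"
  "\<not> (NEAR t. w t $ a = 0)"
  "NEAR t. \<xi> t ?k $ a = 1 \<and> w t = w t $ a *s \<xi> t ?k \<and>
    u t = (\<chi> j. if j = a then w t $ a else vderiv (%s. \<xi> s ?k) t $ j)"
  using assms unfolding clift.simps by blast
 have wa: "analytic_vec w 0" using clift_integral[OF w(1)] by blast
 have "Ev w a ~= 0" unfolding Ev_def using w(3) E_zero_iff[OF analytic_vecD[OF wa]] by simp
 moreover have "Ev w j = Ev w a * Ec \<xi> ?k j" for j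
 proof -
  have "NEAR t. w t $ j = w t $ a * \<xi> t ?k $ j"
   using w(4)
  proof eventually_elim
   case (elim t)
   then have e: "w t = w t $ a *s \<xi> t ?k" by blast
   from arg_cong[OF e, of "%v. v $ j"] show ?case by (simp only: vector_smult_component)
  qed
  from E_cong[OF this] show ?thesis
   unfolding Ev_def Ec_def using E_mult[OF analytic_vecD[OF wa] analytic_vecD[OF w(2)]] by simp
 qed
 moreover have "Ec \<xi> ?k a = 1"
 proof -
  have "NEAR t. \<xi> t ?k $ a = 1" using w(4) by eventually_elim blast
  from E_cong[OF this] show ?thesis unfolding Ec_def using E_const[of 1] by simp
 qed
 moreover have "Ev u j = (if j = a then Ev w a else fps_deriv (Ec \<xi> ?k j))" for j
 proof (cases "j = a")
  case True
  have "NEAR t. u t $ j = w t $ a" using w(4)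
  proof eventually_elim
   case (elim t)
   then have "u t = (\<chi> j. if j = a then w t $ a else vderiv (%s. \<xi> s ?k) t $ j)" by blast
   then show ?case using True by simp
  qed
  from E_cong[OF this] show ?thesis using True by (simp add: Ev_def)
 next
  case False
  have "NEAR t. u t $ j = vderiv (%s. \<xi> s ?k) t $ j" using w(4)
  proof eventually_elim
   case (elim t)
   then have "u t = (\<chi> j. if j = a then w t $ a else vderiv (%s. \<xi> s ?k) t $ j)" by blast
   then show ?case using False by simp
  qed
  from E_cong[OF this] show ?thesis using False Ev_vderiv[OF w(2), of j] by (simp add: Ev_def Ec_def)
 qed
 ultimately show ?thesis using w(1) by blast
qed

text \<open>
 The equations of a lift to level three, in terms of the power series \<open>G\<close> of the velocity and \<open>X\<close>,
 \<open>Y\<close>, \<open>Z\<close> of the coordinates of the levels one, two and three.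
\<close>

definition lift3 ::
 "'n => 'n => 'n => ('n => complex fps) => ('n => complex fps) => ('n => complex fps) =>
  ('n => complex fps) => complex fps => complex fps => complex fps => ('n => complex fps) => bool" where
 "lift3 a1 a2 a3 D X Y Z G1 G2 G3 U \<longleftrightarrow>
   (\<forall>j. D j = G1 * X j) \<and> X a1 = 1 \<and> G1 ~= 0 \<and>
   (\<forall>j. (if j = a1 then G1 else fps_deriv (X j)) = G2 * Y j) \<and> Y a2 = 1 \<and> G2 ~= 0 \<and>
   (\<forall>j. (if j = a2 then G2 else fps_deriv (Y j)) = G3 * Z j) \<and> Z a3 = 1 \<and> G3 ~= 0 \<and>
   (\<forall>j. U j = (if j = a3 then G3 else fps_deriv (Z j)))"

lemma clift3_cases:
 assumes "clift \<gamma> [a3, a2, a1] \<xi> u"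
 obtains w1 w2 w3 where
  "clift \<gamma> [] (%t. (\<xi> t)(3 := 0, 2 := 0, 1 := 0)) w1" "Ev w1 a1 ~= 0"
  "!!j. Ev w1 j = Ev w1 a1 * Ec \<xi> 1 j" "Ec \<xi> 1 a1 = 1"
  "!!j. Ev w2 j = (if j = a1 then Ev w1 a1 else fps_deriv (Ec \<xi> 1 j))"
  "clift \<gamma> [a1] (%t. (\<xi> t)(3 := 0, 2 := 0)) w2" "Ev w2 a2 ~= 0"
  "!!j. Ev w2 j = Ev w2 a2 * Ec \<xi> 2 j" "Ec \<xi> 2 a2 = 1"
  "!!j. Ev w3 j = (if j = a2 then Ev w2 a2 else fps_deriv (Ec \<xi> 2 j))"
  "clift \<gamma> [a2, a1] (%t. (\<xi> t)(3 := 0)) w3" "Ev w3 a3 ~= 0"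
  "!!j. Ev w3 j = Ev w3 a3 * Ec \<xi> 3 j" "Ec \<xi> 3 a3 = 1"
  "!!j. Ev u j = (if j = a3 then Ev w3 a3 else fps_deriv (Ec \<xi> 3 j))"
proof -
 have n: "Suc (length [a2, a1]) = 3" "Suc (length [a1]) = 2" "Suc (length []) = 1" by simp_all
 have e2: "Ec (%t. (\<xi> t)(3 := 0)) 2 = Ec \<xi> 2" by (simp add: Ec_def fun_eq_iff)
 have e1: "Ec (%t. (\<xi> t)(3 := 0, 2 := 0)) 1 = Ec \<xi> 1" by (simp add: Ec_def fun_eq_iff)
 from clift_Cons_fps[OF assms, unfolded n]
 obtain w3 where w3: "clift \<gamma> [a2, a1] (%t. (\<xi> t)(3 := 0)) w3" "Ev w3 a3 ~= 0"
  "\<forall>j. Ev w3 j = Ev w3 a3 * Ec \<xi> 3 j" "Ec \<xi> 3 a3 = 1"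
  "\<forall>j. Ev u j = (if j = a3 then Ev w3 a3 else fps_deriv (Ec \<xi> 3 j))" by blast
 from clift_Cons_fps[OF w3(1), unfolded n e2]
 obtain w2 where w2: "clift \<gamma> [a1] (%t. (\<xi> t)(3 := 0, 2 := 0)) w2" "Ev w2 a2 ~= 0"
  "\<forall>j. Ev w2 j = Ev w2 a2 * Ec \<xi> 2 j" "Ec \<xi> 2 a2 = 1"
  "\<forall>j. Ev w3 j = (if j = a2 then Ev w2 a2 else fps_deriv (Ec \<xi> 2 j))" by blast
 from clift_Cons_fps[OF w2(1), unfolded n e1]
 obtain w1 where w1: "clift \<gamma> [] (%t. (\<xi> t)(3 := 0, 2 := 0, 1 := 0)) w1" "Ev w1 a1 ~= 0"
  "\<forall>j. Ev w1 j = Ev w1 a1 * Ec \<xi> 1 j" "Ec \<xi> 1 a1 = 1"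
  "\<forall>j. Ev w2 j = (if j = a1 then Ev w1 a1 else fps_deriv (Ec \<xi> 1 j))" by blast
 show thesis
  by (rule that[OF w1(1,2) w1(3)[rule_format] w1(4) w1(5)[rule_format] w2(1,2) w2(3)[rule_format] w2(4)
     w2(5)[rule_format] w3(1,2) w3(3)[rule_format] w3(4) w3(5)[rule_format]])
qed

lemma clift_lift3:
 assumes "clift \<gamma> [a3, a2, a1] \<xi> u"
 shows "\<exists>G1 G2 G3. lift3 a1 a2 a3 (%j. fps_deriv (Ev \<gamma> j)) (Ec \<xi> 1) (Ec \<xi> 2) (Ec \<xi> 3) G1 G2 G3 (Ev u)"
proof -
 obtain w1 w2 w3 where
  w: "clift \<gamma> [] (%t. (\<xi> t)(3 := 0, 2 := 0, 1 := 0)) w1" "Ev w1 a1 ~= 0"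
  "!!j. Ev w1 j = Ev w1 a1 * Ec \<xi> 1 j" "Ec \<xi> 1 a1 = 1"
  "!!j. Ev w2 j = (if j = a1 then Ev w1 a1 else fps_deriv (Ec \<xi> 1 j))"
  "clift \<gamma> [a1] (%t. (\<xi> t)(3 := 0, 2 := 0)) w2" "Ev w2 a2 ~= 0"
  "!!j. Ev w2 j = Ev w2 a2 * Ec \<xi> 2 j" "Ec \<xi> 2 a2 = 1"
  "!!j. Ev w3 j = (if j = a2 then Ev w2 a2 else fps_deriv (Ec \<xi> 2 j))"
  "clift \<gamma> [a2, a1] (%t. (\<xi> t)(3 := 0)) w3" "Ev w3 a3 ~= 0"
  "!!j. Ev w3 j = Ev w3 a3 * Ec \<xi> 3 j" "Ec \<xi> 3 a3 = 1"
  "!!j. Ev u j = (if j = a3 then Ev w3 a3 else fps_deriv (Ec \<xi> 3 j))"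
  by (rule clift3_cases[OF assms]) (rule that)
 have "lift3 a1 a2 a3 (%j. fps_deriv (Ev \<gamma> j)) (Ec \<xi> 1) (Ec \<xi> 2) (Ec \<xi> 3) (Ev w1 a1) (Ev w2 a2) (Ev w3 a3) (Ev u)"
  unfolding lift3_def clift_Nil_fps[OF w(1), symmetric] w(5)[symmetric] w(10)[symmetric]
  by (intro conjI allI w(2,4,7,9,12,14) w(3) w(8) w(13) w(15))
 then show ?thesis by blast
qed

text \<open>
  If the velocities of two curves in the same chart agree to sufficiently high order, then so do the coordinates
  of the next level. Dividing by a component of order \<open>d\<close> loses \<open>d\<close> orders, differentiating the quotient one
  more.
\<close>

lemma clift_step:
 assumes k: "k = Suc (length c)" and \<alpha>: "clift \<alpha> (a # c) \<xi> u" and low: "clift \<alpha> c (%t. (\<xi> t)(k := 0)) w"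
  and \<beta>: "clift \<beta> c \<zeta> v"
  and agree: "!!j. ge (Ev w j - Ev v j) (r + d)" and d: "od (Ev w a) d" and r: "r \<ge> 1"
  and w: "!!j. Ev w j = Ev w a * Ec \<xi> k j"
   "!!j. Ev u j = (if j = a then Ev w a else fps_deriv (Ec \<xi> k j))"
  and z0: "\<zeta> 0 = (\<xi> 0)(k := 0)"
 shows "\<exists>\<zeta>' v'. clift \<beta> (a # c) \<zeta>' v' \<and> \<zeta>' 0 = \<xi> 0 \<and> (\<forall>j. ge (Ev u j - Ev v' j) (r - 1))"
proof -
 have va: "analytic_vec v 0" using clift_integral[OF \<beta>] by blast
 have an: "(%t. v t $ j) analytic_on {0}" for j by (rule analytic_vecD[OF va])
 have gw: "ge (Ev w j) d" for j using ge_mult[OF od_ge[OF d] ge_0] w(1)[of j] by simp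
 have gv: "ge (Ev v j) d" for j
 proof -
  have "ge (Ev w j - (Ev w j - Ev v j)) d" by (rule ge_diff[OF gw ge_mono[OF agree]]) simp
  then show ?thesis by simp
 qed
 have "ge (Ev v a - Ev w a) (Suc d)" using ge_mono[OF agree[of a], of "Suc d"] r by (auto simp: ge_def)
 then have dv: "od (Ev v a) d" using d by (rule od_congr)
 have vnz: "\<not> (NEAR t. v t $ a = 0)"
  using dv E_zero_iff[OF an] by (auto simp: od_iff Ev_def)
 obtain g where g: "g analytic_on {0}" "g 0 ~= 0" "NEAR t. v t $ a = t ^ d * g t"
  using E_factor_exact[OF an vnz] dv unfolding od_iff Ev_def by auto
 have "\<exists>h. h analytic_on {0} \<and> (NEAR t. v t $ j = t ^ d * h t)" for j
  using E_factor[OF an] gv[of j] unfolding ge_def Ev_def by blast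
 then have "\<exists>h. \<forall>j. h j analytic_on {0} \<and> (NEAR t. v t $ j = t ^ d * h j t)"
  by (intro choice allI)
 then obtain h where h: "!!j. h j analytic_on {0}" "!!j. NEAR t. v t $ j = t ^ d * h j t" by blast
 define y :: "complex => complex^'a" where "y t = (\<chi> j. if j = a then 1 else h j t / g t)" for t
 have "(%t. h j t / g t) analytic_on {0}" for j by (intro analytic_intros h g) (use g in auto)
 then have "(%t. if j = a then 1 else h j t / g t) analytic_on {0}" for j by (cases "j = a") auto
 then have y: "analytic_vec y 0" unfolding analytic_vec_def y_def by simp
 have "NEAR t. \<forall>j. v t $ j = t ^ d * h j t" using h(2) by (intro eventually_all_finite) auto
 with g(3) analytic_eventually_nonzero[OF g(1,2)]
 have ev: "NEAR t. y t $ a = 1 \<and> v t = v t $ a *s y t"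
 proof eventually_elim
  case (elim t)
  have "v t $ j = v t $ a * y t $ j" for j
  proof (cases "j = a")
   case False
   have "v t $ j = t ^ d * h j t" "v t $ a = t ^ d * g t" using elim by blast+
   then show ?thesis using False elim(2) by (simp only: y_def vec_lambda_beta if_False) simp
  qed (simp add: y_def)
  then have "v t = v t $ a *s y t" unfolding vec_eq_iff vector_smult_component by blast
  moreover have "y t $ a = 1" by (simp add: y_def)
  ultimately show ?case by blast
 qed
 let ?\<zeta> = "%t. (\<zeta> t)(k := y t)" and ?v = "%t. \<chi> j. if j = a then v t $ a else vderiv y t $ j"
 have l: "clift \<beta> (a # c) ?\<zeta> ?v" unfolding k by (rule clift_ConsI[OF \<beta> y vnz ev])
 have Y: "Ev v j = Ev v a * Ev y j" for j
 proof -
  have "NEAR t. v t $ j = v t $ a * y t $ j" using ev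
  proof eventually_elim
   case (elim t)
   then have e: "v t = v t $ a *s y t" by blast
   from arg_cong[OF e, of "%v. v $ j"] show ?case by (simp only: vector_smult_component)
  qed
  from E_cong[OF this] show ?thesis
   unfolding Ev_def using E_mult[OF an analytic_vecD[OF y]] by simp
 qed
 let ?X = "Ec \<xi> k"
 have diff: "ge (?X j - Ev y j) r" for j
 proof -
  have "Ev w a * (?X j - Ev y j) = (Ev w j - Ev v j) - (Ev w a - Ev v a) * Ev y j"
   unfolding w(1)[of j] Y[of j] by (simp add: algebra_simps)
  moreover have "ge ((Ev w a - Ev v a) * Ev y j) (r + d)" using ge_mult[OF agree ge_0] by simp
  ultimately have "ge (Ev w a * (?X j - Ev y j)) (d + r)" using ge_diff[OF agree] by (simp add: add.commute)
  then show ?thesis by (rule ge_cancel[OF d])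
 qed
 have "\<xi> 0 k $ j = y 0 $ j" for j
  using diff[of j] r by (auto simp: ge_def Ec_def Ev_def E_nth_0)
 then have "y 0 = \<xi> 0 k" by (simp add: vec_eq_iff)
 then have z: "?\<zeta> 0 = \<xi> 0" using z0 by (auto simp: fun_eq_iff)
 have "ge (Ev u j - Ev ?v j) (r - 1)" for j
 proof (cases "j = a")
  case True
  have "Ev ?v a = Ev v a" by (simp add: Ev_def)
  then show ?thesis using ge_mono[OF agree[of a]] True w(2)[of a] by simp
 next
  case False
  have "Ev ?v j = Ev (vderiv y) j" using False by (simp add: Ev_def)
  then have "Ev u j - Ev ?v j = fps_deriv (?X j - Ev y j)" using False w(2)[of j] Ev_vderiv[OF y] by simp
  then show ?thesis using ge_deriv[of "?X j - Ev y j" "r - 1"] diff r by simp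
 qed
 then show ?thesis using l z by blast
qed

text \<open>
  Three applications of \<open>clift_step\<close> lose the orders \<open>d1\<close>, \<open>d2\<close>, \<open>d3\<close> of the normalizing components and
  three derivatives.
\<close>

lemma jet_determines_prolongation:
 assumes \<alpha>: "clift \<alpha> [a3, a2, a1] \<xi> u" and an: "analytic_vec \<beta> 0" and 0: "\<alpha> 0 = \<beta> 0"
  and L: "lift3 a1 a2 a3 (%j. fps_deriv (Ev \<alpha> j)) (Ec \<xi> 1) (Ec \<xi> 2) (Ec \<xi> 3) G1 G2 G3 (Ev u)"
  and d: "od G1 d1" "od G2 d2" "od G3 d3"
  and agree: "!!j. ge (fps_deriv (Ev \<alpha> j) - fps_deriv (Ev \<beta> j)) (d1 + d2 + d3 + 3)"
 shows "prolong_curve \<alpha> 3 0 = prolong_curve \<beta> 3 0"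
proof -
 have e2: "Ec (%t. (\<xi> t)(3 := 0)) 2 = Ec \<xi> 2" by (simp add: Ec_def fun_eq_iff)
 have e1: "Ec (%t. (\<xi> t)(3 := 0, 2 := 0)) 1 = Ec \<xi> 1" by (simp add: Ec_def fun_eq_iff)
 obtain w1 w2 w3 where
  w1: "clift \<alpha> [] (%t. (\<xi> t)(3 := 0, 2 := 0, 1 := 0)) w1" "Ev w1 a1 ~= 0"
  "!!j. Ev w1 j = Ev w1 a1 * Ec \<xi> 1 j" "Ec \<xi> 1 a1 = 1"
  "!!j. Ev w2 j = (if j = a1 then Ev w1 a1 else fps_deriv (Ec \<xi> 1 j))" and
  w2: "clift \<alpha> [a1] (%t. (\<xi> t)(3 := 0, 2 := 0)) w2" "Ev w2 a2 ~= 0"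
  "!!j. Ev w2 j = Ev w2 a2 * Ec \<xi> 2 j" "Ec \<xi> 2 a2 = 1"
  "!!j. Ev w3 j = (if j = a2 then Ev w2 a2 else fps_deriv (Ec \<xi> 2 j))" and
  w3: "clift \<alpha> [a2, a1] (%t. (\<xi> t)(3 := 0)) w3" "Ev w3 a3 ~= 0"
  "!!j. Ev w3 j = Ev w3 a3 * Ec \<xi> 3 j" "Ec \<xi> 3 a3 = 1"
  "!!j. Ev u j = (if j = a3 then Ev w3 a3 else fps_deriv (Ec \<xi> 3 j))"
  by (rule clift3_cases[OF \<alpha>]) (rule that)
 have D: "Ev w1 j = fps_deriv (Ev \<alpha> j)" for j by (rule clift_Nil_fps[OF w1(1)])
 have Ls: "!!j. fps_deriv (Ev \<alpha> j) = G1 * Ec \<xi> 1 j"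
  "!!j. (if j = a1 then G1 else fps_deriv (Ec \<xi> 1 j)) = G2 * Ec \<xi> 2 j"
  "!!j. (if j = a2 then G2 else fps_deriv (Ec \<xi> 2 j)) = G3 * Ec \<xi> 3 j"
  using L unfolding lift3_def by blast+
 have g1: "Ev w1 a1 = G1" using Ls(1)[of a1] D[of a1] w1(4) by simp
 have g2: "Ev w2 a2 = G2" using Ls(2)[of a2] w1(5)[of a2] g1 w2(4) by (simp del: One_nat_def split: if_splits)
 have g3: "Ev w3 a3 = G3" using Ls(3)[of a3] w2(5)[of a3] g2 w3(4) by (simp del: One_nat_def split: if_splits)
 let ?\<zeta> = "%t i. if i = (0::nat) then \<beta> t else 0"
 have b0: "clift \<beta> [] ?\<zeta> (vderiv \<beta>)" using an by simp
 have n: "Suc (length [a2, a1]) = 3" "Suc (length [a1]) = 2" "Suc (length []) = 1" by simp_all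
 have x0: "(\<xi> 0)(3 := 0, 2 := 0, 1 := 0) = ?\<zeta> 0"
 proof -
  have "NEAR t. (\<xi> t)(3 := 0, 2 := 0, 1 := 0) = (%i. if i = 0 then \<alpha> t else 0)"
   using w1(1) by (auto elim: eventually_mono)
  from eventually_nhds_x_imp_x[OF this] show ?thesis unfolding 0 .
 qed
 have ag1: "ge (Ev w1 j - Ev (vderiv \<beta>) j) (d2 + d3 + 3 + d1)" for j
  using agree[of j] unfolding D Ev_vderiv[OF an] by (simp add: ac_simps)
 have "\<exists>\<zeta>1 v1. clift \<beta> (a1 # []) \<zeta>1 v1 \<and> \<zeta>1 0 = (\<xi> 0)(3 := 0, 2 := 0) \<and>
   (\<forall>j. ge (Ev w2 j - Ev v1 j) (d2 + d3 + 3 - 1))"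
  by (rule clift_step[OF n(3)[symmetric] w2(1) w1(1) b0 ag1 _ _ w1(3)[folded e1] w1(5)[folded e1] x0[symmetric]])
   (simp_all add: g1 d(1))
 then obtain \<zeta>1 v1 where v1: "clift \<beta> [a1] \<zeta>1 v1" "\<zeta>1 0 = (\<xi> 0)(3 := 0, 2 := 0)"
   "!!j. ge (Ev w2 j - Ev v1 j) (d2 + d3 + 2)" by auto
 have ag2: "ge (Ev w2 j - Ev v1 j) (d3 + 2 + d2)" for j using v1(3)[of j] by (simp add: ac_simps)
 have "\<exists>\<zeta>2 v2. clift \<beta> (a2 # [a1]) \<zeta>2 v2 \<and> \<zeta>2 0 = (\<xi> 0)(3 := 0) \<and>
   (\<forall>j. ge (Ev w3 j - Ev v2 j) (d3 + 2 - 1))"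
  by (rule clift_step[OF n(2)[symmetric] w3(1) w2(1) v1(1) ag2 _ _ w2(3)[folded e2] w2(5)[folded e2] v1(2)])
   (simp_all add: g2 d(2))
 then obtain \<zeta>2 v2 where v2: "clift \<beta> [a2, a1] \<zeta>2 v2" "\<zeta>2 0 = (\<xi> 0)(3 := 0)"
   "!!j. ge (Ev w3 j - Ev v2 j) (d3 + 1)" by auto
 have ag3: "ge (Ev w3 j - Ev v2 j) (1 + d3)" for j using v2(3)[of j] by (simp add: ac_simps)
 have "\<exists>\<zeta>3 v3. clift \<beta> (a3 # [a2, a1]) \<zeta>3 v3 \<and> \<zeta>3 0 = \<xi> 0 \<and> (\<forall>j. ge (Ev u j - Ev v3 j) (1 - 1))"
  by (rule clift_step[OF n(1)[symmetric] \<alpha> w3(1) v2(1) ag3 _ _ w3(3) w3(5) v2(2)])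
   (simp_all add: g3 d(3))
 then obtain \<zeta>3 v3 where v3: "clift \<beta> [a3, a2, a1] \<zeta>3 v3" "\<zeta>3 0 = \<xi> 0" by blast
 show ?thesis
  using eventually_nhds_x_imp_x[OF clift_prolong[OF \<alpha>]] eventually_nhds_x_imp_x[OF clift_prolong[OF v3(1)]] v3(2)
  by (simp add: numeral_3_eq_3 del: prolong_curve.simps)
qed

section \<open>The two types of spatial curves\<close>

lemma third_index:
 fixes a b :: 3
 assumes "a ~= b"
 obtains c where "c ~= a" "c ~= b" "!!j. j = a \<or> j = b \<or> j = c"
proof -
 have "card (UNIV - {a, b}) = 1" using assms by (subst card_Diff_subset) auto
 then obtain c where c: "UNIV - {a, b} = {c}" by (rule card_1_singletonE)
 show ?thesis by (rule that[of c]) (use c in auto)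
qed

lemma sum_three:
 fixes a b c :: 3
 assumes "a ~= b" "c ~= a" "c ~= b" "!!j. j = a \<or> j = b \<or> j = c"
 shows "sum f UNIV = f a + f b + (f c :: 'b::comm_monoid_add)"
proof -
 have "UNIV = {a, b, c}" using assms(4) by blast
 then have "sum f UNIV = sum f {a, b, c}" by (rule arg_cong)
 then show ?thesis using assms(1-3) by (auto simp: add.assoc)
qed

lemma exists_orthogonal:
 fixes v1 v2 :: "complex^3"
 shows "\<exists>w. w ~= 0 \<and> dot w v1 = 0 \<and> dot w v2 = 0"
proof -
 define M :: "complex^3^3" where "M = (\<chi> i. if i = 1 then v1 else if i = 2 then v2 else 0)"
 have "row 3 M = 0" by (simp add: row_def M_def vec_eq_iff)
 then have "det M = 0" by (rule det_zero_row)
 then have "\<not> invertible M" by (simp add: invertible_det_nz)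
 then have "\<not> (\<exists>B. B ** M = mat 1)" using invertible_left_inverse by blast
 then obtain w where w: "M *v w = 0" "w ~= 0" using matrix_left_invertible_ker by blast
 have "(M *v w) $ i = dot w (M $ i)" for i
  by (simp add: matrix_vector_mult_def dot_def mult.commute)
 then have "dot w (M $ i) = 0" for i using w(1) by simp
 from this[of 1] this[of 2] show ?thesis using w(2) by (auto simp: M_def)
qed

definition lin :: "complex^'n::finite => ('n => complex fps) => complex fps" where
 "lin w X = (\<Sum>j\<in>UNIV. fps_const (w $ j) * X j)"

lemma lin_nth: "fps_nth (lin w X) i = dot w (\<chi> j. fps_nth (X j) i)"
 by (simp add: lin_def dot_def fps_sum_nth)

lemma lin_mult: "lin w (%j. G * X j) = G * lin w X"
 by (simp add: lin_def sum_distrib_left algebra_simps)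

lemma lin_axis: "lin (axis j 1) X = X j"
 by (rule fps_ext) (simp add: lin_nth dot_axis)

lemma deriv_E_dot:
 "analytic_vec \<gamma> 0 ==> fps_deriv (E (%t. dot w (\<gamma> t))) = lin w (%j. fps_deriv (Ev \<gamma> j))"
 by (simp add: E_dot lin_def fps_deriv_sum)

lemma velocity_orders_lin:
 "velocity_orders S \<gamma> \<longleftrightarrow> analytic_vec \<gamma> 0 \<and> (\<forall>w. w ~= 0 --> (\<exists>d\<in>S. od (lin w (%j. fps_deriv (Ev \<gamma> j))) d))"
 unfolding velocity_orders_def using deriv_E_dot by metis

lemma ge_lin: "(!!j. ge (X j) d) ==> ge (lin w X) d"
 by (simp add: ge_def lin_nth dot_def)

lemma ge_Suc: "ge F (Suc d) \<longleftrightarrow> ge F d \<and> fps_nth F d = 0"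
 by (auto simp: ge_def less_Suc_eq)

lemma ge_od_contr: "ge F d ==> od F e ==> e < d ==> False"
 by (auto simp: ge_def od_def)

lemma od_0_mult: "od (F * G) 0 \<longleftrightarrow> od F 0 \<and> od G 0"
 by (simp add: od_0)

lemma lift3D:
 assumes "lift3 a1 a2 a3 D X Y Z G1 G2 G3 U"
 shows "D j = G1 * X j" "X a1 = 1" "G1 ~= 0" "(if j = a1 then G1 else fps_deriv (X j)) = G2 * Y j"
  "Y a2 = 1" "G2 ~= 0" "(if j = a2 then G2 else fps_deriv (Y j)) = G3 * Z j" "Z a3 = 1" "G3 ~= 0"
  "U j = (if j = a3 then G3 else fps_deriv (Z j))"
 using assms unfolding lift3_def by blast+

text \<open>
 In both types a linear relation between the coordinates of level one would follow from a vanishing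
 coordinate of higher level.
\<close>

lemma lift3_relation:
 fixes X :: "3 => complex fps"
 assumes L: "lift3 a1 a2 a3 D X Y Z G1 G2 G3 U" and a: "a1 ~= a2" and b: "b ~= a1" "b ~= a2"
  and d: "ge G2 e" and y: "fps_nth (Y b) 1 = 0"
 shows "\<exists>w. w ~= 0 \<and> ge (lin w X) (e + 3)"
proof -
 obtain c where c: "c ~= a1" "c ~= a2" "!!j. j = a1 \<or> j = a2 \<or> j = c" using third_index[OF a] by blast
 then have cb: "c = b" using b by metis
 define y0 where "y0 = fps_nth (Y b) 0"
 define F where "F = X b - fps_const y0 * X a2"
 define F0 where "F0 = fps_nth F 0"
 define w :: "complex^3" where "w = (\<chi> j. if j = b then 1 else if j = a2 then - y0 else - F0)"
 have "lin w X = fps_const (w $ a1) * X a1 + fps_const (w $ a2) * X a2 + fps_const (w $ b) * X b"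
  unfolding lin_def by (rule sum_three[OF a]) (use c cb in auto)
 also have "\<dots> = F - fps_const F0"
  using a b lift3D(2)[OF L] by (simp add: w_def F_def fps_const_neg[symmetric] del: fps_const_neg)
 finally have lw: "lin w X = F - fps_const F0" .
 have "fps_deriv (lin w X) = fps_deriv (X b) - fps_const y0 * fps_deriv (X a2)"
  unfolding lw by (simp add: F_def)
 also have "\<dots> = G2 * (Y b - fps_const y0)"
  using lift3D(4)[OF L, of b] lift3D(4)[OF L, of a2] lift3D(5)[OF L] a b by (simp add: algebra_simps)
 finally have d1: "fps_deriv (lin w X) = G2 * (Y b - fps_const y0)" .
 have "ge (Y b - fps_const y0) 2" using y by (auto simp: ge_def y0_def numeral_2_eq_2 less_Suc_eq)
 from ge_mult[OF d this] have "ge (fps_deriv (lin w X)) (e + 2)" unfolding d1 .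
 then have "ge (lin w X) (Suc (e + 2))" unfolding ge_deriv_iff using lw by (simp add: F0_def)
 moreover have "w $ b = 1" by (simp add: w_def)
 then have "w ~= 0" by auto
 ultimately show ?thesis by (auto simp: numeral_3_eq_3 numeral_2_eq_2)
qed

text \<open>
  If an order were different, or a coordinate vanished, then some linear combination of the \<open>X j\<close> would vanish to
  order three or more, or to the wrong order, contradicting the list of orders. The equations then force
  the values of the remaining coordinates.
\<close>

lemma lift3_orders_345:
 fixes X :: "3 => complex fps"
 assumes L: "lift3 a1 a2 a3 D X Y Z G1 G2 G3 U"
  and o: "!!w. w ~= 0 ==> \<exists>d\<in>{2,3,4}. od (lin w D) d"
 shows "od G1 2" "od G2 0" "od G3 0" "a1 ~= a2" "a1 ~= a3" "fps_nth (Y a1) 0 = 0" "fps_nth (Z a1) 0 = 0"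
  "fps_nth (Z a2) 0 ~= 0" "b ~= a1 ==> b ~= a2 ==> fps_nth (Z b) 0 ~= 0"
  "fps_nth (U a1) 0 ~= 0" "fps_nth (U a3) 0 ~= 0"
proof -
 note E = lift3D[OF L]
 have D: "lin w D = G1 * lin w X" for w using lin_mult[of w G1 X] E(1) by (metis ext)
 obtain d where d: "d \<in> {2,3,4}" "od G1 d" using o[OF axis_nonzero[of a1]] E(1)[of a1] E(2) by (auto simp: lin_axis)
 have "d = 2"
 proof (rule ccontr)
  assume "d ~= 2"
  then have "3 \<le> d" using d(1) by auto
  then have G: "ge G1 3" using ge_mono[OF od_ge[OF d(2)]] by blast
  have g: "ge (D j) 3" for j using ge_mult[OF G ge_0] E(1)[of j] by simp
  obtain w where w: "w ~= 0" "dot w (\<chi> j. fps_nth (D j) 3) = 0" "dot w (\<chi> j. fps_nth (D j) 4) = 0"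
   using exists_orthogonal by blast
  have "ge (lin w D) 3" by (rule ge_lin[OF g])
  then have "ge (lin w D) (Suc 3)" using w(2) by (simp only: ge_Suc lin_nth)
  then have "ge (lin w D) 5" using w(3) ge_Suc[of "lin w D" 4] by (simp add: lin_nth)
  then show False using o[OF w(1)] ge_od_contr by fastforce
 qed
 then show G1: "od G1 2" using d(2) by simp
 have star: "\<not> ge (lin w X) 3" if "w ~= 0" for w
 proof
  assume "ge (lin w X) 3"
  from ge_mult[OF od_ge[OF G1] this] have "ge (lin w D) 5" by (simp add: D)
  then show False using o[OF that] ge_od_contr by fastforce
 qed
 show G2: "od G2 0"
 proof (rule ccontr)
  assume "\<not> od G2 0"
  then have z: "fps_nth G2 0 = 0" by (simp add: od_0)
  have x1: "fps_nth (X j) 1 = 0" for j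
  proof (cases "j = a1")
   case False
   have "fps_nth (fps_deriv (X j)) 0 = fps_nth (G2 * Y j) 0" using E(4)[of j] False by simp
   then show ?thesis using z by simp
  qed (simp add: E(2))
  obtain w where w: "w ~= 0" "dot w (\<chi> j. fps_nth (X j) 0) = 0" "dot w (\<chi> j. fps_nth (X j) 2) = 0"
   using exists_orthogonal by blast
  have "fps_nth (lin w X) 0 = 0" "fps_nth (lin w X) 2 = 0" using w by (simp_all add: lin_nth)
  moreover have "fps_nth (lin w X) 1 = 0" by (simp add: lin_nth x1 dot_def del: One_nat_def)
  ultimately have "ge (lin w X) 3" by (auto simp: ge_def numeral_3_eq_3 numeral_2_eq_2 less_Suc_eq)
  then show False using star[OF w(1)] by blast
 qed
 show a12: "a1 ~= a2" using E(4)[of a2] E(5) G1 G2 od_unique[of G1 2 0] by auto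
 have "G2 * Y a1 = G1" using E(4)[of a1] by simp
 then have Y1: "od (Y a1) 2" using od_cancel[OF G2, of "Y a1" 2] G1 by (simp add: numeral_2_eq_2)
 then show "fps_nth (Y a1) 0 = 0" by (simp add: od_def)
 have "G3 * Z a2 = G2" using E(7)[of a2] by simp
 then show G3: "od G3 0" and Z2: "fps_nth (Z a2) 0 ~= 0" using G2 od_0_mult[of G3 "Z a2"] by (auto simp: od_0)
 have "fps_deriv (Y a1) = G3 * Z a1" using E(7)[of a1] a12 by simp
 moreover have "od (fps_deriv (Y a1)) 1" using od_deriv[of "Y a1" 1] Y1 by (simp add: numeral_2_eq_2)
 ultimately have Z1: "od (Z a1) 1" using od_cancel[OF G3, of "Z a1" 1] by simp
 then show z1: "fps_nth (Z a1) 0 = 0" by (simp add: od_1)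
 show a13: "a1 ~= a3" using z1 E(8) by auto
 show "fps_nth (U a1) 0 ~= 0" using E(10)[of a1] a13 Z1 by (simp add: od_1)
 show "fps_nth (U a3) 0 ~= 0" using E(10)[of a3] G3 by (simp add: od_0)
 assume b: "b ~= a1" "b ~= a2"
 show "fps_nth (Z b) 0 ~= 0"
 proof
  assume "fps_nth (Z b) 0 = 0"
  moreover have "fps_deriv (Y b) = G3 * Z b" using E(7)[of b] b by simp
  ultimately have "fps_nth (fps_deriv (Y b)) 0 = 0" by simp
  then have "fps_nth (Y b) 1 = 0" by simp
  from lift3_relation[OF L a12 b od_ge[OF G2] this] show False using star by auto
 qed
qed

text \<open>
  As before. Here \<open>G1\<close> has order three, and the missing order four of the velocity is a missing order one
  of the \<open>X j\<close>, which forces \<open>G2\<close> to vanish at 0.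
\<close>

lemma lift3_orders_467:
 fixes X :: "3 => complex fps"
 assumes L: "lift3 a1 a2 a3 D X Y Z G1 G2 G3 U"
  and o: "!!w. w ~= 0 ==> \<exists>d\<in>{3,5,6}. od (lin w D) d"
 shows "od G1 3" "od G2 1" "od G3 0" "a1 ~= a2" "a1 ~= a3" "a2 ~= a3" "fps_nth (Y a1) 0 = 0" "fps_nth (Z a1) 0 = 0"
  "fps_nth (Z a2) 0 = 0" "fps_nth (U a1) 0 ~= 0" "fps_nth (U a2) 0 ~= 0" "fps_nth (U a3) 0 ~= 0"
proof -
 note E = lift3D[OF L]
 have D: "lin w D = G1 * lin w X" for w using lin_mult[of w G1 X] E(1) by (metis ext)
 obtain d where d: "d \<in> {3,5,6}" "od G1 d" using o[OF axis_nonzero[of a1]] E(1)[of a1] E(2) by (auto simp: lin_axis)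
 have "d = 3"
 proof (rule ccontr)
  assume "d ~= 3"
  then have "5 \<le> d" using d(1) by auto
  then have G: "ge G1 5" using ge_mono[OF od_ge[OF d(2)]] by blast
  have g: "ge (D j) 5" for j using ge_mult[OF G ge_0] E(1)[of j] by simp
  obtain w where w: "w ~= 0" "dot w (\<chi> j. fps_nth (D j) 5) = 0" "dot w (\<chi> j. fps_nth (D j) 6) = 0"
   using exists_orthogonal by blast
  have "ge (lin w D) 5" by (rule ge_lin[OF g])
  then have "ge (lin w D) (Suc 5)" using w(2) by (simp only: ge_Suc lin_nth)
  then have "ge (lin w D) 7" using w(3) ge_Suc[of "lin w D" 6] by (simp add: lin_nth)
  then show False using o[OF w(1)] ge_od_contr by fastforce
 qed
 then show G1: "od G1 3" using d(2) by simp
 have star: "\<exists>e\<in>{0,2,3}. od (lin w X) e" if w: "w ~= 0" for w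
 proof -
  obtain e where e: "e \<in> {3,5,6}" "od (lin w D) e" using o[OF w] by blast
  have "3 + (e - 3) = e" using e(1) by auto
  then have "od (lin w X) (e - 3)" using od_cancel[OF G1, of "lin w X" "e - 3"] e(2) D by simp
  then show ?thesis using e(1) by auto
 qed
 have star4: "\<not> ge (lin w X) 4" if "w ~= 0" for w using star[OF that] ge_od_contr by fastforce
 have x1: "fps_nth (X j) 1 = 0" for j
 proof (rule ccontr)
  assume n: "fps_nth (X j) 1 ~= 0"
  then have j: "j ~= a1" using E(2) by auto
  obtain c where c: "c ~= a1" "c ~= j" "!!i. i = a1 \<or> i = j \<or> i = c" using third_index[of a1 j] j by blast
  define w :: "complex^3" where "w = (\<chi> i. if i = j then 1 else if i = a1 then - fps_nth (X j) 0 else 0)"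
  have "lin w X = fps_const (w $ a1) * X a1 + fps_const (w $ j) * X j + fps_const (w $ c) * X c"
   unfolding lin_def by (rule sum_three) (use c j in auto)
  also have "\<dots> = X j - fps_const (fps_nth (X j) 0)"
   using c j E(2) by (simp add: w_def fps_const_neg[symmetric] del: fps_const_neg)
  finally have "od (lin w X) 1" using n by (simp add: od_1)
  moreover have "w $ j = 1" by (simp add: w_def)
  then have "w ~= 0" by auto
  ultimately show False using star[of w] od_unique by fastforce
 qed
 have g20: "fps_nth G2 0 = 0"
 proof (cases "a2 = a1")
  case True
  then show ?thesis using E(4)[of a2] E(5) G1 by (simp add: od_def)
 next
  case False
  then have "G2 = fps_deriv (X a2)" using E(4)[of a2] E(5) by simp
  then show ?thesis using x1[of a2] by simp
 qed
 show G2: "od G2 1"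
 proof (rule ccontr)
  assume "\<not> od G2 1"
  then have z: "fps_nth G2 1 = 0" using g20 by (simp add: od_1)
  have x2: "fps_nth (X j) 2 = 0" for j
  proof (cases "j = a1")
   case False
   have "ge G2 2" using g20 z by (auto simp: ge_def numeral_2_eq_2 less_Suc_eq)
   then have "ge (fps_deriv (X j)) 2" using E(4)[of j] False ge_mult[of G2 2 "Y j" 0] by simp
   have "fps_nth (fps_deriv (X j)) 1 = 0" using \<open>ge (fps_deriv (X j)) 2\<close>[unfolded ge_def, rule_format, of 1] by simp
   then show ?thesis by (simp add: numeral_2_eq_2)
  qed (simp add: E(2))
  obtain w where w: "w ~= 0" "dot w (\<chi> j. fps_nth (X j) 0) = 0" "dot w (\<chi> j. fps_nth (X j) 3) = 0"
   using exists_orthogonal by blast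
  have "fps_nth (lin w X) 0 = 0" "fps_nth (lin w X) 3 = 0" using w by (simp_all add: lin_nth)
  moreover have "fps_nth (lin w X) 1 = 0" by (simp add: lin_nth x1 dot_def del: One_nat_def)
  moreover have "fps_nth (lin w X) 2 = 0" by (simp add: lin_nth x2 dot_def)
  ultimately have "ge (lin w X) (Suc (Suc (Suc (Suc 0))))"
   by (simp add: ge_Suc numeral_3_eq_3 numeral_2_eq_2)
  then show False using star4[OF w(1)] by (simp add: eval_nat_numeral)
 qed
 show a12: "a1 ~= a2" using E(4)[of a2] E(5) G1 G2 od_unique[of G1 3 1] by auto
 have "G2 * Y a1 = G1" using E(4)[of a1] by simp
 then have Y1: "od (Y a1) 2" using od_cancel[OF G2, of "Y a1" 2] G1 by (simp add: numeral_2_eq_2 numeral_3_eq_3)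
 then show "fps_nth (Y a1) 0 = 0" by (simp add: od_def)
 obtain b where b: "b ~= a1" "b ~= a2" "!!j. j = a1 \<or> j = a2 \<or> j = b" using third_index[OF a12] by blast
 have "fps_nth (Y b) 1 ~= 0"
 proof
  assume "fps_nth (Y b) 1 = 0"
  from lift3_relation[OF L a12 b(1,2) od_ge[OF G2] this] show False using star4 by auto
 qed
 then have "od (fps_deriv (Y b)) 0" by (simp add: od_0)
 moreover have "fps_deriv (Y b) = G3 * Z b" using E(7)[of b] b by simp
 ultimately have "od G3 0 \<and> od (Z b) 0" using od_0_mult[of G3 "Z b"] by auto
 then show G3: "od G3 0" by blast
 have "fps_deriv (Y a1) = G3 * Z a1" using E(7)[of a1] a12 by simp
 moreover have "od (fps_deriv (Y a1)) 1" using od_deriv[of "Y a1" 1] Y1 by (simp add: numeral_2_eq_2)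
 ultimately have Z1: "od (Z a1) 1" using od_cancel[OF G3, of "Z a1" 1] by simp
 have "G3 * Z a2 = G2" using E(7)[of a2] by simp
 then have Z2: "od (Z a2) 1" using od_cancel[OF G3, of "Z a2" 1] G2 by simp
 show z: "fps_nth (Z a1) 0 = 0" "fps_nth (Z a2) 0 = 0" using Z1 Z2 by (simp_all add: od_1)
 show a3: "a1 ~= a3" "a2 ~= a3" using z E(8) by auto
 show "fps_nth (U a1) 0 ~= 0" "fps_nth (U a2) 0 ~= 0"
  using E(10)[of a1] E(10)[of a2] a3 Z1 Z2 by (simp_all add: od_1)
 show "fps_nth (U a3) 0 ~= 0" using E(10)[of a3] G3 by (simp add: od_0)
qed

text \<open>
  The derivative of \<open>lin w X\<close> is \<open>G2\<close> times a combination of 1 and \<open>Y b\<close>, which vanishes at most to order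
  one if \<open>Y b\<close> has a nonzero derivative at 0.
\<close>

lemma lift3_lin_order:
 fixes X :: "3 => complex fps"
 assumes L: "lift3 a1 a2 a3 D X Y Z G1 G2 G3 U" and a: "a1 ~= a2"
  and b: "b ~= a1" "b ~= a2" "fps_nth (Y b) 1 ~= 0" and d: "od G2 e" and w: "w ~= 0"
 shows "\<not> ge (lin w X) (e + 3)" "e = 1 ==> \<not> od (lin w X) 1"
proof -
 note E = lift3D[OF L]
 obtain c where c: "c ~= a1" "c ~= a2" "!!j. j = a1 \<or> j = a2 \<or> j = c" using third_index[OF a] by blast
 then have cb: "c = b" using b by metis
 have l: "lin w X = fps_const (w $ a1) * X a1 + fps_const (w $ a2) * X a2 + fps_const (w $ b) * X b"
  unfolding lin_def by (rule sum_three[OF a]) (use c cb in auto)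
 have "fps_deriv (lin w X) = fps_const (w $ a2) * fps_deriv (X a2) + fps_const (w $ b) * fps_deriv (X b)"
  unfolding l using E(2) by simp
 also have "\<dots> = G2 * (fps_const (w $ a2) + fps_const (w $ b) * Y b)"
  using E(4)[of b] E(4)[of a2] E(5) a b by (simp add: algebra_simps)
 finally have dl: "fps_deriv (lin w X) = G2 * (fps_const (w $ a2) + fps_const (w $ b) * Y b)" .
 show "\<not> ge (lin w X) (e + 3)"
 proof
  assume g: "ge (lin w X) (e + 3)"
  then have "ge (fps_deriv (lin w X)) (e + 2)" using ge_deriv[of "lin w X" "e + 2"] by (simp add: numeral_3_eq_3 numeral_2_eq_2)
  then have g2: "ge (fps_const (w $ a2) + fps_const (w $ b) * Y b) 2" unfolding dl by (rule ge_cancel[OF d])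
  have "fps_nth (fps_const (w $ a2) + fps_const (w $ b) * Y b) 1 = 0"
   "fps_nth (fps_const (w $ a2) + fps_const (w $ b) * Y b) 0 = 0"
   using g2[unfolded ge_def, rule_format, of 1] g2[unfolded ge_def, rule_format, of 0] by simp_all
  then have wb: "w $ b = 0" "w $ a2 = 0" using b(3) by auto
  have "fps_nth (lin w X) 0 = 0" using g by (simp add: ge_def)
  then have "w $ a1 = 0" unfolding l using wb E(2) by simp
  then have "w $ j = 0" for j using wb c(3)[of j] cb by auto
  then show False using w by (simp add: vec_eq_iff)
 qed
 assume e: "e = 1"
 show "\<not> od (lin w X) 1"
 proof
  assume "od (lin w X) 1"
  then have "od (fps_deriv (lin w X)) 0" using od_deriv[of "lin w X" 0] by simp
  then have "od G2 0" unfolding dl od_0_mult by blast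
  then show False using d e od_unique by fastforce
 qed
qed

text \<open>
  The conditions on the point and the regularity of the velocity give the orders of \<open>G1\<close>, \<open>G2\<close>, \<open>G3\<close>; each level
  contributes its order and one integration to the projections.
\<close>

lemma lift3_imp_345:
 fixes X :: "3 => complex fps"
 assumes L: "lift3 a1 a2 a3 D X Y Z G1 G2 G3 U"
  and h: "fps_nth (Y a1) 0 = 0" "fps_nth (Z a1) 0 = 0" "fps_nth (Z a2) 0 ~= 0"
   "!!b. b ~= a1 ==> b ~= a2 ==> fps_nth (Z b) 0 ~= 0" "fps_nth (U a1) 0 ~= 0" "fps_nth (U a3) 0 ~= 0" and w: "w ~= 0"
 shows "\<exists>d\<in>{2,3,4}. od (lin w D) d"
proof -
 note E = lift3D[OF L]
 have D: "lin w D = G1 * lin w X" for w using lin_mult[of w G1 X] E(1) by (metis ext)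
 have a12: "a1 ~= a2" using E(5) h(1) by auto
 have a13: "a1 ~= a3" using E(8) h(2) by auto
 have G3: "od G3 0" using E(10)[of a3] h(6) by (simp add: od_0)
 have "od (fps_deriv (Z a1)) 0" using E(10)[of a1] h(5) a13 by (simp add: od_0)
 then have Z1: "od (Z a1) 1" using od_deriv_iff[of "Z a1" 0] h(2) by simp
 have "fps_deriv (Y a1) = G3 * Z a1" using E(7)[of a1] a12 by simp
 then have "od (fps_deriv (Y a1)) 1" using od_mult[OF G3 Z1] by simp
 then have Y1: "od (Y a1) 2" using od_deriv_iff[of "Y a1" 1] h(1) by (simp add: numeral_2_eq_2)
 have G2: "od G2 0" using E(7)[of a2] od_mult[OF G3, of "Z a2" 0] h(3) by (simp add: od_0)
 have G1: "od G1 2" using E(4)[of a1] od_mult[OF G2 Y1] by (simp add: numeral_2_eq_2)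
 obtain b where b: "b ~= a1" "b ~= a2" using third_index[OF a12] by blast
 have "od (fps_deriv (Y b)) 0" using E(7)[of b] b od_mult[OF G3, of "Z b" 0] h(4)[OF b] by (simp add: od_0)
 then have yb: "fps_nth (Y b) 1 ~= 0" by (simp add: od_0)
 have "\<not> ge (lin w X) 3" using lift3_lin_order(1)[OF L a12 b yb G2 w] by simp
 then obtain e where e: "e < 3" "od (lin w X) e" using not_ge_od by blast
 have "od (lin w D) (2 + e)" unfolding D by (rule od_mult[OF G1 e(2)])
 moreover have "2 + e \<in> {2,3,4}" using e(1) by auto
 ultimately show ?thesis by blast
qed

lemma lift3_imp_467:
 fixes X :: "3 => complex fps"
 assumes L: "lift3 a1 a2 a3 D X Y Z G1 G2 G3 U"
  and h: "fps_nth (Y a1) 0 = 0" "fps_nth (Z a1) 0 = 0" "fps_nth (Z a2) 0 = 0"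
   "fps_nth (U a1) 0 ~= 0" "fps_nth (U a2) 0 ~= 0" "fps_nth (U a3) 0 ~= 0" and w: "w ~= 0"
 shows "\<exists>d\<in>{3,5,6}. od (lin w D) d"
proof -
 note E = lift3D[OF L]
 have D: "lin w D = G1 * lin w X" for w using lin_mult[of w G1 X] E(1) by (metis ext)
 have a12: "a1 ~= a2" using E(5) h(1) by auto
 have a13: "a1 ~= a3" "a2 ~= a3" using E(8) h(2,3) by auto
 have G3: "od G3 0" using E(10)[of a3] h(6) by (simp add: od_0)
 have "od (fps_deriv (Z a1)) 0" "od (fps_deriv (Z a2)) 0" using E(10)[of a1] E(10)[of a2] h(4,5) a13 by (simp_all add: od_0)
 then have Z1: "od (Z a1) 1" and Z2: "od (Z a2) 1"
  using od_deriv_iff[of "Z a1" 0] od_deriv_iff[of "Z a2" 0] h(2,3) by simp_all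
 have "fps_deriv (Y a1) = G3 * Z a1" using E(7)[of a1] a12 by simp
 then have "od (fps_deriv (Y a1)) 1" using od_mult[OF G3 Z1] by simp
 then have Y1: "od (Y a1) 2" using od_deriv_iff[of "Y a1" 1] h(1) by (simp add: numeral_2_eq_2)
 have G2: "od G2 1" using E(7)[of a2] od_mult[OF G3 Z2] by simp
 have G1: "od G1 3" using E(4)[of a1] od_mult[OF G2 Y1] by (simp add: numeral_3_eq_3)
 have "fps_deriv (Y a3) = G3" using E(7)[of a3] E(8) a13 by simp
 then have yb: "fps_nth (Y a3) 1 ~= 0" using G3 by (auto simp: od_0)
 have a3: "a3 ~= a1" "a3 ~= a2" using a13 by auto
 have "\<not> ge (lin w X) 4" using lift3_lin_order(1)[OF L a12 a3 yb G2 w] by simp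
 then obtain e where e: "e < 4" "od (lin w X) e" using not_ge_od by blast
 have "e ~= 1" using lift3_lin_order(2)[OF L a12 a3 yb G2 w] e(2) by auto
 have "od (lin w D) (3 + e)" unfolding D by (rule od_mult[OF G1 e(2)])
 moreover have "3 + e \<in> {3,5,6}" using e(1) \<open>e ~= 1\<close> by auto
 ultimately show ?thesis by blast
qed

text \<open>
  The remainder of second order of \<open>\<phi>\<close> along \<open>\<gamma>\<close> has order \<open>2 * (e + 1)\<close>, and differentiation lowers it
  by one.
\<close>

lemma component_expansion:
 fixes \<gamma> :: "complex => complex^'n::finite"
 assumes \<phi>: "diffeo_at \<phi> (\<gamma> 0)" and an: "analytic_vec \<gamma> 0" and e: "!!j. ge (fps_deriv (Ev \<gamma> j)) e"
 shows "ge (fps_deriv (Ev (%t. \<phi> (\<gamma> t)) j) -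
  (\<Sum>i\<in>UNIV. fps_const (pdiv (%z. \<phi> z $ j) i (\<gamma> 0)) * fps_deriv (Ev \<gamma> i))) (2 * e + 1)"
proof -
 let ?m = "%i. pdiv (%z. \<phi> z $ j) i (\<gamma> 0)"
 have hn: "hol_near (%z. \<phi> z $ j) (\<gamma> 0)" using \<phi> by (simp add: diffeo_at_def)
 have an': "analytic_vec (%t. \<phi> (\<gamma> t)) 0" by (rule diffeo_analytic_vec[OF \<phi> an])
 have ord: "\<forall>i<Suc e. fps_nth (E (%t. \<gamma> t $ k - \<gamma> 0 $ k)) i = 0" for k
 proof -
  have "E (%t. \<gamma> t $ k - \<gamma> 0 $ k) = Ev \<gamma> k - fps_const (\<gamma> 0 $ k)"
   using E_diff[OF analytic_vecD[OF an, of k], of "%t. \<gamma> 0 $ k"] by (simp add: E_const Ev_def)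
  then have "ge (E (%t. \<gamma> t $ k - \<gamma> 0 $ k)) (Suc e)" unfolding ge_deriv_iff using e[of k] by (simp add: Ev_nth_0)
  then show ?thesis unfolding ge_def .
 qed
 let ?f = "%t. \<phi> (\<gamma> t) $ j - \<phi> (\<gamma> 0) $ j - (\<Sum>i\<in>UNIV. ?m i * (\<gamma> t - \<gamma> 0) $ i)"
 have fa: "?f analytic_on {0}"
  unfolding vector_minus_component
  by (intro analytic_intros analytic_vecD[OF an] analytic_vecD[OF an'])
 have fd: "fd (%z. \<phi> z $ j) (\<gamma> 0) v = (\<Sum>i\<in>UNIV. ?m i * v $ i)" for v
  using fd_sum[OF hol_near_cdiff[OF hn], of v] by (simp add: mult.commute)
 obtain C where "NEAR t. norm (?f t) \<le> C * norm t ^ (2 * Suc e)"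
  using hol_near_taylor_curve[OF hn an ord] unfolding fd by blast
 from E_order_bound[OF fa this] have "ge (E ?f) (Suc (2 * e + 1))" unfolding ge_def by simp
 then have "ge (fps_deriv (E ?f)) (2 * e + 1)" by (rule ge_deriv)
 moreover have "E ?f = Ev (%t. \<phi> (\<gamma> t)) j - fps_const (\<phi> (\<gamma> 0) $ j) - (\<Sum>i\<in>UNIV. fps_const (?m i) * (Ev \<gamma> i - fps_const (\<gamma> 0 $ i)))"
 proof -
  have "E ?f = E (%t. (\<phi> (\<gamma> t) $ j - \<phi> (\<gamma> 0) $ j) - (\<Sum>i\<in>UNIV. ?m i * (\<gamma> t $ i - \<gamma> 0 $ i)))" by simp
  also have "\<dots> = E (%t. \<phi> (\<gamma> t) $ j - \<phi> (\<gamma> 0) $ j) - E (%t. \<Sum>i\<in>UNIV. ?m i * (\<gamma> t $ i - \<gamma> 0 $ i))"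
   by (intro E_diff analytic_intros analytic_vecD[OF an] analytic_vecD[OF an'])
  also have "E (%t. \<phi> (\<gamma> t) $ j - \<phi> (\<gamma> 0) $ j) = Ev (%t. \<phi> (\<gamma> t)) j - fps_const (\<phi> (\<gamma> 0) $ j)"
   using E_diff[OF analytic_vecD[OF an', of j], of "%t. \<phi> (\<gamma> 0) $ j"] by (simp add: E_const Ev_def)
  also have "E (%t. \<Sum>i\<in>UNIV. ?m i * (\<gamma> t $ i - \<gamma> 0 $ i)) = (\<Sum>i\<in>UNIV. E (%t. ?m i * (\<gamma> t $ i - \<gamma> 0 $ i)))"
   by (intro E_sum analytic_intros analytic_vecD[OF an])
  also have "\<dots> = (\<Sum>i\<in>UNIV. fps_const (?m i) * (Ev \<gamma> i - fps_const (\<gamma> 0 $ i)))"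
  proof (rule sum.cong[OF refl])
   fix i
   have "(%t. \<gamma> t $ i - \<gamma> 0 $ i) analytic_on {0}" by (intro analytic_intros analytic_vecD[OF an])
   from E_cmult[OF this] show "E (%t. ?m i * (\<gamma> t $ i - \<gamma> 0 $ i)) = fps_const (?m i) * (Ev \<gamma> i - fps_const (\<gamma> 0 $ i))"
    using E_diff[OF analytic_vecD[OF an, of i], of "%t. \<gamma> 0 $ i"] by (simp add: E_const Ev_def)
  qed
  finally show ?thesis .
 qed
 ultimately show "ge (fps_deriv (Ev (%t. \<phi> (\<gamma> t)) j) - (\<Sum>i\<in>UNIV. fps_const (?m i) * fps_deriv (Ev \<gamma> i))) (2 * e + 1)"
  by (simp add: fps_deriv_sum)
qed

text \<open>
  By \<open>component_expansion\<close> the projection of the image along \<open>w\<close> agrees with the projection of \<open>\<gamma>\<close> along the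
  transposed differential of \<open>w\<close>, to an order above all elements of \<open>S\<close>. The transposed differential is
  injective.
\<close>

lemma velocity_orders_diffeo:
 fixes \<gamma> :: "complex => complex^'n::finite"
 assumes \<phi>: "diffeo_at \<phi> (\<gamma> 0)" and vo: "velocity_orders S \<gamma>" and S: "\<forall>s\<in>S. d \<le> Suc s \<and> Suc s < 2 * d"
 shows "velocity_orders S (%t. \<phi> (\<gamma> t))"
proof -
 have an: "analytic_vec \<gamma> 0" using vo by (simp add: velocity_orders_def)
 have an': "analytic_vec (%t. \<phi> (\<gamma> t)) 0" by (rule diffeo_analytic_vec[OF \<phi> an])
 let ?D = "%j. fps_deriv (Ev \<gamma> j)" and ?D' = "%j. fps_deriv (Ev (%t. \<phi> (\<gamma> t)) j)"
 have o: "\<exists>s\<in>S. od (lin w ?D) s" if "w ~= 0" for w using vo that unfolding velocity_orders_lin by blast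
 \<comment> \<open>All velocity orders are at least \<open>e\<close> and less than \<open>2 * e + 1\<close>.\<close>
 define e where "e = d - 1"
 have e: "ge (?D j) e" for j
 proof -
  obtain s where s: "s \<in> S" "od (lin (axis j 1) ?D) s" using o[OF axis_nonzero] by blast
  have "e \<le> s" using S s(1) by (auto simp: e_def)
  from ge_mono[OF od_ge[OF s(2)] this] show ?thesis unfolding lin_axis .
 qed
 define M :: "complex^'n^'n" where "M = (\<chi> j i. pdiv (%z. \<phi> z $ j) i (\<gamma> 0))"
 have ce: "ge (?D' j - (\<Sum>i\<in>UNIV. fps_const (M $ j $ i) * ?D i)) (2 * e + 1)" for j
  unfolding M_def vec_lambda_beta by (rule component_expansion[where e = e, OF \<phi> an e])
 have hn: "hol_near (%z. \<phi> z $ j) (\<gamma> 0)" for j using \<phi> by (simp add: diffeo_at_def)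
 have fdM: "fd (%z. \<phi> z $ j) (\<gamma> 0) v = (M *v v) $ j" for j v
  using fd_sum[OF hol_near_cdiff[OF hn]] by (simp add: M_def matrix_vector_mult_def)
 have inj: "v = 0" if "M *v v = 0" for v using \<phi> that unfolding diffeo_at_def fdM by simp
 show ?thesis
  unfolding velocity_orders_lin
 proof (intro conjI an' allI impI)
  fix w :: "complex^'n" assume w: "w ~= 0"
  define w' where "w' = transpose M *v w"
  have w'0: "w' ~= 0" using w transpose_kernel[OF inj] unfolding w'_def by blast
  have "fps_nth (lin w' ?D) n = fps_nth (lin w (%j. \<Sum>i\<in>UNIV. fps_const (M $ j $ i) * ?D i)) n" for n
  proof -
   have "fps_nth (lin w' ?D) n = (\<Sum>i\<in>UNIV. \<Sum>j\<in>UNIV. w $ j * (M $ j $ i * fps_nth (?D i) n))"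
    unfolding lin_nth dot_def w'_def
    by (simp add: matrix_vector_mult_def transpose_def sum_distrib_left mult_ac del: fps_deriv_nth)
   also have "\<dots> = (\<Sum>j\<in>UNIV. \<Sum>i\<in>UNIV. w $ j * (M $ j $ i * fps_nth (?D i) n))" by (rule sum.swap)
   also have "\<dots> = fps_nth (lin w (%j. \<Sum>i\<in>UNIV. fps_const (M $ j $ i) * ?D i)) n"
    unfolding lin_nth dot_def by (simp add: fps_sum_nth sum_distrib_left del: fps_deriv_nth)
   finally show ?thesis .
  qed
  then have "lin w' ?D = lin w (%j. \<Sum>i\<in>UNIV. fps_const (M $ j $ i) * ?D i)" by (simp add: fps_eq_iff del: fps_deriv_nth)
  then have diff: "lin w ?D' - lin w' ?D = lin w (%j. ?D' j - (\<Sum>i\<in>UNIV. fps_const (M $ j $ i) * ?D i))"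
   by (simp only: lin_def right_diff_distrib sum_subtractf)
  obtain s where s: "s \<in> S" "od (lin w' ?D) s" using o[OF w'0] by blast
  have "Suc s \<le> 2 * e + 1" using S s(1) by (auto simp: e_def)
  from ge_mono[OF ge_lin[OF ce] this] have "ge (lin w ?D' - lin w' ?D) (Suc s)" unfolding diff .
  from od_congr[OF this s(2)] show "\<exists>s\<in>S. od (lin w ?D') s" using s(1) by blast
 qed
qed

section \<open>Jets\<close>

lemma jet_eq_iff:
 "jet_eq m \<alpha> \<beta> \<longleftrightarrow> (\<forall>j. ge (Ev \<alpha> j - Ev \<beta> j) (Suc m))"
 unfolding jet_eq_def ge_def Ev_def by (auto simp: fps_expansion_def less_Suc_eq_le)

lemma velocity_orders_Ev:
 assumes "velocity_orders S \<gamma>" "analytic_vec \<eta> 0" "!!j. Ev \<gamma> j = Ev \<eta> j"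
 shows "velocity_orders S \<eta>"
 using assms unfolding velocity_orders_lin by simp

text \<open>
  The orders in \<open>S\<close> are so small that the \<open>m\<close>-jet determines them, and equivalences preserve them by
  \<open>velocity_orders_diffeo\<close> and \<open>velocity_orders_reparam\<close>.
\<close>

lemma jet_equivalent_velocity_orders:
 fixes \<gamma> :: "complex => complex^'n::finite"
 assumes je: "jet_equivalent m \<gamma> \<eta>" and an: "analytic_vec \<gamma> 0" and \<eta>: "velocity_orders S \<eta>"
  and S: "\<forall>s\<in>S. d \<le> Suc s \<and> Suc s < 2 * d \<and> Suc s \<le> m"
 shows "velocity_orders S \<gamma>"
proof -
 obtain U \<phi> h where U: "local_diffeo U \<phi>" "\<gamma> 0 \<in> U" and h: "h analytic_on {0}" "h 0 = 0" "deriv h 0 ~= 0"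
  and j: "jet_eq m (%t. \<phi> (\<gamma> (h t))) \<eta>"
  using je unfolding jet_equivalent_def by blast
 let ?\<alpha> = "%t. \<phi> (\<gamma> (h t))"
 have an1: "analytic_vec (%t. \<gamma> (h t)) 0" by (rule reparam_analytic_vec[OF h an])
 have dat: "diffeo_at \<phi> (\<gamma> (h 0))" using local_diffeo_diffeo_at[OF U] h(2) by simp
 have an2: "analytic_vec ?\<alpha> 0" by (rule diffeo_analytic_vec[OF dat an1])
 have m: "\<forall>s\<in>S. s \<le> m - 1" using S by fastforce
 have "velocity_orders S ?\<alpha>"
 proof (cases "S = {}")
  case True
  then show ?thesis using \<eta> axis_nonzero unfolding velocity_orders_def by blast
 next
  case False
  then have m1: "Suc (m - 1) = m" using S by fastforce
  show ?thesis
  proof (rule velocity_orders_cong[OF \<eta> an2 m])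
   fix i
   have "ge (Ev ?\<alpha> i - Ev \<eta> i) (Suc m)" using j unfolding jet_eq_iff by blast
   then have "ge (fps_deriv (Ev ?\<alpha> i - Ev \<eta> i)) m" by (rule ge_deriv)
   then show "ge (fps_deriv (Ev \<eta> i) - fps_deriv (Ev ?\<alpha> i)) (Suc (m - 1))"
    unfolding m1 by (simp add: ge_def) metis
  qed
 qed
 obtain \<psi> where \<psi>: "local_diffeo (\<phi> ` U) \<psi>" "!!z. z \<in> U ==> \<psi> (\<phi> z) = z" using local_diffeo_inverse[OF U(1)] by blast
 have d\<psi>: "diffeo_at \<psi> (?\<alpha> 0)" using local_diffeo_diffeo_at[OF \<psi>(1)] U(2) h(2) by simp
 have vo: "velocity_orders S (%t. \<psi> (?\<alpha> t))"
  by (rule velocity_orders_diffeo[OF d\<psi> \<open>velocity_orders S ?\<alpha>\<close>]) (use S in blast)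
 have "((%t. \<gamma> (h t)) \<longlongrightarrow> \<gamma> (h 0)) (nhds 0)" by (rule analytic_vec_tendsto[OF an1])
 then have "NEAR t. \<gamma> (h t) \<in> U"
  using U h(2) by (auto simp: tendsto_def local_diffeo_def)
 then have "NEAR t. \<psi> (?\<alpha> t) = \<gamma> (h t)" by eventually_elim (rule \<psi>(2))
 then have "Ev (%t. \<psi> (?\<alpha> t)) j = Ev (%t. \<gamma> (h t)) j" for j by (rule Ev_cong)
 then have "velocity_orders S (%t. \<gamma> (h t))" by (rule velocity_orders_Ev[OF vo an1])
 then show ?thesis using velocity_orders_reparam[OF h an] by blast
qed

definition tc :: "(complex => complex^'n::finite) => nat => complex^'n" where
 "tc \<alpha> i = (\<chi> j. fps_nth (Ev \<alpha> j) i)"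

lemma tc_0: "tc \<alpha> 0 = \<alpha> 0"
 by (simp add: tc_def Ev_nth_0 vec_eq_iff)

lemma lin_deriv_nth: "fps_nth (lin w (%j. fps_deriv (Ev \<gamma> j))) i = of_nat (Suc i) * dot w (tc \<gamma> (Suc i))"
 by (simp add: lin_nth dot_def tc_def sum_distrib_left algebra_simps del: of_nat_Suc)

lemma dot_all_zero: "(!!w. w ~= 0 ==> dot w v = 0) ==> v = 0"
 using axis_nonzero dot_axis by (metis vec_eq_iff zero_index)

lemma affine_local_diffeo:
 fixes N :: "complex^'n::finite^'n"
 assumes "M ** N = mat 1" "N ** M = mat 1"
 shows "local_diffeo UNIV (%z. N *v (z - a) + b)"
proof -
 have hol: "holomorphic_map UNIV (%z. N *v (z - a) + b)" for N :: "complex^'n^'n" and a b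
  unfolding holomorphic_map_def
 proof (intro ballI exI conjI allI)
  fix z :: "complex^'n"
  have "bounded_linear (%v. N *v v)"
   by (rule linear_conv_bounded_linear[THEN iffD1])
    (auto intro!: linearI simp: matrix_vector_right_distrib matrix_vector_mult_def vec_eq_iff scaleR_right.sum algebra_simps scaleR_sum_right sum.distrib)
  from bounded_linear.has_derivative[OF this, of "%z. z - a" "%v. v" "at z"]
  have "((%z. N *v (z - a)) has_derivative (%v. N *v v)) (at z)"
   using has_derivative_diff[OF has_derivative_ident[of "at z"] has_derivative_const[of a "at z"]] by simp
  from has_derivative_add[OF this has_derivative_const[of b]]
  show "((%z. N *v (z - a) + b) has_derivative (%v. N *v v)) (at z)" by simp
  show "N *v (s *s v) = s *s (N *v v)" for s v by (simp add: vector_scalar_commute)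
 qed
 have inv: "M *v ((N *v (z - a) + b) - b) + a = z" for z
  using assms(2) by (simp add: matrix_vector_mul_assoc assms)
 have inv': "N *v ((M *v (z - b) + a) - a) + b = z" for z
  by (simp add: matrix_vector_mul_assoc assms)
 have surj: "range (%z. N *v (z - a) + b) = UNIV"
  using inv' by (intro surjI[of _ "%z. M *v (z - b) + a"])
 show ?thesis
  unfolding local_diffeo_def surj using hol inv by (intro conjI exI[of _ "%y. M *v (y - b) + a"]) auto
qed

lemma Ev_affine:
 fixes N :: "complex^'n::finite^'n"
 assumes "analytic_vec \<alpha> 0"
 shows "tc (%t. N *v (\<alpha> t - a) + b) i = N *v tc \<alpha> i + (if i = 0 then b - N *v a else 0)"
proof -
 have "(%t. (N *v (\<alpha> t - a) + b) $ j) = (%t. dot (N $ j) (\<alpha> t) + (b - N *v a) $ j)" for j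
  by (simp add: fun_eq_iff matrix_vector_mult_def dot_def right_diff_distrib sum_subtractf)
 then have "Ev (%t. N *v (\<alpha> t - a) + b) j = E (%t. dot (N $ j) (\<alpha> t)) + fps_const ((b - N *v a) $ j)" for j
  unfolding Ev_def using E_add[OF analytic_dot[OF assms], of "%t. (b - N *v a) $ j"] by (simp add: E_const)
 then show ?thesis
  by (simp add: tc_def vec_eq_iff E_dot[OF assms] fps_sum_nth matrix_vector_mult_def)
qed

lemma tc_power:
 fixes p q r :: nat
 assumes "p < q" "q < r"
 shows "tc (%t. vector [t ^ p, t ^ q, t ^ r] :: complex^3) i =
  (if i = p then axis 1 1 else if i = q then axis 2 1 else if i = r then axis 3 1 else 0)"
  and "analytic_vec (%t. vector [t ^ p, t ^ q, t ^ r] :: complex^3) 0"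
proof -
 have X: "E (%t. t ^ n) = fps_X ^ n" for n by (intro E_eqI has_fps_expansion_fps_X_power)
 show "analytic_vec (%t. vector [t ^ p, t ^ q, t ^ r] :: complex^3) 0"
  unfolding analytic_vec_def forall_3 by (auto intro!: analytic_intros)
 show "tc (%t. vector [t ^ p, t ^ q, t ^ r] :: complex^3) i =
  (if i = p then axis 1 1 else if i = q then axis 2 1 else if i = r then axis 3 1 else 0)"
  unfolding tc_def vec_eq_iff forall_3 Ev_def using assms by (auto simp: X axis_def)
qed

text \<open>
  The affine map sends the three Taylor vectors to the standard basis; it is invertible because they are
  independent. Both directions are needed: one maps the jet to the monomial curve, the other back.
\<close>

lemma monomial_normal_form:
 fixes \<alpha> :: "complex => complex^3"
 assumes an: "analytic_vec \<alpha> 0" and pqr: "0 < p" "p < q" "q < r" "r \<le> m"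
  and z: "!!i. 0 < i ==> i \<le> m ==> i \<notin> {p, q, r} ==> tc \<alpha> i = 0"
  and ind: "!!w. dot w (tc \<alpha> p) = 0 ==> dot w (tc \<alpha> q) = 0 ==> dot w (tc \<alpha> r) = 0 ==> w = 0"
 obtains \<phi> \<psi> where "local_diffeo UNIV \<phi>" "jet_eq m (%t. \<phi> (\<alpha> t)) (%t. vector [t ^ p, t ^ q, t ^ r])"
  "local_diffeo UNIV \<psi>" "jet_eq m \<alpha> (%t. \<psi> (vector [t ^ p, t ^ q, t ^ r]))"
proof -
 define A :: "complex^3^3" where "A = (\<chi> i. if i = 1 then tc \<alpha> p else if i = 2 then tc \<alpha> q else tc \<alpha> r)"
 have "w = 0" if "A *v w = 0" for w
 proof -
  have d: "(A *v w) $ i = dot w (A $ i)" for i by (simp add: matrix_vector_mult_def dot_def mult.commute)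
  have "dot w (A $ i) = 0" for i using that d[of i] by simp
  from this[of 1] this[of 2] this[of 3] show ?thesis by (intro ind) (auto simp: A_def)
 qed
 then obtain B where B: "B ** A = mat 1" using matrix_left_invertible_ker[of A] by blast
 then have B': "A ** B = mat 1" using matrix_left_right_inverse by blast
 define M where "M = transpose A"
 define N where "N = transpose B"
 have NM: "N ** M = mat 1" "M ** N = mat 1"
  unfolding M_def N_def using B B' by (metis matrix_transpose_mul transpose_mat)+
 have "M *v axis k 1 = A $ k" for k
  unfolding vec_eq_iff
 proof
  fix i
  have "(M *v axis k 1) $ i = dot (axis k 1) (M $ i)" by (simp add: matrix_vector_mult_def dot_def mult.commute)
  then show "(M *v axis k 1) $ i = A $ k $ i" unfolding dot_axis by (simp add: M_def transpose_def)
 qed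
 from this[of 1] this[of 2] this[of 3]
 have col: "M *v axis 1 1 = tc \<alpha> p" "M *v axis 2 1 = tc \<alpha> q" "M *v axis 3 1 = tc \<alpha> r"
  by (simp_all add: A_def)
 have col': "N *v tc \<alpha> p = axis 1 1" "N *v tc \<alpha> q = axis 2 1" "N *v tc \<alpha> r = axis 3 1"
  unfolding col[symmetric] by (simp_all add: matrix_vector_mul_assoc NM)
 let ?\<eta> = "%t. vector [t ^ p, t ^ q, t ^ r] :: complex^3"
 let ?\<phi> = "%z. N *v (z - \<alpha> 0) + 0" and ?\<psi> = "%y. M *v (y - 0) + \<alpha> 0"
 have jt: "jet_eq m \<beta> \<delta> \<longleftrightarrow> (\<forall>i\<le>m. tc \<beta> i = tc \<delta> i)" for \<beta> \<delta> :: "complex => complex^3"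
  unfolding jet_eq_iff ge_def tc_def vec_eq_iff by (auto simp: less_Suc_eq_le)
 have e: "tc ?\<eta> i = (if i = p then axis 1 1 else if i = q then axis 2 1 else if i = r then axis 3 1 else 0)" for i
  by (rule tc_power(1)[OF pqr(2,3)])
 have "jet_eq m (%t. ?\<phi> (\<alpha> t)) ?\<eta>"
  unfolding jt
 proof (intro allI impI)
  fix i assume i: "i \<le> m"
  show "tc (%t. ?\<phi> (\<alpha> t)) i = tc ?\<eta> i"
  proof (cases "i = 0")
   case True
   then show ?thesis unfolding Ev_affine[OF an] e using pqr by (simp add: tc_0)
  next
   case False
   then show ?thesis unfolding Ev_affine[OF an] e using pqr z[of i] i col' by auto
  qed
 qed
 moreover have "jet_eq m \<alpha> (%t. ?\<psi> (?\<eta> t))"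
  unfolding jt
 proof (intro allI impI)
  fix i assume i: "i \<le> m"
  show "tc \<alpha> i = tc (%t. ?\<psi> (?\<eta> t)) i"
  proof (cases "i = 0")
   case True
   then show ?thesis unfolding Ev_affine[OF tc_power(2)[OF pqr(2,3)]] e using pqr by (simp add: tc_0)
  next
   case False
   then show ?thesis unfolding Ev_affine[OF tc_power(2)[OF pqr(2,3)]] e using pqr z[of i] i col by auto
  qed
 qed
 ultimately show thesis
  using that affine_local_diffeo[OF NM(2,1), of "\<alpha> 0" 0] affine_local_diffeo[OF NM, of 0 "\<alpha> 0"] by blast
qed

lemma od_lin_deriv:
 "od (lin w (%j. fps_deriv (Ev \<gamma> j))) d \<longleftrightarrow> (\<forall>i. 0 < i \<and> i \<le> d --> dot w (tc \<gamma> i) = 0) \<and> dot w (tc \<gamma> (Suc d)) ~= 0"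
proof -
 have n: "of_nat (Suc i) ~= (0::complex)" for i by (rule of_nat_neq_0)
 have "(\<forall>i<d. dot w (tc \<gamma> (Suc i)) = 0) \<longleftrightarrow> (\<forall>i. 0 < i \<and> i \<le> d --> dot w (tc \<gamma> i) = 0)"
  by (metis Suc_le_eq gr0_conv_Suc zero_less_Suc)
 then show ?thesis unfolding od_def lin_deriv_nth mult_eq_0_iff using n by blast
qed

lemma normal_form_345:
 fixes \<gamma> :: "complex => complex^3"
 assumes vo: "velocity_orders {2,3,4} \<gamma>"
 obtains \<phi> \<psi> where "local_diffeo UNIV \<phi>" "jet_eq 5 (%t. \<phi> (\<gamma> t)) (%t. vector [t ^ 3, t ^ 4, t ^ 5])"
  "local_diffeo UNIV \<psi>" "jet_eq 5 \<gamma> (%t. \<psi> (vector [t ^ 3, t ^ 4, t ^ 5]))"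
proof -
 have o: "\<exists>d\<in>{2,3,4}. od (lin w (%j. fps_deriv (Ev \<gamma> j))) d" if "w ~= 0" for w
  using vo that unfolding velocity_orders_lin by blast
 have z: "tc \<gamma> i = 0" if "0 < i" "i \<le> 2" for i
 proof (rule dot_all_zero)
  fix w :: "complex^3" assume "w ~= 0"
  from o[OF this] show "dot w (tc \<gamma> i) = 0" using that unfolding od_lin_deriv by auto
 qed
 have ind: "w = 0" if "dot w (tc \<gamma> 3) = 0" "dot w (tc \<gamma> 4) = 0" "dot w (tc \<gamma> 5) = 0" for w
 proof (rule ccontr)
  assume "w ~= 0"
  from o[OF this] show False using that unfolding od_lin_deriv by (auto simp: numeral_eq_Suc)
 qed
 show thesis
 proof (rule monomial_normal_form[of \<gamma> 3 4 5 5])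
  show "analytic_vec \<gamma> 0" using vo by (simp add: velocity_orders_def)
  show "tc \<gamma> i = 0" if "0 < i" "i \<le> 5" "i \<notin> {3, 4, 5}" for i
  proof -
   have "i \<le> 2" using that by auto
   then show ?thesis using z that by blast
  qed
 qed (use ind that in auto)
qed

text \<open>
  The absence of the velocity order four makes the Taylor vector of order five a multiple of the one of
  order four. The reparametrization \<open>t + s t\<^sup>2\<close> adds \<open>4 s\<close> times the latter to the former, so a suitable
  \<open>s\<close> removes it.
\<close>

lemma normal_form_467:
 fixes \<gamma> :: "complex => complex^3"
 assumes vo: "velocity_orders {3,5,6} \<gamma>"
 obtains h \<phi> \<psi> where "h analytic_on {0}" "h 0 = 0" "deriv h 0 ~= 0"
  "local_diffeo UNIV \<phi>" "jet_eq 7 (%t. \<phi> (\<gamma> (h t))) (%t. vector [t ^ 4, t ^ 6, t ^ 7])"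
  "local_diffeo UNIV \<psi>" "jet_eq 7 (%t. \<gamma> (h t)) (%t. \<psi> (vector [t ^ 4, t ^ 6, t ^ 7]))"
proof -
 have an: "analytic_vec \<gamma> 0" using vo by (simp add: velocity_orders_def)
 have facts: "(\<forall>i. 0 < i \<and> i \<le> 3 --> tc \<delta> i = 0) \<and> (\<forall>w. dot w (tc \<delta> 4) = 0 --> dot w (tc \<delta> 5) = 0) \<and>
   (\<forall>w. dot w (tc \<delta> 4) = 0 \<and> dot w (tc \<delta> 6) = 0 \<and> dot w (tc \<delta> 7) = 0 --> w = 0)"
  if v: "velocity_orders {3,5,6} \<delta>" for \<delta> :: "complex => complex^3"
 proof -
  have o: "\<exists>d\<in>{3,5,6}. od (lin w (%j. fps_deriv (Ev \<delta> j))) d" if "w ~= 0" for w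
   using v that unfolding velocity_orders_lin by blast
  have z: "tc \<delta> i = 0" if "0 < i" "i \<le> 3" for i
  proof (rule dot_all_zero)
   fix w :: "complex^3" assume "w ~= 0"
   from o[OF this] show "dot w (tc \<delta> i) = 0" using that unfolding od_lin_deriv by auto
  qed
  have five: "dot w (tc \<delta> 5) = 0" if "dot w (tc \<delta> 4) = 0" for w
  proof (cases "w = 0")
   case False
   from o[OF this] show ?thesis using that unfolding od_lin_deriv by (auto simp: numeral_eq_Suc)
  qed (simp add: dot_linear)
  have "w = 0" if "dot w (tc \<delta> 4) = 0" "dot w (tc \<delta> 6) = 0" "dot w (tc \<delta> 7) = 0" for w
  proof (rule ccontr)
   assume "w ~= 0"
   from o[OF this] show False using that five unfolding od_lin_deriv by (auto simp: numeral_eq_Suc)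
  qed
  then show ?thesis using z five by blast
 qed
 have nz4: "tc \<gamma> 4 ~= 0"
 proof
  assume "tc \<gamma> 4 = 0"
  moreover obtain w where "w ~= 0" "dot w (tc \<gamma> 6) = 0" "dot w (tc \<gamma> 7) = 0" using exists_orthogonal by blast
  ultimately show False using facts[OF vo] by (auto simp: dot_linear)
 qed
 then obtain k where k: "tc \<gamma> 4 $ k ~= 0" by (auto simp: vec_eq_iff)
 \<comment> \<open>The coefficient of order five of \<open>\<gamma>\<close> at \<open>t + s t\<^sup>2\<close> is \<open>tc \<gamma> 5 + 4 * s * tc \<gamma> 4\<close>.\<close>
 define s where "s = - (tc \<gamma> 5 $ k) / (4 * tc \<gamma> 4 $ k)"
 have par: "tc \<gamma> 5 $ i = - 4 * s * tc \<gamma> 4 $ i" for i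
 proof -
  define w :: "complex^3" where "w = (tc \<gamma> 4 $ k) *s axis i 1 - (tc \<gamma> 4 $ i) *s axis k 1"
  have d: "dot w v = tc \<gamma> 4 $ k * v $ i - tc \<gamma> 4 $ i * v $ k" for v
  proof -
   have "dot w v = dot v w" by (simp add: dot_def mult.commute)
   also have e: "\<dots> = tc \<gamma> 4 $ k * dot v (axis i 1) - tc \<gamma> 4 $ i * dot v (axis k 1)" by (simp add: w_def dot_linear)
   also have "\<dots> = tc \<gamma> 4 $ k * v $ i - tc \<gamma> 4 $ i * v $ k"
    using dot_axis[of i v] dot_axis[of k v] by (simp add: dot_def mult.commute)
   finally show ?thesis .
  qed
  have "dot w (tc \<gamma> 4) = 0" unfolding d by simp
  then have "dot w (tc \<gamma> 5) = 0" using facts[OF vo] by blast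
  then have e: "tc \<gamma> 4 $ k * tc \<gamma> 5 $ i = tc \<gamma> 4 $ i * tc \<gamma> 5 $ k" unfolding d by simp
  have "- 4 * s = tc \<gamma> 5 $ k / tc \<gamma> 4 $ k" using k by (simp add: s_def field_simps)
  have "tc \<gamma> 4 $ k * tc \<gamma> 5 $ i = tc \<gamma> 4 $ k * (- 4 * s * tc \<gamma> 4 $ i)"
  proof -
   have k5: "tc \<gamma> 5 $ k = - 4 * s * tc \<gamma> 4 $ k"
    using \<open>- 4 * s = tc \<gamma> 5 $ k / tc \<gamma> 4 $ k\<close> k by (simp add: field_simps)
   show ?thesis unfolding e k5 by (simp only: mult_ac)
  qed
  then show ?thesis unfolding mult_cancel_left using k by blast
 qed
 let ?h = "%t::complex. t + s * t\<^sup>2"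
 have hE: "?h has_fps_expansion (fps_X + fps_const s * fps_X ^ 2)"
  by (intro has_fps_expansion_add has_fps_expansion_fps_X has_fps_expansion_cmult_left has_fps_expansion_fps_X_power)
 then have Eh: "E ?h = fps_X + fps_const s * fps_X ^ 2" by (rule E_eqI)
 have h: "?h analytic_on {0}" "?h 0 = 0" "deriv ?h 0 ~= 0"
 proof -
  show "?h analytic_on {0}" by (intro analytic_intros)
  have "deriv ?h 0 = 1" by (rule DERIV_imp_deriv) (auto intro!: derivative_eq_intros)
  then show "deriv ?h 0 ~= 0" by simp
 qed simp
 let ?\<delta> = "%t. \<gamma> (?h t)"
 have vo': "velocity_orders {3,5,6} ?\<delta>" using velocity_orders_reparam[OF h an] vo by blast
 have z5: "tc ?\<delta> 5 = 0"
 proof -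
  have "fps_nth (Ev ?\<delta> j) 5 = 0" for j
  proof -
   let ?F = "Ev \<gamma> j" and ?H = "fps_X + fps_const s * fps_X ^ 2 :: complex fps"
   have comp: "Ev ?\<delta> j = ?F oo ?H"
    unfolding Ev_def using od_compose(1)[OF h analytic_vecD[OF an, of j]] Eh by simp
   have F0: "fps_nth ?F 1 = 0" "fps_nth ?F 2 = 0" "fps_nth ?F 3 = 0"
   proof -
    have "tc \<gamma> 1 = 0" "tc \<gamma> 2 = 0" "tc \<gamma> 3 = 0" using facts[OF vo] by auto
    then show "fps_nth ?F 1 = 0" "fps_nth ?F 2 = 0" "fps_nth ?F 3 = 0" by (auto simp: tc_def vec_eq_iff)
   qed
   have H: "?H = fps_X * (1 + fps_const s * fps_X)" by (simp add: algebra_simps power2_eq_square)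
   have H4: "fps_nth (?H ^ 4) 5 = 4 * s"
   proof -
    have "fps_nth (?H ^ 4) 5 = fps_nth ((1 + fps_const s * fps_X) ^ 4) 1"
     unfolding H power_mult_distrib by (simp add: fps_X_power_mult_nth)
    also have "\<dots> = 4 * s" by (simp add: eval_nat_numeral fps_mult_nth algebra_simps)
    finally show ?thesis .
   qed
   have H5: "fps_nth (?H ^ 5) 5 = 1"
    unfolding H power_mult_distrib by (simp add: fps_X_power_mult_nth fps_power_zeroth)
   have "fps_nth (?F oo ?H) 5 = (\<Sum>i=0..5. fps_nth ?F i * fps_nth (?H ^ i) 5)" by (rule fps_compose_nth)
   also have "{0..5} = {0,1,2,3,4,5::nat}" by auto
   also have "(\<Sum>i\<in>{0,1,2,3,4,5}. fps_nth ?F i * fps_nth (?H ^ i) 5) = fps_nth ?F 4 * (4 * s) + fps_nth ?F 5"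
    using F0 H4 H5 by simp
   also have "\<dots> = 0" using par[of j] by (simp add: tc_def)
   finally show ?thesis using comp by simp
  qed
  then show ?thesis by (simp add: tc_def vec_eq_iff)
 qed
 show thesis
 proof (rule monomial_normal_form[of ?\<delta> 4 6 7 7])
  show "analytic_vec ?\<delta> 0" by (rule reparam_analytic_vec[OF h an])
  show "tc ?\<delta> i = 0" if "0 < i" "i \<le> 7" "i \<notin> {4, 6, 7}" for i
  proof -
   have "i \<le> 3 \<or> i = 5" using that by auto
   then show ?thesis using facts[OF vo'] z5 that(1) by blast
  qed
  show "w = 0" if "dot w (tc ?\<delta> 4) = 0" "dot w (tc ?\<delta> 6) = 0" "dot w (tc ?\<delta> 7) = 0" for w
   using facts[OF vo'] that by blast
 qed (use that[OF h] in auto)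
qed

lemma velocity_orders_monomial:
 fixes p q r :: nat
 assumes "0 < p" "p < q" "q < r"
 shows "velocity_orders {p - 1, q - 1, r - 1} (%t. vector [t ^ p, t ^ q, t ^ r] :: complex^3)"
 unfolding velocity_orders_lin
proof (intro conjI allI impI tc_power(2) assms)
 let ?\<eta> = "%t. vector [t ^ p, t ^ q, t ^ r] :: complex^3"
 fix w :: "complex^3" assume "w ~= 0"
 then have w: "w $ 1 ~= 0 \<or> w $ 2 ~= 0 \<or> w $ 3 ~= 0" by (auto simp: vec_eq_iff forall_3)
 have ax: "dot w (axis k 1) = w $ k" for k using dot_axis[of k w] by (simp add: dot_def mult.commute)
 have d: "dot w (tc ?\<eta> i) = (if i = p then w $ 1 else if i = q then w $ 2 else if i = r then w $ 3 else 0)" for i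
  unfolding tc_power(1)[OF assms(2,3)] by (simp add: ax dot_linear)
 have S: "Suc (p - 1) = p" "Suc (q - 1) = q" "Suc (r - 1) = r" using assms by auto
 consider "w $ 1 ~= 0" | "w $ 1 = 0" "w $ 2 ~= 0" | "w $ 1 = 0" "w $ 2 = 0" "w $ 3 ~= 0" using w by blast
 then show "\<exists>e\<in>{p - 1, q - 1, r - 1}. od (lin w (%j. fps_deriv (Ev ?\<eta> j))) e"
 proof cases
  case 1
  then have "od (lin w (%j. fps_deriv (Ev ?\<eta> j))) (p - 1)" unfolding od_lin_deriv d S using assms by auto
  then show ?thesis by blast
 next
  case 2
  then have "od (lin w (%j. fps_deriv (Ev ?\<eta> j))) (q - 1)" unfolding od_lin_deriv d S using assms by auto
  then show ?thesis by blast
 next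
  case 3
  then have "od (lin w (%j. fps_deriv (Ev ?\<eta> j))) (r - 1)" unfolding od_lin_deriv d S using assms by auto
  then show ?thesis by blast
 qed
qed

lemma curves_with_jet_345:
 "curves_with_jet 5 (%t. vector [t ^ 3, t ^ 4, t ^ 5]) = {\<gamma> :: complex => complex^3. velocity_orders {2,3,4} \<gamma>}"
proof (intro equalityI subsetI)
 fix \<gamma> :: "complex => complex^3" assume "\<gamma> \<in> curves_with_jet 5 (%t. vector [t ^ 3, t ^ 4, t ^ 5])"
 then have g: "analytic_vec \<gamma> 0" "jet_equivalent 5 \<gamma> (%t. vector [t ^ 3, t ^ 4, t ^ 5])"
  by (auto simp: curves_with_jet_def analytic_germ_def analytic_vec_def)
 have "velocity_orders {2,3,4} \<gamma>"
  by (rule jet_equivalent_velocity_orders[OF g(2,1), where d=3]) (use velocity_orders_monomial[of 3 4 5] in auto)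
 then show "\<gamma> \<in> {\<gamma>. velocity_orders {2,3,4} \<gamma>}" by simp
next
 fix \<gamma> :: "complex => complex^3" assume "\<gamma> \<in> {\<gamma>. velocity_orders {2,3,4} \<gamma>}"
 then have v: "velocity_orders {2,3,4} \<gamma>" by simp
 then have "analytic_germ \<gamma>" by (simp add: velocity_orders_def analytic_germ_def analytic_vec_def)
 moreover obtain \<phi> where "local_diffeo UNIV \<phi>" "jet_eq 5 (%t. \<phi> (\<gamma> t)) (%t. vector [t ^ 3, t ^ 4, t ^ 5])"
  using normal_form_345[OF v] by blast
 then have "jet_equivalent 5 \<gamma> (%t. vector [t ^ 3, t ^ 4, t ^ 5])"
  unfolding jet_equivalent_def by (intro exI[of _ UNIV] exI[of _ \<phi>] exI[of _ "%t. t"]) (auto intro: analytic_intros)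
 ultimately show "\<gamma> \<in> curves_with_jet 5 (%t. vector [t ^ 3, t ^ 4, t ^ 5])" by (simp add: curves_with_jet_def)
qed

lemma curves_with_jet_467:
 "curves_with_jet 7 (%t. vector [t ^ 4, t ^ 6, t ^ 7]) = {\<gamma> :: complex => complex^3. velocity_orders {3,5,6} \<gamma>}"
proof (intro equalityI subsetI)
 fix \<gamma> :: "complex => complex^3" assume "\<gamma> \<in> curves_with_jet 7 (%t. vector [t ^ 4, t ^ 6, t ^ 7])"
 then have g: "analytic_vec \<gamma> 0" "jet_equivalent 7 \<gamma> (%t. vector [t ^ 4, t ^ 6, t ^ 7])"
  by (auto simp: curves_with_jet_def analytic_germ_def analytic_vec_def)
 have "velocity_orders {3,5,6} \<gamma>"
  by (rule jet_equivalent_velocity_orders[OF g(2,1), where d=4]) (use velocity_orders_monomial[of 4 6 7] in auto)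
 then show "\<gamma> \<in> {\<gamma>. velocity_orders {3,5,6} \<gamma>}" by simp
next
 fix \<gamma> :: "complex => complex^3" assume "\<gamma> \<in> {\<gamma>. velocity_orders {3,5,6} \<gamma>}"
 then have v: "velocity_orders {3,5,6} \<gamma>" by simp
 then have "analytic_germ \<gamma>" by (simp add: velocity_orders_def analytic_germ_def analytic_vec_def)
 moreover have "jet_equivalent 7 \<gamma> (%t. vector [t ^ 4, t ^ 6, t ^ 7])"
  by (rule normal_form_467[OF v]) (unfold jet_equivalent_def, blast)
 ultimately show "\<gamma> \<in> curves_with_jet 7 (%t. vector [t ^ 4, t ^ 6, t ^ 7])" by (simp add: curves_with_jet_def)
qed

section \<open>The classes of level three\<close>

lemma monster_chart: "p \<in> monster k \<longleftrightarrow> (\<exists>c x. length c = k \<and> x \<in> chart_dom c \<and> p = param k c x)"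
 unfolding monster_eq chart_pts_def by blast

lemma monster_chartI: "length c = k ==> x \<in> chart_dom c ==> param k c x \<in> monster k"
 unfolding monster_eq by (rule chart_ptsI)

lemma critical_index_upd:
 "critical_index c (x(Suc (length c) := z)) j \<longleftrightarrow> critical_index c x j"
 unfolding critical_index_def by auto

text \<open>
  The letter of a level depends on the line over the previous level, whose vertical space belongs to the
  head of \<open>c\<close>; on the base there is none.
\<close>

lemma code_Cons:
 assumes x: "x \<in> chart_dom (a # c)"
 shows "code (Suc (length c)) (param (Suc (length c)) (a # c) x) = code (length c) (param (length c) c x) @
  [if c ~= [] \<and> x (Suc (length c)) $ hd c = 0 then V
   else if \<forall>j. critical_index c x j --> x (Suc (length c)) $ (c ! j) ~= 0 then R else T]"
proof -
 let ?x = "x(Suc (length c) := 0)" and ?y = "x (Suc (length c))" and ?p = "param (Suc (length c)) (a # c) x"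
 have x0: "?x \<in> chart_dom c" using x by simp
 have u: "under ?p = param (length c) c ?x" using under_param[OF x] by simp
 have d: "dir ?p = tline (tvf c ?x ?y)" using param_Suc[OF x] by simp
 have r: "regular_line (length c) (under ?p) (dir ?p) \<longleftrightarrow> (\<forall>j. critical_index c x j --> ?y $ (c ! j) ~= 0)"
  unfolding u d using regular_line_chart[OF x0, of ?y] by (simp only: critical_index_upd)
 have v: "vertical_line (length c) (under ?p) (dir ?p) \<longleftrightarrow> c ~= [] \<and> ?y $ hd c = 0"
 proof (cases c)
  case (Cons b d)
  then show ?thesis unfolding u \<open>dir ?p = tline (tvf c ?x ?y)\<close> using vertical_line_chart[of ?x b d ?y] x0 by simp
 qed (simp add: vertical_line_def)
 have "under ?p = param (length c) c x" using under_param[OF x] .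
 then show ?thesis unfolding code.simps v r by simp
qed

context
 fixes a1 a2 a3 :: "'n::finite" and x :: "'n coords"
 assumes x: "x \<in> chart_dom [a3, a2, a1]"
begin

lemma chart3: "x 3 $ a3 = 1" "x 2 $ a2 = 1" "x 1 $ a1 = 1"
 using x by (simp_all add: numeral_3_eq_3 numeral_2_eq_2)

lemma chart3_lower: "x(3 := 0) \<in> chart_dom [a2, a1]" "x(3 := 0, 2 := 0) \<in> chart_dom [a1]"
 using x by (simp_all add: numeral_3_eq_3 numeral_2_eq_2 del: fun_upd_apply)

lemma critical_index_level2: "critical_index [a2, a1] x j \<longleftrightarrow> j = 0 \<or> j = 1 \<and> x 2 $ a1 = 0"
proof -
 have len: "length [a2, a1] = 2" by simp
 have s: "(2 - 1 < m \<and> m \<le> 2) = (m = 2)" for m :: nat by auto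
 have e: "[a2, a1] ! 1 = a1" by simp
 have 1: "critical_index [a2, a1] x 1 \<longleftrightarrow> x 2 $ a1 = 0"
  unfolding critical_index_def len s e by simp
 consider "j = 0" | "j = 1" | "j \<ge> 2" by linarith
 then show ?thesis
 proof cases
  case j: 2
  show ?thesis unfolding j 1 by simp
 qed (auto simp: critical_index_def)
qed

text \<open>
  The three candidates come from the fibers of level three, two and one.
\<close>

lemma critical_index_level3:
 "critical_index [a3, a2, a1] x j \<longleftrightarrow> j = 0 \<or> j = 1 \<and> x 3 $ a2 = 0 \<or> j = 2 \<and> x 2 $ a1 = 0 \<and> x 3 $ a1 = 0"
proof -
 have len: "length [a3, a2, a1] = 3" by simp
 have s: "(3 - 1 < m \<and> m \<le> 3) = (m = 3)" "(3 - 2 < m \<and> m \<le> 3) = (m = 2 \<or> m = 3)" for m :: nat by auto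
 have e: "[a3, a2, a1] ! 1 = a2" "[a3, a2, a1] ! 2 = a1" by simp_all
 have 1: "critical_index [a3, a2, a1] x 1 \<longleftrightarrow> x 3 $ a2 = 0"
  unfolding critical_index_def len s e by simp
 have 2: "critical_index [a3, a2, a1] x 2 \<longleftrightarrow> x 2 $ a1 = 0 \<and> x 3 $ a1 = 0"
  unfolding critical_index_def len s e by auto
 consider "j = 0" | "j = 1" | "j = 2" | "j \<ge> 3" by linarith
 then show ?thesis
 proof cases
  case j: 2
  show ?thesis unfolding j 1 by simp
 next
  case j: 3
  show ?thesis unfolding j 2 by simp
 qed (auto simp: critical_index_def)
qed

lemma code_level3:
 "code 3 (param 3 [a3, a2, a1] x) = [R, if x 2 $ a1 = 0 then V else R,
   if x 3 $ a2 = 0 then V else if x 2 $ a1 = 0 \<and> x 3 $ a1 = 0 then T else R]"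
 "code 2 (param 2 [a2, a1] x) = [R, if x 2 $ a1 = 0 then V else R]"
proof -
 have "code 1 (param 1 [a1] (x(3 := 0, 2 := 0))) = [R]"
  using code_Cons[of "x(3 := 0, 2 := 0)" a1 "[]"] chart3_lower(2)
  by (simp add: critical_index_def del: param.simps fun_upd_apply)
 then have 1: "code 1 (param 1 [a1] x) = [R]" by simp
 have "code 2 (param 2 [a2, a1] (x(3 := 0))) = code 1 (param 1 [a1] (x(3 := 0))) @
   [if x 2 $ a1 = 0 then V else R]"
  using code_Cons[of "x(3 := 0)" a2 "[a1]"] chart3_lower(1)
  by (auto simp: critical_index_def numeral_2_eq_2 simp del: param.simps code.simps)
 then show 2: "code 2 (param 2 [a2, a1] x) = [R, if x 2 $ a1 = 0 then V else R]" using 1 by simp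
 have "code 3 (param 3 [a3, a2, a1] x) = code 2 (param 2 [a2, a1] x) @
   [if x 3 $ a2 = 0 then V else if \<forall>j. critical_index [a2, a1] x j --> x 3 $ ([a2, a1] ! j) ~= 0 then R else T]"
  using code_Cons[OF x] by (simp add: numeral_3_eq_3 numeral_2_eq_2 del: param.simps code.simps)
 then show "code 3 (param 3 [a3, a2, a1] x) = [R, if x 2 $ a1 = 0 then V else R,
   if x 3 $ a2 = 0 then V else if x 2 $ a1 = 0 \<and> x 3 $ a1 = 0 then T else R]"
  unfolding critical_index_level2 2 by auto
qed

lemma RVL_chart: "param 3 [a3, a2, a1] x \<in> RVL \<longleftrightarrow> x 2 $ a1 = 0 \<and> x 3 $ a2 = 0 \<and> x 3 $ a1 = 0"
proof -
 let ?p = "param 3 [a3, a2, a1] x" and ?x = "x(3 := 0)"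
 have len: "length [a2, a1] = 2" "Suc 2 = 3" by simp_all
 have "?p = Prol (param 2 [a2, a1] x) (tline (tvf [a2, a1] x (x 3)))" using param_Suc[OF x] unfolding len .
 then have u': "under ?p = param 2 [a2, a1] x" and d': "dir ?p = tline (tvf [a2, a1] x (x 3))" by (simp_all only: point.sel)
 have u: "under ?p = param 2 [a2, a1] ?x" unfolding u' by (rule param_cong) simp_all
 have d: "dir ?p = tline (tvf [a2, a1] ?x (x 3))" unfolding d' by (subst tvf_upd) simp_all
 have lRV: "length [R, V] = 2" by simp
 have "?p \<in> monster 3" by (rule monster_chartI[OF _ x]) simp
 moreover have m2: "under ?p \<in> monster 2" unfolding u by (rule monster_chartI[OF _ chart3_lower(1)]) simp
 have "under ?p \<in> RVT_class [R, V] \<longleftrightarrow> code 2 (param 2 [a2, a1] x) = [R, V]"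
  using m2 unfolding RVT_class_def mem_Collect_eq lRV u' by blast
 then have "under ?p \<in> RVT_class [R, V] \<longleftrightarrow> x 2 $ a1 = 0" unfolding code_level3(2) by simp
 moreover have "dir ?p \<subseteq> vertical_space 2 (under ?p) \<longleftrightarrow> x 3 $ a2 = 0"
 proof -
  have l: "length [a1] = 1" "Suc 1 = 2" by simp_all
  have "vertical_space 2 (under ?p) = tvf [a2, a1] ?x ` {u. u $ a2 = 0}"
   using vertical_space_chart[OF chart3_lower(1)] unfolding u l .
  then show ?thesis using tline_subset_hyperplane[OF chart3_lower(1), of "x 3" a2] unfolding d by blast
 qed
 moreover have "dir ?p \<subseteq> delta 1 1 (under ?p) \<longleftrightarrow> x 3 $ a1 = 0" if "x 2 $ a1 = 0"
 proof -
  have "critical_index [a2, a1] ?x 1"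
   using critical_index_level2[of 1] critical_index_upd[of "[a2, a1]" x 0 1] that unfolding len by blast
  then have "delta 1 1 (param (length [a2, a1]) [a2, a1] ?x) = tvf [a2, a1] ?x ` {u. u $ ([a2, a1] ! 1) = 0}"
   by (intro baby_monster_chart(2)[OF chart3_lower(1)]) simp_all
  then have "delta 1 1 (under ?p) = tvf [a2, a1] ?x ` {u. u $ a1 = 0}" unfolding u len by simp
  then show ?thesis using tline_subset_hyperplane[OF chart3_lower(1), of "x 3" a1] unfolding d by blast
 qed
 ultimately show ?thesis unfolding RVL_def by auto
qed

lemma RVT_chart: "param 3 [a3, a2, a1] x \<in> RVT_class [R, V, T] \<longleftrightarrow> x 2 $ a1 = 0 \<and> x 3 $ a2 ~= 0 \<and> x 3 $ a1 = 0"
proof -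
 have l: "length [R, V, T] = 3" by simp
 have "param 3 [a3, a2, a1] x \<in> monster 3" by (rule monster_chartI[OF _ x]) simp
 then have "param 3 [a3, a2, a1] x \<in> RVT_class [R, V, T] \<longleftrightarrow> code 3 (param 3 [a3, a2, a1] x) = [R, V, T]"
  unfolding RVT_class_def mem_Collect_eq l by blast
 then show ?thesis unfolding code_level3(1) by auto
qed

lemma Germ_level3:
 assumes "\<gamma> \<in> Germ 3 (param 3 [a3, a2, a1] x)"
 obtains \<xi> u G1 G2 G3 where "clift \<gamma> [a3, a2, a1] \<xi> u" "\<xi> 0 = x"
  "lift3 a1 a2 a3 (%j. fps_deriv (Ev \<gamma> j)) (Ec \<xi> 1) (Ec \<xi> 2) (Ec \<xi> 3) G1 G2 G3 (Ev u)"
  "!!m j. fps_nth (Ec \<xi> m j) 0 = x m $ j"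
  "fps_nth (Ev u a3) 0 ~= 0" "x 3 $ a2 = 0 ==> fps_nth (Ev u a2) 0 ~= 0"
  "x 2 $ a1 = 0 ==> x 3 $ a1 = 0 ==> fps_nth (Ev u a1) 0 ~= 0"
proof -
 have len: "length [a3, a2, a1] = 3" by simp
 have "\<gamma> \<in> Germ (length [a3, a2, a1]) (param (length [a3, a2, a1]) [a3, a2, a1] x)"
  unfolding len by (rule assms)
 then obtain \<xi> u where l: "clift \<gamma> [a3, a2, a1] \<xi> u" "\<xi> 0 = x"
  and c: "!!j. critical_index [a3, a2, a1] x j ==> u 0 $ ([a3, a2, a1] ! j) ~= 0"
  unfolding Germ_chart[OF x] by blast
 obtain G1 G2 G3 where L: "lift3 a1 a2 a3 (%j. fps_deriv (Ev \<gamma> j)) (Ec \<xi> 1) (Ec \<xi> 2) (Ec \<xi> 3) G1 G2 G3 (Ev u)"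
  using clift_lift3[OF l(1)] by blast
 have n: "fps_nth (Ec \<xi> m j) 0 = x m $ j" for m j unfolding Ec_def E_nth_0 using l(2) by simp
 show thesis
  using that[OF l L n] c[of 0] c[of 1] c[of 2] unfolding critical_index_level3 Ev_nth_0 by simp
qed

end

text \<open>
  The class of \<open>(t\<^sup>3, t\<^sup>4, t\<^sup>5)\<close> in a chart: code \<open>RVT\<close>, and no other coordinate of the line vanishes. The last
  condition cuts out the open subset.
\<close>

definition cusp345 :: "3 => 3 => 3 coords => bool" where
 "cusp345 a2 a1 x \<longleftrightarrow> x 2 $ a1 = 0 \<and> x 3 $ a1 = 0 \<and> x 3 $ a2 ~= 0 \<and> (\<forall>b. b ~= a1 --> b ~= a2 --> x 3 $ b ~= 0)"

text \<open>
  The class \<open>RVL\<close> in a chart.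
\<close>

definition cusp467 :: "3 => 3 => 3 coords => bool" where
 "cusp467 a2 a1 x \<longleftrightarrow> x 2 $ a1 = 0 \<and> x 3 $ a1 = 0 \<and> x 3 $ a2 = 0"

lemma velocity_orders_Germ:
 assumes x: "x \<in> chart_dom [a3, a2, a1 :: 3]" and g: "\<gamma> \<in> Germ 3 (param 3 [a3, a2, a1] x)"
 shows "velocity_orders {2,3,4} \<gamma> \<longleftrightarrow> cusp345 a2 a1 x" "velocity_orders {3,5,6} \<gamma> \<longleftrightarrow> cusp467 a2 a1 x"
proof -
 from Germ_level3[OF x g] obtain \<xi> u G1 G2 G3 where l: "clift \<gamma> [a3, a2, a1] \<xi> u" "\<xi> 0 = x" and
  L: "lift3 a1 a2 a3 (%j. fps_deriv (Ev \<gamma> j)) (Ec \<xi> 1) (Ec \<xi> 2) (Ec \<xi> 3) G1 G2 G3 (Ev u)" and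
  n: "!!m j. fps_nth (Ec \<xi> m j) 0 = x m $ j" and
  U: "fps_nth (Ev u a3) 0 ~= 0" "x 3 $ a2 = 0 ==> fps_nth (Ev u a2) 0 ~= 0"
  "x 2 $ a1 = 0 ==> x 3 $ a1 = 0 ==> fps_nth (Ev u a1) 0 ~= 0"
  by metis
 have an: "analytic_vec \<gamma> 0" by (rule clift_germ[OF l(1)])
 show "velocity_orders {2,3,4} \<gamma> \<longleftrightarrow> cusp345 a2 a1 x"
 proof
  assume "velocity_orders {2,3,4} \<gamma>"
  then have o: "!!w. w ~= 0 ==> \<exists>d\<in>{2,3,4}. od (lin w (%j. fps_deriv (Ev \<gamma> j))) d"
   unfolding velocity_orders_lin by blast
  show "cusp345 a2 a1 x" unfolding cusp345_def using lift3_orders_345[OF L o] unfolding n by blast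
 next
  assume c: "cusp345 a2 a1 x"
  show "velocity_orders {2,3,4} \<gamma>"
   unfolding velocity_orders_lin
  proof (intro conjI an allI impI)
   fix w :: "complex^3" assume "w ~= 0"
   then show "\<exists>d\<in>{2,3,4}. od (lin w (%j. fps_deriv (Ev \<gamma> j))) d"
    by (intro lift3_imp_345[OF L]) (use c U in \<open>auto simp: n cusp345_def\<close>)
  qed
 qed
 show "velocity_orders {3,5,6} \<gamma> \<longleftrightarrow> cusp467 a2 a1 x"
 proof
  assume "velocity_orders {3,5,6} \<gamma>"
  then have o: "!!w. w ~= 0 ==> \<exists>d\<in>{3,5,6}. od (lin w (%j. fps_deriv (Ev \<gamma> j))) d"
   unfolding velocity_orders_lin by blast
  show "cusp467 a2 a1 x" unfolding cusp467_def using lift3_orders_467[OF L o] unfolding n by blast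
 next
  assume c: "cusp467 a2 a1 x"
  show "velocity_orders {3,5,6} \<gamma>"
   unfolding velocity_orders_lin
  proof (intro conjI an allI impI)
   fix w :: "complex^3" assume "w ~= 0"
   then show "\<exists>d\<in>{3,5,6}. od (lin w (%j. fps_deriv (Ev \<gamma> j))) d"
    by (intro lift3_imp_467[OF L]) (use c U in \<open>auto simp: n cusp467_def\<close>)
  qed
 qed
qed

text \<open>
  In any chart that contains the lift, the orders determine which coordinates vanish, and show that the velocity
  of the lift avoids the critical hyperplanes.
\<close>

lemma Germ_velocity_orders:
 fixes \<gamma> :: "complex => complex^3"
 assumes vo: "velocity_orders {2,3,4} \<gamma> \<or> velocity_orders {3,5,6} \<gamma>"
 shows "\<gamma> \<in> Germ 3 (prolong_curve \<gamma> 3 0)" "prolong_curve \<gamma> 3 0 \<in> monster 3"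
proof -
 have an: "analytic_vec \<gamma> 0" using vo by (auto simp: velocity_orders_def)
 have nc: "nonconstant_germ \<gamma>" using vo velocity_orders_nonconstant by blast
 obtain c :: "3 list" and \<xi> u where c: "length c = 3" "clift \<gamma> c \<xi> u" using clift_any[OF an nc] by blast
 then obtain a1 a2 a3 where c3: "c = [a3, a2, a1]"
  by (auto simp: numeral_3_eq_3 length_Suc_conv)
 note l = c(2)[unfolded c3]
 have len: "length [a3, a2, a1] = 3" by simp
 have x: "\<xi> 0 \<in> chart_dom [a3, a2, a1]" using clift_integral[OF l] eventually_nhds_x_imp_x by blast
 have p: "prolong_curve \<gamma> 3 0 = param 3 [a3, a2, a1] (\<xi> 0)"
  using eventually_nhds_x_imp_x[OF clift_prolong[OF l]] unfolding len .
 obtain G1 G2 G3 where L: "lift3 a1 a2 a3 (%j. fps_deriv (Ev \<gamma> j)) (Ec \<xi> 1) (Ec \<xi> 2) (Ec \<xi> 3) G1 G2 G3 (Ev u)"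
  using clift_lift3[OF l] by blast
 have n: "fps_nth (Ec \<xi> m j) 0 = \<xi> 0 m $ j" for m j unfolding Ec_def E_nth_0 by simp
 have U: "fps_nth (Ev u a3) 0 ~= 0 \<and> (\<xi> 0 3 $ a2 = 0 --> fps_nth (Ev u a2) 0 ~= 0) \<and> fps_nth (Ev u a1) 0 ~= 0"
  using vo
 proof
  assume "velocity_orders {2,3,4} \<gamma>"
  then have o: "!!w. w ~= 0 ==> \<exists>d\<in>{2,3,4}. od (lin w (%j. fps_deriv (Ev \<gamma> j))) d"
   unfolding velocity_orders_lin by blast
  show ?thesis using lift3_orders_345[OF L o] unfolding n by blast
 next
  assume "velocity_orders {3,5,6} \<gamma>"
  then have o: "!!w. w ~= 0 ==> \<exists>d\<in>{3,5,6}. od (lin w (%j. fps_deriv (Ev \<gamma> j))) d"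
   unfolding velocity_orders_lin by blast
  show ?thesis using lift3_orders_467[OF L o] unfolding n by blast
 qed
 then have "u 0 ~= 0" unfolding Ev_nth_0 by (auto simp: vec_eq_iff)
 moreover have "\<forall>j. critical_index [a3, a2, a1] (\<xi> 0) j --> u 0 $ ([a3, a2, a1] ! j) ~= 0"
  using U unfolding critical_index_level3[OF x] Ev_nth_0 by auto
 ultimately have "\<gamma> \<in> Germ (length [a3, a2, a1]) (param (length [a3, a2, a1]) [a3, a2, a1] (\<xi> 0))"
  unfolding Germ_chart[OF x] using nc l by blast
 then show "\<gamma> \<in> Germ 3 (prolong_curve \<gamma> 3 0)" unfolding p len .
 show "prolong_curve \<gamma> 3 0 \<in> monster 3" unfolding p by (rule monster_chartI[OF len x])
qed

section \<open>Curves with prescribed velocity\<close>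

lemma primitive:
 assumes "f analytic_on {0}"
 shows "\<exists>F. F analytic_on {0} \<and> F 0 = z \<and> (NEAR t. deriv F t = f t)"
proof -
 obtain e where e: "e > 0" "f holomorphic_on ball 0 e" using assms unfolding analytic_on_def by auto
 obtain g where g: "!!x. x \<in> ball 0 e ==> (g has_field_derivative f x) (at x)"
  using holomorphic_convex_primitive'[OF convex_ball open_ball e(2)] at_within_open[OF _ open_ball] by metis
 let ?F = "%t. g t - g 0 + z"
 have d: "(?F has_field_derivative f x) (at x)" if "x \<in> ball 0 e" for x
  using g[OF that] by (auto intro!: derivative_eq_intros)
 have "?F holomorphic_on ball 0 e" using d holomorphic_on_open[OF open_ball] by blast
 then have "?F analytic_on {0}" unfolding analytic_at using e(1) open_ball centre_in_ball by blast
 moreover have "NEAR t. t \<in> ball 0 e" using e(1) by (intro eventually_nhds_in_open) auto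
 then have "NEAR t. deriv ?F t = f t" by eventually_elim (rule DERIV_imp_deriv[OF d])
 moreover have "?F 0 = z" by simp
 ultimately show ?thesis by blast
qed

lemma vec_primitive:
 assumes "analytic_vec u 0"
 shows "\<exists>F. analytic_vec F 0 \<and> F 0 = z \<and> (NEAR t. vderiv F t = u t)"
proof -
 have "\<forall>j. \<exists>F. F analytic_on {0} \<and> F 0 = z $ j \<and> (NEAR t. deriv F t = u t $ j)"
  using primitive analytic_vecD[OF assms] by blast
 then have "\<exists>F. \<forall>j. F j analytic_on {0} \<and> F j 0 = z $ j \<and> (NEAR t. deriv (F j) t = u t $ j)" by (rule choice)
 then obtain F where F: "\<forall>j. F j analytic_on {0} \<and> F j 0 = z $ j \<and> (NEAR t. deriv (F j) t = u t $ j)" by blast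
 have "NEAR t. \<forall>j. deriv (F j) t = u t $ j" by (intro eventually_all_finite) (use F in blast)
 then have "NEAR t. vderiv (%t. \<chi> j. F j t) t = u t" by eventually_elim (simp add: vderiv_def vec_eq_iff)
 moreover have "analytic_vec (%t. \<chi> j. F j t) 0" using F by (simp add: analytic_vec_def)
 moreover have "(\<chi> j. F j 0) = z" using F by (simp add: vec_eq_iff)
 ultimately show ?thesis by (intro exI[of _ "%t. \<chi> j. F j t"]) simp
qed

text \<open>
  A velocity on the last level determines the curve by successive integration downwards: the coordinates
  of a level are primitives, and the velocity one level lower is a component times these coordinates.
  The assumption on the components keeps these products from vanishing identically.
\<close>

lemma clift_prescribed:
 "x \<in> chart_dom c ==> analytic_vec u 0 ==> \<not> (NEAR t. u t = 0) ==>
  (!!j. j \<in> set c ==> \<not> (NEAR t. u t $ j = 0)) ==>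
  \<exists>\<gamma> \<xi>. clift \<gamma> c \<xi> u \<and> \<xi> 0 = x \<and> nonconstant_germ \<gamma>"
proof (induction c arbitrary: x u)
 case Nil
 obtain \<gamma> where g: "analytic_vec \<gamma> 0" "\<gamma> 0 = x 0" "NEAR t. vderiv \<gamma> t = u t"
  using vec_primitive[OF Nil.prems(2)] by blast
 have "clift \<gamma> [] (%t i. if i = 0 then \<gamma> t else 0) u" using g(1,3) by (auto elim: eventually_mono)
 moreover have "(%i. if i = 0 then \<gamma> 0 else 0) = x" using Nil.prems(1) g(2) by (auto simp: fun_eq_iff)
 moreover have "nonconstant_germ \<gamma>"
  unfolding nonconstant_germ_def
 proof
  assume "\<exists>z. NEAR t. \<gamma> t = z"
  then obtain z where "NEAR t. \<gamma> t = z" by blast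
  from eventually_nhds_nhds[OF this] g(3) have "NEAR t. u t = 0"
  proof eventually_elim
   case (elim t)
   have "vderiv \<gamma> t = vderiv (%_. z) t" by (rule vderiv_cong[OF elim(1)])
   then show ?case using elim(2) by (simp add: vderiv_def vec_eq_iff)
  qed
  then show False using Nil.prems(3) by blast
 qed
 ultimately show ?case by (intro exI[of _ \<gamma>] exI[of _ "%t i. if i = 0 then \<gamma> t else 0"]) blast
next
 case (Cons a c)
 let ?k = "Suc (length c)"
 obtain Y where Y: "analytic_vec Y 0" "Y 0 = x ?k" "NEAR t. vderiv Y t = u t"
  using vec_primitive[OF Cons.prems(2)] by blast
 define y where "y = (%t. \<chi> j. if j = a then 1 else Y t $ j)"
 define w where "w = (%t. u t $ a *s y t)"
 have x: "x(?k := 0) \<in> chart_dom c" "x ?k $ a = 1" using Cons.prems(1) by simp_all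
 have ya: "y t $ a = 1" and yj: "j ~= a ==> y t $ j = Y t $ j" and wa: "w t $ a = u t $ a" for t j
  by (simp_all add: y_def w_def)
 have yan: "(%t. y t $ j) analytic_on {0}" for j using analytic_vecD[OF Y(1), of j] by (cases "j = a") (simp_all add: ya yj)
 have y0: "y 0 = x ?k" using Y(2) x(2) by (simp add: y_def vec_eq_iff)
 have wan: "analytic_vec w 0" unfolding analytic_vec_def w_def vector_smult_component
  by (intro allI analytic_on_mult analytic_vecD[OF Cons.prems(2)] yan)
 have ua: "\<not> (NEAR t. u t $ a = 0)" using Cons.prems(4) by simp
 have "\<not> (NEAR t. w t = 0)"
 proof
  assume "NEAR t. w t = 0"
  then have "NEAR t. u t $ a = 0" by eventually_elim (metis wa zero_index)
  then show False using ua by blast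
 qed
 moreover have "\<not> (NEAR t. w t $ j = 0)" if j: "j \<in> set c" for j
 proof -
  have "\<not> (NEAR t. y t $ j = 0)"
  proof
   assume y0: "NEAR t. y t $ j = 0"
   show False
   proof (cases "j = a")
    case True
    then show False using eventually_nhds_x_imp_x[OF y0] by (simp add: ya)
   next
    case False
    from eventually_nhds_nhds[OF y0] Y(3) have "NEAR t. u t $ j = 0"
    proof eventually_elim
     case (elim t)
     have "deriv (%s. Y s $ j) t = deriv (%s. 0) t"
      by (rule deriv_cong_ev[OF _ refl], rule eventually_mono[OF elim(1)]) (simp add: yj[OF False])
     then have "vderiv Y t $ j = 0" by (simp add: vderiv_def)
     then show ?case using elim(2) by simp
    qed
    then show False using Cons.prems(4)[of j] j by simp
   qed
  qed
  then have "E (%t. u t $ a) * E (%t. y t $ j) ~= 0"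
   using ua E_zero_iff[OF yan] E_zero_iff[OF analytic_vecD[OF Cons.prems(2)]] by simp
  then have "E (%t. w t $ j) ~= 0"
   using E_mult[OF analytic_vecD[OF Cons.prems(2)] yan, of a j] by (simp add: w_def)
  then show ?thesis using E_zero_iff[OF analytic_vecD[OF wan]] by blast
 qed
 ultimately obtain \<gamma> \<xi> where g: "clift \<gamma> c \<xi> w" "\<xi> 0 = x(?k := 0)" "nonconstant_germ \<gamma>"
  using Cons.IH[OF x(1) wan] by blast
 have "\<not> (NEAR t. w t $ a = 0)" using ua unfolding wa .
 moreover have "y t $ a = 1 \<and> w t = w t $ a *s y t" for t unfolding ya wa by (simp add: w_def)
 then have "NEAR t. y t $ a = 1 \<and> w t = w t $ a *s y t" by (intro always_eventually) blast
 moreover have "analytic_vec y 0" using yan by (simp add: analytic_vec_def)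
 ultimately have l: "clift \<gamma> (a # c) (%t. (\<xi> t)(?k := y t)) (%t. \<chi> j. if j = a then w t $ a else vderiv y t $ j)"
  using clift_ConsI[OF g(1)] by blast
 have "vderiv y t $ j = vderiv Y t $ j" if "j ~= a" for t j unfolding vderiv_def using yj[OF that] by simp
 then have "NEAR t. (\<chi> j. if j = a then w t $ a else vderiv y t $ j) = u t"
  using Y(3) by (auto elim!: eventually_mono simp: vec_eq_iff wa)
 from clift_cong[OF l always_eventually[OF allI[OF refl]] this]
 have "clift \<gamma> (a # c) (%t. (\<xi> t)(?k := y t)) u" .
 moreover have "(\<xi> 0)(?k := y 0) = x" unfolding g(2) y0 by simp
 ultimately show ?case using g(3) by (intro exI[of _ \<gamma>] exI[of _ "%t. (\<xi> t)(?k := y t)"]) blast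
qed

lemma Germ_prescribed:
 assumes x: "x \<in> chart_dom c" and u: "u ~= 0" "!!j. j \<in> set c ==> u $ j ~= 0"
 shows "\<exists>\<gamma> \<xi>. \<gamma> \<in> Germ (length c) (param (length c) c x) \<and> clift \<gamma> c \<xi> (%_. u) \<and> \<xi> 0 = x"
proof -
 have nz: "\<not> (NEAR t. u = 0)" "j \<in> set c ==> \<not> (NEAR t. u $ j = 0)" for j
  using u eventually_nhds_x_imp_x by blast+
 have "analytic_vec (%_. u) 0" by (simp add: analytic_vec_def)
 from clift_prescribed[OF x this nz] obtain \<gamma> \<xi> where g: "clift \<gamma> c \<xi> (%_. u)" "\<xi> 0 = x" "nonconstant_germ \<gamma>" by blast
 have "\<forall>j. critical_index c x j --> u $ (c ! j) ~= 0" using u(2) by (auto simp: critical_index_def)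
 then have "\<gamma> \<in> Germ (length c) (param (length c) c x)" unfolding Germ_chart[OF x] using g u(1) by blast
 then show ?thesis using g by blast
qed

section \<open>Embedding dimension\<close>

text \<open>
  In a submanifold of smaller dimension some coordinate of a straightening diffeomorphism is constant along
  the curve, hence a linear projection of the image has no velocity order at all.
\<close>

lemma embedding_dim_full:
 fixes \<gamma> :: "complex => complex^'n::finite"
 assumes vo: "velocity_orders S \<gamma>" and S: "\<forall>s\<in>S. d \<le> Suc s \<and> Suc s < 2 * d"
 shows "embedding_dim \<gamma> = CARD('n)"
 unfolding embedding_dim_def
proof (rule Least_equality)
 have "local_diffeo (UNIV :: (complex^'n) set) (%z. z)"
  unfolding local_diffeo_def holomorphic_map_def by (auto intro!: exI[of _ "%z. z"] has_derivative_ident)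
 then have "submanifold CARD('n) (UNIV :: (complex^'n) set)"
  unfolding submanifold_def by (intro ballI exI[of _ UNIV] exI[of _ "%z. z"]) auto
 then show "\<exists>T. submanifold CARD('n) T \<and> (NEAR t. \<gamma> t \<in> T)" by (intro exI[of _ UNIV]) simp
next
 fix e assume "\<exists>T. submanifold e T \<and> (NEAR t. \<gamma> t \<in> T)"
 then obtain T where T: "submanifold e T" "NEAR t. \<gamma> t \<in> T" by blast
 have an: "analytic_vec \<gamma> 0" using vo by (simp add: velocity_orders_def)
 have "\<gamma> 0 \<in> T" by (rule eventually_nhds_x_imp_x[OF T(2)])
 then obtain U \<phi> and J :: "'n set" where U: "\<gamma> 0 \<in> U" "local_diffeo U \<phi>" "card J = e"
  "\<phi> ` (T \<inter> U) = {w \<in> \<phi> ` U. \<forall>j. j \<notin> J --> w $ j = 0}"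
  using T(1) unfolding submanifold_def by blast
 show "CARD('n) \<le> e"
 proof (rule ccontr)
  assume "\<not> CARD('n) \<le> e"
  then have "J ~= UNIV" using U(3) by auto
  then obtain j where j: "j \<notin> J" by blast
  have dat: "diffeo_at \<phi> (\<gamma> 0)" by (rule local_diffeo_diffeo_at[OF U(2,1)])
  have vo': "velocity_orders S (%t. \<phi> (\<gamma> t))" by (rule velocity_orders_diffeo[OF dat vo S])
  have "open U" using U(2) by (simp add: local_diffeo_def)
  then have "NEAR t. \<gamma> t \<in> U" using analytic_vec_tendsto[OF an] U(1) by (auto simp: tendsto_def)
  with T(2) have "NEAR t. dot (axis j 1) (\<phi> (\<gamma> t)) = 0"
  proof eventually_elim
   case (elim t)
   then have "\<phi> (\<gamma> t) \<in> \<phi> ` (T \<inter> U)" by blast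
   then show ?case unfolding U(4) dot_axis using j by blast
  qed
  then have "E (%t. dot (axis j 1) (\<phi> (\<gamma> t))) = E (%t. 0)" by (rule E_cong)
  then have z: "fps_deriv (E (%t. dot (axis j 1) (\<phi> (\<gamma> t)))) = 0" by (simp add: E_const)
  obtain i where o: "od (fps_deriv (E (%t. dot (axis j 1) (\<phi> (\<gamma> t))))) i"
   using vo' axis_nonzero[of j] unfolding velocity_orders_def by blast
  show False using o unfolding z od_def by simp
 qed
qed

lemma vec_has_derivative:
 fixes \<phi> :: "complex^'n::finite => complex^'n"
 assumes "!!j. ((%z. \<phi> z $ j) has_derivative (%v. D v $ j)) (at z)"
 shows "(\<phi> has_derivative D) (at z)"
proof -
 have bl: "bounded_linear (%c::complex. c *s (v :: complex^'n))" for v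
  by (rule linear_conv_bounded_linear[THEN iffD1]) (auto intro!: linearI simp: vec_eq_iff algebra_simps)
 have "((%z. \<Sum>j\<in>UNIV. \<phi> z $ j *s axis j 1) has_derivative (%v. \<Sum>j\<in>UNIV. D v $ j *s axis j 1)) (at z)"
  by (intro has_derivative_sum bounded_linear.has_derivative[OF bl] assms)
 then show ?thesis unfolding basis_expansion .
qed

text \<open>
  The shear that subtracts \<open>f b z\<close> from the coordinates \<open>b \<notin> A\<close> straightens the graph; its inverse adds the
  same values, because these do not change under the shear.
\<close>

lemma graph_submanifold:
 fixes f :: "'n::finite => complex^'n => complex"
 assumes cd: "!!b z. cdiff (f b) z" and dep: "!!b z z'. (!!j. j \<in> A ==> z $ j = z' $ j) ==> f b z = f b z'"
 shows "submanifold (card A) {z. \<forall>b. b \<notin> A --> z $ b = f b z}"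
proof -
 define \<Phi> where "\<Phi> = (%s z. \<chi> b. if b \<in> A then z $ b else z $ b + s * f b z)"
 have nth: "\<Phi> s z $ b = (if b \<in> A then z $ b else z $ b + s * f b z)" for s z b by (simp add: \<Phi>_def)
 have f\<Phi>: "f b (\<Phi> s z) = f b z" for b s z by (rule dep) (simp add: nth)
 have inv: "\<Phi> (- s) (\<Phi> s z) = z" for s z
 proof -
  have "\<Phi> (- s) (\<Phi> s z) $ b = z $ b" for b unfolding nth[of "- s"] f\<Phi> by (simp add: nth)
  then show ?thesis by (simp add: vec_eq_iff)
 qed
 have hol: "holomorphic_map UNIV (\<Phi> s)" for s
  unfolding holomorphic_map_def
 proof (intro ballI exI conjI allI)
  fix z :: "complex^'n"
  let ?D = "%v. \<chi> b. if b \<in> A then v $ b else v $ b + s * fd (f b) z v"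
  have "((%z. \<Phi> s z $ b) has_derivative (%v. ?D v $ b)) (at z)" for b
  proof -
   have "((%z :: complex^'n. z $ b) has_derivative (%v. v $ b)) (at z)"
    by (intro bounded_linear_imp_has_derivative bounded_linear_vec_nth)
   then show ?thesis
    using has_derivative_add[OF _ has_derivative_mult_right[OF cdiff_fd(1)[OF cd]]] by (cases "b \<in> A") (simp_all add: nth)
  qed
  then show "(\<Phi> s has_derivative ?D) (at z)" by (rule vec_has_derivative)
  show "?D (r *s v) = r *s ?D v" for r v by (simp add: vec_eq_iff cdiff_fd(2)[OF cd] algebra_simps)
 qed
 have surj: "range (\<Phi> s) = UNIV" for s using inv[of "- s"] by (intro surjI[of _ "\<Phi> (- s)"]) simp
 have ld: "local_diffeo UNIV (\<Phi> (-1))"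
  unfolding local_diffeo_def surj using hol inv[of "-1"] by (intro conjI exI[of _ "\<Phi> 1"]) auto
 show ?thesis
  unfolding submanifold_def
 proof (rule ballI, rule exI[of _ UNIV], rule exI[of _ "\<Phi> (-1)"], rule exI[of _ A], intro conjI ld UNIV_I refl)
  show "\<Phi> (-1) ` ({z. \<forall>b. b \<notin> A --> z $ b = f b z} \<inter> UNIV) = {w \<in> range (\<Phi> (-1)). \<forall>j. j \<notin> A --> w $ j = 0}"
   by (auto simp: nth)
 qed
qed

lemma cdiff_affine:
 fixes z :: "complex^'n::finite"
 assumes g: "g holomorphic_on UNIV"
 shows "cdiff (%z. (\<Sum>j\<in>A. K j * z $ j) + g (z $ q)) z"
proof -
 have nth: "((%z :: complex^'n. z $ j) has_derivative (%v. v $ j)) (at z)" for j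
  by (intro bounded_linear_imp_has_derivative bounded_linear_vec_nth)
 have "(g has_field_derivative deriv g (z $ q)) (at (z $ q))" by (rule holomorphic_derivI[OF g]) auto
 then have "(g has_derivative (*) (deriv g (z $ q))) (at (z $ q))" by (simp add: has_field_derivative_def)
 from has_derivative_compose[OF nth this]
 have "((%z. g (z $ q)) has_derivative (%v. deriv g (z $ q) * v $ q)) (at z)" by simp
 then have "((%z. (\<Sum>j\<in>A. K j * z $ j) + g (z $ q)) has_derivative
   (%v. (\<Sum>j\<in>A. K j * v $ j) + deriv g (z $ q) * v $ q)) (at z)"
  by (intro has_derivative_add has_derivative_sum has_derivative_mult_right nth)
 moreover have "(\<Sum>j\<in>A. K j * (s *s v) $ j) + deriv g (z $ q) * (s *s v) $ q =
   s * ((\<Sum>j\<in>A. K j * v $ j) + deriv g (z $ q) * v $ q)" for s v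
  by (simp add: algebra_simps sum_distrib_left)
 ultimately show ?thesis unfolding cdiff_def by blast
qed

section \<open>Planar curves\<close>

lemma fps_antideriv: "fps_deriv F = fps_deriv (G :: complex fps) ==> \<exists>k. F = G + fps_const k"
 unfolding fps_deriv_eq_iff by (metis add.commute)

lemma fps_deriv_half_square: "fps_deriv (fps_const (c / 2) * P ^ 2) = fps_const c * (P * fps_deriv (P :: complex fps))"
proof -
 have "fps_const (c / 2) * (2 * F) = fps_const c * F" for F :: "complex fps"
  by (simp add: fps_eq_iff fps_numeral_fps_const)
 moreover have "fps_deriv (P ^ 2) = 2 * (P * fps_deriv P)" by (simp add: power2_eq_square)
 ultimately show ?thesis by simp
qed

lemma fps_deriv_sixth_cube: "fps_deriv (fps_const (c / 6) * P ^ 3) = fps_const (c / 2) * P ^ 2 * fps_deriv (P :: complex fps)"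
proof -
 have "fps_const (c / 6) * (3 * F) = fps_const (c / 2) * F" for F :: "complex fps"
  by (simp add: fps_eq_iff fps_numeral_fps_const)
 moreover have "fps_deriv (P ^ 3) = 3 * (P ^ 2 * fps_deriv P)" by (simp add: power3_eq_cube power2_eq_square algebra_simps)
 ultimately show ?thesis by (simp add: mult.assoc)
qed

text \<open>
  A velocity with zero component \<open>b\<close> and other components one makes \<open>Z b\<close> constant. Integrating downwards, the
  component \<open>b\<close> on each level is a combination of another component and of powers of \<open>P a1\<close>. The case
  distinction is which of the components of the line serves as a parameter.
\<close>

lemma planar_relation:
 fixes a1 a2 a3 b :: 3
 assumes L: "lift3 a1 a2 a3 (%j. fps_deriv (P j)) X Y Z G1 G2 G3 U"
  and U: "!!j. U j = (if j = b then 0 else 1)" and b: "b ~= a1" "b ~= a2" "b ~= a3"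
  and cs: "a1 = a2 \<or> a3 = a1 \<or> a3 = a2 \<and> fps_nth (Z b) 0 = 0"
 shows "\<exists>p l k3 k2 k1 k0. p ~= b \<and> P b = fps_const l * P p + fps_const k3 * P a1 ^ 3 + fps_const k2 * P a1 ^ 2 +
  fps_const k1 * P a1 + fps_const k0"
proof -
 note E = lift3D[OF L]
 define \<beta> where "\<beta> = fps_nth (Z b) 0"
 have G3: "G3 = 1" using E(10)[of a3] U[of a3] b by simp
 have "fps_deriv (Z b) = 0" using E(10)[of b] U[of b] b by simp
 then have Zb: "Z b = fps_const \<beta>" unfolding \<beta>_def fps_deriv_eq_0_iff .
 have Yb: "fps_deriv (Y b) = fps_const \<beta>" using E(7)[of b] b Zb G3 by simp
 have Xb: "fps_deriv (X b) = G2 * Y b" and Pb: "fps_deriv (P b) = G1 * X b" using E(4)[of b] E(1)[of b] b by simp_all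
 have P1: "fps_deriv (P a1) = G1" using E(1)[of a1] E(2) by simp
 have G1: "G1 = G2 * Y a1" using E(4)[of a1] by simp
 consider "a1 = a2" "a3 ~= a1" | "a1 = a2" "a3 = a1" | "a1 ~= a2" "a3 = a1" | "a1 ~= a2" "\<beta> = 0" using cs \<beta>_def by blast
 then show ?thesis
 proof cases
  case 1
  then have G12: "G2 = G1" using G1 E(5) by simp
  have "fps_deriv (Y a3) = 1" using E(7)[of a3] 1 E(8) G3 by simp
  then have "fps_deriv (Y b) = fps_deriv (fps_const \<beta> * Y a3)" using Yb by simp
  then obtain C2 where C2: "Y b = fps_const \<beta> * Y a3 + fps_const C2" using fps_antideriv by blast
  have X3: "fps_deriv (X a3) = G1 * Y a3" using E(4)[of a3] 1 G12 by simp
  have "fps_deriv (X b) = fps_deriv (fps_const \<beta> * X a3 + fps_const C2 * P a1)"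
   unfolding Xb C2 G12 by (simp add: X3 P1 algebra_simps)
  then obtain C1 where C1: "X b = fps_const \<beta> * X a3 + fps_const C2 * P a1 + fps_const C1" using fps_antideriv by blast
  have "fps_deriv (P b) = fps_deriv (fps_const \<beta> * P a3 + fps_const (C2 / 2) * P a1 ^ 2 + fps_const C1 * P a1)"
   unfolding fps_deriv_add fps_deriv_half_square Pb C1 by (simp add: E(1)[of a3] P1 algebra_simps)
  then obtain C0 where "P b = fps_const \<beta> * P a3 + fps_const (C2 / 2) * P a1 ^ 2 + fps_const C1 * P a1 + fps_const C0"
   using fps_antideriv by blast
  then have "P b = fps_const \<beta> * P a3 + fps_const 0 * P a1 ^ 3 + fps_const (C2 / 2) * P a1 ^ 2 + fps_const C1 * P a1 + fps_const C0"
   by simp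
  then show ?thesis using b(3)[symmetric] by blast
 next
  case 2
  then have G2: "G2 = 1" using E(7)[of a2] E(8) G3 by simp
  then have P1': "fps_deriv (P a1) = 1" "G1 = 1" using P1 G1 2 E(5) by simp_all
  have "fps_deriv (Y b) = fps_deriv (fps_const \<beta> * P a1)" using Yb P1' by simp
  then obtain C2 where C2: "Y b = fps_const \<beta> * P a1 + fps_const C2" using fps_antideriv by blast
  have "fps_deriv (X b) = fps_deriv (fps_const (\<beta> / 2) * P a1 ^ 2 + fps_const C2 * P a1)"
   unfolding fps_deriv_add fps_deriv_half_square Xb C2 G2 by (simp add: P1')
  then obtain C1 where C1: "X b = fps_const (\<beta> / 2) * P a1 ^ 2 + fps_const C2 * P a1 + fps_const C1" using fps_antideriv by blast
  have "fps_deriv (P b) = fps_deriv (fps_const (\<beta> / 6) * P a1 ^ 3 + fps_const (C2 / 2) * P a1 ^ 2 + fps_const C1 * P a1)"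
   unfolding fps_deriv_add fps_deriv_half_square fps_deriv_sixth_cube Pb C1 by (simp add: P1')
  then obtain C0 where "P b = fps_const (\<beta> / 6) * P a1 ^ 3 + fps_const (C2 / 2) * P a1 ^ 2 + fps_const C1 * P a1 + fps_const C0"
   using fps_antideriv by blast
  then have "P b = fps_const 0 * P a1 + fps_const (\<beta> / 6) * P a1 ^ 3 + fps_const (C2 / 2) * P a1 ^ 2 + fps_const C1 * P a1 + fps_const C0"
   by simp
  then show ?thesis using b(1)[symmetric] by blast
 next
  case 3
  have "fps_deriv (Y a1) = 1" using E(7)[of a1] 3 E(8) G3 by simp
  then have "fps_deriv (Y b) = fps_deriv (fps_const \<beta> * Y a1)" using Yb by simp
  then obtain C2 where C2: "Y b = fps_const \<beta> * Y a1 + fps_const C2" using fps_antideriv by blast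
  have X2: "fps_deriv (X a2) = G2" using E(4)[of a2] 3 E(5) by simp
  have "fps_deriv (X b) = fps_deriv (fps_const \<beta> * P a1 + fps_const C2 * X a2)"
   unfolding Xb C2 by (simp add: X2 P1 G1 algebra_simps)
  then obtain C1 where C1: "X b = fps_const \<beta> * P a1 + fps_const C2 * X a2 + fps_const C1" using fps_antideriv by blast
  have "fps_deriv (P b) = fps_deriv (fps_const C2 * P a2 + fps_const (\<beta> / 2) * P a1 ^ 2 + fps_const C1 * P a1)"
   unfolding fps_deriv_add fps_deriv_half_square Pb C1 by (simp add: E(1)[of a2] P1 algebra_simps)
  then obtain C0 where "P b = fps_const C2 * P a2 + fps_const (\<beta> / 2) * P a1 ^ 2 + fps_const C1 * P a1 + fps_const C0"
   using fps_antideriv by blast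
  then have "P b = fps_const C2 * P a2 + fps_const 0 * P a1 ^ 3 + fps_const (\<beta> / 2) * P a1 ^ 2 + fps_const C1 * P a1 + fps_const C0"
   by simp
  then show ?thesis using b(2)[symmetric] by blast
 next
  case 4
  then have "fps_deriv (Y b) = fps_deriv 0" using Yb by simp
  then obtain C2 where C2: "Y b = 0 + fps_const C2" using fps_antideriv by blast
  have X2: "fps_deriv (X a2) = G2" using E(4)[of a2] 4 E(5) by simp
  have "fps_deriv (X b) = fps_deriv (fps_const C2 * X a2)" unfolding Xb C2 by (simp add: X2 algebra_simps)
  then obtain C1 where C1: "X b = fps_const C2 * X a2 + fps_const C1" using fps_antideriv by blast
  have "fps_deriv (P b) = fps_deriv (fps_const C2 * P a2 + fps_const C1 * P a1)"
   unfolding Pb C1 by (simp add: E(1)[of a2] P1 algebra_simps)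
  then obtain C0 where "P b = fps_const C2 * P a2 + fps_const C1 * P a1 + fps_const C0" using fps_antideriv by blast
  then have "P b = fps_const C2 * P a2 + fps_const 0 * P a1 ^ 3 + fps_const 0 * P a1 ^ 2 + fps_const C1 * P a1 + fps_const C0"
   by simp
  then show ?thesis using b(2)[symmetric] by blast
 qed
qed

text \<open>
  Two of the indices coincide, so they do not exhaust the type.
\<close>

lemma third_index3:
 fixes a1 a2 a3 :: 3
 assumes "a1 = a2 \<or> a3 = a1 \<or> a3 = a2"
 obtains b where "b ~= a1" "b ~= a2" "b ~= a3"
proof -
 obtain b c :: 3 where "a1 ~= c" "b ~= a1" "b ~= c" "c \<in> {a2, a3} \<or> a2 = a1 \<and> a3 = a1" "a2 \<in> {a1, c}" "a3 \<in> {a1, c}"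
 proof (cases "a1 = a2 \<and> a1 = a3")
  case True
  obtain c :: 3 where c: "a1 ~= c" by (metis exhaust_3 num1_eq1 one_neq_zero zero_neq_numeral numeral_eq_iff)
  from third_index[OF c] show thesis using that c True by (metis insertCI)
 next
  case False
  then obtain c where c: "a1 ~= c" "c \<in> {a2, a3}" "a2 \<in> {a1, c}" "a3 \<in> {a1, c}" using assms by blast
  from third_index[OF c(1)] show thesis using that c by metis
 qed
 then show thesis using that by blast
qed

text \<open>
  The index \<open>b\<close> avoids the chart, so the velocity \<open>u\<close> below is regular, and \<open>planar_relation\<close> puts the curve
  into the graph of a function.
\<close>

lemma planar_Germ:
 fixes x :: "3 coords"
 assumes x: "x \<in> chart_dom [a3, a2, a1]"
  and cs: "a1 = a2 \<or> a3 = a1 \<or> a3 = a2 \<and> (\<forall>b. b ~= a1 --> b ~= a2 --> x 3 $ b = 0)"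
 shows "\<exists>\<gamma>\<in>Germ 3 (param 3 [a3, a2, a1] x). embedding_dim \<gamma> \<le> 2"
proof -
 have len: "length [a3, a2, a1] = 3" by simp
 obtain b where b: "b ~= a1" "b ~= a2" "b ~= a3" using third_index3 cs by metis
 define u :: "complex^3" where "u = (\<chi> j. if j = b then 0 else 1)"
 have "u $ a1 ~= 0" using b by (simp add: u_def)
 then have "u ~= 0" by auto
 moreover have "u $ j ~= 0" if "j \<in> set [a3, a2, a1]" for j using that b by (auto simp: u_def)
 ultimately obtain \<gamma> \<xi> where g: "\<gamma> \<in> Germ 3 (param 3 [a3, a2, a1] x)" "clift \<gamma> [a3, a2, a1] \<xi> (%_. u)" "\<xi> 0 = x"
  using Germ_prescribed[OF x] unfolding len by blast
 have an: "analytic_vec \<gamma> 0" by (rule clift_germ[OF g(2)])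
 obtain G1 G2 G3 where L: "lift3 a1 a2 a3 (%j. fps_deriv (Ev \<gamma> j)) (Ec \<xi> 1) (Ec \<xi> 2) (Ec \<xi> 3) G1 G2 G3 (Ev (%_. u))"
  using clift_lift3[OF g(2)] by blast
 have U: "Ev (%_. u) j = (if j = b then 0 else 1)" for j by (simp add: Ev_def u_def E_const)
 have "a1 = a2 \<or> a3 = a1 \<or> a3 = a2 \<and> fps_nth (Ec \<xi> 3 b) 0 = 0"
  using cs b unfolding Ec_def E_nth_0 g(3) by blast
 from planar_relation[OF L U b this] obtain p l k3 k2 k1 k0 where p: "p ~= b" and
  rel: "Ev \<gamma> b = fps_const l * Ev \<gamma> p + fps_const k3 * Ev \<gamma> a1 ^ 3 + fps_const k2 * Ev \<gamma> a1 ^ 2 +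
   fps_const k1 * Ev \<gamma> a1 + fps_const k0" by blast
 define h where "h = (%z::complex. k3 * z ^ 3 + k2 * z ^ 2 + k1 * z + k0)"
 have g_an: "(%t. \<gamma> t $ j) analytic_on {0}" for j by (rule analytic_vecD[OF an])
 have "(%t. l * \<gamma> t $ p + h (\<gamma> t $ a1)) has_fps_expansion
   (fps_const l * Ev \<gamma> p + (fps_const k3 * Ev \<gamma> a1 ^ 3 + fps_const k2 * Ev \<gamma> a1 ^ 2 + fps_const k1 * Ev \<gamma> a1 + fps_const k0))"
  unfolding h_def Ev_def
  by (intro has_fps_expansion_add has_fps_expansion_cmult_left has_fps_expansion_power has_fps_expansion_const E_exp g_an)
 from E_eqI[OF this] have "E (%t. \<gamma> t $ b) = E (%t. l * \<gamma> t $ p + h (\<gamma> t $ a1))"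
  using rel by (simp add: Ev_def add.assoc)
 moreover have "(%t. l * \<gamma> t $ p + h (\<gamma> t $ a1)) analytic_on {0}"
  unfolding h_def by (intro analytic_intros g_an)
 ultimately have "NEAR t. \<gamma> t $ b = l * \<gamma> t $ p + h (\<gamma> t $ a1)" using E_eq_iff[OF g_an] by blast
 then have ev: "NEAR t. \<gamma> t \<in> {z. z $ b = l * z $ p + h (z $ a1)}" by simp
 have "h holomorphic_on UNIV" unfolding h_def by (intro holomorphic_intros)
 then have "cdiff (%z :: complex^3. l * z $ p + h (z $ a1)) z" for z
  using cdiff_affine[where g = h and A = "{p}" and K = "%_. l" and q = a1 and z = z] by simp
 then have "submanifold (card (- {b})) {z :: complex^3. \<forall>c. c \<notin> - {b} --> z $ c = l * z $ p + h (z $ a1)}"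
  by (intro graph_submanifold[where f = "%_ z. l * z $ p + h (z $ a1)"]) (use p b(1) in auto)
 then have "submanifold 2 {z :: complex^3. z $ b = l * z $ p + h (z $ a1)}" by (simp add: Compl_eq_Diff_UNIV)
 then have "embedding_dim \<gamma> \<le> 2" unfolding embedding_dim_def using ev by (intro Least_le) blast
 then show ?thesis using g(1) by blast
qed

section \<open>Submanifolds given by coordinates\<close>

definition chart_coords :: "'n::finite list => 'n point => 'n coords" where
 "chart_coords c q = (SOME y. y \<in> chart_dom c \<and> param (length c) c y = q)"

lemma chart_coords_param: "y \<in> chart_dom c ==> chart_coords c (param (length c) c y) = y"
 unfolding chart_coords_def by (rule some_equality) (auto simp: param_inj)

text \<open>
  In any other chart the coordinate is a component of the transition map.
\<close>

lemma chart_coords_holomorphic: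
 fixes c :: "'n::finite list"
 assumes U: "U \<subseteq> param (length c) c ` chart_dom c"
 shows "holomorphic_fun (length c) U (%q. chart_coords c q m $ j)"
 unfolding holomorphic_fun_def
proof (intro allI impI conjI)
 fix d :: "'n list" assume d: "length d = length c"
 have ok: "trok idm d c y" if y: "y \<in> chart_dom d" "param (length c) d y \<in> U" for y
 proof -
  obtain z where z: "z \<in> chart_dom c" "param (length c) d y = param (length c) c z" using U y(2) by blast
  then show ?thesis using param_eq_iff[OF d y(1) z(1)] by blast
 qed
 have co: "chart_coords c (param (length c) d y) = trm idm d c y" if y: "y \<in> chart_dom d" "trok idm d c y" for y
 proof -
  have t: "trm idm d c y \<in> chart_dom c" by (rule trm_dom[OF d y])
  then have "param (length c) d y = param (length c) c (trm idm d c y)" using param_eq_iff[OF d y(1) t] y(2) by blast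
  then show ?thesis using chart_coords_param[OF t] by simp
 qed
 let ?A = "{x \<in> chart_dom d. param (length c) d x \<in> U}"
 have "continuous_on ?A (trm idm d c)" by (rule continuous_on_subset[OF trm_continuous]) (use ok in blast)
 then have "continuous_on ?A (%x. trm idm d c x m)" by (rule continuous_on_product_then_coordinatewise)
 then have "continuous_on ?A (%x. trm idm d c x m $ j)" by (intro continuous_intros)
 then show "continuous_on ?A (%x. chart_coords c (param (length c) d x) m $ j)"
  by (rule continuous_on_cong[THEN iffD2, rotated -1]) (use ok co in auto)
 fix x w :: "'n coords"
 assume a: "x \<in> chart_dom d \<and> param (length c) d x \<in> U \<and> (\<forall>s. (%i. x i + s *s w i) \<in> chart_dom d)"
 let ?\<xi> = "%s i. x i + s *s w i"
 have x0: "?\<xi> 0 = x" by (simp add: fun_eq_iff)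
 have ok0: "trok idm d c (?\<xi> 0)" unfolding x0 using ok a by blast
 note t = trm_curve[OF analytic_line[of x w 0] ok0 d]
 have "(%s. trm idm d c (?\<xi> s) m $ j) analytic_on {0}" using t(1) by (simp add: analytic_coords_def)
 moreover have ev: "NEAR s. chart_coords c (param (length c) d (?\<xi> s)) m $ j = trm idm d c (?\<xi> s) m $ j"
  using t(3) by eventually_elim (use co a in simp)
 ultimately show "(%s. chart_coords c (param (length c) d (?\<xi> s)) m $ j) analytic_on {0}"
  using analytic_at_cong[OF ev refl] by blast
qed

text \<open>
  If \<open>S\<close> is given locally by the vanishing of coordinates that are free in a chart, then these coordinates are
  defining functions, and straight lines in the chart realize all values of their differentials.
\<close>

lemma has_codim_chart:
 fixes S :: "'n::finite point set"
 assumes S: "S \<subseteq> monster k"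
  and loc: "!!p. p \<in> S ==> \<exists>c x W I. length c = k \<and> x \<in> chart_dom c \<and> p = param k c x \<and> open W \<and> x \<in> W \<and>
   inj_on I {..<r} \<and> (\<forall>y\<in>chart_dom c \<inter> W. param k c y \<in> S \<longleftrightarrow> (\<forall>i<r. y (fst (I i)) $ snd (I i) = 0)) \<and>
   (\<forall>v. (\<forall>m j. (m, j) \<notin> I ` {..<r} --> v m $ j = 0) --> v \<in> chart_tan c)"
 shows "has_codim k S r"
 unfolding has_codim_def
proof (intro conjI S ballI)
 fix p assume "p \<in> S"
 from loc[OF this] obtain c x W and I :: "nat => nat \<times> 'n" where
  c: "length c = k" and x: "x \<in> chart_dom c" "p = param k c x" and W: "open W" "x \<in> W" and I: "inj_on I {..<r}"
  and eq: "\<forall>y\<in>chart_dom c \<inter> W. param k c y \<in> S \<longleftrightarrow> (\<forall>i<r. y (fst (I i)) $ snd (I i) = 0)"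
  and tan: "\<forall>v. (\<forall>m j. (m, j) \<notin> I ` {..<r} --> v m $ j = 0) --> v \<in> chart_tan c"
  by blast
 let ?U = "param k c ` (chart_dom c \<inter> W)"
 let ?f = "%i q. chart_coords c q (fst (I i)) $ snd (I i)"
 have co: "y \<in> chart_dom c ==> chart_coords c (param k c y) = y" for y using chart_coords_param c by blast
 have 1: "openin (monster_topology k) ?U" using chart_open[OF W(1), of c] c by simp
 have 2: "p \<in> ?U" using x W by blast
 have 3: "holomorphic_fun k ?U (?f i)" for i using chart_coords_holomorphic[of ?U c] c by blast
 have 4: "S \<inter> ?U = {q \<in> ?U. \<forall>i<r. ?f i q = 0}"
 proof (intro equalityI subsetI)
  fix q assume "q \<in> S \<inter> ?U"
  then obtain y where "y \<in> chart_dom c \<inter> W" "q = param k c y" "q \<in> S" by blast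
  then show "q \<in> {q \<in> ?U. \<forall>i<r. ?f i q = 0}" using eq co by auto
 next
  fix q assume q: "q \<in> {q \<in> ?U. \<forall>i<r. ?f i q = 0}"
  then obtain y where "y \<in> chart_dom c \<inter> W" "q = param k c y" by blast
  then show "q \<in> S \<inter> ?U" using eq co q by auto
 qed
 have 5: "\<exists>\<Gamma>. analytic_curve k \<Gamma> 0 \<and> \<Gamma> 0 = p \<and> (\<forall>i<r. deriv (%t. ?f i (\<Gamma> t)) 0 = w i)" for w :: "nat => complex"
 proof -
  define v :: "'n coords" where
   "v = (%m. \<chi> j. if (m, j) \<in> I ` {..<r} then w (the_inv_into {..<r} I (m, j)) else 0)"
  have v: "v \<in> chart_tan c" using tan by (simp add: v_def)
  have vi: "v (fst (I i)) $ snd (I i) = w i" if "i < r" for i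
   using that the_inv_into_f_f[OF I, of i] by (simp add: v_def)
  let ?\<xi> = "%t i. x i + t *s v i"
  let ?\<Gamma> = "%t. param k c (?\<xi> t)"
  have dom: "?\<xi> t \<in> chart_dom c" for t by (rule chart_line[OF x(1) v])
  have "represents (param k) c ?\<xi> ?\<Gamma> 0" unfolding represents_iff using analytic_line dom by simp
  then have "analytic_curve k ?\<Gamma> 0" unfolding analytic_curve_def using c by blast
  moreover have "?\<xi> 0 = x" by (simp add: fun_eq_iff)
  then have "?\<Gamma> 0 = p" using x(2) by simp
  moreover have "deriv (%t. ?f i (?\<Gamma> t)) 0 = w i" if i: "i < r" for i
   unfolding co[OF dom] by (rule DERIV_imp_deriv) (auto intro!: derivative_eq_intros simp: vi[OF i])
  ultimately show ?thesis by blast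
 qed
 show "\<exists>U f. openin (monster_topology k) U \<and> p \<in> U \<and> (\<forall>i<r. holomorphic_fun k U (f i)) \<and>
   S \<inter> U = {q \<in> U. \<forall>i<r. f i q = 0} \<and>
   (\<forall>w. \<exists>\<Gamma>. analytic_curve k \<Gamma> 0 \<and> \<Gamma> 0 = p \<and> (\<forall>i<r. deriv (%t. f i (\<Gamma> t)) 0 = w i))"
  by (rule exI[of _ ?U], rule exI[of _ ?f]) (use 1 2 3 4 5 in blast)
qed

lemma chart_tan3:
 assumes "v 3 $ a3 = 0" "v 2 $ a2 = 0" "v 1 $ a1 = 0" "!!i. i > 3 ==> v i = 0"
 shows "v \<in> chart_tan [a3, a2, a1]"
proof -
 have "(v(3 := 0, 2 := 0, 1 := 0)) i = 0" if "i > 0" for i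
  using assms(4)[of i] that by (cases "i > 3") (auto simp: not_less le_Suc_eq numeral_3_eq_3 numeral_2_eq_2)
 then show ?thesis using assms(1-3) by (simp add: numeral_3_eq_3 numeral_2_eq_2)
qed

lemma monster3_chart:
 assumes "p \<in> monster 3"
 obtains a3 a2 a1 :: "'n::finite" and x where "x \<in> chart_dom [a3, a2, a1]" "p = param 3 [a3, a2, a1] x"
proof -
 obtain c :: "'n list" and x where c: "length c = 3" "x \<in> chart_dom c" "p = param 3 c x"
  using assms unfolding monster_chart by blast
 moreover obtain a3 a2 a1 where "c = [a3, a2, a1]" using c(1) by (auto simp: numeral_3_eq_3 length_Suc_conv)
 ultimately show thesis using that by blast
qed

text \<open>
  The open condition that distinguishes the class within \<open>RVT\<close>.
\<close>

definition nonzero_off :: "3 => 3 coords set" where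
 "nonzero_off a = {x. \<forall>b. b ~= a --> x 3 $ b ~= 0}"

lemma open_nonzero_off: "open (nonzero_off a)"
proof -
 have "continuous_on UNIV (%x :: 3 coords. x 3 $ b)" for b
  by (intro continuous_intros continuous_on_product_coordinates)
 then have "open {x :: 3 coords. x 3 $ b ~= 0}" for b by (intro open_Collect_neq continuous_on_const)
 then have "open (\<Inter>b\<in>- {a}. {x :: 3 coords. x 3 $ b ~= 0})" by (intro open_INT) auto
 moreover have "nonzero_off a = (\<Inter>b\<in>- {a}. {x :: 3 coords. x 3 $ b ~= 0})" by (auto simp: nonzero_off_def)
 ultimately show ?thesis by simp
qed

lemma cusp345_iff:
 "cusp345 a2 a1 x \<longleftrightarrow> x 2 $ a1 = 0 \<and> x 3 $ a2 ~= 0 \<and> x 3 $ a1 = 0 \<and> x \<in> nonzero_off a1"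
 unfolding cusp345_def nonzero_off_def by auto

context
 fixes S :: "3 point set"
 assumes S: "S \<subseteq> monster 3"
begin

lemma cusp345_open:
 assumes char: "!!a3 a2 a1 x. x \<in> chart_dom [a3, a2, a1] ==> param 3 [a3, a2, a1] x \<in> S \<longleftrightarrow> cusp345 a2 a1 x"
 shows "openin (subtopology (monster_topology 3) (RVT_class [R, V, T])) S"
proof -
 let ?O = "\<Union>a3. \<Union>a2. \<Union>a1. param 3 [a3, a2, a1] ` (chart_dom [a3, a2, a1] \<inter> nonzero_off a1)"
 have "openin (monster_topology 3) (param 3 [a3, a2, a1] ` (chart_dom [a3, a2, a1] \<inter> nonzero_off a1))" for a3 a2 a1
 proof -
  have "length [a3, a2, a1] = 3" by simp
  then show ?thesis using chart_open[OF open_nonzero_off, of "[a3, a2, a1]" a1] by presburger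
 qed
 then have "openin (monster_topology 3) (\<Union>a1. param 3 [a3, a2, a1] ` (chart_dom [a3, a2, a1] \<inter> nonzero_off a1))" for a3 a2
  by (intro openin_Union) blast
 then have "openin (monster_topology 3) (\<Union>a2. \<Union>a1. param 3 [a3, a2, a1] ` (chart_dom [a3, a2, a1] \<inter> nonzero_off a1))" for a3
  by (intro openin_Union) blast
 then have "openin (monster_topology 3) ?O" by (intro openin_Union) blast
 moreover have "S = ?O \<inter> RVT_class [R, V, T]"
 proof (intro equalityI subsetI)
  fix p assume p: "p \<in> S"
  obtain a3 a2 a1 x where x: "x \<in> chart_dom [a3, a2, a1]" "p = param 3 [a3, a2, a1] x"
   by (rule monster3_chart[OF subsetD[OF S p]])
  then have c: "cusp345 a2 a1 x" using char[OF x(1)] p unfolding x(2) by blast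
  then have "p \<in> RVT_class [R, V, T]" "x \<in> nonzero_off a1"
   using RVT_chart[OF x(1)] unfolding x(2) cusp345_iff by blast+
  then show "p \<in> ?O \<inter> RVT_class [R, V, T]" using x by blast
 next
  fix p assume p: "p \<in> ?O \<inter> RVT_class [R, V, T]"
  then obtain a3 a2 a1 x where x: "x \<in> chart_dom [a3, a2, a1]" "x \<in> nonzero_off a1" "p = param 3 [a3, a2, a1] x" by blast
  then have "cusp345 a2 a1 x" using p RVT_chart[OF x(1)] unfolding cusp345_iff by blast
  then show "p \<in> S" using char[OF x(1)] unfolding x(3) by blast
 qed
 ultimately show ?thesis unfolding openin_subtopology by blast
qed

lemma cusp345_codim:
 assumes char: "!!a3 a2 a1 x. x \<in> chart_dom [a3, a2, a1] ==> param 3 [a3, a2, a1] x \<in> S \<longleftrightarrow> cusp345 a2 a1 x"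
 shows "has_codim 3 S 2"
proof (rule has_codim_chart[OF S])
 fix p assume p: "p \<in> S"
 obtain a3 a2 a1 x where x: "x \<in> chart_dom [a3, a2, a1]" "p = param 3 [a3, a2, a1] x"
  by (rule monster3_chart[OF subsetD[OF S p]])
 then have c: "cusp345 a2 a1 x" using char[OF x(1)] p unfolding x(2) by blast
 then have ne: "a2 ~= a1" "a3 ~= a1" using chart3[OF x(1)] unfolding cusp345_def by auto
 let ?I = "%i. if i = (0::nat) then (2::nat, a1) else (3, a1)"
 have lt: "(\<forall>i<2. P i) \<longleftrightarrow> P 0 \<and> P 1" for P :: "nat => bool" by (auto simp: less_2_cases_iff)
 have im: "?I ` {..<2} = {(2, a1), (3, a1)}" by (auto simp: image_iff less_2_cases_iff intro: bexI[of _ 0] bexI[of _ 1])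
 have inj: "inj_on ?I {..<2}" by (auto simp: inj_on_def less_2_cases_iff)
 have zero: "param 3 [a3, a2, a1] y \<in> S \<longleftrightarrow> (\<forall>i<2. y (fst (?I i)) $ snd (?I i) = 0)"
  if "y \<in> chart_dom [a3, a2, a1] \<inter> nonzero_off a1" for y
  unfolding lt using char[of y a3 a2 a1] that ne by (auto simp: cusp345_iff nonzero_off_def)
 have tan: "v \<in> chart_tan [a3, a2, a1]" if "\<forall>m j. (m, j) \<notin> ?I ` {..<2} --> v m $ j = 0" for v
  using that[unfolded im] ne by (intro chart_tan3) (auto simp: vec_eq_iff)
 show "\<exists>c x W I. length c = 3 \<and> x \<in> chart_dom c \<and> p = param 3 c x \<and> open W \<and> x \<in> W \<and>
   inj_on I {..<2::nat} \<and> (\<forall>y\<in>chart_dom c \<inter> W. param 3 c y \<in> S \<longleftrightarrow> (\<forall>i<2. y (fst (I i)) $ snd (I i) = 0)) \<and>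
   (\<forall>v. (\<forall>m j. (m, j) \<notin> I ` {..<2} --> v m $ j = 0) --> v \<in> chart_tan c)"
 proof (rule exI[of _ "[a3, a2, a1]"], rule exI[of _ x], rule exI[of _ "nonzero_off a1"], rule exI[of _ ?I], intro conjI)
  show "length [a3, a2, a1] = 3" by simp
  show "x \<in> chart_dom [a3, a2, a1]" "p = param 3 [a3, a2, a1] x" by (fact x)+
  show "open (nonzero_off a1)" by (rule open_nonzero_off)
  show "x \<in> nonzero_off a1" using c by (simp add: cusp345_iff)
  show "inj_on ?I {..<2}" by (fact inj)
  show "\<forall>y\<in>chart_dom [a3, a2, a1] \<inter> nonzero_off a1. param 3 [a3, a2, a1] y \<in> S \<longleftrightarrow> (\<forall>i<2. y (fst (?I i)) $ snd (?I i) = 0)"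
   using zero by blast
  show "\<forall>v. (\<forall>m j. (m, j) \<notin> ?I ` {..<2} --> v m $ j = 0) --> v \<in> chart_tan [a3, a2, a1]"
   using tan by blast
 qed
qed

lemma cusp467_codim:
 assumes char: "!!a3 a2 a1 x. x \<in> chart_dom [a3, a2, a1] ==> param 3 [a3, a2, a1] x \<in> S \<longleftrightarrow> cusp467 a2 a1 x"
 shows "has_codim 3 S 3"
proof (rule has_codim_chart[OF S])
 fix p assume p: "p \<in> S"
 obtain a3 a2 a1 x where x: "x \<in> chart_dom [a3, a2, a1]" "p = param 3 [a3, a2, a1] x"
  by (rule monster3_chart[OF subsetD[OF S p]])
 then have c: "cusp467 a2 a1 x" using char[OF x(1)] p unfolding x(2) by blast
 then have ne: "a2 ~= a1" "a3 ~= a1" "a3 ~= a2" using chart3[OF x(1)] unfolding cusp467_def by auto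
 let ?I = "%i. if i = (0::nat) then (2::nat, a1) else if i = 1 then (3, a1) else (3, a2)"
 have l3: "i < 3 \<longleftrightarrow> i = 0 \<or> i = 1 \<or> i = 2" for i :: nat by auto
 have lt: "(\<forall>i<3. P i) \<longleftrightarrow> P 0 \<and> P 1 \<and> P 2" for P :: "nat => bool" unfolding l3 by auto
 have s3: "{..<3} = {0, 1, 2::nat}" by auto
 have im: "?I ` {..<3} = {(2, a1), (3, a1), (3, a2)}" unfolding s3 by auto
 have inj: "inj_on ?I {..<3}" unfolding s3 using ne by (auto simp: inj_on_def)
 have zero: "param 3 [a3, a2, a1] y \<in> S \<longleftrightarrow> (\<forall>i<3. y (fst (?I i)) $ snd (?I i) = 0)"
  if "y \<in> chart_dom [a3, a2, a1] \<inter> UNIV" for y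
  unfolding lt using char[of y a3 a2 a1] that by (simp add: cusp467_def del: chart_dom.simps)
 have tan: "v \<in> chart_tan [a3, a2, a1]" if "\<forall>m j. (m, j) \<notin> ?I ` {..<3} --> v m $ j = 0" for v
  using that[unfolded im] ne by (intro chart_tan3) (auto simp: vec_eq_iff)
 show "\<exists>c x W I. length c = 3 \<and> x \<in> chart_dom c \<and> p = param 3 c x \<and> open W \<and> x \<in> W \<and>
   inj_on I {..<3::nat} \<and> (\<forall>y\<in>chart_dom c \<inter> W. param 3 c y \<in> S \<longleftrightarrow> (\<forall>i<3. y (fst (I i)) $ snd (I i) = 0)) \<and>
   (\<forall>v. (\<forall>m j. (m, j) \<notin> I ` {..<3} --> v m $ j = 0) --> v \<in> chart_tan c)"
 proof (rule exI[of _ "[a3, a2, a1]"], rule exI[of _ x], rule exI[of _ UNIV], rule exI[of _ ?I], intro conjI)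
  show "length [a3, a2, a1] = 3" by simp
  show "x \<in> chart_dom [a3, a2, a1]" "p = param 3 [a3, a2, a1] x" by (fact x)+
  show "open (UNIV :: 3 coords set)" by simp
  show "x \<in> UNIV" by simp
  show "inj_on ?I {..<3}" by (fact inj)
  show "\<forall>y\<in>chart_dom [a3, a2, a1] \<inter> UNIV. param 3 [a3, a2, a1] y \<in> S \<longleftrightarrow> (\<forall>i<3. y (fst (?I i)) $ snd (?I i) = 0)"
   using zero by blast
  show "\<forall>v. (\<forall>m j. (m, j) \<notin> ?I ` {..<3} --> v m $ j = 0) --> v \<in> chart_tan [a3, a2, a1]"
   using tan by blast
 qed
qed

end

section \<open>The class RVL in any dimension\<close>

text \<open>
  The component that the charts use for the horizontal lift is the factor of the projection to the lower
  level, and the projection commutes with the transition map.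
\<close>

lemma trG_head:
 assumes cd: "length c = length d" and x: "x \<in> chart_dom (a # c)" and ok: "trok \<phi> (a # c) (b # d) x"
 shows "trG \<phi> (a # c) (b # d) x u $ b = u $ a * trG \<phi> c d x (x (Suc (length c))) $ b"
proof -
 let ?k = "Suc (length c)" and ?y = "x (Suc (length c))"
 let ?x0 = "x(Suc (length c) := 0)" and ?w = "trG \<phi> (a # c) (b # d) x u"
 have kd: "Suc (length d) = ?k" "length (a # c) = length (b # d)" using cd by simp_all
 have x0: "?x0 \<in> chart_dom c" using x by simp
 have ok': "trok \<phi> c d x" "trG \<phi> c d x ?y $ b ~= 0" using ok trok_Cons[OF cd, of \<phi> a b x] by simp_all
 have ok0: "trok \<phi> c d ?x0" using ok'(1) cd by simp
 define y' where "y' = inverse (trG \<phi> c d x ?y $ b) *s trG \<phi> c d x ?y"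
 have yb: "y' $ b = 1" using ok'(2) by (simp add: y'_def)
 have tm: "trm \<phi> (a # c) (b # d) x = (trm \<phi> c d x)(?k := y')" unfolding y'_def by (rule trm_Cons[OF cd])
 have "trd \<phi> (a # c) (b # d) x (chart_frame (a # c) x u) = chart_frame (b # d) (trm \<phi> (a # c) (b # d) x) ?w"
  by (rule trd_frame[OF kd(2) x ok])
 then have "(trd \<phi> (a # c) (b # d) x (chart_frame (a # c) x u))(?k := 0) =
   (chart_frame (b # d) (trm \<phi> (a # c) (b # d) x) ?w)(?k := 0)" by simp
 moreover have "(chart_frame (b # d) (trm \<phi> (a # c) (b # d) x) ?w)(?k := 0) = chart_frame d (trm \<phi> c d x) (?w $ b *s y')"
  using chart_frame_trunc[of b d "trm \<phi> (a # c) (b # d) x" ?w] cd unfolding kd tm by simp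
 moreover have "(trd \<phi> (a # c) (b # d) x (chart_frame (a # c) x u))(?k := 0) = trd \<phi> c d x (chart_frame c x (u $ a *s ?y))"
  using trd_Cons_trunc[OF cd, of \<phi> a b x "chart_frame (a # c) x u"] chart_frame_trunc[of a c x u]
   tr_upd(5)[OF cd, of ?k \<phi> x "chart_frame (a # c) x u" 0] cd by (simp del: chart_frame.simps)
 moreover have "trd \<phi> c d x (chart_frame c x (u $ a *s ?y)) = chart_frame d (trm \<phi> c d x) (u $ a *s trG \<phi> c d x ?y)"
  using trd_frame[OF cd x0 ok0, of "u $ a *s ?y"] cd by (simp add: trG_linear)
 ultimately have "chart_frame d (trm \<phi> c d x) (?w $ b *s y') = chart_frame d (trm \<phi> c d x) (u $ a *s trG \<phi> c d x ?y)" by simp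
 moreover have "trm \<phi> c d x \<in> chart_dom d" using trm_dom[OF cd x0 ok0] cd by simp
 ultimately have "?w $ b *s y' = u $ a *s trG \<phi> c d x ?y" using chart_frame_inj by blast
 from arg_cong[OF this, of "%v. v $ b"] show ?thesis using yb by (simp only: vector_smult_component) simp
qed

text \<open>
  Prolonged maps preserve the fibers, hence vertical lines.
\<close>

lemma vertical_transition:
 assumes x: "x \<in> chart_dom [a2, a1]" and ok: "trok \<phi> [a2, a1] [b2, b1] x" and 0: "x 2 $ a1 = 0"
 shows "trm \<phi> [a2, a1] [b2, b1] x 2 $ b1 = 0"
proof -
 have l: "length [a1] = length [b1]" "length [] = length []" "Suc (length [a1]) = 2" by simp_all
 have x1: "x(2 := 0) \<in> chart_dom [a1]" using x by (simp add: numeral_2_eq_2 del: fun_upd_apply)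
 have ok1: "trok \<phi> [a1] [b1] x" using ok trok_Cons[OF l(1), of \<phi> a2 b2 x] by blast
 have ok2: "trok \<phi> [a1] [b1] (x(2 := 0))" using tr_upd(2)[OF l(1), of 2 \<phi> x 0] ok1 by simp
 have "trG \<phi> [a1] [b1] (x(2 := 0)) (x 2) $ b1 = 0"
  using trG_head[OF l(2) x1 ok2, of "x 2"] 0 by simp
 then have "trG \<phi> [a1] [b1] x (x 2) $ b1 = 0" using tr_upd(3)[OF l(1), of 2 \<phi> x 0 "x 2"] by simp
 then show ?thesis unfolding trm_Cons[OF l(1)] l(3) by simp
qed

text \<open>
  Only the last claim is not about vertical directions. There the line is tangent to the locus where the
  coordinate \<open>x 2 $ a1\<close> vanishes; this locus is preserved by \<open>vertical_transition\<close>, so the derivative of the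
  corresponding coordinate of the image along the line vanishes.
\<close>

lemma RVL_transition:
 assumes x: "x \<in> chart_dom [a3, a2, a1]" and ok: "trok \<phi> [a3, a2, a1] [b3, b2, b1] x"
  and h: "x 2 $ a1 = 0" "x 3 $ a2 = 0" "x 3 $ a1 = 0"
 shows "trm \<phi> [a3, a2, a1] [b3, b2, b1] x 2 $ b1 = 0" "trm \<phi> [a3, a2, a1] [b3, b2, b1] x 3 $ b2 = 0"
  "trm \<phi> [a3, a2, a1] [b3, b2, b1] x 3 $ b1 = 0"
proof -
 have l: "length [a2, a1] = length [b2, b1]" "Suc (length [a2, a1]) = 3" "length [a1] = length [b1]" "length [b2, b1] < 3" by simp_all
 let ?c = "[a2, a1]" and ?d = "[b2, b1]" and ?x = "x(3 := 0)"
 have x2: "?x \<in> chart_dom ?c" by (rule chart3_lower(1)[OF x])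
 have ok1: "trok \<phi> ?c ?d x" using ok trok_Cons[OF l(1), of \<phi> a3 b3 x] by blast
 have ok2: "trok \<phi> ?c ?d ?x" using tr_upd(2)[OF l(1,4), of \<phi> x 0] ok1 by blast
 have Gx: "trG \<phi> ?c ?d ?x u = trG \<phi> ?c ?d x u" for u by (rule tr_upd(3)[OF l(1,4)])
 have tx: "trm \<phi> ?c ?d ?x = trm \<phi> ?c ?d x" by (rule tr_upd(1)[OF l(1,4)])
 note tm = trm_Cons[OF l(1), of \<phi> a3 b3 x, unfolded l(2)]
 have m2: "trm \<phi> ?c ?d ?x 2 $ b1 = 0" by (rule vertical_transition[OF x2 ok2]) (use h in simp)
 then show "trm \<phi> [a3, a2, a1] [b3, b2, b1] x 2 $ b1 = 0" unfolding tm tx by simp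
 have "trG \<phi> ?c ?d ?x (x 3) $ b2 = 0" using trG_head[OF l(3) x2 ok2, of "x 3"] h by simp
 then show "trm \<phi> [a3, a2, a1] [b3, b2, b1] x 3 $ b2 = 0" unfolding tm Gx by simp
 let ?v = "chart_frame ?c ?x (x 3)"
 let ?\<xi> = "%t i. ?x i + t *s ?v i"
 have \<xi>0: "?\<xi> 0 = ?x" by (simp add: fun_eq_iff)
 have ok3: "trok \<phi> ?c ?d (?\<xi> 0)" unfolding \<xi>0 by (rule ok2)
 note t = trm_curve[OF analytic_line[of ?x ?v 0] ok3 l(1)]
 have v: "?v 2 $ a1 = 0" using h by (simp add: numeral_2_eq_2)
 have dom: "?\<xi> s \<in> chart_dom ?c" for s by (rule chart_line[OF x2 chart_frame_tan])
 have z: "?\<xi> s 2 $ a1 = 0" for s using v h(1) by (simp del: chart_frame.simps)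
 from t(3) have ev: "NEAR s. trm \<phi> ?c ?d (?\<xi> s) 2 $ b1 = 0"
  by eventually_elim (rule vertical_transition[OF dom _ z])
 have "cderiv (%s. trm \<phi> ?c ?d (?\<xi> s)) 0 2 $ b1 = deriv (%s. trm \<phi> ?c ?d (?\<xi> s) 2 $ b1) 0"
  by (simp add: cderiv_def)
 also have "\<dots> = deriv (%s. 0) 0" by (rule deriv_cong_ev[OF ev refl])
 finally have "cderiv (%s. trm \<phi> ?c ?d (?\<xi> s)) 0 2 $ b1 = 0" by simp
 then have "trd \<phi> ?c ?d ?x ?v 2 $ b1 = 0" unfolding t(2) \<xi>0 cderiv_line .
 then have f: "chart_frame ?d (trm \<phi> ?c ?d ?x) (trG \<phi> ?c ?d ?x (x 3)) 2 $ b1 = 0" unfolding trd_frame[OF l(1) x2 ok2] .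
 have "trm \<phi> ?c ?d ?x \<in> chart_dom ?d" by (rule trm_dom[OF l(1) x2 ok2])
 then have "trm \<phi> ?c ?d ?x 2 $ b2 = 1" by (simp add: numeral_2_eq_2)
 then have "b1 ~= b2" using m2 by auto
 then have "trG \<phi> ?c ?d ?x (x 3) $ b1 = 0" using f by (simp add: numeral_2_eq_2)
 then show "trm \<phi> [a3, a2, a1] [b3, b2, b1] x 3 $ b1 = 0" unfolding tm Gx by simp
qed

lemma RVL_orbit:
 fixes p :: "'n::finite point"
 assumes p: "p \<in> RVL"
 shows "orbit 3 p \<subseteq> RVL"
proof
 fix q assume "q \<in> orbit 3 p"
 then obtain U \<phi> where U: "q = prolong_map \<phi> 3 p" "local_diffeo U \<phi>" "foot ((under ^^ 3) p) \<in> U" unfolding orbit_def by blast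
 have "p \<in> monster 3" using p by (simp add: RVL_def)
 then obtain a3 a2 a1 x where x: "x \<in> chart_dom [a3, a2, a1]" "p = param 3 [a3, a2, a1] x" by (rule monster3_chart)
 have len: "length [a3, a2, a1] = 3" by simp
 have "(under ^^ 3) p = Base (x 0)" using under_pow_param[OF x(1), of 3] unfolding x(2) len by simp
 then have x0: "x 0 \<in> U" using U(3) by simp
 obtain d where d: "length d = length [a3, a2, a1]" "trok \<phi> [a3, a2, a1] d x"
  using trok_exists[OF x(1) local_diffeo_diffeo_at[OF U(2) x0]] by blast
 then obtain b3 b2 b1 where b: "d = [b3, b2, b1]" by (auto simp: length_Suc_conv)
 have q: "q = param 3 [b3, b2, b1] (trm \<phi> [a3, a2, a1] [b3, b2, b1] x)"
  using prolong_map_chart[OF d(1)[symmetric] x(1) d(2)] unfolding U(1) x(2) len b .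
 have dom: "trm \<phi> [a3, a2, a1] [b3, b2, b1] x \<in> chart_dom [b3, b2, b1]"
  using trm_dom[OF d(1)[symmetric] x(1) d(2)] unfolding b .
 show "q \<in> RVL"
  using p RVL_transition[OF x(1) d(2)[unfolded b]] unfolding q RVL_chart[OF dom] x(2) RVL_chart[OF x(1)] by blast
qed

text \<open>
  Some nontrivial combination of the three series is zero, but a nontrivial combination of series of
  different orders is not.
\<close>

lemma span_two_orders:
 fixes \<alpha> \<beta> :: "complex^3"
 assumes F: "!!k. F k = fps_const (\<alpha> $ k) * f + fps_const (\<beta> $ k) * g"
  and o: "od (F 1) p" "od (F 2) q" "od (F 3) r" and pqr: "p < q" "q < r"
 shows False
proof -
 obtain c where c: "c ~= 0" "dot c \<alpha> = 0" "dot c \<beta> = 0" using exists_orthogonal by blast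
 have "fps_nth (F k) i = \<alpha> $ k * fps_nth f i + \<beta> $ k * fps_nth g i" for k i unfolding F by simp
 then have "c $ 1 * fps_nth (F 1) i + c $ 2 * fps_nth (F 2) i + c $ 3 * fps_nth (F 3) i =
   dot c \<alpha> * fps_nth f i + dot c \<beta> * fps_nth g i" for i by (simp add: dot_def sum_3 algebra_simps)
 then have s: "c $ 1 * fps_nth (F 1) i + c $ 2 * fps_nth (F 2) i + c $ 3 * fps_nth (F 3) i = 0" for i using c by simp
 have "c $ 1 = 0" using s[of p] o pqr by (simp add: od_def)
 moreover then have "c $ 2 = 0" using s[of q] o pqr by (simp add: od_def)
 moreover then have "c $ 3 = 0" using s[of r] o \<open>c $ 1 = 0\<close> by (simp add: od_def)
 ultimately show False using c(1) by (simp add: vec_eq_iff forall_3)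
qed

lemma od_shift:
 assumes "od (fps_deriv F) d" shows "od (F - fps_const (fps_nth F 0)) (Suc d)"
 unfolding od_deriv_iff using assms by simp

text \<open>
  The coordinates of a level, minus their constant terms, have order one more than the \<open>G\<close> of the next level.
  Subtracting the constants amounts to subtracting multiples of the previous projections.
\<close>

lemma RVL_orders:
 assumes L: "lift3 a1 a2 a3 D X Y Z G1 G2 G3 U"
  and h: "fps_nth (Y a1) 0 = 0" "fps_nth (Z a1) 0 = 0" "fps_nth (Z a2) 0 = 0"
   "fps_nth (U a1) 0 ~= 0" "fps_nth (U a2) 0 ~= 0" "fps_nth (U a3) 0 ~= 0"
 shows "ge (D j) 3" "od (D a1) 3" "\<exists>c. od (D a2 - fps_const c * D a1) 5"
  "\<exists>y c. od (D a3 - fps_const y * D a2 - fps_const c * D a1) 6"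
proof -
 note E = lift3D[OF L]
 have ne: "a1 ~= a2" "a1 ~= a3" "a2 ~= a3" using h(1-3) E(5,8) by auto
 have G3: "od G3 0" using h(6) E(10)[of a3] by (simp add: od_0)
 have "od (Z a2) 1" "od (Z a1) 1" using h E(10)[of a2] E(10)[of a1] ne by (simp_all add: od_deriv_iff od_0 One_nat_def)
 then have oG2: "od (G3 * Z a2) 1" and "od (G3 * Z a1) 1" using od_mult[OF G3] by fastforce+
 then have G2: "od G2 1" and Y1: "od (fps_deriv (Y a1)) 1" using E(7)[of a2] E(7)[of a1] ne by simp_all
 have "od (Y a1) 2" using Y1 h(1) od_deriv_iff[of "Y a1" 1] by (simp add: numeral_2_eq_2)
 then have G1: "od G1 3" using od_mult[OF G2, of "Y a1" 2] E(4)[of a1] by (simp add: numeral_3_eq_3 numeral_2_eq_2)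
 show "ge (D j) 3" using ge_mult[OF od_ge[OF G1], of "X j" 0] E(1)[of j] by simp
 show "od (D a1) 3" using G1 E(1)[of a1] E(2) by simp
 have X2: "fps_deriv (X a2) = G2" using E(4)[of a2] E(5) ne by simp
 have "od (X a2 - fps_const (fps_nth (X a2) 0)) (Suc 1)" by (rule od_shift) (simp only: X2 G2)
 from od_mult[OF G1 this] have "od (D a2 - fps_const (fps_nth (X a2) 0) * D a1) 5"
  using E(1)[of a1] E(1)[of a2] E(2) by (simp add: algebra_simps eval_nat_numeral)
 then show "\<exists>c. od (D a2 - fps_const c * D a1) 5" by blast
 define y where "y = fps_nth (Y a3) 0"
 have "fps_deriv (Y a3) = G3" using E(7)[of a3] E(8) ne by simp
 then have "od (Y a3 - fps_const y) (Suc 0)" unfolding y_def by (intro od_shift) (simp only: G3)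
 from od_mult[OF G2 this] have o: "od (G2 * (Y a3 - fps_const y)) 2" by (simp add: numeral_2_eq_2)
 define W where "W = X a3 - fps_const y * X a2"
 have "fps_deriv W = G2 * (Y a3 - fps_const y)" using E(4)[of a3] X2 ne by (simp add: W_def algebra_simps)
 then have "od (W - fps_const (fps_nth W 0)) (Suc 2)" using o by (intro od_shift) simp
 from od_mult[OF G1 this] have o6: "od (G1 * (W - fps_const (fps_nth W 0))) 6" by (simp add: eval_nat_numeral)
 have "G1 * (W - fps_const (fps_nth W 0)) = D a3 - fps_const y * D a2 - fps_const (fps_nth W 0) * D a1"
  unfolding E(1)[of a3] E(1)[of a2] E(1)[of a1] E(2) W_def by (simp add: algebra_simps)
 then show "\<exists>y c. od (D a3 - fps_const y * D a2 - fps_const c * D a1) 6" using o6 by metis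
qed

text \<open>
  If the curve were in a surface, then its image under a straightening map \<open>\<phi>\<close> would have at most two nonconstant
  coordinates. Applying \<open>component_expansion\<close> to the inverse of \<open>\<phi>\<close> exhibits three projections, of
  orders 3, 5, 6, as combinations of two series up to order seven.
\<close>

lemma RVL_embedding_ge:
 fixes x :: "'n::finite coords" and T :: "(complex^'n) set"
 assumes x: "x \<in> chart_dom [a3, a2, a1]" and p: "param 3 [a3, a2, a1] x \<in> RVL" and g: "\<gamma> \<in> Germ 3 (param 3 [a3, a2, a1] x)"
  and T: "submanifold e T" "NEAR t. \<gamma> t \<in> T"
 shows "3 \<le> e"
proof (rule ccontr)
 assume e: "\<not> 3 \<le> e"
 have h: "x 2 $ a1 = 0" "x 3 $ a2 = 0" "x 3 $ a1 = 0" using p RVL_chart[OF x] by blast+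
 from Germ_level3[OF x g] obtain \<xi> u G1 G2 G3 where l: "clift \<gamma> [a3, a2, a1] \<xi> u" and
  L: "lift3 a1 a2 a3 (%j. fps_deriv (Ev \<gamma> j)) (Ec \<xi> 1) (Ec \<xi> 2) (Ec \<xi> 3) G1 G2 G3 (Ev u)" and
  n: "!!m j. fps_nth (Ec \<xi> m j) 0 = x m $ j" and
  U: "fps_nth (Ev u a3) 0 ~= 0" "x 3 $ a2 = 0 ==> fps_nth (Ev u a2) 0 ~= 0"
  "x 2 $ a1 = 0 ==> x 3 $ a1 = 0 ==> fps_nth (Ev u a1) 0 ~= 0" by metis
 let ?D = "%j. fps_deriv (Ev \<gamma> j)"
 have an: "analytic_vec \<gamma> 0" by (rule clift_germ[OF l])
 note O = RVL_orders[OF L, unfolded n, OF h(1) h(3) h(2) U(3)[OF h(1,3)] U(2)[OF h(2)] U(1)]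
 obtain c where o5: "od (?D a2 - fps_const c * ?D a1) 5" using O(3) by blast
 obtain y c' where o6: "od (?D a3 - fps_const y * ?D a2 - fps_const c' * ?D a1) 6" using O(4) by blast
 have "\<gamma> 0 \<in> T" by (rule eventually_nhds_x_imp_x[OF T(2)])
 then obtain V \<phi> and J :: "'n set" where V: "\<gamma> 0 \<in> V" "local_diffeo V \<phi>" "card J = e"
  "\<phi> ` (T \<inter> V) = {w \<in> \<phi> ` V. \<forall>j. j \<notin> J --> w $ j = 0}"
  using T(1) unfolding submanifold_def by blast
 obtain \<psi> where \<psi>: "local_diffeo (\<phi> ` V) \<psi>" "!!z. z \<in> V ==> \<psi> (\<phi> z) = z" using local_diffeo_inverse[OF V(2)] by blast
 let ?\<delta> = "%t. \<phi> (\<gamma> t)"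
 have d: "diffeo_at \<phi> (\<gamma> 0)" by (rule local_diffeo_diffeo_at[OF V(2,1)])
 have d': "diffeo_at \<psi> (?\<delta> 0)" using local_diffeo_diffeo_at[OF \<psi>(1)] V(1) by simp
 have an': "analytic_vec ?\<delta> 0" by (rule diffeo_analytic_vec[OF d an])
 have "open V" using V(2) by (simp add: local_diffeo_def)
 then have evV: "NEAR t. \<gamma> t \<in> V" using analytic_vec_tendsto[OF an] V(1) by (auto simp: tendsto_def)
 have zero: "fps_deriv (Ev ?\<delta> j) = 0" if j: "j \<notin> J" for j
 proof -
  from T(2) evV have "NEAR t. ?\<delta> t $ j = 0"
  proof eventually_elim
   case (elim t)
   then have "\<phi> (\<gamma> t) \<in> \<phi> ` (T \<inter> V)" by blast
   then show ?case unfolding V(4) using j by blast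
  qed
  then have "Ev ?\<delta> j = E (%t. 0)" unfolding Ev_def by (rule E_cong)
  then show ?thesis by (simp add: E_const)
 qed
 have e\<delta>: "ge (fps_deriv (Ev ?\<delta> j)) 3" for j
 proof -
  define M where "M j i = pdiv (%z. \<phi> z $ j) i (\<gamma> 0)" for j i
  have M: "\<forall>j. ge (fps_deriv (Ev ?\<delta> j) - (\<Sum>i\<in>UNIV. fps_const (M j i) * ?D i)) (2 * 3 + 1)"
   unfolding M_def using component_expansion[OF d an O(1)] by blast
  have "ge (\<Sum>i\<in>UNIV. fps_const (M j i) * ?D i) 3" 
  proof -
   have "ge (fps_const (M j i) * ?D i) 3" for i using ge_mult[OF ge_0 O(1)[of i], of "fps_const (M j i)"] by simp
   then show ?thesis unfolding ge_def fps_sum_nth by (simp add: sum.neutral del: fps_deriv_nth fps_mult_left_const_nth)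
  qed
  moreover have "ge (fps_deriv (Ev ?\<delta> j) - (\<Sum>i\<in>UNIV. fps_const (M j i) * ?D i)) 3"
   by (rule ge_mono[OF M[rule_format]]) simp
  ultimately show ?thesis using ge_add by fastforce
 qed
 define M where "M j i = pdiv (%z. \<psi> z $ j) i (?\<delta> 0)" for j i
 have M: "\<forall>j. ge (fps_deriv (Ev (%t. \<psi> (?\<delta> t)) j) - (\<Sum>i\<in>UNIV. fps_const (M j i) * fps_deriv (Ev ?\<delta> i))) (2 * 3 + 1)"
  unfolding M_def using component_expansion[where e = 3, OF d' an' e\<delta>] by blast
 from evV have "NEAR t. \<psi> (?\<delta> t) = \<gamma> t" by eventually_elim (rule \<psi>(2))
 then have Ev\<psi>: "Ev (%t. \<psi> (?\<delta> t)) j = Ev \<gamma> j" for j by (rule Ev_cong)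
 define P where "P j = (\<Sum>i\<in>UNIV. fps_const (M j i) * fps_deriv (Ev ?\<delta> i))" for j
 have PD: "ge (P j - ?D j) 7" for j
  using M[rule_format, of j] unfolding Ev\<psi> P_def[symmetric] by (simp add: ge_def)
 obtain i k where ik: "J \<subseteq> {i, k}"
 proof -
  have fin: "finite J" by simp
  consider "card J = 0" | "card J = 1" | "card J = 2" using e V(3) by linarith
  then show thesis
  proof cases
   case 1
   then show thesis using that[of undefined undefined] fin by simp
  next
   case 2
   then obtain i where "J = {i}" using card_1_singletonE by blast
   then show thesis using that[of i i] by simp
  next
   case 3
   then obtain i k where "J = {i, k}" unfolding card_2_iff by blast
   then show thesis using that[of i k] by simp
  qed
 qed
 \<comment> \<open>If \<open>i = k\<close>, there is at most one series, and it must not be counted twice.\<close>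
 define \<alpha> where "\<alpha> j = M j i" for j
 define \<beta> where "\<beta> j = (if i = k then 0 else M j k)" for j
 let ?f = "fps_deriv (Ev ?\<delta> i)" and ?g = "fps_deriv (Ev ?\<delta> k)"
 have P: "P j = fps_const (\<alpha> j) * ?f + fps_const (\<beta> j) * ?g" for j
 proof -
  have "P j = (\<Sum>m\<in>{i, k}. fps_const (M j m) * fps_deriv (Ev ?\<delta> m))"
   unfolding P_def by (rule sum.mono_neutral_right) (use zero ik in auto)
  then show ?thesis by (simp add: \<alpha>_def \<beta>_def)
 qed
 define F where "F m = (if m = 1 then P a1 else if m = 2 then P a2 - fps_const c * P a1
   else P a3 - fps_const y * P a2 - fps_const c' * P a1)" for m :: 3
 define A :: "complex^3" where "A = (\<chi> m. if m = 1 then \<alpha> a1 else if m = 2 then \<alpha> a2 - c * \<alpha> a1 else \<alpha> a3 - y * \<alpha> a2 - c' * \<alpha> a1)"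
 define B :: "complex^3" where "B = (\<chi> m. if m = 1 then \<beta> a1 else if m = 2 then \<beta> a2 - c * \<beta> a1 else \<beta> a3 - y * \<beta> a2 - c' * \<beta> a1)"
 have lin: "ge (fps_const s * H) 7" if "ge H 7" for s H using that by (simp add: ge_def)
 show False
 proof (rule span_two_orders[of F A ?f B ?g 3 5 6])
  show "F m = fps_const (A $ m) * ?f + fps_const (B $ m) * ?g" for m
   unfolding F_def A_def B_def P by (simp add: fps_eq_iff algebra_simps)
  have "ge (F 1 - ?D a1) 4" using ge_mono[OF PD, of 4] by (simp add: F_def)
  then show "od (F 1) 3" by (intro od_congr[OF _ O(2)]) simp
  have e2: "F 2 - (?D a2 - fps_const c * ?D a1) = (P a2 - ?D a2) - fps_const c * (P a1 - ?D a1)"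
   by (simp add: F_def algebra_simps)
  have "ge (F 2 - (?D a2 - fps_const c * ?D a1)) 7" unfolding e2 by (intro ge_diff PD lin)
  from od_congr[OF ge_mono[OF this, of "Suc 5"] o5] show "od (F 2) 5" by simp
  have e3: "F 3 - (?D a3 - fps_const y * ?D a2 - fps_const c' * ?D a1) =
    (P a3 - ?D a3) - fps_const y * (P a2 - ?D a2) - fps_const c' * (P a1 - ?D a1)"
   by (simp add: F_def algebra_simps)
  have "ge (F 3 - (?D a3 - fps_const y * ?D a2 - fps_const c' * ?D a1)) 7"
   unfolding e3 by (intro ge_diff PD lin)
  from od_congr[OF ge_mono[OF this, of "Suc 6"] o6] show "od (F 3) 6" by simp
 qed simp_all
qed

lemma affine_submanifold:
 fixes A :: "'n::finite set"
 shows "submanifold (card A) {z :: complex^'n. \<forall>b. b \<notin> A --> z $ b = (\<Sum>j\<in>A. K b j * z $ j) + k b}"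
proof (rule graph_submanifold)
 show "cdiff (%z. (\<Sum>j\<in>A. K b j * z $ j) + k b) z" for b and z :: "complex^'n"
  using cdiff_affine[where g = "%_. k b" and A = A and K = "K b" and z = z] by simp
qed (simp cong: sum.cong)

text \<open>
  The same integration as in \<open>planar_relation\<close>, with three indices in which the velocity is one.
\<close>

lemma RVL_relation:
 assumes L: "lift3 a1 a2 a3 (%j. fps_deriv (P j)) X Y Z G1 G2 G3 U" and ne: "a1 ~= a2" "a1 ~= a3" "a2 ~= a3"
  and U: "U a3 = 1" "U b = 0" and b: "b ~= a1" "b ~= a2" "b ~= a3"
 shows "\<exists>k3 k2 k1 k0. P b = fps_const k3 * P a3 + fps_const k2 * P a2 + fps_const k1 * P a1 + fps_const k0"
proof -
 note E = lift3D[OF L]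
 have G3: "G3 = 1" using E(10)[of a3] U by simp
 have "fps_deriv (Z b) = 0" using E(10)[of b] U b by simp
 then obtain \<beta> where Zb: "Z b = fps_const \<beta>" unfolding fps_deriv_eq_0_iff by blast
 have "fps_deriv (Y b) = fps_deriv (fps_const \<beta> * Y a3)" using E(7)[of b] E(7)[of a3] E(8) b ne Zb G3 by simp
 then obtain C2 where C2: "Y b = fps_const \<beta> * Y a3 + fps_const C2" using fps_antideriv by blast
 have "fps_deriv (X b) = fps_deriv (fps_const \<beta> * X a3 + fps_const C2 * X a2)"
  using E(4)[of b] E(4)[of a3] E(4)[of a2] E(5) b ne C2 by (simp add: algebra_simps)
 then obtain C1 where C1: "X b = fps_const \<beta> * X a3 + fps_const C2 * X a2 + fps_const C1" using fps_antideriv by blast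
 have "fps_deriv (P b) = fps_deriv (fps_const \<beta> * P a3 + fps_const C2 * P a2 + fps_const C1 * P a1)"
  unfolding E(1)[of b] C1 by (simp add: E(1)[of a1] E(1)[of a2] E(1)[of a3] E(2) algebra_simps)
 then show ?thesis using fps_antideriv by blast
qed

text \<open>
  The curve with velocity one in the directions of the chart and zero in all others lies in an affine space
  of dimension three.
\<close>

lemma RVL_spatial:
 fixes x :: "'n::finite coords"
 assumes x: "x \<in> chart_dom [a3, a2, a1]" and p: "param 3 [a3, a2, a1] x \<in> RVL"
 shows "spatial 3 (param 3 [a3, a2, a1] x)"
proof -
 let ?p = "param 3 [a3, a2, a1] x"
 have len: "length [a3, a2, a1] = 3" by simp
 have lower: "3 \<le> embedding_dim \<gamma>" if g: "\<gamma> \<in> Germ 3 ?p" for \<gamma>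
 proof -
  have "submanifold (card (UNIV :: 'n set)) (UNIV :: (complex^'n) set)"
   using affine_submanifold[of UNIV] by simp
  then have "\<exists>d. \<exists>T. submanifold d T \<and> (NEAR t. \<gamma> t \<in> T)"
   by (intro exI[of _ "card (UNIV :: 'n set)"] exI[of _ UNIV]) simp
  from LeastI_ex[OF this] obtain T where "submanifold (embedding_dim \<gamma>) T" "NEAR t. \<gamma> t \<in> T"
   unfolding embedding_dim_def by blast
  then show ?thesis by (rule RVL_embedding_ge[OF x p g])
 qed
 have h: "x 2 $ a1 = 0" "x 3 $ a2 = 0" "x 3 $ a1 = 0" using p RVL_chart[OF x] by blast+
 have ne: "a1 ~= a2" "a1 ~= a3" "a2 ~= a3" using h chart3[OF x] by auto
 let ?A = "{a1, a2, a3}"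
 define u :: "complex^'n" where "u = (\<chi> j. if j \<in> ?A then 1 else 0)"
 have "u $ a1 ~= 0" by (simp add: u_def)
 then have "u ~= 0" by auto
 moreover have "u $ j ~= 0" if "j \<in> set [a3, a2, a1]" for j using that by (auto simp: u_def)
 ultimately obtain \<gamma> \<xi> where g: "\<gamma> \<in> Germ 3 ?p" "clift \<gamma> [a3, a2, a1] \<xi> (%_. u)"
  using Germ_prescribed[OF x] unfolding len by blast
 have an: "(%t. \<gamma> t $ j) analytic_on {0}" for j by (rule analytic_vecD[OF clift_germ[OF g(2)]])
 obtain G1 G2 G3 where L: "lift3 a1 a2 a3 (%j. fps_deriv (Ev \<gamma> j)) (Ec \<xi> 1) (Ec \<xi> 2) (Ec \<xi> 3) G1 G2 G3 (Ev (%_. u))"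
  using clift_lift3[OF g(2)] by blast
 have U: "Ev (%_. u) j = (if j \<in> ?A then 1 else 0)" for j by (simp add: Ev_def u_def E_const)
 have "\<forall>b. \<exists>K. b \<notin> ?A --> (NEAR t. \<gamma> t $ b = (\<Sum>j\<in>?A. fst K j * \<gamma> t $ j) + snd K)"
 proof
  fix b
  show "\<exists>K. b \<notin> ?A --> (NEAR t. \<gamma> t $ b = (\<Sum>j\<in>?A. fst K j * \<gamma> t $ j) + snd K)"
  proof (cases "b \<in> ?A")
   case False
   then have b: "b ~= a1" "b ~= a2" "b ~= a3" by auto
   obtain k3 k2 k1 k0 where "Ev \<gamma> b = fps_const k3 * Ev \<gamma> a3 + fps_const k2 * Ev \<gamma> a2 + fps_const k1 * Ev \<gamma> a1 + fps_const k0"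
    using RVL_relation[OF L ne _ _ b] U[of a3] U[of b] False by auto
   moreover have "(%t. k3 * \<gamma> t $ a3 + k2 * \<gamma> t $ a2 + k1 * \<gamma> t $ a1 + k0) has_fps_expansion
     (fps_const k3 * Ev \<gamma> a3 + fps_const k2 * Ev \<gamma> a2 + fps_const k1 * Ev \<gamma> a1 + fps_const k0)"
    unfolding Ev_def by (intro has_fps_expansion_add has_fps_expansion_cmult_left has_fps_expansion_const E_exp an)
   ultimately have "E (%t. \<gamma> t $ b) = E (%t. k3 * \<gamma> t $ a3 + k2 * \<gamma> t $ a2 + k1 * \<gamma> t $ a1 + k0)"
    using E_eqI by (simp add: Ev_def)
   moreover have "(%t. k3 * \<gamma> t $ a3 + k2 * \<gamma> t $ a2 + k1 * \<gamma> t $ a1 + k0) analytic_on {0}"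
    by (intro analytic_intros an)
   ultimately have ev: "NEAR t. \<gamma> t $ b = k3 * \<gamma> t $ a3 + k2 * \<gamma> t $ a2 + k1 * \<gamma> t $ a1 + k0"
    using E_eq_iff[OF an] by blast
   let ?K = "(%j. if j = a3 then k3 else if j = a2 then k2 else k1, k0)"
   have "(\<Sum>j\<in>?A. fst ?K j * \<gamma> t $ j) + snd ?K = k3 * \<gamma> t $ a3 + k2 * \<gamma> t $ a2 + k1 * \<gamma> t $ a1 + k0" for t
    using ne by (simp add: algebra_simps)
   then have "NEAR t. \<gamma> t $ b = (\<Sum>j\<in>?A. fst ?K j * \<gamma> t $ j) + snd ?K" using ev by simp
   then show ?thesis by blast
  qed simp
 qed
 from choice[OF this] obtain K where K: "!!b. b \<notin> ?A ==> NEAR t. \<gamma> t $ b = (\<Sum>j\<in>?A. fst (K b) j * \<gamma> t $ j) + snd (K b)" by blast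
 let ?T = "{z :: complex^'n. \<forall>b. b \<notin> ?A --> z $ b = (\<Sum>j\<in>?A. fst (K b) j * z $ j) + snd (K b)}"
 have "NEAR t. b \<notin> ?A --> \<gamma> t $ b = (\<Sum>j\<in>?A. fst (K b) j * \<gamma> t $ j) + snd (K b)" for b
  using K[of b] by (cases "b \<in> ?A") (auto elim: eventually_mono)
 then have "NEAR t. \<forall>b. b \<notin> ?A --> \<gamma> t $ b = (\<Sum>j\<in>?A. fst (K b) j * \<gamma> t $ j) + snd (K b)"
  by (intro eventually_all_finite) blast
 then have evT: "NEAR t. \<gamma> t \<in> ?T" by eventually_elim blast
 have "card ?A = 3" using ne by simp
 then have "submanifold 3 ?T" using affine_submanifold[of ?A "%b. fst (K b)" "%b. snd (K b)"] by simp
 then have "embedding_dim \<gamma> \<le> 3" unfolding embedding_dim_def using evT by (intro Least_le) blast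
 then have "embedding_dim \<gamma> = 3" using lower[OF g(1)] by simp
 then show ?thesis unfolding spatial_def using lower g(1) by blast
qed

lemma RVL_spatial_class: "spatial_class 3 (RVL :: 'n::finite point set)"
proof -
 have "spatial 3 p" if p: "p \<in> RVL" for p :: "'n point"
 proof -
  have "p \<in> monster 3" using p by (simp add: RVL_def)
  then obtain a3 a2 a1 x where x: "x \<in> chart_dom [a3, a2, a1]" "p = param 3 [a3, a2, a1] x" by (rule monster3_chart)
  show ?thesis using RVL_spatial[OF x(1)] p unfolding x(2) by blast
 qed
 moreover have "RVL \<subseteq> (monster 3 :: 'n point set)" unfolding RVL_def by blast
 moreover have "\<forall>p\<in>RVL. orbit 3 p \<subseteq> (RVL :: 'n point set)" using RVL_orbit by blast
 ultimately show ?thesis unfolding spatial_class_def singularity_class_def by blast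
qed

section \<open>Changing the last coordinates of a chart\<close>

lemma rechart_last:
 assumes x: "x \<in> chart_dom (a # c)" and k: "k = Suc (length c)" and b: "x k $ b ~= 0"
 shows "x(k := inverse (x k $ b) *s x k) \<in> chart_dom (b # c)"
  "param k (b # c) (x(k := inverse (x k $ b) *s x k)) = param k (a # c) x"
proof -
 let ?y = "inverse (x k $ b) *s x k" and ?x0 = "x(k := 0)"
 have x0: "?x0 \<in> chart_dom c" using x k by simp
 have yb: "?y $ b = 1" using b by simp
 have "?x0(k := ?y) \<in> chart_dom (b # c)" unfolding k by (rule chart_dom_Cons_upd) (use x0 yb k in simp_all)
 then show x': "x(k := ?y) \<in> chart_dom (b # c)" by simp
 have "tline (tvf c ?x0 (x k)) = tline (tvf c ?x0 ?y)" using tline_tvf_eq[OF x0 yb, of "x k"] b by blast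
 then show "param k (b # c) (x(k := ?y)) = param k (a # c) x"
  using param_Suc[OF x] param_Suc[OF x'] unfolding k by simp
qed

text \<open>
  The chart of the lower levels can be changed; only the index of the last level must then be chosen anew.
\<close>

lemma rechart_lower:
 fixes c c' :: "'n::finite list"
 assumes x: "x \<in> chart_dom (a # c)" and x': "x' \<in> chart_dom c'" and l: "length c' = length c"
  and k: "k = Suc (length c)" and e: "param (length c) c' x' = param (length c) c x"
 shows "\<exists>b y. x'(k := y) \<in> chart_dom (b # c') \<and> param k (b # c') (x'(k := y)) = param k (a # c) x"
proof -
 let ?x0 = "x(k := 0)"
 have x0: "?x0 \<in> chart_dom c" using x k by simp
 have e': "param (length c) c ?x0 = param (length c') c' x'" using e l k by simp
 have "tvf c ?x0 (x k) \<in> Delta (length c) (param (length c) c ?x0)" using Delta_eq[OF x0] by blast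
 then have "tvf c ?x0 (x k) \<in> range (tvf c' x')" unfolding e' using Delta_eq[OF x'] l by simp
 then obtain y where y: "tvf c ?x0 (x k) = tvf c' x' y" by blast
 have "x k $ a = 1" using x k by simp
 then have "x k ~= 0" by auto
 then have "y ~= 0" using y tzero_tvf[OF x0, of "x k"] tzero_tvf[OF x', of y] by simp
 then obtain b where b: "y $ b ~= 0" by (auto simp: vec_eq_iff)
 let ?z = "inverse (y $ b) *s y"
 have zb: "?z $ b = 1" using b by simp
 have z: "x'(k := ?z) \<in> chart_dom (b # c')" unfolding k using chart_dom_Cons_upd[OF x' zb] l by simp
 have "tline (tvf c' x' y) = tline (tvf c' x' ?z)" using tline_tvf_eq[OF x' zb, of y] b by blast
 then have "tline (tvf c x (x k)) = tline (tvf c' x' ?z)" using y k by simp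
 moreover have "param k (a # c) x = Prol (param (length c) c x) (tline (tvf c x (x k)))"
  using param_Suc[OF x] k by simp
 moreover have "param k (b # c') (x'(k := ?z)) = Prol (param (length c) c' x') (tline (tvf c' x' ?z))"
  using param_Suc[OF z] l k by simp
 ultimately show ?thesis using e z by metis
qed

section \<open>Points that are realized by planar curves\<close>

text \<open>
  If one of the first two cases holds, the chart can be changed so that it uses \<open>a1\<close> twice. Otherwise the point
  has code \<open>RVT\<close> and the line has a further vanishing coordinate.
\<close>

lemma planar_level3:
 assumes x: "x \<in> chart_dom [a3, a2, a1]" and n: "\<not> cusp345 a2 a1 x" "\<not> cusp467 a2 a1 x"
 shows "\<exists>\<gamma>\<in>Germ 3 (param 3 [a3, a2, a1] x). embedding_dim \<gamma> \<le> 2"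
proof -
 have len: "3 = Suc (length [a2, a1])" "2 = Suc (length [a1])" by simp_all
 consider "x 2 $ a1 ~= 0" | "x 2 $ a1 = 0" "x 3 $ a1 ~= 0" | "x 2 $ a1 = 0" "x 3 $ a1 = 0" by blast
 then show ?thesis
 proof cases
  case 1
  let ?x0 = "x(3 := 0)"
  have b: "?x0 2 $ a1 ~= 0" using 1 by simp
  note r = rechart_last[OF chart3_lower(1)[OF x] len(2) b]
  let ?x' = "?x0(2 := inverse (?x0 2 $ a1) *s ?x0 2)"
  have e2: "length [a2, a1] = 2" by simp
  have "param 2 [a2, a1] ?x0 = param 2 [a2, a1] x" by (rule param_cong) simp_all
  then have "param (length [a2, a1]) [a1, a1] ?x' = param (length [a2, a1]) [a2, a1] x"
   unfolding e2 using r(2) by (rule trans[rotated])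
  from rechart_lower[OF x r(1) _ len(1) this]
  obtain b y where y: "?x'(3 := y) \<in> chart_dom [b, a1, a1]" "param 3 [b, a1, a1] (?x'(3 := y)) = param 3 [a3, a2, a1] x"
   by auto
  show ?thesis using planar_Germ[OF y(1)] unfolding y(2) by blast
 next
  case 2
  note r = rechart_last[OF x len(1) 2(2)]
  show ?thesis using planar_Germ[OF r(1)] unfolding r(2) by blast
 next
  case 3
  then have a2: "x 3 $ a2 ~= 0" using n(2) by (simp add: cusp467_def)
  then have a12: "a1 ~= a2" using 3 by auto
  obtain b where b: "b ~= a1" "b ~= a2" "x 3 $ b = 0" using n(1) 3 a2 unfolding cusp345_def by blast
  obtain b' where b': "!!j. j = a1 \<or> j = a2 \<or> j = b'" using third_index[OF a12] by blast
  note r = rechart_last[OF x len(1) a2]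
  have "(x(3 := inverse (x 3 $ a2) *s x 3)) 3 $ j = 0" if "j ~= a1" "j ~= a2" for j
   using b'[of j] b'[of b] that b by simp
  then show ?thesis using planar_Germ[OF r(1)] unfolding r(2) by blast
 qed
qed

text \<open>
  If all coordinates of the line are nonzero, then the velocity one level lower, which is a multiple of them,
  avoids all coordinate hyperplanes.
\<close>

lemma Germ_project:
 assumes x: "x \<in> chart_dom (a # c)" and k: "k = Suc (length c)" and nz: "!!j. x k $ j ~= 0"
  and g: "\<gamma> \<in> Germ k (param k (a # c) x)"
 shows "\<gamma> \<in> Germ (length c) (param (length c) c x)"
proof -
 have "\<gamma> \<in> Germ (length (a # c)) (param (length (a # c)) (a # c) x)" using g k by simp
 then obtain \<xi> u where l: "nonconstant_germ \<gamma>" "clift \<gamma> (a # c) \<xi> u" "\<xi> 0 = x"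
  and c: "!!j. critical_index (a # c) x j ==> u 0 $ ((a # c) ! j) ~= 0" unfolding Germ_chart[OF x] by blast
 have "critical_index (a # c) x 0" unfolding critical_index_def by auto
 from c[OF this] have ua: "u 0 $ a ~= 0" by simp
 obtain w where w: "clift \<gamma> c (%t. (\<xi> t)(Suc (length c) := 0)) w"
  "NEAR t. \<xi> t (Suc (length c)) $ a = 1 \<and> w t = w t $ a *s \<xi> t (Suc (length c)) \<and>
    u t = (\<chi> j. if j = a then w t $ a else vderiv (%s. \<xi> s (Suc (length c))) t $ j)"
  using l(2) unfolding clift.simps by blast
 have w0: "w 0 = w 0 $ a *s x k" "u 0 = (\<chi> j. if j = a then w 0 $ a else vderiv (%s. \<xi> s (Suc (length c))) 0 $ j)"
  using eventually_nhds_x_imp_x[OF w(2)] l(3) k by blast+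
 have "u 0 $ a = w 0 $ a" unfolding w0(2) by simp
 then have "w 0 $ j ~= 0" for j
 proof -
  have "w 0 $ j = w 0 $ a * x k $ j" using arg_cong[OF w0(1), of "%v. v $ j"] by (simp only: vector_smult_component)
  then show ?thesis using ua nz[of j] \<open>u 0 $ a = w 0 $ a\<close> by (metis mult_eq_0_iff)
 qed
 then have nz0: "w 0 ~= 0" "\<forall>j. critical_index c (x(k := 0)) j --> w 0 $ (c ! j) ~= 0" by (metis zero_index, blast)
 have x0: "x(k := 0) \<in> chart_dom c" using x k by simp
 have "(\<xi> 0)(Suc (length c) := 0) = x(k := 0)" using l(3) k by simp
 then have "\<gamma> \<in> Germ (length c) (param (length c) c (x(k := 0)))"
  unfolding Germ_chart[OF x0] using l(1) w(1) nz0 by blast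
 then show ?thesis using k by simp
qed

lemma planar_project:
 assumes x: "x \<in> chart_dom c"
  and g: "\<exists>\<gamma>\<in>Germ (Suc (length c)) (param (Suc (length c)) (a # c) (x(Suc (length c) := \<chi> j. 1))). embedding_dim \<gamma> \<le> 2"
 shows "\<exists>\<gamma>\<in>Germ (length c) (param (length c) c x). embedding_dim \<gamma> \<le> 2"
proof -
 let ?y = "x(Suc (length c) := \<chi> j. 1)"
 have y: "?y \<in> chart_dom (a # c)" by (rule chart_dom_Cons_upd[OF x]) simp
 have nz: "?y (Suc (length c)) $ j ~= 0" for j by simp
 from g obtain \<gamma> where \<gamma>: "\<gamma> \<in> Germ (Suc (length c)) (param (Suc (length c)) (a # c) ?y)" "embedding_dim \<gamma> \<le> 2" by blast
 have "\<gamma> \<in> Germ (length c) (param (length c) c ?y)" by (rule Germ_project[OF y refl nz \<gamma>(1)])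
 then show ?thesis using \<gamma>(2) by auto
qed

text \<open>
  The point is lifted to level three through lines with all coordinates equal to one. The case distinctions of
  \<open>planar_Germ\<close> are then satisfied, and the planar curve realizes all lower points by \<open>Germ_project\<close>.
\<close>

lemma planar_low_level:
 fixes p :: "3 point"
 assumes "k \<le> 2" and p: "p \<in> monster k"
 shows "\<exists>\<gamma>\<in>Germ k p. embedding_dim \<gamma> \<le> 2"
proof -
 have two: "\<exists>\<gamma>\<in>Germ 2 (param 2 [a2, a1] x). embedding_dim \<gamma> \<le> 2" if x: "x \<in> chart_dom [a2, a1]" for a1 a2 :: 3 and x
 proof -
  have l: "length [a2, a1] = 2" "Suc 2 = 3" by simp_all
  let ?y = "x(3 := \<chi> j. 1)"
  have y: "?y \<in> chart_dom [a1, a2, a1]" using chart_dom_Cons_upd[OF x, of "\<chi> j. 1" a1] unfolding l by simp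
  have "\<exists>\<gamma>\<in>Germ 3 (param 3 [a1, a2, a1] ?y). embedding_dim \<gamma> \<le> 2" by (rule planar_Germ[OF y]) blast
  then show ?thesis using planar_project[OF x, of a1] unfolding l by blast
 qed
 have one: "\<exists>\<gamma>\<in>Germ 1 (param 1 [a1] x). embedding_dim \<gamma> \<le> 2" if x: "x \<in> chart_dom [a1]" for a1 :: 3 and x
 proof -
  have l: "length [a1] = 1" "Suc 1 = 2" by simp_all
  let ?y = "x(2 := \<chi> j. 1)"
  have y: "?y \<in> chart_dom [a1, a1]" using chart_dom_Cons_upd[OF x, of "\<chi> j. 1" a1] unfolding l by simp
  then show ?thesis using planar_project[OF x, of a1] two[OF y] unfolding l by blast
 qed
 have zero: "\<exists>\<gamma>\<in>Germ 0 (param 0 [] x). embedding_dim \<gamma> \<le> 2" if x: "x \<in> chart_dom []" for x :: "3 coords"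
 proof -
  have l: "length [] = 0" "Suc 0 = 1" by simp_all
  let ?y = "x(1 := \<chi> j. 1)"
  have y: "?y \<in> chart_dom [1]" using chart_dom_Cons_upd[OF x, of "\<chi> j. 1" 1] unfolding l by simp
  then show ?thesis using planar_project[OF x, of 1] one[OF y] unfolding l by blast
 qed
 obtain c and x :: "3 coords" where c: "length c = k" "x \<in> chart_dom c" "p = param k c x"
  using p unfolding monster_chart by blast
 consider "k = 0" | "k = 1" | "k = 2" using assms(1) by linarith
 then show ?thesis
 proof cases
  case 1
  then have "c = []" using c(1) by simp
  then show ?thesis using zero c unfolding 1 by blast
 next
  case 2
  then obtain a1 where "c = [a1]" using c(1) by (auto simp: length_Suc_conv)
  then show ?thesis using one c unfolding 2 by blast
 next
  case 3
  then obtain a2 a1 where "c = [a2, a1]" using c(1) by (auto simp: numeral_2_eq_2 length_Suc_conv)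
  then show ?thesis using two c unfolding 3 by blast
 qed
qed

section \<open>The two classes and their orbits\<close>

definition curve_class :: "nat set => 3 point set" where
 "curve_class S = {prolong_curve \<gamma> 3 0 | \<gamma>. velocity_orders S \<gamma>}"

lemma curve_class_monster: "S = {2,3,4} \<or> S = {3,5,6} ==> curve_class S \<subseteq> monster 3"
 unfolding curve_class_def using Germ_velocity_orders(2) by blast

lemma Germ_nonempty3:
 fixes x :: "3 coords"
 assumes x: "x \<in> chart_dom [a3, a2, a1]"
 shows "\<exists>\<gamma>. \<gamma> \<in> Germ 3 (param 3 [a3, a2, a1] x)"
proof -
 have len: "length [a3, a2, a1] = 3" by simp
 have "(\<chi> j. (1::complex)) ~= (0 :: complex^3)" by (simp add: vec_eq_iff)
 then show ?thesis using Germ_prescribed[OF x, of "\<chi> j. 1"] unfolding len by auto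
qed

lemma curve_class_chart:
 assumes x: "x \<in> chart_dom [a3, a2, a1]"
 shows "param 3 [a3, a2, a1] x \<in> curve_class {2,3,4} \<longleftrightarrow> cusp345 a2 a1 x"
  "param 3 [a3, a2, a1] x \<in> curve_class {3,5,6} \<longleftrightarrow> cusp467 a2 a1 x"
proof -
 let ?p = "param 3 [a3, a2, a1] x"
 have *: "?p \<in> curve_class S \<longleftrightarrow> P"
  if S: "S = {2,3,4} \<or> S = {3,5,6}" and P: "!!\<gamma>. \<gamma> \<in> Germ 3 ?p ==> velocity_orders S \<gamma> \<longleftrightarrow> P" for S P
 proof
  assume "?p \<in> curve_class S"
  then obtain \<gamma> where g: "velocity_orders S \<gamma>" "?p = prolong_curve \<gamma> 3 0" unfolding curve_class_def by blast
  then have "\<gamma> \<in> Germ 3 ?p" using Germ_velocity_orders(1) S unfolding g(2) by blast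
  then show P using P g(1) by blast
 next
  assume P': P
  obtain \<gamma> where g: "\<gamma> \<in> Germ 3 ?p" using Germ_nonempty3[OF x] by blast
  then have "velocity_orders S \<gamma>" using P P' by blast
  moreover have pc: "prolong_curve \<gamma> 3 0 = ?p" using g unfolding Germ_def by blast
  ultimately show "?p \<in> curve_class S" unfolding curve_class_def using pc[symmetric] by blast
 qed
 show "?p \<in> curve_class {2,3,4} \<longleftrightarrow> cusp345 a2 a1 x" by (rule *) (use velocity_orders_Germ(1)[OF x] in blast)+
 show "?p \<in> curve_class {3,5,6} \<longleftrightarrow> cusp467 a2 a1 x" by (rule *) (use velocity_orders_Germ(2)[OF x] in blast)+
qed

lemma curve_class_RVL: "curve_class {3,5,6} = RVL"
proof -
 have "p \<in> curve_class {3,5,6} \<longleftrightarrow> p \<in> RVL" if p: "p \<in> monster 3" for p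
 proof -
  obtain a3 a2 a1 x where x: "x \<in> chart_dom [a3, a2, a1]" "p = param 3 [a3, a2, a1] x" by (rule monster3_chart[OF p])
  show ?thesis unfolding x(2) curve_class_chart(2)[OF x(1)] RVL_chart[OF x(1)] cusp467_def by blast
 qed
 then show ?thesis using curve_class_monster[of "{3,5,6}"] unfolding RVL_def by blast
qed

lemma Union_Germ:
 assumes S: "S = {2,3,4} \<or> S = {3,5,6}"
 shows "(\<Union>p\<in>curve_class S. Germ 3 p) = {\<gamma>. velocity_orders S \<gamma>}"
proof (intro equalityI subsetI)
 fix \<gamma> assume "\<gamma> \<in> (\<Union>p\<in>curve_class S. Germ 3 p)"
 then obtain p where p: "p \<in> curve_class S" "\<gamma> \<in> Germ 3 p" by blast
 then have "p \<in> monster 3" using curve_class_monster[OF S] by blast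
 then obtain a3 a2 a1 x where x: "x \<in> chart_dom [a3, a2, a1]" "p = param 3 [a3, a2, a1] x" by (rule monster3_chart)
 show "\<gamma> \<in> {\<gamma>. velocity_orders S \<gamma>}"
  using S velocity_orders_Germ[OF x(1) p(2)[unfolded x(2)]] curve_class_chart[OF x(1)] p(1)[unfolded x(2)] by blast
next
 fix \<gamma> :: "complex => complex^3" assume "\<gamma> \<in> {\<gamma>. velocity_orders S \<gamma>}"
 then show "\<gamma> \<in> (\<Union>p\<in>curve_class S. Germ 3 p)"
  using S Germ_velocity_orders(1)[of \<gamma>] unfolding curve_class_def by blast
qed

lemma spatial_level3:
 assumes p: "p \<in> (monster 3 :: 3 point set)"
 shows "spatial 3 p \<longleftrightarrow> p \<in> curve_class {2,3,4} \<or> p \<in> curve_class {3,5,6}"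
proof -
 obtain a3 a2 a1 x where x: "x \<in> chart_dom [a3, a2, a1]" "p = param 3 [a3, a2, a1] x" by (rule monster3_chart[OF p])
 show ?thesis
 proof
  assume s: "spatial 3 p"
  show "p \<in> curve_class {2,3,4} \<or> p \<in> curve_class {3,5,6}"
  proof (rule ccontr)
   assume "\<not> (p \<in> curve_class {2,3,4} \<or> p \<in> curve_class {3,5,6})"
   then have "\<not> cusp345 a2 a1 x" "\<not> cusp467 a2 a1 x" unfolding x(2) curve_class_chart[OF x(1)] by auto
   from planar_level3[OF x(1) this] show False using s unfolding spatial_def x(2) by fastforce
  qed
 next
  assume c: "p \<in> curve_class {2,3,4} \<or> p \<in> curve_class {3,5,6}"
  have three: "CARD(3) = 3" by simp
  have e: "embedding_dim \<gamma> = 3" if g: "\<gamma> \<in> Germ 3 p" for \<gamma>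
  proof -
   have "velocity_orders {2,3,4} \<gamma> \<or> velocity_orders {3,5,6} \<gamma>"
    using c curve_class_chart[OF x(1)] velocity_orders_Germ[OF x(1) g[unfolded x(2)]] unfolding x(2) by blast
   then show ?thesis
   proof
    assume "velocity_orders {2,3,4} \<gamma>"
    from embedding_dim_full[OF this, of 3] show ?thesis by simp
   next
    assume "velocity_orders {3,5,6} \<gamma>"
    from embedding_dim_full[OF this, of 4] show ?thesis by simp
   qed
  qed
  obtain \<gamma> where "\<gamma> \<in> Germ 3 p" using Germ_nonempty3[OF x(1)] unfolding x(2) by blast
  then show "spatial 3 p" unfolding spatial_def using e by auto
 qed
qed

lemma foot_prolong_curve:
 assumes "analytic_vec \<gamma> 0" "nonconstant_germ \<gamma>"
 shows "foot ((under ^^ k) (prolong_curve \<gamma> k 0)) = \<gamma> 0"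
proof (induction k)
 case (Suc k)
 have "(under ^^ Suc k) (prolong_curve \<gamma> (Suc k) 0) = (under ^^ k) (under (prolong_curve \<gamma> (Suc k) 0))"
  by (simp only: funpow_Suc_right comp_apply)
 then show ?case using Suc unfolding under_prolong_curve[OF assms] by simp
qed simp

lemma orbit_curve_class:
 assumes p: "p \<in> curve_class S" and S: "\<forall>s\<in>S. d \<le> Suc s \<and> Suc s < 2 * d"
 shows "orbit 3 p \<subseteq> curve_class S"
proof
 fix q assume q: "q \<in> orbit 3 p"
 obtain \<gamma> where g: "velocity_orders S \<gamma>" "p = prolong_curve \<gamma> 3 0" using p unfolding curve_class_def by blast
 have an: "analytic_vec \<gamma> 0" using g(1) by (simp add: velocity_orders_def)
 have nc: "nonconstant_germ \<gamma>" by (rule velocity_orders_nonconstant[OF g(1)])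
 obtain U \<phi> where U: "q = prolong_map \<phi> 3 p" "local_diffeo U \<phi>" "\<gamma> 0 \<in> U"
  using q foot_prolong_curve[OF an nc, of 3] unfolding orbit_def g(2) by auto
 have d: "diffeo_at \<phi> (\<gamma> 0)" by (rule local_diffeo_diffeo_at[OF U(2,3)])
 have "q = prolong_curve (%t. \<phi> (\<gamma> t)) 3 0" unfolding U(1) g(2) by (rule prolong_map_curve[OF an nc d])
 moreover have "velocity_orders S (%t. \<phi> (\<gamma> t))" by (rule velocity_orders_diffeo[OF d g(1) S])
 ultimately show "q \<in> curve_class S" unfolding curve_class_def by blast
qed

text \<open>
  The orders \<open>2 + 0 + 0 + 3\<close> and \<open>3 + 1 + 0 + 3\<close> of \<open>jet_determines_prolongation\<close> are 5 and 7.
\<close>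

lemma jet_determines_prolongation':
 fixes \<delta> \<beta> :: "complex => complex^3"
 assumes vo: "velocity_orders S \<delta>" and an: "analytic_vec \<beta> 0" and j: "jet_eq m \<delta> \<beta>"
  and S: "S = {2,3,4} \<and> m = 5 \<or> S = {3,5,6} \<and> m = 7"
 shows "prolong_curve \<delta> 3 0 = prolong_curve \<beta> 3 0"
proof -
 have an\<delta>: "analytic_vec \<delta> 0" using vo by (simp add: velocity_orders_def)
 obtain c :: "3 list" and \<xi> u where c: "length c = 3" "clift \<delta> c \<xi> u"
  using clift_any[OF an\<delta> velocity_orders_nonconstant[OF vo]] by blast
 then obtain a1 a2 a3 where c3: "c = [a3, a2, a1]" by (auto simp: numeral_3_eq_3 length_Suc_conv)
 note l = c(2)[unfolded c3]
 obtain G1 G2 G3 where L: "lift3 a1 a2 a3 (%j. fps_deriv (Ev \<delta> j)) (Ec \<xi> 1) (Ec \<xi> 2) (Ec \<xi> 3) G1 G2 G3 (Ev u)"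
  using clift_lift3[OF l] by blast
 have ge: "ge (Ev \<delta> i - Ev \<beta> i) (Suc m)" for i using j unfolding jet_eq_iff by blast
 have 0: "\<delta> 0 = \<beta> 0"
 proof -
  have "\<delta> 0 $ i = \<beta> 0 $ i" for i using ge[of i] Ev_nth_0[of \<delta> i] Ev_nth_0[of \<beta> i] by (simp add: ge_def)
  then show ?thesis by (simp add: vec_eq_iff)
 qed
 have ged: "ge (fps_deriv (Ev \<delta> i) - fps_deriv (Ev \<beta> i)) m" for i
  using ge_deriv[OF ge[of i]] by simp
 from S show ?thesis
 proof (elim disjE conjE)
  assume s: "S = {2,3,4}" "m = 5"
  have o: "!!w. w ~= 0 ==> \<exists>d\<in>{2,3,4}. od (lin w (%j. fps_deriv (Ev \<delta> j))) d"
   using vo unfolding s velocity_orders_lin by blast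
  note o = lift3_orders_345(1-3)[OF L o]
  show ?thesis by (rule jet_determines_prolongation[OF l an 0 L o]) (use ged s in simp_all)
 next
  assume s: "S = {3,5,6}" "m = 7"
  have o: "!!w. w ~= 0 ==> \<exists>d\<in>{3,5,6}. od (lin w (%j. fps_deriv (Ev \<delta> j))) d"
   using vo unfolding s velocity_orders_lin by blast
  note o = lift3_orders_467(1-3)[OF L o]
  show ?thesis by (rule jet_determines_prolongation[OF l an 0 L o]) (use ged s in simp_all)
 qed
qed

text \<open>
  A curve of the class has the same jet as a diffeomorphic image of \<open>\<eta>\<close>, after a reparametrization, which
  does not change the prolonged point.
\<close>

lemma curve_class_orbit:
 fixes \<eta> :: "complex => complex^3" and d :: nat
 assumes S: "S = {2,3,4} \<and> m = 5 \<and> d = 3 \<or> S = {3,5,6} \<and> m = 7 \<and> d = 4"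
  and \<eta>: "velocity_orders S \<eta>"
  and normal: "!!\<gamma>. velocity_orders S \<gamma> ==> \<exists>h \<psi>. h analytic_on {0} \<and> h 0 = 0 \<and> deriv h 0 ~= 0 \<and>
    local_diffeo UNIV \<psi> \<and> jet_eq m (%t. \<gamma> (h t)) (%t. \<psi> (\<eta> t))"
 shows "is_orbit 3 (curve_class S)"
proof -
 let ?p = "prolong_curve \<eta> 3 0"
 have p: "?p \<in> curve_class S" using \<eta> unfolding curve_class_def by blast
 have an: "analytic_vec \<eta> 0" using \<eta> by (simp add: velocity_orders_def)
 have nc: "nonconstant_germ \<eta>" by (rule velocity_orders_nonconstant[OF \<eta>])
 have Sd: "\<forall>s\<in>S. d \<le> Suc s \<and> Suc s < 2 * d" using S by auto
 have "curve_class S \<subseteq> orbit 3 ?p"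
 proof
  fix q assume "q \<in> curve_class S"
  then obtain \<gamma> where g: "velocity_orders S \<gamma>" "q = prolong_curve \<gamma> 3 0" unfolding curve_class_def by blast
  have g_an: "analytic_vec \<gamma> 0" using g(1) by (simp add: velocity_orders_def)
  obtain h \<psi> where h: "h analytic_on {0}" "h 0 = 0" "deriv h 0 ~= 0" and \<psi>: "local_diffeo UNIV \<psi>"
   and j: "jet_eq m (%t. \<gamma> (h t)) (%t. \<psi> (\<eta> t))" using normal[OF g(1)] by blast
  have d: "diffeo_at \<psi> (\<eta> 0)" by (rule local_diffeo_diffeo_at[OF \<psi> UNIV_I])
  have "q = prolong_curve (%t. \<gamma> (h t)) 3 0"
   unfolding g(2) by (rule prolong_reparam[OF h g_an velocity_orders_nonconstant[OF g(1)], symmetric])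
  also have "\<dots> = prolong_curve (%t. \<psi> (\<eta> t)) 3 0"
  proof (rule jet_determines_prolongation'[OF _ _ j])
   show "velocity_orders S (%t. \<gamma> (h t))" using velocity_orders_reparam[OF h g_an] g(1) by blast
   show "analytic_vec (%t. \<psi> (\<eta> t)) 0" by (rule diffeo_analytic_vec[OF d an])
   show "S = {2,3,4} \<and> m = 5 \<or> S = {3,5,6} \<and> m = 7" using S by blast
  qed
  also have "\<dots> = prolong_map \<psi> 3 ?p" by (rule prolong_map_curve[OF an nc d, symmetric])
  finally show "q \<in> orbit 3 ?p" unfolding orbit_def using \<psi> by blast
 qed
 moreover have "?p \<in> monster 3" using p curve_class_monster[of S] S by blast
 ultimately show ?thesis unfolding is_orbit_def using orbit_curve_class[OF p Sd] by blast
qed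

lemma curve_class_345_orbit: "is_orbit 3 (curve_class {2,3,4})"
proof (rule curve_class_orbit[where m = 5 and d = 3])
 show "velocity_orders {2,3,4} (%t. vector [t ^ 3, t ^ 4, t ^ 5] :: complex^3)"
  using velocity_orders_monomial[of 3 4 5] by simp
 fix \<gamma> :: "complex => complex^3" assume "velocity_orders {2,3,4} \<gamma>"
 then obtain \<psi> where "local_diffeo UNIV \<psi>" "jet_eq 5 \<gamma> (%t. \<psi> (vector [t ^ 3, t ^ 4, t ^ 5]))"
  using normal_form_345 by blast
 then show "\<exists>h \<psi>. h analytic_on {0} \<and> h 0 = 0 \<and> deriv h 0 ~= 0 \<and> local_diffeo UNIV \<psi> \<and>
   jet_eq 5 (%t. \<gamma> (h t)) (%t. \<psi> (vector [t ^ 3, t ^ 4, t ^ 5]))"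
  by (intro exI[of _ "%t. t"] exI[of _ \<psi>]) (auto intro: analytic_intros)
qed simp

lemma curve_class_467_orbit: "is_orbit 3 (curve_class {3,5,6})"
proof (rule curve_class_orbit[where m = 7 and d = 4])
 show "velocity_orders {3,5,6} (%t. vector [t ^ 4, t ^ 6, t ^ 7] :: complex^3)"
  using velocity_orders_monomial[of 4 6 7] by simp
 fix \<gamma> :: "complex => complex^3" assume v: "velocity_orders {3,5,6} \<gamma>"
 show "\<exists>h \<psi>. h analytic_on {0} \<and> h 0 = 0 \<and> deriv h 0 ~= 0 \<and> local_diffeo UNIV \<psi> \<and>
   jet_eq 7 (%t. \<gamma> (h t)) (%t. \<psi> (vector [t ^ 4, t ^ 6, t ^ 7]))"
  by (rule normal_form_467[OF v]) blast
qed simp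

lemma curve_class_spatial: "spatial_class 3 (curve_class {2,3,4})"
proof -
 have "\<forall>s\<in>{2,3,4}. 3 \<le> Suc s \<and> Suc s < 2 * (3::nat)" by auto
 then have "\<forall>p\<in>curve_class {2,3,4}. orbit 3 p \<subseteq> curve_class {2,3,4}" using orbit_curve_class by blast
 moreover have m: "curve_class {2,3,4} \<subseteq> monster 3" by (rule curve_class_monster) simp
 moreover have "spatial 3 p" if "p \<in> curve_class {2,3,4}" for p
  using spatial_level3[of p] that m by blast
 ultimately show ?thesis unfolding spatial_class_def singularity_class_def by blast
qed

theorem proposition3p25:
  shows "(\<forall>k\<le>2. \<forall>p\<in>(monster k :: 3 point set). \<not> spatial k p) \<and>
    (\<exists>C :: 3 point set.
       {p \<in> monster 3. spatial 3 p} = C \<union> RVL \<and> C \<inter> RVL = {} \<and>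
       spatial_class 3 C \<and> spatial_class 3 RVL \<and>
       is_orbit 3 C \<and> is_orbit 3 (RVL :: 3 point set) \<and>
       openin (subtopology (monster_topology 3) (RVT_class [R, V, T])) C \<and>
       has_codim 3 C 2 \<and>
       C = (\<lambda>\<gamma>. prolong_curve \<gamma> 3 0) `
             curves_with_jet 5 (\<lambda>t. vector [t ^ 3, t ^ 4, t ^ 5]) \<and>
       (\<Union>p\<in>C. Germ 3 p) = curves_with_jet 5 (\<lambda>t. vector [t ^ 3, t ^ 4, t ^ 5]) \<and>
       has_codim 3 (RVL :: 3 point set) 3 \<and>
       (RVL :: 3 point set) = (\<lambda>\<gamma>. prolong_curve \<gamma> 3 0) `
             curves_with_jet 7 (\<lambda>t. vector [t ^ 4, t ^ 6, t ^ 7]) \<and>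
       (\<Union>p\<in>(RVL :: 3 point set). Germ 3 p) =
             curves_with_jet 7 (\<lambda>t. vector [t ^ 4, t ^ 6, t ^ 7]))"
  (is "_ \<and> Ex ?P")
proof (rule conjI)
  show "\<forall>k\<le>2. \<forall>p\<in>(monster k :: 3 point set). \<not> spatial k p"
  proof (intro allI impI ballI notI)
    fix k and p :: "3 point" assume "k \<le> 2" "p \<in> monster k" "spatial k p"
    then show False using planar_low_level[of k p] unfolding spatial_def by fastforce
  qed
  let ?C = "curve_class {2,3,4}" and ?D = "curve_class {3,5,6}"
  have mC: "?C \<subseteq> monster 3" and mD: "?D \<subseteq> monster 3" using curve_class_monster by blast+
  have disj: "?C \<inter> ?D = {}"
  proof (rule ccontr)
    assume "?C \<inter> ?D \<noteq> {}"
    then obtain p where p: "p \<in> ?C" "p \<in> ?D" by blast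
    obtain a3 a2 a1 x where x: "x \<in> chart_dom [a3, a2, a1]" "p = param 3 [a3, a2, a1] x"
      by (rule monster3_chart[OF subsetD[OF mC p(1)]])
    show False using p unfolding x(2) curve_class_chart[OF x(1)] cusp345_def cusp467_def by blast
  qed
  have im: "curve_class S = (\<lambda>\<gamma>. prolong_curve \<gamma> 3 0) ` {\<gamma>. velocity_orders S \<gamma>}" for S
    unfolding curve_class_def by blast
  show "Ex ?P"
    unfolding curve_class_RVL[symmetric] curves_with_jet_345 curves_with_jet_467
  proof (rule exI[of _ ?C], intro conjI disj)
    show "{p \<in> monster 3. spatial 3 p} = ?C \<union> ?D" using spatial_level3 mC mD by blast
    show "spatial_class 3 ?C" by (rule curve_class_spatial) 
    show "spatial_class 3 RVL" by (rule RVL_spatial_class)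
    show "is_orbit 3 ?C" "is_orbit 3 ?D" by (rule curve_class_345_orbit curve_class_467_orbit)+
    show "openin (subtopology (monster_topology 3) (RVT_class [R, V, T])) ?C" "has_codim 3 ?C 2"
      by (rule cusp345_open[OF mC curve_class_chart(1)] cusp345_codim[OF mC curve_class_chart(1)], assumption)+
    show "has_codim 3 ?D 3" by (rule cusp467_codim[OF mD curve_class_chart(2)])
    show "?C = (\<lambda>\<gamma>. prolong_curve \<gamma> 3 0) ` {\<gamma>. velocity_orders {2,3,4} \<gamma>}"
      "?D = (\<lambda>\<gamma>. prolong_curve \<gamma> 3 0) ` {\<gamma>. velocity_orders {3,5,6} \<gamma>}" by (rule im)+
    show "(\<Union>p\<in>?C. Germ 3 p) = {\<gamma>. velocity_orders {2,3,4} \<gamma>}" "(\<Union>p\<in>?D. Germ 3 p) = {\<gamma>. velocity_orders {3,5,6} \<gamma>}"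
      by (rule Union_Germ, blast)+
  qed
qed

end
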